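(* Let $n\ge2$ and let $\mathfrak p=\mathfrak p_{\Pi\setminus\{\alpha_1\}}$. Then $$\overline{\mathrm{Pr}}_k^{\mathcal O_{\min}}=\bigsqcup_{w\in W^{\mathfrak p}}w^{-1}\cdot\Lambda_k(\mathfrak p)$$ (a disjoint union), where $\Lambda_k(\mathfrak p)=\{\mu-\tfrac pq a\omega_1:\mu\in\overline{\mathrm{Pr}}_{k,\mathbb Z},\ a\in\mathbb N,\ a\le q-1\}$ and $W^{\mathfrak p}=\{e,s_1,s_1s_2,\dots,s_1s_2\cdots s_n\}$. Moreover $\overline{\mathrm{Pr}}_k^{\mathcal O_{\min}}$ is non-empty if $q\ge2$.
   Context: Let $\mathfrak g=\mathfrak{sl}_{n+1}(\mathbb C)$, $\mathfrak h$ the traceless diagonal matrices, $\Delta=\{\varepsilon_i-\varepsilon_j:i\ne j\}$, $\Delta_+=\{\varepsilon_i-\varepsilon_j:i<j\}$, $\Delta_-=-\Delta_+$, $\Pi=\{\alpha_1,\dots,\alpha_n\}$, $\alpha_i=\varepsilon_i-\varepsilon_{i+1}$, $\theta=\alpha_1+\dots+\alpha_n$; $(\cdot,\cdot)$ the invariant form on $\mathfrak h^*$ with $(\alpha,\alpha)=2$ for roots; $\omega_i$ fundamental weights, $P^\vee=\bigoplus\mathbb Z\omega_i$, $\rho=\sum\omega_i$; $W$ the Weyl group generated by $s_i$, $w\cdot\mu=w(\mu+\rho)-\rho$. For $\Sigma\subset\Pi$, $\Delta_\Sigma$ is the root subsystem generated by $\Sigma$, $\mathfrak p_\Sigma$ the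 standard parabolic, $W^{\mathfrak p_\Sigma}=\{w\in W:\Delta_+\cap w(\Delta_-)\subset\Delta_+\setminus\Delta_\Sigma\}$. Fix $k\in\mathbb Q$ with $k+n+1=p/q$, $p,q\in\mathbb N$ coprime, $p\ge n+1$. $\overline{\mathrm{Pr}}_{k,\mathbb Z}=\{\sum\lambda_i\omega_i:\lambda_i\in\mathbb N_0,\sum\lambda_i\le p-n-1\}$. For $w\in W,\eta\in P^\vee$, $C(w,\eta)$ means: for all $\alpha\in\Delta_+$, $0\le(\eta,\alpha)\le q-1$ if $w(\alpha)\in\Delta_+$ and $1\le(\eta,\alpha)\le q$ if $w(\alpha)\in\Delta_-$. The admissible weights of level $k$: $\overline{\mathrm{Pr}}_k=\{w\cdot(\mu-\tfrac pq\eta):\mu\in\overline{\mathrm{Pr}}_{k,\mathbb Z},w\in W,\eta\in P^\vee,C(w,\eta)\}$. For $\mu\in\mathfrak h^*$, $J_\mu$ is the annihilator in $U(\mathfrak g)$ of the simple highest weight module $L(\mu)$ (standard Borel), $\mathcal V(J_\mu)\subset\mathfrak g^*$ the zero locus of $\mathrm{gr}J_\mu\subset S(\mathfrak g)$. For a nilpotent orbit $\mathcal O$, $\mathcal O^*$ is its image in $\mathfrak g^*$ via the Killing form and $\overline{\mathrm{Pr}}_k^{\mathcal O}=\{\mu\in\overline{\mathrm{Pr}}_k:\mathcal V(J_\mu)=\overline{\mathcal O^*}\}$. $\mathcal O_{\min}$ is the minimal nonzero nilpotent orbit (Jordan type $[2,1^{n-1}]$). *)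

theory Defs
  imports "HOL-Analysis.Analysis" "HOL-Combinatorics.Transposition"
begin

text \<open>Matrices are functions nat => nat => complex; entries outside {0..n}^2 are zero.
  Indices are 0-based: the standard basis vectors are e_0,...,e_n, and
  eps_i - eps_j (0-based) corresponds to the root vector E_ij.\<close>

type_synonym mat = "nat \<Rightarrow> nat \<Rightarrow> complex"

definition supp_mat :: "nat \<Rightarrow> mat \<Rightarrow> bool" where
  "supp_mat n X \<longleftrightarrow> (\<forall>i j. (n < i \<or> n < j) \<longrightarrow> X i j = 0)"

definition mtrace :: "nat \<Rightarrow> mat \<Rightarrow> complex" where
  "mtrace n X = (\<Sum>i\<le>n. X i i)"

definition mmul :: "nat \<Rightarrow> mat \<Rightarrow> mat \<Rightarrow> mat" where
  "mmul n A B = (\<lambda>i j. if i \<le> n \<and> j \<le> n then (\<Sum>k\<le>n. A i k * B k j) else 0)"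

definition idm :: "nat \<Rightarrow> mat" where
  "idm n = (\<lambda>i j. if i = j \<and> i \<le> n then 1 else 0)"

definition mlin :: "complex \<Rightarrow> mat \<Rightarrow> complex \<Rightarrow> mat \<Rightarrow> mat" where
  "mlin a X b Y = (\<lambda>i j. a * X i j + b * Y i j)"

definition bracket :: "nat \<Rightarrow> mat \<Rightarrow> mat \<Rightarrow> mat" where
  "bracket n X Y = mlin 1 (mmul n X Y) (-1) (mmul n Y X)"

definition emat :: "nat \<Rightarrow> nat \<Rightarrow> mat" where
  "emat i j = (\<lambda>a b. if a = i \<and> b = j then 1 else 0)"

definition sl :: "nat \<Rightarrow> mat set" where
  "sl n = {X. supp_mat n X \<and> mtrace n X = 0}"

definition cartan :: "nat \<Rightarrow> mat set" where
  "cartan n = {H \<in> sl n. \<forall>i j. i \<noteq> j \<longrightarrow> H i j = 0}"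

definition gdual :: "nat \<Rightarrow> (mat \<Rightarrow> complex) set" where
  "gdual n = {\<xi>. (\<forall>X\<in>sl n. \<forall>Y\<in>sl n. \<forall>a b. \<xi> (mlin a X b Y) = a * \<xi> X + b * \<xi> Y)
                 \<and> (\<forall>X. X \<notin> sl n \<longrightarrow> \<xi> X = 0)}"

definition killing :: "nat \<Rightarrow> mat \<Rightarrow> mat \<Rightarrow> complex" where
  "killing n X Y = 2 * of_nat (n + 1) * mtrace n (mmul n X Y)"

definition killing_dual :: "nat \<Rightarrow> mat \<Rightarrow> (mat \<Rightarrow> complex)" where
  "killing_dual n X = (\<lambda>Y. if Y \<in> sl n then killing n X Y else 0)"

text \<open>The minimal nilpotent orbit: the adjoint orbit of E_{01}, which has Jordan type [2,1^{n-1}]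
  (conjugation by GL_{n+1} gives the same orbits as the adjoint group).\<close>
definition Omin :: "nat \<Rightarrow> mat set" where
  "Omin n = {mmul n (mmul n A (emat 0 1)) B | A B.
               supp_mat n A \<and> supp_mat n B \<and> mmul n A B = idm n \<and> mmul n B A = idm n}"

text \<open>Weights mu in h^* are given by their coordinates mu_i = mu(h_i) w.r.t. the fundamental
  weights omega_1..omega_n (1-based), normalised to be 0 outside {1..n}.\<close>
type_synonym weight = "nat \<Rightarrow> complex"

definition normw :: "nat \<Rightarrow> weight \<Rightarrow> weight" where
  "normw n l = (\<lambda>i. if 1 \<le> i \<and> i \<le> n then l i else 0)"

text \<open>eps-coordinates (0-based, j = 0..n): lambda = sum_j m_j eps_{j+1} (1-based eps) with m_n = 0.\<close>
definition epsc :: "nat \<Rightarrow> weight \<Rightarrow> nat \<Rightarrow> complex" where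
  "epsc n l j = (\<Sum>i\<in>{j+1..n}. l i)"

definition omegac :: "nat \<Rightarrow> (nat \<Rightarrow> complex) \<Rightarrow> weight" where
  "omegac n m = (\<lambda>i. if 1 \<le> i \<and> i \<le> n then m (i - 1) - m i else 0)"

definition weval :: "nat \<Rightarrow> weight \<Rightarrow> mat \<Rightarrow> complex" where
  "weval n \<mu> H = (\<Sum>j\<le>n. epsc n \<mu> j * H j j)"

text \<open>Vectors: modules are realised inside the space nat => complex (enough room for any
  module of countable dimension, in particular for L(mu)).\<close>
type_synonym vect = "nat \<Rightarrow> complex"

definition vadd :: "vect \<Rightarrow> vect \<Rightarrow> vect" where "vadd u w = (\<lambda>k. u k + w k)"
definition vsmul :: "complex \<Rightarrow> vect \<Rightarrow> vect" where "vsmul c u = (\<lambda>k. c * u k)"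
definition vzero :: vect where "vzero = (\<lambda>k. 0)"

definition vsubspace :: "vect set \<Rightarrow> bool" where
  "vsubspace V \<longleftrightarrow> vzero \<in> V \<and> (\<forall>u\<in>V. \<forall>w\<in>V. vadd u w \<in> V) \<and> (\<forall>c. \<forall>u\<in>V. vsmul c u \<in> V)"

definition is_rep :: "nat \<Rightarrow> vect set \<Rightarrow> (mat \<Rightarrow> vect \<Rightarrow> vect) \<Rightarrow> bool" where
  "is_rep n V \<rho> \<longleftrightarrow> vsubspace V
     \<and> (\<forall>X\<in>sl n. \<forall>u\<in>V. \<rho> X u \<in> V)
     \<and> (\<forall>X\<in>sl n. \<forall>u\<in>V. \<forall>w\<in>V. \<forall>a b.
           \<rho> X (vadd (vsmul a u) (vsmul b w)) = vadd (vsmul a (\<rho> X u)) (vsmul b (\<rho> X w)))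
     \<and> (\<forall>X\<in>sl n. \<forall>Y\<in>sl n. \<forall>u\<in>V. \<forall>a b.
           \<rho> (mlin a X b Y) u = vadd (vsmul a (\<rho> X u)) (vsmul b (\<rho> Y u)))
     \<and> (\<forall>X\<in>sl n. \<forall>Y\<in>sl n. \<forall>u\<in>V.
           \<rho> (bracket n X Y) u = vadd (\<rho> X (\<rho> Y u)) (vsmul (-1) (\<rho> Y (\<rho> X u))))"

definition simple_hw :: "nat \<Rightarrow> vect set \<Rightarrow> (mat \<Rightarrow> vect \<Rightarrow> vect) \<Rightarrow> vect \<Rightarrow> weight \<Rightarrow> bool" where
  "simple_hw n V \<rho> v \<mu> \<longleftrightarrow> is_rep n V \<rho> \<and> v \<in> V \<and> v \<noteq> vzero
     \<and> (\<forall>H\<in>cartan n. \<rho> H v = vsmul (weval n \<mu> H) v)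
     \<and> (\<forall>i j. i < j \<and> j \<le> n \<longrightarrow> \<rho> (emat i j) v = vzero)
     \<and> (\<forall>W. W \<subseteq> V \<and> vsubspace W \<and> (\<forall>X\<in>sl n. \<forall>w\<in>W. \<rho> X w \<in> W) \<and> W \<noteq> {vzero}
            \<longrightarrow> W = V)"

text \<open>Elements of the tensor algebra T(g) (which surjects onto U(g)) are written as formal
  linear combinations of words X_1 ... X_k of elements of g.\<close>
type_synonym texpr = "(complex \<times> mat list) list"

definition texpr_in :: "nat \<Rightarrow> texpr \<Rightarrow> bool" where
  "texpr_in n e \<longleftrightarrow> (\<forall>t\<in>set e. set (snd t) \<subseteq> sl n)"

definition vsum :: "vect list \<Rightarrow> vect" where
  "vsum us = foldr vadd us vzero"

definition tact :: "(mat \<Rightarrow> vect \<Rightarrow> vect) \<Rightarrow> texpr \<Rightarrow> vect \<Rightarrow> vect" where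
  "tact \<rho> e u = vsum (map (\<lambda>t. vsmul (fst t) (foldr \<rho> (snd t) u)) e)"

text \<open>Preimage in T(g) of the annihilator J_mu of L(mu) in U(g).\<close>
definition annT :: "nat \<Rightarrow> weight \<Rightarrow> texpr set" where
  "annT n \<mu> = {e. texpr_in n e \<and>
      (\<forall>V \<rho> v. simple_hw n V \<rho> v \<mu> \<longrightarrow> (\<forall>u\<in>V. tact \<rho> e u = vzero))}"

text \<open>Principal symbol of degree d (for an element of filtration degree at most d),
  as a polynomial function on g^* (S(g) = polynomial functions on g^*).\<close>
definition symb :: "nat \<Rightarrow> texpr \<Rightarrow> (mat \<Rightarrow> complex) \<Rightarrow> complex" where
  "symb d e \<xi> = sum_list (map (\<lambda>t. if length (snd t) = d then fst t * prod_list (map \<xi> (snd t)) else 0) e)"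

text \<open>The associated variety V(J_mu) in g^*: the zero locus of gr J_mu.\<close>
definition assoc_var :: "nat \<Rightarrow> weight \<Rightarrow> (mat \<Rightarrow> complex) set" where
  "assoc_var n \<mu> = {\<xi> \<in> gdual n. \<forall>e\<in>annT n \<mu>. \<forall>d.
        (\<forall>t\<in>set e. length (snd t) \<le> d) \<longrightarrow> symb d e \<xi> = 0}"

text \<open>W = S_{n+1}, acting on 0-based eps-indices {0..n}; w(eps_j) = eps_{w j}.\<close>
definition weyl :: "nat \<Rightarrow> (nat \<Rightarrow> nat) set" where
  "weyl n = {w. w permutes {0..n}}"

definition sref :: "nat \<Rightarrow> nat \<Rightarrow> nat" where
  "sref i = Transposition.transpose (i - 1) i"

definition rho_w :: weight where "rho_w = (\<lambda>i. 1)"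

definition wadd :: "nat \<Rightarrow> weight \<Rightarrow> weight \<Rightarrow> weight" where
  "wadd n a b = normw n (\<lambda>i. a i + b i)"

definition wsub :: "nat \<Rightarrow> weight \<Rightarrow> weight \<Rightarrow> weight" where
  "wsub n a b = normw n (\<lambda>i. a i - b i)"

definition wsc :: "nat \<Rightarrow> complex \<Rightarrow> weight \<Rightarrow> weight" where
  "wsc n c a = normw n (\<lambda>i. c * a i)"

definition wact :: "nat \<Rightarrow> (nat \<Rightarrow> nat) \<Rightarrow> weight \<Rightarrow> weight" where
  "wact n w l = omegac n (\<lambda>j. epsc n l (inv w j))"

definition dot :: "nat \<Rightarrow> (nat \<Rightarrow> nat) \<Rightarrow> weight \<Rightarrow> weight" where
  "dot n w \<mu> = wsub n (wact n w (wadd n \<mu> rho_w)) rho_w"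

definition omega1 :: weight where "omega1 = (\<lambda>i. if i = 1 then 1 else 0)"

text \<open>Pairing of a coweight eta = sum eta_l omega_l with the root eps_i - eps_j (0-based, i < j).\<close>
definition cpair :: "(nat \<Rightarrow> int) \<Rightarrow> nat \<Rightarrow> nat \<Rightarrow> int" where
  "cpair \<eta> i j = (\<Sum>l\<in>{i+1..j}. \<eta> l)"

definition cond_C :: "nat \<Rightarrow> nat \<Rightarrow> (nat \<Rightarrow> nat) \<Rightarrow> (nat \<Rightarrow> int) \<Rightarrow> bool" where
  "cond_C n q w \<eta> \<longleftrightarrow> (\<forall>i j. i < j \<and> j \<le> n \<longrightarrow>
      (if w i < w j then 0 \<le> cpair \<eta> i j \<and> cpair \<eta> i j \<le> int q - 1
                    else 1 \<le> cpair \<eta> i j \<and> cpair \<eta> i j \<le> int q))"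

definition PrZ :: "nat \<Rightarrow> nat \<Rightarrow> weight set" where
  "PrZ n p = {normw n (\<lambda>i. of_nat (c i)) | c :: nat \<Rightarrow> nat.
                 int (\<Sum>i\<in>{1..n}. c i) \<le> int p - int n - 1}"

text \<open>Admissible weights of level k, where k + n + 1 = p/q.\<close>
definition Pr :: "nat \<Rightarrow> nat \<Rightarrow> nat \<Rightarrow> weight set" where
  "Pr n p q = {dot n w (wsub n \<mu> (normw n (\<lambda>i. (of_nat p / of_nat q) * of_int (\<eta> i))))
                | \<mu> w \<eta>. \<mu> \<in> PrZ n p \<and> w \<in> weyl n \<and> cond_C n q w \<eta>}"

definition PrO :: "nat \<Rightarrow> nat \<Rightarrow> nat \<Rightarrow> mat set \<Rightarrow> weight set" where
  "PrO n p q Orb = {\<mu> \<in> Pr n p q. assoc_var n \<mu> = killing_dual n ` closure Orb}"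

definition Lam :: "nat \<Rightarrow> nat \<Rightarrow> nat \<Rightarrow> weight set" where
  "Lam n p q = {wsub n \<mu> (wsc n (of_nat p / of_nat q * of_nat a) omega1) | \<mu> a.
                  \<mu> \<in> PrZ n p \<and> 1 \<le> a \<and> a \<le> q - 1}"

text \<open>Delta_Sigma membership for the root eps_a - eps_b (0-based, a < b): all simple roots
  alpha_{a+1},...,alpha_b (1-based) lie in Sigma.\<close>
definition in_rootsub :: "nat set \<Rightarrow> nat \<Rightarrow> nat \<Rightarrow> bool" where
  "in_rootsub \<Sigma> a b \<longleftrightarrow> {a+1..b} \<subseteq> \<Sigma>"

text \<open>W^{p_Sigma} = { w : Delta_+ cap w(Delta_-) subset Delta_+ \ Delta_Sigma }.
  A positive root eps_a - eps_b (a<b) lies in w(Delta_-) iff inv w a > inv w b.\<close>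
definition Wpar :: "nat \<Rightarrow> nat set \<Rightarrow> (nat \<Rightarrow> nat) set" where
  "Wpar n \<Sigma> = {w \<in> weyl n. \<forall>a b. a < b \<and> b \<le> n \<and> inv w b < inv w a \<longrightarrow> \<not> in_rootsub \<Sigma> a b}"

end

theory Submission
  imports Defs "HOL-Library.Function_Algebras" "HOL-Computational_Algebra.Polynomial" "HOL-Combinatorics.Permutations"
begin

text \<open>
  Write \<open>m\<close> for the \<open>\<epsilon>\<close>-coordinates of a weight, and call two indices equivalent if their coordinates differ by
  an integer. A point \<open>\<xi>\<close> lies in the associated variety as soon as no element of the annihilator has a symbol
  that is nonzero at \<open>\<xi>\<close>; this is checked on words in few root vectors applied to the highest weight vector. If
  \<open>m i - m j\<close> is not an integer, a single root vector is such a point, so the closure of the minimal orbit is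
  contained in the associated variety. Unless all indices but one are equivalent, sums of two root vectors, which
  have rank two, are such points.

  For the remaining weights an upper bound comes from a model: the tensor product of copies of the vector representation with a module
  of monomials \<open>x\<^sub>0\<^bsup>k 0\<^esup> \<dots> x\<^sub>n\<^bsup>k n\<^esup>\<close>, one exponent of which is not an integer. The \<open>2 \<times> 2\<close> minors
  annihilate the monomials, hence suitable products of shifted minors annihilate the tensor product. If all indices
  are equivalent, admissible weights are dominant integral and a power of a root vector annihilates the module.

  For admissible weights, the position of the exceptional index determines the element of \<open>W\<^sup>\<pp>\<close>, and the residue
  modulo \<open>q\<close> of the coweight determines \<open>a\<close>.
\<close>

section \<open>Matrices\<close>

text \<open>The annihilator is defined through all realisations of the simple module. So two facts
  are needed before any symbol is computed: a realisation exists, as otherwise the variety is empty;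
  and whatever kills some other highest weight module of the same weight kills the simple one. The
  second fact allows an upper bound from an explicit module whose simplicity is never examined.

  For lower bounds, words are followed by raising operators and by the coefficient of the highest
  weight vector; a non-integral \<open>m i - m j\<close> makes the resulting sl_2 constants nonzero.
  For i < j < k < l with gaps at (i, j) and (k, l) this suffices. If the gap sits at an adjacent
  pair j, k, the weight should first be reflected in it, which would take a non-integral power of
  the lowering operator; interpolation from natural exponents replaces that power. For n = 2 there
  are no four distinct indices, and the regular nilpotent E_10 + E_21 is handled by an explicit
  linear independence.\<close>

definition etl :: "nat \<Rightarrow> nat \<Rightarrow> nat \<Rightarrow> mat" where
  "etl n a b = (\<lambda>i j. emat a b i j - (if a = b then idm n i j / of_nat (n + 1) else 0))"

definition dg :: "nat \<Rightarrow> (nat \<Rightarrow> complex) \<Rightarrow> mat" where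
  "dg n d = (\<lambda>i j. if i = j \<and> i \<le> n then d i else 0)"

lemma emat_sl [simp]: "a \<le> n \<Longrightarrow> b \<le> n \<Longrightarrow> a \<noteq> b \<Longrightarrow> emat a b \<in> sl n"
  by (auto simp: sl_def mtrace_def supp_mat_def emat_def intro!: sum.neutral)

lemma etl_neq: "a \<noteq> b \<Longrightarrow> etl n a b = emat a b"
  by (auto simp: etl_def)

lemma etl_sl [simp]: assumes "a \<le> n" "b \<le> n" shows "etl n a b \<in> sl n"
proof (cases "a = b")
  case True
  have "(\<Sum>i\<le>n. emat b b i i) = (\<Sum>i\<le>n. if i = b then (1::complex) else 0)"
    by (rule sum.cong) (auto simp: emat_def)
  also have "\<dots> = 1" using assms by simp
  finally have s: "(\<Sum>i\<le>n. emat b b i i) = 1" .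
  have "mtrace n (etl n a b) = 1 - (\<Sum>i\<le>n. 1 / of_nat (n + 1))"
    unfolding mtrace_def etl_def sum_subtractf using True s by (simp add: idm_def)
  also have "\<dots> = 0" using of_nat_neq_0 [where 'a = complex, of n] by (simp del: of_nat_Suc)
  finally show ?thesis using assms True by (auto simp: sl_def supp_mat_def etl_def emat_def idm_def)
qed (use assms in \<open>simp add: etl_neq\<close>)

lemma cartan_sl [simp]: "H \<in> cartan n \<Longrightarrow> H \<in> sl n"
  by (simp add: cartan_def)

lemma dg_cartan: "(\<Sum>i\<le>n. d i) = 0 \<Longrightarrow> dg n d \<in> cartan n"
  by (auto simp: cartan_def sl_def supp_mat_def mtrace_def dg_def simp del: cartan_sl)

lemma dg_ii [simp]: "i \<le> n \<Longrightarrow> dg n d i i = d i"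
  by (simp add: dg_def)

text \<open>The coroot of the root with root vector \<open>emat i j\<close>, that is, the bracket of
  \<open>emat i j\<close> and \<open>emat j i\<close>.\<close>

definition hmat :: "nat \<Rightarrow> nat \<Rightarrow> nat \<Rightarrow> mat" where
  "hmat n i j = dg n (\<lambda>a. (if a = i then 1 else 0) - (if a = j then 1 else 0))"

lemma hmat_cartan [simp]: "i \<le> n \<Longrightarrow> j \<le> n \<Longrightarrow> hmat n i j \<in> cartan n"
  unfolding hmat_def by (rule dg_cartan) (simp add: sum_subtractf)

lemma bracket_emat:
  assumes "i \<le> n" "j \<le> n" "k \<le> n" "l \<le> n"
  shows "bracket n (emat i j) (emat k l) =
    (\<lambda>a b. (if j = k then emat i l a b else 0) - (if l = i then emat k j a b else 0))"
proof -
  have *: "mmul n (emat x y) (emat z t) = (\<lambda>a b. if y = z then emat x t a b else 0)"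
    if "x \<le> n" "y \<le> n" "z \<le> n" "t \<le> n" for x y z t
  proof (intro ext)
    fix a b
    have "(\<Sum>k\<le>n. emat x y a k * emat z t k b)
        = (\<Sum>k\<le>n. if k = y then (if a = x \<and> y = z \<and> b = t then 1 else 0) else 0)"
      by (rule sum.cong) (auto simp: emat_def)
    thus "mmul n (emat x y) (emat z t) a b = (if y = z then emat x t a b else 0)"
      using that by (auto simp: mmul_def emat_def)
  qed
  show ?thesis unfolding bracket_def mlin_def using assms by (simp add: * algebra_simps)
qed

lemma bracket_cartan_emat:
  assumes "H \<in> cartan n" "i \<le> n" "j \<le> n"
  shows "bracket n H (emat i j) = (\<lambda>a b. (H i i - H j j) * emat i j a b)"
proof (intro ext)
  fix a b
  have 1: "(\<Sum>k\<le>n. H a k * emat i j k b) = (\<Sum>k\<le>n. if k = i then H a i * (if b = j then 1 else 0) else 0)"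
    by (rule sum.cong) (auto simp: emat_def)
  have 2: "(\<Sum>k\<le>n. emat i j a k * H k b) = (\<Sum>k\<le>n. if k = j then H j b * (if a = i then 1 else 0) else 0)"
    by (rule sum.cong) (simp_all add: emat_def)
  have z: "H x y = 0" if "x \<noteq> y" for x y using assms(1) that
    by (auto simp: cartan_def simp del: cartan_sl)
  show "bracket n H (emat i j) a b = (H i i - H j j) * emat i j a b"
    using assms(2,3) z [of a i] z [of j b] unfolding bracket_def mlin_def mmul_def 1 2
    by (cases "a = i"; cases "b = j") (simp_all add: emat_def)
qed

lemma mmul_supp: "supp_mat n (mmul n X Y)"
  by (auto simp: supp_mat_def mmul_def)

lemma mlin_sl [simp]: "X \<in> sl n \<Longrightarrow> Y \<in> sl n \<Longrightarrow> mlin a X b Y \<in> sl n"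
  by (auto simp: sl_def supp_mat_def mlin_def mtrace_def sum.distrib sum_distrib_left [symmetric])

lemma mtrace_mmul_comm: "mtrace n (mmul n X Y) = mtrace n (mmul n Y X)"
  unfolding mtrace_def mmul_def by (simp, subst sum.swap) (simp add: mult.commute)

lemma bracket_sl [simp]: "bracket n X Y \<in> sl n"
  using mmul_supp [of n X Y] mmul_supp [of n Y X] mtrace_mmul_comm [of n X Y]
  by (auto simp: sl_def supp_mat_def mlin_def mtrace_def bracket_def sum_subtractf)

text \<open>The \<open>etl n a b\<close> are the traceless parts of the matrix units. They span
  \<open>sl n\<close> without being independent; the multiples of the identity that they carry add
  up to the trace of \<open>X\<close>, which is zero.\<close>

lemma sl_expand:
  assumes "X \<in> sl n"
  shows "X = (\<lambda>i j. \<Sum>p\<in>{..n} \<times> {..n}. X (fst p) (snd p) * etl n (fst p) (snd p) i j)"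
proof (intro ext)
  fix i j
  have s: "supp_mat n X" and t: "(\<Sum>i\<le>n. X i i) = 0" using assms by (auto simp: sl_def mtrace_def)
  have "(\<Sum>p\<in>{..n} \<times> {..n}. X (fst p) (snd p) * etl n (fst p) (snd p) i j)
      = (\<Sum>a\<le>n. \<Sum>b\<le>n. X a b * etl n a b i j)"
    by (subst sum.cartesian_product) (simp add: case_prod_beta)
  also have "\<dots> = (\<Sum>a\<le>n. \<Sum>b\<le>n. X a b * emat a b i j) - (\<Sum>a\<le>n. \<Sum>b\<le>n. X a b * (if a = b then idm n i j / of_nat (n+1) else 0))"
    by (simp add: etl_def right_diff_distrib sum_subtractf)
  also have "(\<Sum>a\<le>n. \<Sum>b\<le>n. X a b * (if a = b then idm n i j / of_nat (n+1) else 0))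
      = (\<Sum>a\<le>n. \<Sum>b\<le>n. if b = a then X a a * (idm n i j / of_nat (n+1)) else 0)"
    by (intro sum.cong) auto
  also have "\<dots> = (\<Sum>a\<le>n. X a a) * (idm n i j / of_nat (n+1))"
    by (simp add: sum_distrib_right sum_divide_distrib)
  also have "\<dots> = 0" using t by simp
  also have "(\<Sum>a\<le>n. \<Sum>b\<le>n. X a b * emat a b i j)
      = (\<Sum>a\<le>n. \<Sum>b\<le>n. if b = j then (if a = i then X i j else 0) else 0)"
    by (intro sum.cong) (auto simp: emat_def)
  also have "\<dots> = X i j" using s by (cases "j \<le> n"; cases "i \<le> n") (auto simp: supp_mat_def)
  finally show "X i j = (\<Sum>p\<in>{..n} \<times> {..n}. X (fst p) (snd p) * etl n (fst p) (snd p) i j)" by simp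
qed

section \<open>Representations\<close>

text \<open>The vector type is left open because the locale is used for modules of sequences, for
  direct sums of two modules and for spaces of tensors. \<open>R\<close> is constrained only on
  \<open>sl n\<close> and on \<open>V\<close>.\<close>

locale slrep = vector_space sc
  for sc :: "complex \<Rightarrow> 'v::ab_group_add \<Rightarrow> 'v" +
  fixes n :: nat and V :: "'v set" and R :: "mat \<Rightarrow> 'v \<Rightarrow> 'v"
  assumes V_sub: "subspace V"
    and R_V [simp]: "X \<in> sl n \<Longrightarrow> u \<in> V \<Longrightarrow> R X u \<in> V"
    and R_add: "X \<in> sl n \<Longrightarrow> u \<in> V \<Longrightarrow> w \<in> V \<Longrightarrow> R X (u + w) = R X u + R X w"
    and R_sc: "X \<in> sl n \<Longrightarrow> u \<in> V \<Longrightarrow> R X (sc c u) = sc c (R X u)"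
    and R_mlin: "X \<in> sl n \<Longrightarrow> Y \<in> sl n \<Longrightarrow> u \<in> V \<Longrightarrow> R (mlin a X b Y) u = sc a (R X u) + sc b (R Y u)"
    and R_bracket: "X \<in> sl n \<Longrightarrow> Y \<in> sl n \<Longrightarrow> u \<in> V \<Longrightarrow> R (bracket n X Y) u = R X (R Y u) - R Y (R X u)"
begin

lemma V_0 [simp]: "0 \<in> V" and V_add [simp]: "u \<in> V \<Longrightarrow> w \<in> V \<Longrightarrow> u + w \<in> V"
  and V_sc [simp]: "u \<in> V \<Longrightarrow> sc c u \<in> V" and V_diff [simp]: "u \<in> V \<Longrightarrow> w \<in> V \<Longrightarrow> u - w \<in> V"
  using V_sub by (auto simp: subspace_0 subspace_add subspace_scale subspace_diff)

lemma V_sum: "(\<And>x. x \<in> A \<Longrightarrow> f x \<in> V) \<Longrightarrow> sum f A \<in> V"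
  using V_sub by (rule subspace_sum)

lemma R_0 [simp]: "X \<in> sl n \<Longrightarrow> R X 0 = 0"
  using R_sc [of X 0 0] by simp

lemma R_diff: "X \<in> sl n \<Longrightarrow> u \<in> V \<Longrightarrow> w \<in> V \<Longrightarrow> R X (u - w) = R X u - R X w"
  using R_add [of X "u - w" w] by (simp add: algebra_simps)

lemma R_sum: "X \<in> sl n \<Longrightarrow> (\<And>x. x \<in> A \<Longrightarrow> f x \<in> V) \<Longrightarrow> R X (sum f A) = (\<Sum>x\<in>A. R X (f x))"
  by (induction A rule: infinite_finite_induct) (auto simp: R_add V_sum)

lemma R_smat: "X \<in> sl n \<Longrightarrow> u \<in> V \<Longrightarrow> R (\<lambda>a b. c * X a b) u = sc c (R X u)"
  using R_mlin [of X X u c 0] by (simp add: mlin_def)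

lemma R_zmat [simp]: "u \<in> V \<Longrightarrow> R (\<lambda>a b. 0) u = 0"
  using R_smat [of "\<lambda>a b. 0" u 0] by (simp add: sl_def supp_mat_def mtrace_def)

text \<open>Membership of the sum in \<open>sl n\<close> is carried along because the induction step
  applies \<open>R_mlin\<close> to the partial sum.\<close>

lemma R_matsum:
  assumes "\<And>x. x \<in> A \<Longrightarrow> Y x \<in> sl n" "u \<in> V"
  shows "R (\<lambda>i j. \<Sum>x\<in>A. c x * Y x i j) u = (\<Sum>x\<in>A. sc (c x) (R (Y x) u))
    \<and> (\<lambda>i j. \<Sum>x\<in>A. c x * Y x i j) \<in> sl n"
  using assms(1)
proof (induction A rule: infinite_finite_induct)
  case (insert x A)
  have "(\<lambda>i j. \<Sum>x\<in>insert x A. c x * Y x i j) = mlin (c x) (Y x) 1 (\<lambda>i j. \<Sum>x\<in>A. c x * Y x i j)"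
    using insert by (auto simp: mlin_def)
  with insert assms(2) show ?case by (simp add: R_mlin)
qed (use assms(2) in \<open>auto simp: sl_def supp_mat_def mtrace_def\<close>)

lemma R_expand:
  assumes "X \<in> sl n" "u \<in> V"
  shows "R X u = (\<Sum>p\<in>{..n} \<times> {..n}. sc (X (fst p) (snd p)) (R (etl n (fst p) (snd p)) u))"
  by (subst sl_expand [OF assms(1)]) (rule conjunct1 [OF R_matsum], use assms in auto)

lemma R_comm: "X \<in> sl n \<Longrightarrow> Y \<in> sl n \<Longrightarrow> u \<in> V \<Longrightarrow> R X (R Y u) = R Y (R X u) + R (bracket n X Y) u"
  by (simp add: R_bracket)

lemma EE_comm:
  assumes "i \<le> n" "j \<le> n" "k \<le> n" "l \<le> n" "i \<noteq> j" "k \<noteq> l" "j \<noteq> k" "i \<noteq> l" "u \<in> V"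
  shows "R (emat i j) (R (emat k l) u) = R (emat k l) (R (emat i j) u)"
  using assms by (subst R_comm) (auto simp: bracket_emat)

lemma EE_br:
  assumes "i \<le> n" "j \<le> n" "l \<le> n" "i \<noteq> j" "j \<noteq> l" "i \<noteq> l" "u \<in> V"
  shows "R (emat i j) (R (emat j l) u) = R (emat j l) (R (emat i j) u) + R (emat i l) u"
  using assms by (subst R_comm) (auto simp: bracket_emat)

lemma EE_h:
  assumes "i \<le> n" "j \<le> n" "i \<noteq> j" "u \<in> V"
  shows "R (emat i j) (R (emat j i) u) = R (emat j i) (R (emat i j) u) + R (hmat n i j) u"
proof -
  have "bracket n (emat i j) (emat j i) = hmat n i j"
    using assms by (subst bracket_emat) (auto simp: hmat_def dg_def emat_def fun_eq_iff)
  with assms show ?thesis by (subst R_comm) auto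
qed

lemma HE:
  assumes "H \<in> cartan n" "i \<le> n" "j \<le> n" "i \<noteq> j" "u \<in> V"
  shows "R H (R (emat i j) u) = R (emat i j) (R H u) + sc (H i i - H j j) (R (emat i j) u)"
  using assms by (subst R_comm) (auto simp: bracket_cartan_emat R_smat)

lemma R_foldr_V [simp]: "set w \<subseteq> sl n \<Longrightarrow> u \<in> V \<Longrightarrow> foldr R w u \<in> V"
  by (induction w) auto

lemma foldr_R_sc: "set w \<subseteq> sl n \<Longrightarrow> u \<in> V \<Longrightarrow> foldr R w (sc c u) = sc c (foldr R w u)"
  by (induction w) (auto simp: R_sc)

lemma foldr_R_add: "set w \<subseteq> sl n \<Longrightarrow> u \<in> V \<Longrightarrow> u' \<in> V \<Longrightarrow> foldr R w (u + u') = foldr R w u + foldr R w u'"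
  by (induction w) (auto simp: R_add)

lemma foldr_R_0: "set w \<subseteq> sl n \<Longrightarrow> foldr R w 0 = 0"
  by (induction w) auto

definition ta :: "texpr \<Rightarrow> 'v \<Rightarrow> 'v" where
  "ta e u = sum_list (map (\<lambda>t. sc (fst t) (foldr R (snd t) u)) e)"

lemma ta_Nil [simp]: "ta [] u = 0" and ta_Cons: "ta (t # e) u = sc (fst t) (foldr R (snd t) u) + ta e u"
  by (auto simp: ta_def)

lemma ta_append: "ta (e @ f) u = ta e u + ta f u"
  by (simp add: ta_def)

lemma texpr_in_Cons: "texpr_in n (t # e) \<longleftrightarrow> set (snd t) \<subseteq> sl n \<and> texpr_in n e"
  by (auto simp: texpr_in_def)

lemma texpr_in_Nil [simp]: "texpr_in n []" by (simp add: texpr_in_def)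

lemma texpr_in_append: "texpr_in n (e @ f) \<longleftrightarrow> texpr_in n e \<and> texpr_in n f"
  by (auto simp: texpr_in_def)

lemma ta_V [simp]: "texpr_in n e \<Longrightarrow> u \<in> V \<Longrightarrow> ta e u \<in> V"
  by (induction e) (auto simp: ta_Cons texpr_in_Cons)

lemma ta_scmap: "texpr_in n e \<Longrightarrow> ta (map (\<lambda>t. (c * fst t, snd t)) e) u = sc c (ta e u)"
  by (induction e) (auto simp: ta_Cons texpr_in_Cons scale_right_distrib)

lemma ta_consmap: "texpr_in n e \<Longrightarrow> X \<in> sl n \<Longrightarrow> u \<in> V \<Longrightarrow> ta (map (\<lambda>t. (fst t, X # snd t)) e) u = R X (ta e u)"
  by (induction e) (auto simp: ta_Cons texpr_in_Cons R_add R_sc)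

end

section \<open>Products and orbits under the tensor algebra\<close>

definition tmul :: "texpr \<Rightarrow> texpr \<Rightarrow> texpr" where
  "tmul e f = concat (map (\<lambda>s. map (\<lambda>t. (fst s * fst t, snd s @ snd t)) f) e)"

lemma texpr_in_tmul: "texpr_in n e \<Longrightarrow> texpr_in n f \<Longrightarrow> texpr_in n (tmul e f)"
  by (fastforce simp: tmul_def texpr_in_def)

context slrep begin

lemma ta_tmul_aux:
  "set w \<subseteq> sl n \<Longrightarrow> texpr_in n f \<Longrightarrow> u \<in> V \<Longrightarrow>
   ta (map (\<lambda>t. (c * fst t, w @ snd t)) f) u = sc c (foldr R w (ta f u))"
  by (induction f) (auto simp: ta_Cons texpr_in_Cons foldr_R_add foldr_R_sc foldr_R_0 scale_right_distrib)

lemma ta_tmul: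
  "texpr_in n e \<Longrightarrow> texpr_in n f \<Longrightarrow> u \<in> V \<Longrightarrow> ta (tmul e f) u = ta e (ta f u)"
  by (induction e) (auto simp: ta_Cons tmul_def texpr_in_Cons ta_append ta_tmul_aux)

lemma ta_orbit_sub:
  assumes "u \<in> V"
  defines "W \<equiv> {ta e u | e. texpr_in n e}"
  shows "subspace W" "u \<in> W" "W \<subseteq> V" "\<And>X w. X \<in> sl n \<Longrightarrow> w \<in> W \<Longrightarrow> R X w \<in> W"
proof -
  show "subspace W"
    unfolding subspace_def
  proof (intro conjI ballI allI)
    show "0 \<in> W" unfolding W_def by (rule CollectI, rule exI [of _ "[]"]) simp
    show "x + y \<in> W" if "x \<in> W" "y \<in> W" for x y
    proof -
      from that obtain e f where "texpr_in n e" "x = ta e u" "texpr_in n f" "y = ta f u"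
        unfolding W_def by blast
      hence "texpr_in n (e @ f)" "x + y = ta (e @ f) u" by (auto simp: ta_append texpr_in_append)
      thus ?thesis unfolding W_def by blast
    qed
    show "sc c x \<in> W" if "x \<in> W" for c x
    proof -
      from that obtain e where "texpr_in n e" "x = ta e u" unfolding W_def by blast
      hence "texpr_in n (map (\<lambda>t. (c * fst t, snd t)) e)"
        "sc c x = ta (map (\<lambda>t. (c * fst t, snd t)) e) u"
        by (auto simp: ta_scmap texpr_in_def)
      thus ?thesis unfolding W_def by blast
    qed
  qed
  show "u \<in> W" unfolding W_def
    by (rule CollectI, rule exI [of _ "[(1, [])]"]) (simp add: ta_Cons texpr_in_Cons)
  show "W \<subseteq> V" using assms unfolding W_def by auto
  show "R X w \<in> W" if "X \<in> sl n" "w \<in> W" for X w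
  proof -
    from that(2) obtain e where e: "texpr_in n e" "w = ta e u" unfolding W_def by blast
    have "R X w = ta (map (\<lambda>t. (fst t, X # snd t)) e) u"
      using e that assms(1) by (simp add: ta_consmap)
    moreover have "texpr_in n (map (\<lambda>t. (fst t, X # snd t)) e)"
      using e that by (auto simp: texpr_in_def)
    ultimately show ?thesis unfolding W_def by blast
  qed
qed

end

section \<open>Highest weight modules\<close>

text \<open>A pair (a, b) with a < b stands for the lowering root vector \<open>emat b a\<close>, so
  the entries are in the order of the positive root.\<close>

definition lowering :: "nat \<Rightarrow> (nat \<times> nat) list \<Rightarrow> bool" where
  "lowering n ps \<longleftrightarrow> (\<forall>p\<in>set ps. fst p < snd p \<and> snd p \<le> n)"

definition lshift :: "mat \<Rightarrow> (nat \<times> nat) list \<Rightarrow> complex" where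
  "lshift H ps = sum_list (map (\<lambda>p. H (snd p) (snd p) - H (fst p) (fst p)) ps)"

lemma lowering_simps [simp]: "lowering n []"
  "lowering n (p # ps) \<longleftrightarrow> fst p < snd p \<and> snd p \<le> n \<and> lowering n ps"
  by (auto simp: lowering_def)

lemma lshift_simps [simp]: "lshift H [] = 0"
  "lshift H (p # ps) = H (snd p) (snd p) - H (fst p) (fst p) + lshift H ps"
  by (auto simp: lshift_def)

text \<open>Half the sum of the positive coroots. Every simple root takes the value 1 on it, so a
  lowering word decreases its eigenvalue by the total height of its roots, which is
  \<open>depth\<close>.\<close>

definition H0 :: "nat \<Rightarrow> mat" where
  "H0 n = dg n (\<lambda>i. of_nat n / 2 - of_nat i)"

lemma H0_cartan [simp]: "H0 n \<in> cartan n"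
  unfolding H0_def
proof (rule dg_cartan)
  have "2 * (\<Sum>i\<le>n. (of_nat i :: complex)) = of_nat n * (of_nat n + 1)"
    by (induction n) (simp_all add: algebra_simps)
  hence e: "(\<Sum>i\<le>n. (of_nat i :: complex)) = of_nat n * (of_nat n + 1) / 2" by (simp add: field_simps)
  show "(\<Sum>i\<le>n. (of_nat n / 2 - of_nat i :: complex)) = 0"
    unfolding sum_subtractf e by simp
qed

definition depth :: "(nat \<times> nat) list \<Rightarrow> nat" where
  "depth ps = sum_list (map (\<lambda>p. snd p - fst p) ps)"

lemma lshift_H0: "lowering n ps \<Longrightarrow> lshift (H0 n) ps = - of_nat (depth ps)"
  by (induction ps) (auto simp: depth_def H0_def of_nat_diff)

lemma depth_pos: "lowering n ps \<Longrightarrow> ps \<noteq> [] \<Longrightarrow> 0 < depth ps"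
  by (cases ps) (auto simp: depth_def)

text \<open>\<open>V\<close> need be neither simple nor generated by \<open>v\<close>. Since Cartan
  elements are traceless, the coordinates \<open>m\<close> matter only up to a common additive
  constant, a freedom used later to fit the model to a given weight.\<close>

locale hwrep = slrep sc n V R for sc :: "complex \<Rightarrow> 'v::ab_group_add \<Rightarrow> 'v" and n V R +
  fixes v :: 'v and m :: "nat \<Rightarrow> complex"
  assumes v_V [simp]: "v \<in> V" and v_nz: "v \<noteq> 0"
    and H_v: "H \<in> cartan n \<Longrightarrow> R H v = sc (\<Sum>j\<le>n. m j * H j j) v"
    and E_v: "i < j \<Longrightarrow> j \<le> n \<Longrightarrow> R (emat i j) v = 0"
begin

definition wt :: "mat \<Rightarrow> complex" where "wt H = (\<Sum>j\<le>n. m j * H j j)"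

lemma H_v': "H \<in> cartan n \<Longrightarrow> R H v = sc (wt H) v"
  by (simp add: H_v wt_def)

lemma wt_hmat: "i \<le> n \<Longrightarrow> j \<le> n \<Longrightarrow> wt (hmat n i j) = m i - m j"
proof -
  assume ij: "i \<le> n" "j \<le> n"
  have "wt (hmat n i j) = (\<Sum>a\<le>n. (if a = i then m i else 0) - (if a = j then m j else 0))"
    unfolding wt_def by (rule sum.cong) (auto simp: hmat_def)
  thus ?thesis using ij by (simp add: sum_subtractf)
qed

definition low :: "(nat \<times> nat) list \<Rightarrow> 'v" where
  "low ps = foldr (\<lambda>p. R (emat (snd p) (fst p))) ps v"

lemma low_simps [simp]: "low [] = v" "low (p # ps) = R (emat (snd p) (fst p)) (low ps)"
  by (auto simp: low_def)

lemma low_V [simp]: "lowering n ps \<Longrightarrow> low ps \<in> V"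
  by (induction ps) auto

lemma H_low:
  assumes "H \<in> cartan n"
  shows "lowering n ps \<Longrightarrow> R H (low ps) = sc (wt H + lshift H ps) (low ps)"
proof (induction ps)
  case (Cons p ps)
  thus ?case using assms by (simp add: HE R_sc scale_left_distrib [symmetric] add_ac)
qed (use assms in \<open>simp add: H_v'\<close>)

definition S :: "'v set" where "S = span {low ps | ps. lowering n ps}"

lemma low_S: "lowering n ps \<Longrightarrow> low ps \<in> S"
  unfolding S_def by (rule span_base) blast

lemma S_sub: "subspace S" unfolding S_def by (rule subspace_span)

lemma S_V: "S \<subseteq> V"
  unfolding S_def by (rule span_minimal) (use V_sub in auto)

lemma S_add: "x \<in> S \<Longrightarrow> y \<in> S \<Longrightarrow> x + y \<in> S" and S_sc: "x \<in> S \<Longrightarrow> sc c x \<in> S"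
  and S_0: "0 \<in> S" and S_sum: "(\<And>i. i \<in> A \<Longrightarrow> f i \<in> S) \<Longrightarrow> sum f A \<in> S"
  using S_sub by (auto simp: subspace_0 subspace_add subspace_scale subspace_sum)

lemma S_induct [consumes 1, case_names sub low]:
  assumes "u \<in> S" "subspace {u. P u}" "\<And>ps. lowering n ps \<Longrightarrow> P (low ps)"
  shows "P u"
proof -
  have "span {low ps | ps. lowering n ps} \<subseteq> {u. P u}"
    by (rule span_minimal) (use assms in auto)
  thus ?thesis using assms(1) unfolding S_def by blast
qed

text \<open>Both conditions define subspaces, so an operator identity on \<open>S\<close> need only be checked on the
  spanning vectors.\<close>

lemma sub_R_in: assumes "X \<in> sl n" "subspace T" shows "subspace {u \<in> V. R X u \<in> T}"
  using V_sub assms by (auto simp: subspace_def R_add R_sc)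

lemma R_v_S: assumes "X \<in> sl n" shows "R X v \<in> S"
proof -
  have "R (etl n a b) v \<in> S" if "a \<le> n" "b \<le> n" for a b
  proof -
    consider "a = b" | "a < b" | "b < a" by linarith
    thus ?thesis
    proof cases
      case 1
      hence "etl n a b \<in> cartan n" using etl_sl [OF that]
        by (auto simp: cartan_def etl_def emat_def idm_def simp del: etl_sl cartan_sl)
      thus ?thesis using low_S [of "[]"] by (simp add: H_v' S_sc)
    next
      case 2
      thus ?thesis using that by (simp add: etl_neq E_v S_0)
    next
      case 3
      thus ?thesis using low_S [of "[(b, a)]"] that by (simp add: etl_neq)
    qed
  qed
  thus ?thesis by (subst R_expand [OF assms]) (auto intro!: S_sum S_sc)
qed

lemma R_E_S: assumes "i < j" "j \<le> n" "u \<in> S" shows "R (emat j i) u \<in> S"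
proof -
  have X: "emat j i \<in> sl n" using assms by auto
  have "S \<subseteq> {u \<in> V. R (emat j i) u \<in> S}"
    unfolding S_def
  proof (rule span_minimal)
    show "subspace {u \<in> V. R (emat j i) u \<in> span {low ps |ps. lowering n ps}}"
      using sub_R_in [OF X S_sub] unfolding S_def .
    show "{low ps |ps. lowering n ps} \<subseteq> {u \<in> V. R (emat j i) u \<in> span {low ps |ps. lowering n ps}}"
    proof safe
      fix ps assume "lowering n ps"
      thus "low ps \<in> V" "R (emat j i) (low ps) \<in> span {low ps |ps. lowering n ps}"
        using low_S [of "(i, j) # ps"] assms unfolding S_def by auto
    qed
  qed
  thus ?thesis using assms by blast
qed

text \<open>Moving \<open>X\<close> past the first lowering operator leaves a bracket, again an
  element of \<open>sl n\<close>, acting on a shorter word; hence the induction for all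
  \<open>X\<close> at once. It follows that \<open>S\<close>, spanned by lowering words in arbitrary
  order, is a submodule.\<close>

lemma R_low_S: "lowering n ps \<Longrightarrow> X \<in> sl n \<Longrightarrow> R X (low ps) \<in> S"
proof (induction ps arbitrary: X)
  case (Cons p ps)
  have "R X (low (p # ps)) = R (emat (snd p) (fst p)) (R X (low ps)) + R (bracket n X (emat (snd p) (fst p))) (low ps)"
    using Cons.prems R_comm [of X "emat (snd p) (fst p)" "low ps"] by simp
  moreover have "R (emat (snd p) (fst p)) (R X (low ps)) \<in> S"
    using Cons by (intro R_E_S) auto
  moreover have "R (bracket n X (emat (snd p) (fst p))) (low ps) \<in> S"
    using Cons by auto
  ultimately show ?case by (simp add: S_add)
qed (simp add: R_v_S)

lemma R_S: assumes "X \<in> sl n" "u \<in> S" shows "R X u \<in> S"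
proof -
  have "S \<subseteq> {u \<in> V. R X u \<in> S}"
    unfolding S_def
    by (rule span_minimal) (use sub_R_in [OF assms(1) S_sub] R_low_S assms in \<open>auto simp: S_def\<close>)
  thus ?thesis using assms by blast
qed

lemma foldr_R_S: "set w \<subseteq> sl n \<Longrightarrow> u \<in> S \<Longrightarrow> foldr R w u \<in> S"
  by (induction w) (auto simp: R_S)

lemma ta_S: "texpr_in n e \<Longrightarrow> u \<in> S \<Longrightarrow> ta e u \<in> S"
  by (induction e) (auto simp: ta_Cons texpr_in_Cons S_0 S_add S_sc foldr_R_S)

subsection \<open>The component along the highest weight vector\<close>

definition Sm :: "'v set" where "Sm = span {low ps | ps. lowering n ps \<and> ps \<noteq> []}"

lemma Sm_sub: "subspace Sm" unfolding Sm_def by (rule subspace_span)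

lemma low_Sm: "lowering n ps \<Longrightarrow> ps \<noteq> [] \<Longrightarrow> low ps \<in> Sm"
  unfolding Sm_def by (rule span_base) blast

definition Z :: "nat \<Rightarrow> 'v \<Rightarrow> 'v" where "Z s u = R (H0 n) u - sc (wt (H0 n) - of_nat s) u"

text \<open>An interpolation operator: the product over s = 1, ..., r kills every vector of depth
  between 1 and r and multiplies \<open>v\<close> by r!. It isolates the highest weight component
  without any independence statement for lowering words.\<close>

definition zp :: "nat \<Rightarrow> 'v \<Rightarrow> 'v" where "zp r u = foldr Z [1..<r+1] u"

lemma Z_V [simp]: "u \<in> V \<Longrightarrow> Z s u \<in> V" by (simp add: Z_def)

lemma Z_add: "u \<in> V \<Longrightarrow> w \<in> V \<Longrightarrow> Z s (u + w) = Z s u + Z s w"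
  by (simp add: Z_def R_add scale_right_distrib)

lemma Z_sc: "u \<in> V \<Longrightarrow> Z s (sc c u) = sc c (Z s u)"
  by (simp add: Z_def R_sc scale_right_diff_distrib mult.commute)

lemma Z_low: "lowering n ps \<Longrightarrow> Z s (low ps) = sc (of_nat s - of_nat (depth ps)) (low ps)"
  by (simp add: Z_def H_low lshift_H0 scale_left_diff_distrib [symmetric])

lemma Zs_V [simp]: "u \<in> V \<Longrightarrow> foldr Z ss u \<in> V" by (induction ss) auto

lemma Zs_add: "u \<in> V \<Longrightarrow> w \<in> V \<Longrightarrow> foldr Z ss (u + w) = foldr Z ss u + foldr Z ss w"
  by (induction ss) (auto simp: Z_add)

lemma Zs_sc: "u \<in> V \<Longrightarrow> foldr Z ss (sc c u) = sc c (foldr Z ss u)"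
  by (induction ss) (auto simp: Z_sc)

lemma Zs_low: "lowering n ps \<Longrightarrow>
  foldr Z ss (low ps) = sc (prod_list (map (\<lambda>s. of_nat s - of_nat (depth ps)) ss)) (low ps)"
  by (induction ss) (auto simp: Z_sc Z_low mult.commute)

lemma zp_V [simp]: "u \<in> V \<Longrightarrow> zp r u \<in> V"
  and zp_add: "u \<in> V \<Longrightarrow> w \<in> V \<Longrightarrow> zp r (u + w) = zp r u + zp r w"
  and zp_sc: "u \<in> V \<Longrightarrow> zp r (sc c u) = sc c (zp r u)"
  by (auto simp: zp_def Zs_add Zs_sc)

lemma zp_v: "zp r v = sc (fact r) v"
proof -
  have "prod_list (map (\<lambda>s. of_nat s - of_nat (depth [])) [1..<r+1]) = (fact r :: complex)"
    by (induction r) (auto simp: depth_def algebra_simps)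
  thus ?thesis using Zs_low [of "[]" "[1..<r+1]"] unfolding zp_def by simp
qed

lemma zp_low: "lowering n ps \<Longrightarrow> ps \<noteq> [] \<Longrightarrow> depth ps \<le> r \<Longrightarrow> zp r (low ps) = 0"
proof -
  assume a: "lowering n ps" "ps \<noteq> []" "depth ps \<le> r"
  have "depth ps \<in> set [1..<r+1]" using a depth_pos [of n ps] by auto
  hence "(0::complex) \<in> set (map (\<lambda>s. of_nat s - of_nat (depth ps)) [1..<r+1])" by force
  hence "prod_list (map (\<lambda>s. of_nat s - of_nat (depth ps)) [1..<r+1]) = (0::complex)"
    by (subst prod_list_zero_iff) auto
  thus ?thesis using Zs_low [OF a(1)] unfolding zp_def by simp
qed

text \<open>An element of \<open>Sm\<close> involves finitely many depths, all positive, and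
  \<open>zp r\<close> kills each of them once \<open>r\<close> is large enough.\<close>

lemma zp_Sm: assumes "u \<in> Sm" shows "\<exists>r0. \<forall>r\<ge>r0. zp r u = 0"
proof -
  have "Sm \<subseteq> {u \<in> V. \<exists>r0. \<forall>r\<ge>r0. zp r u = 0}" (is "_ \<subseteq> ?W")
    unfolding Sm_def
  proof (rule span_minimal)
    show "{low ps |ps. lowering n ps \<and> ps \<noteq> []} \<subseteq> ?W" using zp_low by fastforce
    show "subspace ?W"
      unfolding subspace_def
    proof (intro conjI ballI allI)
      show "0 \<in> ?W" using zp_sc [of v _ 0] by auto
      show "x + y \<in> ?W" if xy: "x \<in> ?W" "y \<in> ?W" for x y
      proof -
        from xy obtain r1 r2 where "\<forall>r\<ge>r1. zp r x = 0" "\<forall>r\<ge>r2. zp r y = 0" "x \<in> V" "y \<in> V" by auto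
        hence "\<forall>r\<ge>max r1 r2. zp r (x + y) = 0" by (simp add: zp_add)
        thus ?thesis using \<open>x \<in> V\<close> \<open>y \<in> V\<close>
          by (intro CollectI conjI exI [of _ "max r1 r2"]) auto
      qed
      show "sc c x \<in> ?W" if "x \<in> ?W" for c x using that by (auto simp: zp_sc)
    qed
  qed
  thus ?thesis using assms by auto
qed

lemma S_split: assumes "u \<in> S" shows "\<exists>c. u - sc c v \<in> Sm"
  using assms
proof (induction rule: S_induct)
  case sub
  show ?case
    unfolding subspace_def
  proof (intro conjI ballI allI)
    show "0 \<in> {u. \<exists>c. u - sc c v \<in> Sm}" using subspace_0 [OF Sm_sub] by (auto intro: exI [of _ 0])
    show "x + y \<in> {u. \<exists>c. u - sc c v \<in> Sm}" if "x \<in> {u. \<exists>c. u - sc c v \<in> Sm}" "y \<in> {u. \<exists>c. u - sc c v \<in> Sm}" for x y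
    proof -
      from that obtain c d where "x - sc c v \<in> Sm" "y - sc d v \<in> Sm" by auto
      hence "(x - sc c v) + (y - sc d v) \<in> Sm" using Sm_sub by (auto simp: subspace_add)
      hence "(x + y) - sc (c + d) v \<in> Sm" by (simp add: scale_left_distrib algebra_simps)
      thus ?thesis by blast
    qed
    show "sc k x \<in> {u. \<exists>c. u - sc c v \<in> Sm}" if "x \<in> {u. \<exists>c. u - sc c v \<in> Sm}" for k x
    proof -
      from that obtain c where "x - sc c v \<in> Sm" by auto
      hence "sc k (x - sc c v) \<in> Sm" using Sm_sub by (auto simp: subspace_scale)
      hence "sc k x - sc (k * c) v \<in> Sm" by (simp add: scale_right_diff_distrib)
      thus ?thesis by blast
    qed
  qed
next
  case (low ps)
  show ?case
  proof (cases "ps = []")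
    case True
    thus ?thesis using subspace_0 [OF Sm_sub] by (auto intro: exI [of _ 1])
  next
    case False
    thus ?thesis using low_Sm [OF low False] by (auto intro: exI [of _ 0])
  qed
qed

text \<open>\<open>zp r\<close> kills \<open>Sm\<close> for large \<open>r\<close> but multiplies
  \<open>v\<close> by r!, which is not zero; so the coefficient \<open>comp\<close> of
  \<open>v\<close> is well defined on \<open>S\<close>.\<close>

lemma v_Sm: assumes "sc c v \<in> Sm" shows "c = 0"
proof -
  from zp_Sm [OF assms] obtain r where "zp r (sc c v) = 0" by blast
  hence "sc (c * fact r) v = 0" by (simp add: zp_sc zp_v)
  thus ?thesis using v_nz by simp
qed

definition comp :: "'v \<Rightarrow> complex" where "comp u = (THE c. u - sc c v \<in> Sm)"

lemma comp_unique: assumes "u - sc c v \<in> Sm" shows "comp u = c"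
  unfolding comp_def
proof (rule the_equality, rule assms)
  fix d assume "u - sc d v \<in> Sm"
  from subspace_diff [OF Sm_sub assms this] have "(u - sc c v) - (u - sc d v) \<in> Sm" .
  hence "sc (d - c) v \<in> Sm" by (simp add: scale_left_diff_distrib)
  from v_Sm [OF this] show "d = c" by simp
qed

lemma comp_S: "u \<in> S \<Longrightarrow> u - sc (comp u) v \<in> Sm"
  using S_split [of u] comp_unique [of u] by auto

lemma v_S [simp]: "v \<in> S" using low_S [of "[]"] by simp

lemma comp_v [simp]: "comp v = 1"
  by (rule comp_unique) (simp add: subspace_0 [OF Sm_sub])

lemma comp_0 [simp]: "comp 0 = 0"
  by (rule comp_unique) (simp add: subspace_0 [OF Sm_sub])

lemma comp_add: assumes "u \<in> S" "w \<in> S" shows "comp (u + w) = comp u + comp w"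
proof (rule comp_unique)
  have "(u - sc (comp u) v) + (w - sc (comp w) v) \<in> Sm"
    using assms comp_S Sm_sub by (auto simp: subspace_add)
  thus "u + w - sc (comp u + comp w) v \<in> Sm" by (simp add: scale_left_distrib algebra_simps)
qed

lemma comp_sc: assumes "u \<in> S" shows "comp (sc c u) = c * comp u"
proof (rule comp_unique)
  have "sc c (u - sc (comp u) v) \<in> Sm" using assms comp_S Sm_sub by (auto simp: subspace_scale)
  thus "sc c u - sc (c * comp u) v \<in> Sm" by (simp add: scale_right_diff_distrib)
qed

lemma comp_sum: "(\<And>i. i \<in> A \<Longrightarrow> f i \<in> S) \<Longrightarrow> comp (sum f A) = (\<Sum>i\<in>A. comp (f i))"
  by (induction A rule: infinite_finite_induct) (auto simp: comp_add S_sum)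

lemma comp_low: "lowering n ps \<Longrightarrow> ps \<noteq> [] \<Longrightarrow> comp (low ps) = 0"
  by (rule comp_unique) (simp add: low_Sm)

lemma comp_H: assumes "H \<in> cartan n" "u \<in> S" shows "comp (R H u) = wt H * comp u"
proof -
  have "u \<in> S \<and> comp (R H u) = wt H * comp u"
  using assms(2)
proof (induction rule: S_induct)
  case sub
  show ?case using S_sub assms(1) S_V
    by (auto simp: subspace_def R_add R_sc comp_add comp_sc R_S subset_iff algebra_simps)
next
  case (low ps)
  show ?case using low assms low_S [OF low]
    by (cases "ps = []") (auto simp: H_low H_v' comp_sc comp_low)
qed
  thus ?thesis by simp
qed

lemma comp_eigen: "H \<in> cartan n \<Longrightarrow> u \<in> S \<Longrightarrow> R H u = sc c u \<Longrightarrow> c \<noteq> wt H \<Longrightarrow> comp u = 0"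
  using comp_H [of H u] by (simp add: comp_sc)

end

subsection \<open>Simple modules\<close>

lemma (in slrep) ta_zero: "texpr_in n e \<Longrightarrow> ta e 0 = 0"
  by (induction e) (auto simp: ta_Cons texpr_in_Cons foldr_R_0)

definition (in slrep) submod :: "'v set \<Rightarrow> bool" where
  "submod W \<longleftrightarrow> W \<subseteq> V \<and> subspace W \<and> (\<forall>X\<in>sl n. \<forall>w\<in>W. R X w \<in> W)"

definition (in slrep) simple :: bool where
  "simple \<longleftrightarrow> (\<forall>W. submod W \<and> W \<noteq> {0} \<longrightarrow> W = V)"

lemma (in slrep) simple_orbit:
  assumes simple "u \<in> V" "u \<noteq> 0" "w \<in> V"
  obtains e where "texpr_in n e" "w = ta e u"
proof -
  have "submod {ta e u | e. texpr_in n e}"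
    unfolding submod_def using ta_orbit_sub [OF assms(2)] by blast
  moreover have "{ta e u | e. texpr_in n e} \<noteq> {0}" using ta_orbit_sub(2) [OF assms(2)] assms(3) by blast
  ultimately have "{ta e u | e. texpr_in n e} = V" using assms(1) unfolding simple_def by blast
  with assms(4) that show ?thesis by blast
qed

text \<open>The direct sum of two modules with the same highest weight. The pair (v, v') is again a
  highest weight vector, so \<open>comp\<close> and \<open>zp\<close> are available for the
  submodule that it generates.\<close>

lemma hwrep_prod:
  assumes "hwrep sc n V R v m" "hwrep sc' n V' R' v' m"
  shows "hwrep (\<lambda>c p. (sc c (fst p), sc' c (snd p))) n (V \<times> V') (\<lambda>X p. (R X (fst p), R' X (snd p))) (v, v') m"
proof -
  interpret a: hwrep sc n V R v m by fact
  interpret b: hwrep sc' n V' R' v' m by fact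
  have vs: "vector_space (\<lambda>c p. (sc c (fst p), sc' c (snd p)))"
    by unfold_locales
      (auto simp: a.scale_right_distrib b.scale_right_distrib a.scale_left_distrib b.scale_left_distrib)
  interpret p: vector_space "\<lambda>c p. (sc c (fst p), sc' c (snd p))" by (rule vs)
  show ?thesis
  proof (unfold_locales, goal_cases)
    case 1
    show ?case by (auto simp: p.subspace_def zero_prod_def)
  qed (use a.v_nz in \<open>auto simp: a.R_add b.R_add a.R_sc b.R_sc a.R_mlin b.R_mlin a.R_bracket b.R_bracket
          a.H_v b.H_v a.E_v b.E_v zero_prod_def\<close>)
qed

lemma ta_prod:
  assumes "hwrep sc n V R v m" "hwrep sc' n V' R' v' m"
  shows "slrep.ta (\<lambda>c p. (sc c (fst p), sc' c (snd p))) (\<lambda>X p. (R X (fst p), R' X (snd p))) e (x, y)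
    = (slrep.ta sc R e x, slrep.ta sc' R' e y)"
proof -
  interpret a: hwrep sc n V R v m by fact
  interpret b: hwrep sc' n V' R' v' m by fact
  interpret p: hwrep "\<lambda>c p. (sc c (fst p), sc' c (snd p))" n "V \<times> V'" "\<lambda>X p. (R X (fst p), R' X (snd p))" "(v, v')" m
    by (rule hwrep_prod) fact+
  have f: "foldr (\<lambda>X p. (R X (fst p), R' X (snd p))) w (x, y) = (foldr R w x, foldr R' w y)" for w
    by (induction w) auto
  show ?thesis
    by (induction e) (auto simp: p.ta_Cons a.ta_Cons b.ta_Cons f zero_prod_def)
qed

text \<open>In the submodule generated by \<open>(v, v')\<close> the weight of \<open>(v, v')\<close> has multiplicity one, so no element of
  the tensor algebra can fix \<open>v\<close> and kill \<open>v'\<close>.\<close>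

lemma annihilator_compare:
  assumes "hwrep sc n V R v m" "hwrep sc' n V' R' v' m" "slrep.simple sc n V R" "texpr_in n e"
    "\<And>x. x \<in> V' \<Longrightarrow> slrep.ta sc' R' e x = 0" "u \<in> V"
  shows "slrep.ta sc R e u = 0"
proof (rule ccontr)
  interpret a: hwrep sc n V R v m by fact
  interpret b: hwrep sc' n V' R' v' m by fact
  interpret p: hwrep "\<lambda>c p. (sc c (fst p), sc' c (snd p))" n "V \<times> V'" "\<lambda>X p. (R X (fst p), R' X (snd p))" "(v, v')" m
    by (rule hwrep_prod) fact+
  assume nz: "a.ta e u \<noteq> 0"
  obtain g where g: "texpr_in n g" "u = a.ta g v"
    using a.simple_orbit [OF assms(3) a.v_V a.v_nz assms(6)] by blast
  obtain f where f: "texpr_in n f" "v = a.ta f (a.ta e u)"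
    using a.simple_orbit [OF assms(3) _ nz a.v_V] assms by (metis a.ta_V)
  define h where "h = tmul f (tmul e g)"
  have h: "texpr_in n h" unfolding h_def by (intro texpr_in_tmul f g assms)
  have "a.ta h v = v"
    unfolding h_def using f g assms by (simp add: a.ta_tmul texpr_in_tmul)
  moreover have "b.ta h v' = 0"
    unfolding h_def using f(1) g(1) assms(4,5) by (simp add: b.ta_tmul texpr_in_tmul b.ta_zero)
  ultimately have vz: "p.ta h (v, v') = (v, 0)" by (simp add: ta_prod [OF assms(1,2)])
  have "(v, 0) \<in> p.S" using p.ta_S [OF h p.v_S] vz by simp
  \<comment> \<open>\<open>c\<close> is the coefficient of (v, v') in (v, 0). The operator
    \<open>p.zp r\<close> acts coordinatewise and multiplies both vectors by r!, so the first
    coordinate demands c = 1 and the second c = 0.\<close>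
  from p.comp_S [OF this] obtain c where c: "(v, 0) - (sc c v, sc' c v') \<in> p.Sm" by auto
  from p.zp_Sm [OF this] obtain r where r: "p.zp r ((v, 0) - (sc c v, sc' c v')) = 0" by blast
  have zpp: "p.zp r (x, y) = (a.zp r x, b.zp r y)" for x y
  proof -
    have "foldr p.Z ss (x, y) = (foldr a.Z ss x, foldr b.Z ss y)" for ss
      by (induction ss) (auto simp: p.Z_def a.Z_def b.Z_def)
    thus ?thesis by (simp add: p.zp_def a.zp_def b.zp_def)
  qed
  have e: "(v, 0) - (sc c v, sc' c v') = (sc (1 - c) v, sc' (- c) v')"
    by (simp add: a.scale_left_diff_distrib b.scale_minus_left)
  have "sc ((1 - c) * fact r) v = 0" "sc' (- c * fact r) v' = 0"
    using r unfolding e zpp a.zp_sc [OF a.v_V] b.zp_sc [OF b.v_V] a.zp_v b.zp_v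
    by (simp_all add: zero_prod_def)
  thus False using a.v_nz b.v_nz by simp
qed

subsection \<open>Modules inside \<open>nat \<Rightarrow> complex\<close>\<close>

lemma vect_ops: "vadd = (+)" "vzero = 0"
  by (auto simp: vadd_def vzero_def fun_eq_iff)

interpretation fv: vector_space vsmul
  by unfold_locales (auto simp: vsmul_def fun_eq_iff algebra_simps)

lemma vsubspace_iff: "vsubspace W \<longleftrightarrow> fv.subspace W"
  by (auto simp: vsubspace_def fv.subspace_def vect_ops)

lemma is_rep_slrep: assumes "is_rep n V R" shows "slrep vsmul n V R"
proof (unfold_locales, goal_cases)
  case 1
  thus ?case using assms by (auto simp: is_rep_def vsubspace_iff)
next
  case (3 X u w)
  have "R X (vadd (vsmul 1 u) (vsmul 1 w)) = vadd (vsmul 1 (R X u)) (vsmul 1 (R X w))"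
    using 3 assms unfolding is_rep_def by blast
  thus ?case by (simp add: vect_ops)
next
  case (4 X u c)
  have "R X (vadd (vsmul c u) (vsmul 0 u)) = vadd (vsmul c (R X u)) (vsmul 0 (R X u))"
    using 4 assms unfolding is_rep_def by blast
  thus ?case by (simp add: vect_ops)
next
  case (5 X Y u a b)
  thus ?case using assms unfolding is_rep_def by (auto simp: vect_ops)
next
  case (6 X Y u)
  have "R (bracket n X Y) u = vadd (R X (R Y u)) (vsmul (-1) (R Y (R X u)))"
    using 6 assms unfolding is_rep_def by blast
  thus ?case by (simp add: vect_ops)
qed (use assms in \<open>auto simp: is_rep_def\<close>)

lemma simple_hw_hwrep:
  assumes "simple_hw n V R v \<mu>"
  shows "hwrep vsmul n V R v (epsc n \<mu>)" "slrep.simple vsmul n V R"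
proof -
  have s: "slrep vsmul n V R" using assms by (simp add: simple_hw_def is_rep_slrep)
  then interpret slrep vsmul n V R .
  show "hwrep vsmul n V R v (epsc n \<mu>)"
    by unfold_locales (use assms in \<open>auto simp: simple_hw_def weval_def vect_ops\<close>)
  show simple
    unfolding simple_def submod_def using assms
    by (auto simp: simple_hw_def vsubspace_iff vect_ops)
qed

lemma tact_ta: assumes "slrep vsmul n V R" shows "tact R e u = slrep.ta vsmul R e u"
proof -
  interpret slrep vsmul n V R by fact
  show ?thesis
    by (induction e) (auto simp: tact_def vsum_def vect_ops ta_def)
qed

text \<open>By \<open>annihilator_compare\<close>, every highest weight module of weight
  \<open>\<mu>\<close> may serve as a source of annihilating elements; it may be non-simple and live
  in any vector space.\<close>

lemma annT_of_model:
  assumes "hwrep sc n V R v (epsc n \<mu>)" "texpr_in n e" "\<And>x. x \<in> V \<Longrightarrow> slrep.ta sc R e x = 0"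
  shows "e \<in> annT n \<mu>"
  unfolding annT_def
proof (intro CollectI conjI allI impI ballI)
  fix V' R' v' u assume h: "simple_hw n V' R' v' \<mu>" "u \<in> V'"
  note h1 = simple_hw_hwrep [OF h(1)]
  have "slrep vsmul n V' R'" using h1(1) by (simp add: hwrep_def)
  hence "tact R' e u = slrep.ta vsmul R' e u" by (rule tact_ta)
  also have "\<dots> = 0" by (rule annihilator_compare [OF h1(1) assms(1) h1(2) assms(2,3) h(2)])
  finally show "tact R' e u = vzero" by (simp add: vect_ops)
qed (rule assms)

text \<open>Every natural number codes a word in the spanning letters \<open>etl\<close>;
  \<open>min\<close> forces the indices into range, so that no code has to be excluded.\<close>

definition wrd :: "nat \<Rightarrow> nat \<Rightarrow> mat list" where
  "wrd n k = map (\<lambda>p. etl n (min (fst p) n) (min (snd p) n)) (from_nat k)"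

lemma wrd_sl: "set (wrd n k) \<subseteq> sl n"
  by (auto simp: wrd_def)

text \<open>The simple quotient is realised by matrix coefficients: \<open>u\<close> goes to the function
  \<open>w \<mapsto> comp (w u)\<close> on words \<open>w\<close>, whose kernel is the maximal submodule.\<close>

lemma (in hwrep) simple_hw_exists:
  assumes m: "m = epsc n \<mu>"
  shows "\<exists>V' R' v'. simple_hw n V' R' v' \<mu>"
proof -
  define F where "F u = (\<lambda>k. comp (foldr R (wrd n k) u))" for u
  \<comment> \<open>A letter is appended on the right of the word, next to the vector, because w (X
    u) expands over the letters \<open>p\<close> of \<open>X\<close> into the values of
    \<open>F u\<close> at the words w p.\<close>
  define R' where "R' X g = (\<lambda>k. \<Sum>p\<in>{..n}\<times>{..n}. X (fst p) (snd p) * g (to_nat ((from_nat k :: (nat \<times> nat) list) @ [p])))"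
    for X :: mat and g :: vect
  have SV: "u \<in> V" if "u \<in> S" for u using that S_V by blast
  have wS: "foldr R (wrd n k) u \<in> S" if "u \<in> S" for k u
    using that wrd_sl by (simp add: foldr_R_S)
  have Fadd: "F (x + y) = vadd (F x) (F y)" if "x \<in> S" "y \<in> S" for x y
    using that SV wS wrd_sl by (auto simp: F_def vadd_def foldr_R_add comp_add)
  have Fsc: "F (sc c x) = vsmul c (F x)" if "x \<in> S" for x c
    using that SV wS wrd_sl by (auto simp: F_def vsmul_def foldr_R_sc comp_sc)
  have FR: "R' X (F x) = F (R X x)" if "x \<in> S" "X \<in> sl n" for x X
  proof
    fix k
    have w: "wrd n (to_nat ((from_nat k :: (nat \<times> nat) list) @ [p])) = wrd n k @ [etl n (fst p) (snd p)]"
      if "p \<in> {..n} \<times> {..n}" for p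
      using that by (auto simp: wrd_def)
    have f: "foldr R (wrd n k) (\<Sum>p\<in>A. sc (c p) (g p)) = (\<Sum>p\<in>A. sc (c p) (foldr R (wrd n k) (g p)))"
      if "\<And>p. p \<in> A \<Longrightarrow> g p \<in> V" for A :: "(nat \<times> nat) set" and c g
      using that
      by (induction A rule: infinite_finite_induct)
        (auto simp: foldr_R_0 wrd_sl foldr_R_add foldr_R_sc V_sum)
    have "F (R X x) k = comp (foldr R (wrd n k) (\<Sum>p\<in>{..n}\<times>{..n}. sc (X (fst p) (snd p)) (R (etl n (fst p) (snd p)) x)))"
      unfolding F_def using R_expand [OF that(2) SV [OF that(1)]] by simp
    also have "\<dots> = comp (\<Sum>p\<in>{..n}\<times>{..n}. sc (X (fst p) (snd p)) (foldr R (wrd n k) (R (etl n (fst p) (snd p)) x)))"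
      by (subst f) (use SV that in auto)
    also have "\<dots> = (\<Sum>p\<in>{..n}\<times>{..n}. X (fst p) (snd p) * comp (foldr R (wrd n k) (R (etl n (fst p) (snd p)) x)))"
      by (subst comp_sum) (use that wS R_S in \<open>auto intro!: S_sc sum.cong simp: comp_sc\<close>)
    also have "\<dots> = R' X (F x) k"
      unfolding R'_def F_def by (rule sum.cong) (simp_all add: w)
    finally show "R' X (F x) k = F (R X x) k" by simp
  qed
  have F0: "F 0 = vzero" using Fsc [OF S_0, of 0] by (simp add: vsmul_def vzero_def)
  have Fv: "F v \<noteq> vzero"
  proof
    assume "F v = vzero"
    hence "F v (to_nat ([] :: (nat \<times> nat) list)) = 0" by (simp add: vzero_def)
    thus False by (simp add: F_def wrd_def)
  qed
  have rep: "is_rep n (F ` S) R'"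
    unfolding is_rep_def
  proof (intro conjI ballI allI)
    show "vsubspace (F ` S)"
      unfolding vsubspace_def
    proof (intro conjI ballI allI)
      show "vzero \<in> F ` S" using F0 S_0 by force
      show "vadd u w \<in> F ` S" if "u \<in> F ` S" "w \<in> F ` S" for u w
        using that by (auto simp: Fadd [symmetric] S_add)
      show "vsmul c u \<in> F ` S" if "u \<in> F ` S" for c u
        using that by (auto simp: Fsc [symmetric] S_sc)
    qed
    fix X u assume X: "X \<in> sl n" and u: "u \<in> F ` S"
    show "R' X u \<in> F ` S" using X u by (auto simp: FR R_S)
    fix w a b
    show "R' X (vadd (vsmul a u) (vsmul b w)) = vadd (vsmul a (R' X u)) (vsmul b (R' X w))"
      by (simp add: R'_def vadd_def vsmul_def sum.distrib [symmetric] sum_distrib_left algebra_simps)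
  next
    fix X Y u a b assume "X \<in> sl n" "Y \<in> sl n" "u \<in> F ` S"
    show "R' (mlin a X b Y) u = vadd (vsmul a (R' X u)) (vsmul b (R' Y u))"
      by (simp add: R'_def vadd_def vsmul_def mlin_def sum.distrib [symmetric] sum_distrib_left algebra_simps)
  next
    fix X Y u assume XY: "X \<in> sl n" "Y \<in> sl n" and "u \<in> F ` S"
    then obtain x where x: "x \<in> S" "u = F x" by blast
    have s: "sc (-1) (R Y (R X x)) \<in> S" using x XY by (intro S_sc R_S) auto
    have "R' (bracket n X Y) u = F (R X (R Y x) + sc (-1) (R Y (R X x)))"
      using x XY SV by (simp add: FR R_bracket scale_minus_left)
    also have "\<dots> = vadd (F (R X (R Y x))) (vsmul (-1) (F (R Y (R X x))))"
      using x XY by (subst Fadd [OF _ s], blast intro: R_S) (subst Fsc, auto intro: R_S)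
    finally show "R' (bracket n X Y) u = vadd (R' X (R' Y u)) (vsmul (- 1) (R' Y (R' X u)))"
      using x XY by (simp add: FR R_S)
  qed
  have "simple_hw n (F ` S) R' (F v) \<mu>"
    unfolding simple_hw_def
  proof (intro conjI allI impI ballI)
    show "is_rep n (F ` S) R'" by (rule rep)
    show "F v \<in> F ` S" by simp
    show "F v \<noteq> vzero" by (rule Fv)
    show "R' H (F v) = vsmul (weval n \<mu> H) (F v)" if "H \<in> cartan n" for H
      using that by (simp add: FR H_v Fsc weval_def m)
    show "R' (emat i j) (F v) = vzero" if "i < j \<and> j \<le> n" for i j
      using that by (simp add: FR E_v F0)
    fix W assume W: "W \<subseteq> F ` S \<and> vsubspace W \<and> (\<forall>X\<in>sl n. \<forall>w\<in>W. R' X w \<in> W) \<and> W \<noteq> {vzero}"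
    hence Wadd: "vadd x y \<in> W" if "x \<in> W" "y \<in> W" for x y using that by (auto simp: vsubspace_def)
    have Wsc: "vsmul c x \<in> W" if "x \<in> W" for c x using W that by (auto simp: vsubspace_def)
    have WR: "F (R X x) \<in> W" if "x \<in> S" "F x \<in> W" "X \<in> sl n" for x X using W that FR by metis
    have "vzero \<in> W" using W by (auto simp: vsubspace_def)
    with W obtain x where x: "x \<in> S" "F x \<in> W" "F x \<noteq> vzero" by blast
    \<comment> \<open>A nonzero value of \<open>F x\<close> is a word that moves \<open>x\<close> to
      a vector with nonzero component along \<open>v\<close>. Then \<open>zp\<close> turns this
      vector into a nonzero multiple of \<open>v\<close> without leaving the submodule.\<close>
    then obtain k where k: "F x k \<noteq> 0" by (auto simp: vzero_def)
    define y where "y = foldr R (wrd n k) x"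
    have yS: "y \<in> S" unfolding y_def by (rule wS) fact
    have "foldr R w x \<in> S \<and> F (foldr R w x) \<in> W" if "set w \<subseteq> sl n" for w
      using that by (induction w) (auto simp: x R_S WR)
    from this [OF wrd_sl] have yW: "F y \<in> W" unfolding y_def by blast
    have cy: "comp y \<noteq> 0" using k unfolding F_def y_def .
    from zp_Sm [OF comp_S [OF yS]] obtain r where r: "zp r (y - sc (comp y) v) = 0" by blast
    have zps: "foldr Z ss y \<in> S \<and> F (foldr Z ss y) \<in> W" for ss
    proof (induction ss)
      case (Cons s ss)
      let ?u = "foldr Z ss y"
      have e: "Z s ?u = R (H0 n) ?u + sc (- (wt (H0 n) - of_nat s)) ?u"
        by (simp add: Z_def scale_minus_left [symmetric] del: scale_minus_left)
      have "Z s ?u \<in> S" unfolding e using Cons by (intro S_add S_sc R_S) auto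
      moreover have "F (Z s ?u) = vadd (F (R (H0 n) ?u)) (vsmul (- (wt (H0 n) - of_nat s)) (F ?u))"
        unfolding e using Cons by (subst Fadd) (auto intro: S_sc R_S simp: Fsc)
      moreover have "\<dots> \<in> W" using Cons by (intro Wadd Wsc WR) auto
      ultimately show ?case by simp
    qed (use yS yW in auto)
    have "zp r y = zp r (y - sc (comp y) v) + zp r (sc (comp y) v)"
      using yS SV by (subst zp_add [symmetric]) auto
    hence "zp r y = sc (comp y * fact r) v" using r by (simp add: zp_sc zp_v)
    hence "vsmul (comp y * fact r) (F v) \<in> W" using zps [of "[1..<r+1]"] unfolding zp_def by (simp add: Fsc)
    from Wsc [OF this, of "1 / (comp y * fact r)"] have vW: "F v \<in> W"
      using cy by (simp add: vsmul_def)
    have lowW: "lowering n ps \<Longrightarrow> F (low ps) \<in> W" for ps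
      by (induction ps) (auto simp: vW intro!: WR low_S)
    have "x \<in> S \<and> F x \<in> W" if "x \<in> S" for x
      using that
    proof (induction rule: S_induct)
      case sub
      show ?case using S_sub \<open>vzero \<in> W\<close> by (auto simp: subspace_def F0 Fadd Fsc Wadd Wsc)
    qed (use lowW low_S in auto)
    thus "W = F ` S" using W by blast
  qed
  thus ?thesis by blast
qed

section \<open>Points of the associated variety\<close>

context hwrep begin

text \<open>An increasing filtration by the integral shift of the \<open>H\<close>-eigenvalue. Only
  an upper bound on the shift is recorded, since terms of lower degree are to be discarded
  together.\<close>

definition G :: "mat \<Rightarrow> complex \<Rightarrow> int \<Rightarrow> 'v set" where
  "G H \<mu> s = span {x \<in> S. \<exists>t\<le>s. R H x = sc (\<mu> + of_int t) x}"

lemma G_sub: "subspace (G H \<mu> s)" unfolding G_def by (rule subspace_span)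

lemma G_add: "x \<in> G H \<mu> s \<Longrightarrow> y \<in> G H \<mu> s \<Longrightarrow> x + y \<in> G H \<mu> s"
  and G_diff: "x \<in> G H \<mu> s \<Longrightarrow> y \<in> G H \<mu> s \<Longrightarrow> x - y \<in> G H \<mu> s"
  and G_sc: "x \<in> G H \<mu> s \<Longrightarrow> sc c x \<in> G H \<mu> s" and G_0 [simp]: "0 \<in> G H \<mu> s"
  and G_sum: "(\<And>i. i \<in> A \<Longrightarrow> f i \<in> G H \<mu> s) \<Longrightarrow> sum f A \<in> G H \<mu> s"
  using G_sub by (auto simp: subspace_0 subspace_add subspace_diff subspace_scale subspace_sum)

lemma G_mono: "s \<le> s' \<Longrightarrow> G H \<mu> s \<subseteq> G H \<mu> s'"
  unfolding G_def
proof (rule span_mono, safe)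
  fix x t assume "s \<le> s'" "x \<in> S" "t \<le> s" "R H x = sc (\<mu> + of_int t) x"
  thus "\<exists>t\<le>s'. R H x = sc (\<mu> + of_int t) x" by (intro exI [of _ t]) auto
qed

lemma G_base: "x \<in> S \<Longrightarrow> R H x = sc (\<mu> + of_int t) x \<Longrightarrow> t \<le> s \<Longrightarrow> x \<in> G H \<mu> s"
  unfolding G_def by (rule span_base) blast

lemma G_S: "G H \<mu> s \<subseteq> S"
  unfolding G_def by (rule span_minimal) (use S_sub in auto)

lemma SV: "x \<in> S \<Longrightarrow> x \<in> V" using S_V by blast

lemma G_V: "x \<in> G H \<mu> s \<Longrightarrow> x \<in> V" using G_S SV by blast

lemma G_induct [consumes 1, case_names sub base]:
  assumes "x \<in> G H \<mu> s" "subspace {x. P x}" "\<And>x t. x \<in> S \<Longrightarrow> t \<le> s \<Longrightarrow> R H x = sc (\<mu> + of_int t) x \<Longrightarrow> P x"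
  shows "P x"
proof -
  have "G H \<mu> s \<subseteq> {x. P x}" unfolding G_def by (rule span_minimal) (use assms in auto)
  thus ?thesis using assms(1) by blast
qed

lemma G_R:
  assumes "x \<in> G H \<mu> s" "X \<in> sl n"
    "\<And>x t. x \<in> S \<Longrightarrow> t \<le> s \<Longrightarrow> R H x = sc (\<mu> + of_int t) x \<Longrightarrow> R X x \<in> G H \<mu> s'"
  shows "R X x \<in> G H \<mu> s'"
proof -
  have "x \<in> V \<and> R X x \<in> G H \<mu> s'"
    using assms(1)
  proof (induction rule: G_induct)
    case sub
    show ?case using sub_R_in [OF assms(2) G_sub] by simp
  qed (use assms(3) SV in auto)
  thus ?thesis ..
qed

lemma G_E:
  assumes "dg n (\<lambda>a. of_int (h a)) \<in> cartan n" "x \<in> G (dg n (\<lambda>a. of_int (h a))) \<mu> s" "a \<le> n" "b \<le> n" "a \<noteq> b"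
  shows "R (emat a b) x \<in> G (dg n (\<lambda>a. of_int (h a))) \<mu> (s + h a - h b)"
proof (rule G_R [OF assms(2)])
  let ?H = "dg n (\<lambda>a. of_int (h a))"
  fix y t assume x: "y \<in> S" "t \<le> s" "R ?H y = sc (\<mu> + of_int t) y"
  show "R (emat a b) y \<in> G ?H \<mu> (s + h a - h b)"
  proof (rule G_base)
    show "R (emat a b) y \<in> S" using x(1) assms(3-5) by (simp add: R_S)
    have "R ?H (R (emat a b) y) = R (emat a b) (R ?H y) + sc (?H a a - ?H b b) (R (emat a b) y)"
      by (rule HE [OF assms(1,3,4,5) SV [OF x(1)]])
    also have "R (emat a b) (R ?H y) = sc (\<mu> + of_int t) (R (emat a b) y)"
      unfolding x(3) using assms(3-5) SV [OF x(1)] by (simp add: R_sc)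
    finally show "R ?H (R (emat a b) y) = sc (\<mu> + of_int (t + h a - h b)) (R (emat a b) y)"
      using assms(3,4) by (simp add: scale_left_distrib [symmetric] add_diff_eq)
    show "t + h a - h b \<le> s + h a - h b" using x by simp
  qed
qed (use assms in auto)

lemma G_cartan:
  assumes "x \<in> G H \<mu> s" "K \<in> cartan n" "H \<in> cartan n"
  shows "R K x \<in> G H \<mu> s"
proof (rule G_R [OF assms(1)])
  fix x t assume x: "x \<in> S" "t \<le> s" "R H x = sc (\<mu> + of_int t) x"
  have d: "mmul n H K = mmul n K H"
  proof (intro ext)
    have z: "H a b = 0" "K a b = 0" if "a \<noteq> b" for a b
      using assms(2,3) that by (auto simp: cartan_def simp del: cartan_sl)
    have "H a k * K k b = K a k * H k b" for a k b
      using z(1) [of a k] z(2) [of a k] z(1) [of k b] z(2) [of k b]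
      by (cases "a = k"; cases "k = b") auto
    thus "mmul n H K a b = mmul n K H a b" for a b unfolding mmul_def by (simp cong: sum.cong)
  qed
  have "bracket n H K = (\<lambda>a b. 0)" by (simp add: bracket_def mlin_def d)
  hence "R H (R K x) = R K (R H x)"
    using R_comm [of H K x] x SV assms by simp
  thus "R K x \<in> G H \<mu> s"
    using x assms SV by (intro G_base [OF _ _ x(2)]) (auto simp: R_sc R_S)
qed (use assms in auto)

lemma etl_diag_cartan: "a \<le> n \<Longrightarrow> etl n a a \<in> cartan n"
  using etl_sl [of a n a] by (auto simp: cartan_def etl_def emat_def idm_def simp del: etl_sl cartan_sl)

lemma G_etl:
  assumes "dg n (\<lambda>a. of_int (h a)) \<in> cartan n" "x \<in> G (dg n (\<lambda>a. of_int (h a))) \<mu> s" "a \<le> n" "b \<le> n"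
  shows "R (etl n a b) x \<in> G (dg n (\<lambda>a. of_int (h a))) \<mu> (s + h a - h b)"
  using assms G_E [OF assms] G_cartan [OF assms(2) _ assms(1)]
  by (cases "a = b") (auto simp: etl_diag_cartan etl_neq)

text \<open>The part of the action of \<open>X\<close> carried by the matrix positions in
  \<open>Q\<close>. With \<open>Q\<close> the positions \<open>topl h D\<close> of maximal degree,
  this is the leading part of \<open>X\<close> for the filtration.\<close>

definition T :: "(nat \<times> nat) set \<Rightarrow> mat \<Rightarrow> 'v \<Rightarrow> 'v" where
  "T Q X x = (\<Sum>p\<in>Q. sc (X (fst p) (snd p)) (R (emat (fst p) (snd p)) x))"

definition topl :: "(nat \<Rightarrow> int) \<Rightarrow> int \<Rightarrow> (nat \<times> nat) set" where
  "topl h D = {p \<in> {..n} \<times> {..n}. h (fst p) - h (snd p) = D}"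

lemma top_letters:
  assumes H: "dg n (\<lambda>a. of_int (h a)) \<in> cartan n" and D: "\<forall>a\<le>n. \<forall>b\<le>n. h a - h b \<le> D" "D \<ge> 1"
    and X: "X \<in> sl n" and x: "x \<in> G (dg n (\<lambda>a. of_int (h a))) \<mu> s"
  shows "R X x - T (topl h D) X x \<in> G (dg n (\<lambda>a. of_int (h a))) \<mu> (s + D - 1)"
    "T (topl h D) X x \<in> G (dg n (\<lambda>a. of_int (h a))) \<mu> (s + D)"
    "R X x \<in> G (dg n (\<lambda>a. of_int (h a))) \<mu> (s + D)"
proof -
  let ?G = "G (dg n (\<lambda>a. of_int (h a))) \<mu>"
  let ?f = "\<lambda>p. sc (X (fst p) (snd p)) (R (etl n (fst p) (snd p)) x)"
  have t: "T (topl h D) X x = sum ?f (topl h D)"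
    unfolding T_def
  proof (rule sum.cong)
    fix p assume "p \<in> topl h D"
    hence "fst p \<noteq> snd p" using D(2) by (auto simp: topl_def)
    thus "sc (X (fst p) (snd p)) (R (emat (fst p) (snd p)) x) = ?f p" by (simp add: etl_neq)
  qed simp
  have "R X x = sum ?f ({..n} \<times> {..n})" using R_expand [OF X G_V [OF x]] .
  also have "\<dots> = sum ?f ({..n} \<times> {..n} - topl h D) + sum ?f (topl h D)"
    by (rule sum.subset_diff) (auto simp: topl_def)
  finally have e: "R X x - T (topl h D) X x = sum ?f ({..n} \<times> {..n} - topl h D)" unfolding t by simp
  show 1: "R X x - T (topl h D) X x \<in> ?G (s + D - 1)"
    unfolding e
  proof (rule G_sum)
    fix p assume p: "p \<in> {..n} \<times> {..n} - topl h D"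
    hence "h (fst p) - h (snd p) \<noteq> D" "h (fst p) - h (snd p) \<le> D" using D(1)
      by (auto simp: topl_def)
    hence "?G (s + h (fst p) - h (snd p)) \<subseteq> ?G (s + D - 1)" by (intro G_mono) auto
    thus "?f p \<in> ?G (s + D - 1)" using G_etl [OF H x, of "fst p" "snd p"] p by (auto intro!: G_sc)
  qed
  show 2: "T (topl h D) X x \<in> ?G (s + D)"
    unfolding t
  proof (rule G_sum)
    fix p assume p: "p \<in> topl h D"
    hence q: "s + h (fst p) - h (snd p) = s + D" "fst p \<le> n" "snd p \<le> n" by (auto simp: topl_def)
    show "?f p \<in> ?G (s + D)" using G_etl [OF H x q(2,3)] unfolding q(1) by (rule G_sc)
  qed
  have "?G (s + D - 1) \<subseteq> ?G (s + D)" by (rule G_mono) simp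
  hence "(R X x - T (topl h D) X x) + T (topl h D) X x \<in> ?G (s + D)" using 1 2 by (intro G_add) auto
  thus "R X x \<in> ?G (s + D)" by simp
qed

definition tT :: "(nat \<times> nat) set \<Rightarrow> nat \<Rightarrow> texpr \<Rightarrow> 'v \<Rightarrow> 'v" where
  "tT Q d e u = sum_list (map (\<lambda>t. if length (snd t) = d then sc (fst t) (foldr (T Q) (snd t) u) else 0) e)"

lemma tT_Nil [simp]: "tT Q d [] u = 0"
  and tT_Cons: "tT Q d (t # e) u = (if length (snd t) = d then sc (fst t) (foldr (T Q) (snd t) u) else 0) + tT Q d e u"
  by (auto simp: tT_def)

lemma T_S: assumes "x \<in> S" "\<And>p. p \<in> Q \<Longrightarrow> fst p \<le> n \<and> snd p \<le> n \<and> fst p \<noteq> snd p"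
  shows "T Q X x \<in> S"
  unfolding T_def using assms by (intro S_sum S_sc R_S) auto

lemma T_add: assumes "x \<in> V" "y \<in> V" "\<And>p. p \<in> Q \<Longrightarrow> fst p \<le> n \<and> snd p \<le> n \<and> fst p \<noteq> snd p"
  shows "T Q X (x + y) = T Q X x + T Q X y"
  unfolding T_def using assms by (simp add: R_add scale_right_distrib sum.distrib [symmetric])

lemma T_sc: assumes "x \<in> V" "\<And>p. p \<in> Q \<Longrightarrow> fst p \<le> n \<and> snd p \<le> n \<and> fst p \<noteq> snd p"
  shows "T Q X (sc c x) = sc c (T Q X x)"
  unfolding T_def using assms by (simp add: R_sc scale_sum_right mult.commute)

lemma top_words:
  assumes H: "dg n (\<lambda>a. of_int (h a)) \<in> cartan n" and D: "\<forall>a\<le>n. \<forall>b\<le>n. h a - h b \<le> D" "D \<ge> 1"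
    and u: "u \<in> G (dg n (\<lambda>a. of_int (h a))) \<mu> 0"
  shows "set w \<subseteq> sl n \<Longrightarrow> foldr R w u - foldr (T (topl h D)) w u \<in> G (dg n (\<lambda>a. of_int (h a))) \<mu> (D * int (length w) - 1)
    \<and> foldr (T (topl h D)) w u \<in> G (dg n (\<lambda>a. of_int (h a))) \<mu> (D * int (length w))
    \<and> foldr R w u \<in> G (dg n (\<lambda>a. of_int (h a))) \<mu> (D * int (length w))"
proof (induction w)
  case (Cons X w)
  let ?G = "G (dg n (\<lambda>a. of_int (h a))) \<mu>"
  let ?T = "T (topl h D)"
  note tl = top_letters [OF H D]
  have X: "X \<in> sl n" using Cons.prems by simp
  let ?a = "foldr R w u" and ?b = "foldr ?T w u" and ?r = "D * int (length w)"
  have ih: "?a - ?b \<in> ?G (?r - 1)" "?b \<in> ?G ?r" "?a \<in> ?G ?r" using Cons by auto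
  have e: "R X ?a - ?T X ?b = R X (?a - ?b) + (R X ?b - ?T X ?b)"
    using X ih G_V by (simp add: R_diff)
  have "R X (?a - ?b) \<in> ?G (?r - 1 + D)" using tl(3) [OF X ih(1)] .
  moreover have "R X ?b - ?T X ?b \<in> ?G (?r + D - 1)" using tl(1) [OF X ih(2)] .
  moreover have "?r - 1 + D = ?r + D - 1" by simp
  ultimately have "R X ?a - ?T X ?b \<in> ?G (?r + D - 1)" unfolding e by (metis G_add)
  moreover have "D * int (length (X # w)) = ?r + D" by (simp add: algebra_simps)
  ultimately show ?case using tl(2) [OF X ih(2)] tl(3) [OF X ih(3)] by simp
qed (use u in simp)

text \<open>The bridge from an annihilating expression to its symbol: words shorter than
  \<open>d\<close> fall into lower degree because D is at least 1, and in a word of length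
  \<open>d\<close> each letter may be replaced by its leading part.\<close>

lemma top_texpr:
  assumes H: "dg n (\<lambda>a. of_int (h a)) \<in> cartan n" and D: "\<forall>a\<le>n. \<forall>b\<le>n. h a - h b \<le> D" "D \<ge> 1"
    and u: "u \<in> G (dg n (\<lambda>a. of_int (h a))) \<mu> 0"
  shows "texpr_in n e \<Longrightarrow> \<forall>t\<in>set e. length (snd t) \<le> d \<Longrightarrow>
    ta e u - tT (topl h D) d e u \<in> G (dg n (\<lambda>a. of_int (h a))) \<mu> (D * int d - 1)"
proof (induction e)
  case (Cons t e)
  let ?G = "G (dg n (\<lambda>a. of_int (h a))) \<mu>"
  let ?T = "T (topl h D)"
  have w: "set (snd t) \<subseteq> sl n" using Cons.prems by (simp add: texpr_in_Cons)
  note tw = top_words [OF H D u w]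
  have *: "sc (fst t) (foldr R (snd t) u) - (if length (snd t) = d then sc (fst t) (foldr ?T (snd t) u) else 0)
      \<in> ?G (D * int d - 1)"
  proof (cases "length (snd t) = d")
    case True
    have "sc (fst t) (foldr R (snd t) u - foldr ?T (snd t) u) \<in> ?G (D * int d - 1)"
      using tw True by (intro G_sc) auto
    thus ?thesis using True by (simp add: scale_right_diff_distrib)
  next
    case False
    hence "length (snd t) + 1 \<le> d" using Cons.prems by simp
    hence "D * (int (length (snd t)) + 1) \<le> D * int d" using D(2) by (intro mult_left_mono) auto
    hence "D * int (length (snd t)) \<le> D * int d - 1" using D(2) by (simp add: algebra_simps)
    hence "?G (D * int (length (snd t))) \<subseteq> ?G (D * int d - 1)" by (rule G_mono)
    thus ?thesis using tw False by (auto intro!: G_sc)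
  qed
  have "ta e u - tT (topl h D) d e u \<in> ?G (D * int d - 1)" using Cons by (auto simp: texpr_in_Cons)
  from G_add [OF * this] show ?case by (simp add: ta_Cons tT_Cons algebra_simps)
qed simp

definition lin_S :: "('v \<Rightarrow> complex) \<Rightarrow> bool" where
  "lin_S \<phi> \<longleftrightarrow> (\<forall>x\<in>S. \<forall>y\<in>S. \<phi> (x + y) = \<phi> x + \<phi> y) \<and> (\<forall>c. \<forall>x\<in>S. \<phi> (sc c x) = c * \<phi> x)"

lemma lin_S_add: "lin_S \<phi> \<Longrightarrow> x \<in> S \<Longrightarrow> y \<in> S \<Longrightarrow> \<phi> (x + y) = \<phi> x + \<phi> y"
  and lin_S_sc: "lin_S \<phi> \<Longrightarrow> x \<in> S \<Longrightarrow> \<phi> (sc c x) = c * \<phi> x"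
  by (auto simp: lin_S_def)

lemma lin_S_0: "lin_S \<phi> \<Longrightarrow> \<phi> 0 = 0"
  using lin_S_sc [OF _ S_0, of \<phi> 0] by simp

lemma lin_S_sum: "lin_S \<phi> \<Longrightarrow> (\<And>i. i \<in> A \<Longrightarrow> f i \<in> S) \<Longrightarrow> \<phi> (sum f A) = (\<Sum>i\<in>A. \<phi> (f i))"
  by (induction A rule: infinite_finite_induct) (auto simp: lin_S_0 lin_S_add S_sum)

lemma lin_S_R: "lin_S \<phi> \<Longrightarrow> X \<in> sl n \<Longrightarrow> lin_S (\<lambda>x. \<phi> (R X x))"
  by (auto simp: lin_S_def R_add R_sc R_S SV)

lemma lin_S_pw: "lin_S \<phi> \<Longrightarrow> X \<in> sl n \<Longrightarrow> lin_S (\<lambda>x. \<phi> ((R X ^^ a) x))"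
proof (induction a arbitrary: \<phi>)
  case (Suc a)
  have "lin_S (\<lambda>x. \<phi> (R X ((R X ^^ a) x)))"
    using Suc.IH [OF lin_S_R [OF Suc.prems] Suc.prems(2)] .
  thus ?case by simp
qed simp

lemma lin_S_comp: "lin_S comp" by (auto simp: lin_S_def comp_add comp_sc)

lemma lin_S_eigen:
  assumes "lin_S \<phi>" "\<phi> (R H x) = c * \<phi> x" "x \<in> S" "R H x = sc d x" "c \<noteq> d"
  shows "\<phi> x = 0"
  using assms by (simp add: lin_S_sc)

text \<open>A functional of weight \<open>\<mu> + r\<close> vanishes on eigenvectors of any other
  eigenvalue, in particular on everything of degree below \<open>r\<close>. This is how the error
  terms of \<open>top_texpr\<close> are discarded.\<close>

lemma lin_S_G:
  assumes "lin_S \<phi>" "\<And>x. x \<in> S \<Longrightarrow> \<phi> (R H x) = (\<mu> + of_int r) * \<phi> x" "x \<in> G H \<mu> s" "s < r"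
  shows "\<phi> x = 0"
proof -
  have "x \<in> S \<and> \<phi> x = 0"
    using assms(3)
  proof (induction rule: G_induct)
    case sub
    show ?case using assms(1) S_sub by (auto simp: subspace_def lin_S_0 lin_S_add lin_S_sc)
  next
    case (base x t)
    have "\<mu> + of_int r \<noteq> \<mu> + of_int t" using base assms(4) by simp
    thus ?case using lin_S_eigen [OF assms(1) assms(2) _ base(3)] base by auto
  qed
  thus ?thesis ..
qed

lemma pw_S [simp]: "X \<in> sl n \<Longrightarrow> x \<in> S \<Longrightarrow> (R X ^^ a) x \<in> S"
  by (induction a) (auto simp: R_S)

lemma pw_sc: "X \<in> sl n \<Longrightarrow> x \<in> S \<Longrightarrow> (R X ^^ a) (sc c x) = sc c ((R X ^^ a) x)"
  by (induction a) (auto simp: R_sc SV)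

lemma H_pw:
  assumes "H \<in> cartan n" "i \<le> n" "j \<le> n" "i \<noteq> j" "x \<in> S"
  shows "R H ((R (emat i j) ^^ a) x) = (R (emat i j) ^^ a) (R H x) + sc (of_nat a * (H i i - H j j)) ((R (emat i j) ^^ a) x)"
proof (induction a)
  case (Suc a)
  let ?E = "R (emat i j)"
  have "R H (?E ((?E ^^ a) x)) = ?E (R H ((?E ^^ a) x)) + sc (H i i - H j j) (?E ((?E ^^ a) x))"
    using assms by (intro HE) (auto simp: SV)
  also have "?E (R H ((?E ^^ a) x)) = ?E ((?E ^^ a) (R H x)) + sc (of_nat a * (H i i - H j j)) (?E ((?E ^^ a) x))"
    unfolding Suc using assms by (subst R_add) (auto simp: SV R_S R_sc S_sc)
  finally show ?case by (simp add: algebra_simps)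
qed (use assms in simp)

lemma weight_functional_pw:
  assumes "lin_S \<phi>" "H \<in> cartan n" "i \<le> n" "j \<le> n" "i \<noteq> j"
    "\<And>x. x \<in> S \<Longrightarrow> \<phi> (R H x) = \<mu> * \<phi> x" "x \<in> S"
  shows "\<phi> ((R (emat i j) ^^ a) (R H x)) = (\<mu> - of_nat a * (H i i - H j j)) * \<phi> ((R (emat i j) ^^ a) x)"
proof -
  let ?y = "(R (emat i j) ^^ a) x"
  have "\<mu> * \<phi> ?y = \<phi> (R H ?y)" using assms by simp
  also have "\<dots> = \<phi> ((R (emat i j) ^^ a) (R H x)) + of_nat a * (H i i - H j j) * \<phi> ?y"
    using assms by (simp add: H_pw lin_S_add lin_S_sc S_sc R_S)
  finally show ?thesis by (simp add: algebra_simps)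
qed

lemma pw_comm:
  assumes "i \<le> n" "j \<le> n" "k \<le> n" "l \<le> n" "i \<noteq> j" "k \<noteq> l" "j \<noteq> k" "i \<noteq> l" "x \<in> S"
  shows "R (emat i j) ((R (emat k l) ^^ a) x) = (R (emat k l) ^^ a) (R (emat i j) x)"
proof (induction a)
  case (Suc a)
  have "R (emat i j) (R (emat k l) ((R (emat k l) ^^ a) x)) = R (emat k l) (R (emat i j) ((R (emat k l) ^^ a) x))"
    using assms by (intro EE_comm) (auto simp: SV)
  thus ?case using Suc by simp
qed simp

lemma pw_pw_comm:
  assumes "i \<le> n" "j \<le> n" "k \<le> n" "l \<le> n" "i \<noteq> j" "k \<noteq> l" "j \<noteq> k" "i \<noteq> l" "x \<in> S"
  shows "(R (emat i j) ^^ b) ((R (emat k l) ^^ a) x) = (R (emat k l) ^^ a) ((R (emat i j) ^^ b) x)"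
  by (induction b) (use assms in \<open>auto simp: pw_comm\<close>)

lemma sl2_step:
  assumes "i \<le> n" "j \<le> n" "i \<noteq> j" "x \<in> S" "R (emat i j) x = 0" "R (hmat n i j) x = sc c x"
  shows "R (emat i j) ((R (emat j i) ^^ Suc a) x) = sc (of_nat (Suc a) * (c - of_nat a)) ((R (emat j i) ^^ a) x)"
proof (induction a)
  case 0
  show ?case using assms by (simp add: EE_h SV)
next
  case (Suc a)
  let ?y = "(R (emat j i) ^^ Suc a) x"
  have h: "hmat n i j j j - hmat n i j i i = -2" using assms by (simp add: hmat_def)
  have "R (emat i j) (R (emat j i) ?y) = R (emat j i) (R (emat i j) ?y) + R (hmat n i j) ?y"
    using assms by (intro EE_h) (auto simp: SV simp del: funpow.simps)
  also have "R (hmat n i j) ?y = (R (emat j i) ^^ Suc a) (R (hmat n i j) x)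
      + sc (of_nat (Suc a) * (hmat n i j j j - hmat n i j i i)) ?y"
    using assms by (intro H_pw) auto
  also have "\<dots> = sc (c - 2 * of_nat (Suc a)) ?y"
    unfolding h assms(6) using assms pw_sc [of "emat j i" x "Suc a" c]
    by (simp add: algebra_simps del: funpow.simps)
  also have "R (emat j i) (R (emat i j) ?y) = sc (of_nat (Suc a) * (c - of_nat a)) ?y"
    unfolding Suc using assms by (simp add: R_sc SV)
  also have "sc (of_nat (Suc a) * (c - of_nat a)) ?y + sc (c - 2 * of_nat (Suc a)) ?y
      = sc (of_nat (Suc (Suc a)) * (c - of_nat (Suc a))) ?y"
    unfolding scale_left_distrib [symmetric]
    by (rule arg_cong [where f = "\<lambda>c. sc c ?y"]) (simp add: field_simps)
  finally show ?case by simp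
qed

text \<open>The scalar by which e^a f^a acts on an sl_2 highest weight vector of weight
  \<open>c\<close>. It vanishes only if \<open>c\<close> is one of 0, ..., a - 1.\<close>

definition K :: "complex \<Rightarrow> nat \<Rightarrow> complex" where
  "K c a = fact a * (\<Prod>s<a. c - of_nat s)"

lemma K_nz: "c \<notin> \<int> \<Longrightarrow> K c a \<noteq> 0"
  unfolding K_def by (auto simp: prod_zero_iff)

lemma sl2_power:
  assumes "i \<le> n" "j \<le> n" "i \<noteq> j" "x \<in> S" "R (emat i j) x = 0" "R (hmat n i j) x = sc c x"
  shows "(R (emat i j) ^^ a) ((R (emat j i) ^^ a) x) = sc (K c a) x"
proof (induction a)
  case (Suc a)
  have "(R (emat i j) ^^ Suc a) ((R (emat j i) ^^ Suc a) x) = (R (emat i j) ^^ a) (R (emat i j) ((R (emat j i) ^^ Suc a) x))"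
    by (simp only: funpow_Suc_right o_def)
  also have "\<dots> = sc (of_nat (Suc a) * (c - of_nat a)) (sc (K c a) x)"
    unfolding sl2_step [OF assms] using assms Suc by (simp add: pw_sc)
  finally show ?case by (simp add: K_def algebra_simps)
qed (simp add: K_def)

lemma v_eigen: "H \<in> cartan n \<Longrightarrow> v \<in> G H (wt H) 0"
  by (rule G_base [of _ _ _ 0]) (auto simp: H_v')

subsection \<open>One non-integral root\<close>

lemma foldr_T_single:
  assumes "j \<le> n" "i \<le> n" "i \<noteq> j" "u \<in> S"
  shows "foldr (T {(j, i)}) w u = sc (prod_list (map (\<lambda>X. X j i) w)) ((R (emat j i) ^^ length w) u)"
  by (induction w) (use assms in \<open>auto simp: T_def R_sc SV\<close>)

text \<open>The leading part of \<open>e\<close> on \<open>v\<close> is the symbol times the d-th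
  power of the lowering operator. Applying the d-th power of the raising operator and taking the
  component gives the symbol times \<open>K (m i - m j) d\<close>, and the second factor is
  nonzero.\<close>

lemma single_root_point:
  assumes ij: "i < j" "j \<le> n" and nz: "m i - m j \<notin> \<int>"
    and e: "texpr_in n e" "\<forall>t\<in>set e. length (snd t) \<le> d" "ta e v = 0"
  shows "symb d e (\<lambda>X. X j i) = 0"
proof -
  \<comment> \<open>With 1 at \<open>j\<close> and -1 at \<open>i\<close>, the position (j, i) is
    the only one of degree 2, and every other has smaller degree.\<close>
  define h where "h a = (if a = j then 1 else 0) - (if a = i then 1 else (0::int))" for a
  let ?H = "dg n (\<lambda>a. of_int (h a))"
  have Hh: "?H = hmat n j i" unfolding hmat_def h_def by (auto simp: fun_eq_iff dg_def)
  have H: "?H \<in> cartan n" using ij unfolding Hh by simp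
  have top: "topl h 2 = {(j, i)}" using ij by (auto simp: topl_def h_def split: if_splits)
  have g: "ta e v - tT {(j, i)} d e v \<in> G ?H (wt ?H) (2 * int d - 1)"
    unfolding top [symmetric] by (rule top_texpr [OF H _ _ v_eigen [OF H] e(1,2)]) (auto simp: h_def)
  let ?\<phi> = "\<lambda>x. comp ((R (emat i j) ^^ d) x)"
  have l: "lin_S ?\<phi>" using ij by (intro lin_S_pw lin_S_comp) auto
  have ph: "?\<phi> (R ?H x) = (wt ?H + of_int (2 * int d)) * ?\<phi> x" if "x \<in> S" for x
    using weight_functional_pw [OF lin_S_comp H, of i j "wt ?H" x d] ij that H
    by (simp add: comp_H h_def algebra_simps)
  have z: "?\<phi> (ta e v - tT {(j, i)} d e v) = 0"
    by (rule lin_S_G [OF l ph g]) simp_all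
  have hv: "R (hmat n i j) v = sc (m i - m j) v" using ij by (simp add: H_v' wt_hmat)
  have t: "tT {(j, i)} d e' v = sc (symb d e' (\<lambda>X. X j i)) ((R (emat j i) ^^ d) v)" for e'
  proof (induction e')
    case (Cons t e')
    show ?case
      using Cons ij by (auto simp: tT_Cons symb_def foldr_T_single scale_left_distrib)
  qed (simp add: symb_def)
  have "?\<phi> (sc (symb d e (\<lambda>X. X j i)) ((R (emat j i) ^^ d) v)) = symb d e (\<lambda>X. X j i) * K (m i - m j) d"
    using ij sl2_power [OF _ _ _ v_S _ hv, of d] by (simp add: lin_S_sc [OF l] E_v comp_sc)
  moreover have "?\<phi> (0 - sc (symb d e (\<lambda>X. X j i)) ((R (emat j i) ^^ d) v)) = 0" using z e(3) t by simp
  ultimately have "symb d e (\<lambda>X. X j i) * K (m i - m j) d = 0"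
    using lin_S_sc [OF l, of "sc (symb d e (\<lambda>X. X j i)) ((R (emat j i) ^^ d) v)" "-1"] ij
    by (simp add: S_sc scale_minus_left)
  thus ?thesis using K_nz [OF nz] by simp
qed

end

subsection \<open>Two commuting non-integral roots\<close>

lemma mmul_emat_right:
  assumes "i \<le> n" "j \<le> n" shows "mmul n X (emat i j) = (\<lambda>a b. if a \<le> n \<and> b = j then X a i else 0)"
proof (intro ext)
  fix a b
  have "(\<Sum>k\<le>n. X a k * emat i j k b) = (\<Sum>k\<le>n. if k = i then (if b = j then X a i else 0) else 0)"
    by (rule sum.cong) (simp_all add: emat_def)
  thus "mmul n X (emat i j) a b = (if a \<le> n \<and> b = j then X a i else 0)"
    using assms by (auto simp: mmul_def)
qed

lemma mmul_emat_left:
  assumes "i \<le> n" "j \<le> n" shows "mmul n (emat i j) X = (\<lambda>a b. if a = i \<and> b \<le> n then X j b else 0)"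
proof (intro ext)
  fix a b
  have "(\<Sum>k\<le>n. emat i j a k * X k b) = (\<Sum>k\<le>n. if k = j then (if a = i then X j b else 0) else 0)"
    by (rule sum.cong) (simp_all add: emat_def)
  thus "mmul n (emat i j) X a b = (if a = i \<and> b \<le> n then X j b else 0)"
    using assms by (auto simp: mmul_def)
qed

text \<open>The square of E = \<open>emat i j\<close> is zero, so the double bracket is -2 E X E,
  and E X E is the entry \<open>X j i\<close> times E.\<close>

lemma bracket_emat_twice:
  assumes "i \<le> n" "j \<le> n" "i \<noteq> j" "X \<in> sl n"
  shows "bracket n (bracket n X (emat i j)) (emat i j) = (\<lambda>a b. (- 2 * X j i) * emat i j a b)"
proof (intro ext)
  fix a b
  have s: "X a b = 0" if "n < a \<or> n < b" for a b using assms(4) that by (auto simp: sl_def supp_mat_def)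
  show "bracket n (bracket n X (emat i j)) (emat i j) a b = (- 2 * X j i) * emat i j a b"
    unfolding bracket_def mlin_def mmul_emat_left [OF assms(1,2)] mmul_emat_right [OF assms(1,2)]
    using assms(1-3) by (auto simp: emat_def)
qed

text \<open>A generating polynomial: each letter contributes its \<open>q\<close>-entry plus its
  \<open>p\<close>-entry times the variable, so the coefficient of degree a collects all ways of
  choosing the root \<open>p\<close> exactly a times.\<close>

definition cpoly :: "nat \<times> nat \<Rightarrow> nat \<times> nat \<Rightarrow> mat list \<Rightarrow> complex poly" where
  "cpoly p q w = prod_list (map (\<lambda>X. [:X (fst q) (snd q), X (fst p) (snd p):]) w)"

lemma degree_cpoly: "degree (cpoly p q w) \<le> length w"
proof (induction w)
  case (Cons X w)
  have "degree (cpoly p q (X # w)) \<le> degree [:X (fst q) (snd q), X (fst p) (snd p):] + degree (cpoly p q w)"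
    unfolding cpoly_def list.map prod_list.Cons by (rule degree_mult_le)
  also have "\<dots> \<le> 1 + length w" using Cons degree_pCons_le [of "X (fst q) (snd q)" "[:X (fst p) (snd p):]"] by simp
  finally show ?case by simp
qed (simp add: cpoly_def)

definition cpol :: "nat \<times> nat \<Rightarrow> nat \<times> nat \<Rightarrow> nat \<Rightarrow> texpr \<Rightarrow> complex poly" where
  "cpol p q d e = sum_list (map (\<lambda>t. if length (snd t) = d then smult (fst t) (cpoly p q (snd t)) else 0) e)"

lemma cpol_symb: "poly (cpol p q d e) 1 = symb d e (\<lambda>X. X (fst p) (snd p) + X (fst q) (snd q))"
proof -
  have "poly (cpoly p q w) 1 = prod_list (map (\<lambda>X. X (fst p) (snd p) + X (fst q) (snd q)) w)" for w
    by (induction w) (auto simp: cpoly_def algebra_simps)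
  thus ?thesis by (induction e) (auto simp: cpol_def symb_def)
qed

context hwrep begin

text \<open>Substitution of operators into a polynomial made homogeneous of degree \<open>r\<close>:
  the monomial of degree a becomes the a-th power of the first operator after the (r - a)-th power
  of the second.\<close>

definition pval :: "nat \<times> nat \<Rightarrow> nat \<times> nat \<Rightarrow> nat \<Rightarrow> complex poly \<Rightarrow> 'v \<Rightarrow> 'v" where
  "pval p q r c u = (\<Sum>a\<le>r. sc (coeff c a)
     ((R (emat (fst p) (snd p)) ^^ a) ((R (emat (fst q) (snd q)) ^^ (r - a)) u)))"

text \<open>The degree bound removes the coefficient of index \<open>Suc r\<close>, so that
  multiplication by a linear factor only shifts indices and leaves no boundary term.\<close>

lemma pval_Suc:
  assumes "degree c \<le> r"
  shows "pval p q (Suc r) ([:x, y:] * c) u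
    = sc y (\<Sum>a\<le>r. sc (coeff c a) ((R (emat (fst p) (snd p)) ^^ Suc a) ((R (emat (fst q) (snd q)) ^^ (r - a)) u)))
    + sc x (\<Sum>a\<le>r. sc (coeff c a) ((R (emat (fst p) (snd p)) ^^ a) ((R (emat (fst q) (snd q)) ^^ (Suc r - a)) u)))"
proof -
  let ?A = "R (emat (fst p) (snd p))" and ?B = "R (emat (fst q) (snd q))"
  have c0: "coeff c (Suc r) = 0" using assms by (intro coeff_eq_0) simp
  have cc: "[:x, y:] * c = smult x c + pCons 0 (smult y c)" by simp
  have "pval p q (Suc r) ([:x, y:] * c) u
      = (\<Sum>a\<le>Suc r. sc (x * coeff c a) ((?A ^^ a) ((?B ^^ (Suc r - a)) u)))
      + (\<Sum>a\<le>Suc r. sc (coeff (pCons 0 (smult y c)) a) ((?A ^^ a) ((?B ^^ (Suc r - a)) u)))"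
    unfolding pval_def cc by (simp only: coeff_add coeff_smult scale_left_distrib sum.distrib)
  also have "(\<Sum>a\<le>Suc r. sc (x * coeff c a) ((?A ^^ a) ((?B ^^ (Suc r - a)) u)))
      = sc x (\<Sum>a\<le>r. sc (coeff c a) ((?A ^^ a) ((?B ^^ (Suc r - a)) u)))"
    by (simp add: c0 scale_sum_right)
  also have "(\<Sum>a\<le>Suc r. sc (coeff (pCons 0 (smult y c)) a) ((?A ^^ a) ((?B ^^ (Suc r - a)) u)))
      = sc y (\<Sum>a\<le>r. sc (coeff c a) ((?A ^^ Suc a) ((?B ^^ (r - a)) u)))"
    by (subst sum.atMost_Suc_shift) (simp add: scale_sum_right)
  finally show ?thesis by (simp only: add.commute)
qed

lemma foldr_T_pair:
  assumes "j \<le> n" "i \<le> n" "k \<le> n" "l \<le> n" "distinct [i, j, k, l]" "u \<in> S"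
  shows "foldr (T {(j, i), (l, k)}) w u = pval (j, i) (l, k) (length w) (cpoly (j, i) (l, k) w) u"
proof (induction w)
  case (Cons X w)
  let ?A = "R (emat j i)" and ?B = "R (emat l k)" and ?c = "cpoly (j, i) (l, k) w" and ?r = "length w"
  let ?g = "\<lambda>a. (?A ^^ a) ((?B ^^ (?r - a)) u)"
  have gS: "?g a \<in> S" for a using assms by simp
  have P: "T {(j, i), (l, k)} X x = sc (X j i) (?A x) + sc (X l k) (?B x)" for x
    unfolding T_def using assms by simp
  have B: "?B (?g a) = (?A ^^ a) ((?B ^^ (Suc ?r - a)) u)" if "a \<le> ?r" for a
    using assms that by (simp add: pw_comm Suc_diff_le)
  have gV: "?g a \<in> V" for a by (rule SV [OF gS])
  have AB: "emat j i \<in> sl n" "emat l k \<in> sl n" using assms by auto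
  have A1: "?A (pval (j, i) (l, k) ?r ?c u) = (\<Sum>a\<le>?r. sc (coeff ?c a) (?A (?g a)))"
    unfolding pval_def fst_conv snd_conv R_sum [OF AB(1) V_sc [OF gV]] R_sc [OF AB(1) gV] ..
  have B1: "?B (pval (j, i) (l, k) ?r ?c u) = (\<Sum>a\<le>?r. sc (coeff ?c a) ((?A ^^ a) ((?B ^^ (Suc ?r - a)) u)))"
    unfolding pval_def fst_conv snd_conv R_sum [OF AB(2) V_sc [OF gV]] R_sc [OF AB(2) gV]
    by (rule sum.cong) (simp_all add: B)
  have cc: "cpoly (j, i) (l, k) (X # w) = [:X l k, X j i:] * ?c" by (simp add: cpoly_def)
  show ?case using Cons pval_Suc [where c = ?c and r = ?r and p = "(j, i)" and q = "(l, k)" and x = "X l k" and y = "X j i" and u = u, OF degree_cpoly]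
    by (simp add: P A1 B1 cc del: mult_pCons_left)
qed (simp add: pval_def cpoly_def)

lemma tT_pair:
  assumes "j \<le> n" "i \<le> n" "k \<le> n" "l \<le> n" "distinct [i, j, k, l]" "u \<in> S"
  shows "tT {(j, i), (l, k)} d e u = pval (j, i) (l, k) d (cpol (j, i) (l, k) d e) u"
proof (induction e)
  case (Cons t e)
  have "pval (j, i) (l, k) d (c + c') u = pval (j, i) (l, k) d c u + pval (j, i) (l, k) d c' u" for c c'
    unfolding pval_def by (simp add: scale_left_distrib sum.distrib)
  moreover have "pval (j, i) (l, k) d (smult x c) u = sc x (pval (j, i) (l, k) d c u)" for x c
    unfolding pval_def by (simp add: scale_sum_right)
  moreover have "pval (j, i) (l, k) d 0 u = 0" unfolding pval_def by simp
  ultimately show ?case using Cons by (auto simp: tT_Cons cpol_def foldr_T_pair [OF assms])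
qed (simp add: pval_def cpol_def)

text \<open>The letter \<open>E\<^sub>l\<^sub>i\<close> has smaller \<open>h\<close>-degree than \<open>E\<^sub>j\<^sub>i\<close> and \<open>E\<^sub>l\<^sub>k\<close>.\<close>

lemma tT_drop_li:
  assumes ix: "j \<le> n" "i \<le> n" "k \<le> n" "l \<le> n" "distinct [i, j, k, l]"
    and u: "u \<in> G (hmat n j k) \<mu> 0"
  shows "tT {(j, i), (l, i), (l, k)} d e u - tT {(j, i), (l, k)} d e u \<in> G (hmat n j k) \<mu> (int d - 1)"
proof -
  define h where "h a = (if a = j then 1 else 0) - (if a = k then 1 else (0::int))" for a
  have Hh: "hmat n j k = dg n (\<lambda>a. of_int (h a))" unfolding hmat_def h_def by (auto simp: fun_eq_iff dg_def)
  have H: "dg n (\<lambda>a. of_int (h a)) \<in> cartan n" using ix unfolding Hh [symmetric] by simp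
  let ?G = "G (dg n (\<lambda>a. of_int (h a))) \<mu>"
  have u': "u \<in> ?G 0" using u unfolding Hh .
  have E: "R (emat j i) x \<in> ?G (s + 1)" "R (emat l k) x \<in> ?G (s + 1)" "R (emat l i) x \<in> ?G s" if "x \<in> ?G s" for x s
    using G_E [OF H that, of j i] G_E [OF H that, of l k] G_E [OF H that, of l i] ix by (auto simp: h_def)
  have d3: "T {(j, i), (l, i), (l, k)} X x = sc (X l i) (R (emat l i) x) + T {(j, i), (l, k)} X x" for X x
    unfolding T_def using ix by (simp add: add_ac)
  have T2: "T {(j, i), (l, k)} X x \<in> ?G (s + 1)" if "x \<in> ?G s" for X x s
    unfolding T_def by (rule G_sum) (use E [OF that] in \<open>auto intro: G_sc\<close>)
  have T3: "T {(j, i), (l, i), (l, k)} X x \<in> ?G (s + 1)" if "x \<in> ?G s" for X x s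
    using E(3) [OF that] T2 [OF that, of X] G_mono [of s "s + 1" "dg n (\<lambda>a. of_int (h a))" \<mu>]
    unfolding d3 by (auto intro!: G_add G_sc)
  have w: "foldr (T {(j, i), (l, i), (l, k)}) w u - foldr (T {(j, i), (l, k)}) w u \<in> ?G (int (length w) - 1)
      \<and> foldr (T {(j, i), (l, i), (l, k)}) w u \<in> ?G (int (length w)) \<and> foldr (T {(j, i), (l, k)}) w u \<in> ?G (int (length w))" for w
  proof (induction w)
    case (Cons X w)
    let ?a = "foldr (T {(j, i), (l, i), (l, k)}) w u" and ?b = "foldr (T {(j, i), (l, k)}) w u"
    have "T {(j, i), (l, k)} X ?a - T {(j, i), (l, k)} X ?b = T {(j, i), (l, k)} X (?a - ?b)"
    proof -
      have "T {(j, i), (l, k)} X ((?a - ?b) + ?b) = T {(j, i), (l, k)} X (?a - ?b) + T {(j, i), (l, k)} X ?b"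
        using Cons ix by (intro T_add) (auto intro: G_V V_diff)
      thus ?thesis by simp
    qed
    hence e: "T {(j, i), (l, i), (l, k)} X ?a - T {(j, i), (l, k)} X ?b
        = sc (X l i) (R (emat l i) ?a) + T {(j, i), (l, k)} X (?a - ?b)"
      unfolding d3 by (simp add: algebra_simps)
    have "T {(j, i), (l, k)} X (?a - ?b) \<in> ?G (int (length w))" using T2 [of "?a - ?b" "int (length w) - 1"] Cons by simp
    hence "T {(j, i), (l, i), (l, k)} X ?a - T {(j, i), (l, k)} X ?b \<in> ?G (int (length w))"
      unfolding e using E(3) Cons by (intro G_add G_sc) auto
    thus ?case using T2 [of ?b "int (length w)"] T3 [of ?a "int (length w)"] Cons by (simp add: add.commute)
  qed (use u' in simp)
  show ?thesis unfolding Hh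
  proof (induction e)
    case (Cons t e)
    have "tT {(j, i), (l, i), (l, k)} d (t # e) u - tT {(j, i), (l, k)} d (t # e) u =
      (if length (snd t) = d then sc (fst t) (foldr (T {(j, i), (l, i), (l, k)}) (snd t) u - foldr (T {(j, i), (l, k)}) (snd t) u) else 0)
      + (tT {(j, i), (l, i), (l, k)} d e u - tT {(j, i), (l, k)} d e u)"
      by (simp add: tT_Cons scale_right_diff_distrib)
    moreover have "(if length (snd t) = d then sc (fst t) (foldr (T {(j, i), (l, i), (l, k)}) (snd t) u - foldr (T {(j, i), (l, k)}) (snd t) u) else 0)
      \<in> ?G (int d - 1)" using w [of "snd t"] by (auto intro: G_sc)
    ultimately show ?case using Cons by (simp add: G_add)
  qed simp
qed

lemma foldr_T_S:
  assumes "u \<in> S" "\<And>p. p \<in> Q \<Longrightarrow> fst p \<le> n \<and> snd p \<le> n \<and> fst p \<noteq> snd p"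
  shows "foldr (T Q) w u \<in> S"
proof (induction w)
  case (Cons X w)
  from T_S [OF this assms(2)] show ?case by simp
qed (use assms in simp)

lemma tT_S:
  assumes "u \<in> S" "\<And>p. p \<in> Q \<Longrightarrow> fst p \<le> n \<and> snd p \<le> n \<and> fst p \<noteq> snd p"
  shows "tT Q d e u \<in> S"
  by (induction e) (auto simp: tT_Cons S_0 intro!: S_add S_sc foldr_T_S assms)

text \<open>Sequences of vectors that are treated uniformly in \<open>N\<close>. Error terms must
  remain in the family, because later their dependence on \<open>N\<close> has to be polynomial.
  Constant sequences are the simplest instance.\<close>

definition good_family :: "(nat \<Rightarrow> 'v) set \<Rightarrow> bool" where
  "good_family P \<longleftrightarrow> (\<forall>U\<in>P. \<forall>N. U N \<in> S) \<and> (\<lambda>N. 0) \<in> P \<and> (\<forall>U\<in>P. \<forall>W\<in>P. (\<lambda>N. U N + W N) \<in> P)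
     \<and> (\<forall>U\<in>P. \<forall>c. (\<lambda>N. sc c (U N)) \<in> P) \<and> (\<forall>U\<in>P. \<forall>X\<in>sl n. (\<lambda>N. R X (U N)) \<in> P)"

lemma gf_S: "good_family P \<Longrightarrow> U \<in> P \<Longrightarrow> U N \<in> S"
  and gf_0: "good_family P \<Longrightarrow> (\<lambda>N. 0) \<in> P"
  and gf_add: "good_family P \<Longrightarrow> U \<in> P \<Longrightarrow> W \<in> P \<Longrightarrow> (\<lambda>N. U N + W N) \<in> P"
  and gf_sc: "good_family P \<Longrightarrow> U \<in> P \<Longrightarrow> (\<lambda>N. sc c (U N)) \<in> P"
  and gf_R: "good_family P \<Longrightarrow> U \<in> P \<Longrightarrow> X \<in> sl n \<Longrightarrow> (\<lambda>N. R X (U N)) \<in> P"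
  by (auto simp: good_family_def)

lemma gf_pw: "good_family P \<Longrightarrow> U \<in> P \<Longrightarrow> X \<in> sl n \<Longrightarrow> (\<lambda>N. (R X ^^ a) (U N)) \<in> P"
  by (induction a) (auto intro: gf_R)

lemma gf_T:
  assumes "good_family P" "U \<in> P" "\<And>p. p \<in> Q \<Longrightarrow> fst p \<le> n \<and> snd p \<le> n \<and> fst p \<noteq> snd p"
  shows "(\<lambda>N. T Q X (U N)) \<in> P"
proof -
  have "(\<lambda>N. \<Sum>p\<in>Q. sc (X (fst p) (snd p)) (R (emat (fst p) (snd p)) (U N))) \<in> P"
    using assms(3)
    by (induction Q rule: infinite_finite_induct) (auto intro!: gf_0 gf_add gf_sc gf_R assms(1,2) emat_sl)
  thus ?thesis unfolding T_def .
qed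

lemma gf_foldr_T:
  assumes "good_family P" "U \<in> P" "\<And>p. p \<in> Q \<Longrightarrow> fst p \<le> n \<and> snd p \<le> n \<and> fst p \<noteq> snd p"
  shows "(\<lambda>N. foldr (T Q) w (U N)) \<in> P"
proof (induction w)
  case (Cons X w)
  from gf_T [OF assms(1) this assms(3)] show ?case by simp
qed (use assms in simp)

text \<open>E_jk commutes with E_ji, E_li and E_lk. Each occurrence can therefore be moved next to
  the vector, where it yields the factor \<open>\<zeta> N\<close>; all such terms are collected in
  \<open>Y\<close>.\<close>

lemma tT_drop_jk:
  assumes ix: "j \<le> n" "i \<le> n" "k \<le> n" "l \<le> n" "distinct [i, j, k, l]"
    and P: "good_family P" "u \<in> P" "Yz \<in> P" "\<And>N. R (emat j k) (u N) = sc (\<zeta> N) (Yz N)"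
  shows "\<exists>Y\<in>P. \<forall>N. tT {(j, i), (j, k), (l, i), (l, k)} d e (u N)
     = tT {(j, i), (l, i), (l, k)} d e (u N) + sc (\<zeta> N) (Y N)"
proof -
  let ?Q4 = "{(j, i), (j, k), (l, i), (l, k)}" and ?Q3 = "{(j, i), (l, i), (l, k)}"
  have q4: "p \<in> ?Q4 \<Longrightarrow> fst p \<le> n \<and> snd p \<le> n \<and> fst p \<noteq> snd p"
    and q3: "p \<in> ?Q3 \<Longrightarrow> fst p \<le> n \<and> snd p \<le> n \<and> fst p \<noteq> snd p" for p using ix by auto
  have d4: "T ?Q4 X x = sc (X j k) (R (emat j k) x) + T ?Q3 X x" for X x
    unfolding T_def using ix by (simp add: add_ac)
  have c3: "R (emat j k) (foldr (T ?Q3) w x) = foldr (T ?Q3) w (R (emat j k) x)" if "x \<in> S" for w x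
  proof (induction w)
    case (Cons X w)
    have y: "foldr (T ?Q3) w x \<in> S" by (rule foldr_T_S [OF that q3])
    have "R (emat j k) (T ?Q3 X y) = T ?Q3 X (R (emat j k) y)" if "y \<in> S" for y
    proof -
      have y: "y \<in> V" by (rule SV [OF that])
      have d3: "T ?Q3 X z = sc (X j i) (R (emat j i) z) + (sc (X l i) (R (emat l i) z) + sc (X l k) (R (emat l k) z))" for z
        unfolding T_def using ix by simp
      have s: "emat j k \<in> sl n" "emat j i \<in> sl n" "emat l i \<in> sl n" "emat l k \<in> sl n" using ix by auto
      have c: "R (emat j k) (R (emat j i) y) = R (emat j i) (R (emat j k) y)"
        "R (emat j k) (R (emat l i) y) = R (emat l i) (R (emat j k) y)"
        "R (emat j k) (R (emat l k) y) = R (emat l k) (R (emat j k) y)"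
        using ix y by (auto intro: EE_comm)
      show ?thesis unfolding d3 using s y by (simp add: R_add R_sc c)
    qed
    from this [OF y] show ?case using Cons by simp
  qed simp
  have f3sc: "foldr (T ?Q3) w (sc c x) = sc c (foldr (T ?Q3) w x)" if "x \<in> S" for w c x
  proof (induction w)
    case (Cons X w)
    have y: "foldr (T ?Q3) w x \<in> S" by (rule foldr_T_S [OF that q3])
    show ?case by (simp add: Cons) (rule T_sc [OF SV [OF y] q3])
  qed simp
  have Tadd4: "T ?Q4 X (x + y) = T ?Q4 X x + T ?Q4 X y" if "x \<in> V" "y \<in> V" for X x y
    by (rule T_add [OF that]) (rule q4)
  have Tsc4: "T ?Q4 X (sc c x) = sc c (T ?Q4 X x)" if "x \<in> V" for X x c
    by (rule T_sc [OF that]) (rule q4)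
  have w: "\<exists>Y\<in>P. \<forall>N. foldr (T ?Q4) w (u N) = foldr (T ?Q3) w (u N) + sc (\<zeta> N) (Y N)" for w
  proof (induction w)
    case Nil
    show ?case using gf_0 [OF P(1)] by (intro bexI) auto
  next
    case (Cons X w)
    then obtain Y where Y: "Y \<in> P" "\<And>N. foldr (T ?Q4) w (u N) = foldr (T ?Q3) w (u N) + sc (\<zeta> N) (Y N)" by blast
    let ?Y = "\<lambda>N. sc (X j k) (foldr (T ?Q3) w (Yz N)) + T ?Q4 X (Y N)"
    have "?Y \<in> P" by (intro gf_add gf_sc gf_T gf_foldr_T P Y q3 q4)
    moreover have "foldr (T ?Q4) (X # w) (u N) = foldr (T ?Q3) (X # w) (u N) + sc (\<zeta> N) (?Y N)" for N
    proof -
      have y: "foldr (T ?Q3) w (u N) \<in> S" "Y N \<in> S" "u N \<in> S" "Yz N \<in> S"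
        by (rule foldr_T_S [OF gf_S [OF P(1,2)] q3], assumption)
          (rule gf_S [OF P(1)], rule Y P)+
      have "foldr (T ?Q4) (X # w) (u N) = T ?Q4 X (foldr (T ?Q3) w (u N)) + sc (\<zeta> N) (T ?Q4 X (Y N))"
        unfolding foldr.simps o_apply Y(2) Tadd4 [OF SV [OF y(1)] V_sc [OF SV [OF y(2)]]] Tsc4 [OF SV [OF y(2)]] ..
      also have "T ?Q4 X (foldr (T ?Q3) w (u N)) = sc (X j k) (foldr (T ?Q3) w (sc (\<zeta> N) (Yz N))) + foldr (T ?Q3) (X # w) (u N)"
        unfolding d4 by (simp add: c3 [OF y(3)] P(4))
      finally show ?thesis by (simp add: f3sc [OF y(4)] algebra_simps)
    qed
    ultimately show ?case by (intro bexI [of _ ?Y] allI)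
  qed
  show ?thesis
  proof (induction e)
    case Nil
    show ?case using gf_0 [OF P(1)] by (intro bexI) auto
  next
    case (Cons t e)
    then obtain Y where Y: "Y \<in> P" "\<And>N. tT ?Q4 d e (u N) = tT ?Q3 d e (u N) + sc (\<zeta> N) (Y N)" by blast
    from w obtain Y' where Y': "Y' \<in> P" "\<And>N. foldr (T ?Q4) (snd t) (u N) = foldr (T ?Q3) (snd t) (u N) + sc (\<zeta> N) (Y' N)" by blast
    show ?case
    proof (cases "length (snd t) = d")
      case True
      have "(\<lambda>N. sc (fst t) (Y' N) + Y N) \<in> P" by (intro gf_add gf_sc P Y Y')
      moreover have "tT ?Q4 d (t # e) (u N) = tT ?Q3 d (t # e) (u N) + sc (\<zeta> N) (sc (fst t) (Y' N) + Y N)" for N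
        using True by (simp add: tT_Cons Y(2) Y'(2) algebra_simps)
      ultimately show ?thesis by (intro bexI [of _ "\<lambda>N. sc (fst t) (Y' N) + Y N"] allI)
    next
      case False
      thus ?thesis using Y by (auto simp: tT_Cons)
    qed
  qed
qed

text \<open>Of the four positions of top degree, E_jk is removed at the price of the term with
  \<open>\<zeta>\<close>, and E_li by a second grading. On what remains, the functional singles out
  one monomial in E_ji and E_lk, which the two sl_2 computations evaluate. The functionals
  \<open>\<phi> N\<close> stay general so that both the vector \<open>v\<close> and its translates
  by lowering powers are covered.\<close>

lemma pair_functional:
  assumes ix: "j \<le> n" "i \<le> n" "k \<le> n" "l \<le> n" "distinct [i, j, k, l]"
    and P: "good_family P" "u \<in> P" "Yz \<in> P" "\<And>N. R (emat j k) (u N) = sc (\<zeta> N) (Yz N)"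
    and \<phi>: "\<And>N. lin_S (\<phi> N)" "\<And>N H x. H \<in> cartan n \<Longrightarrow> x \<in> S \<Longrightarrow> \<phi> N (R H x) = \<mu> N H * \<phi> N x"
    and u: "\<And>N H. H \<in> cartan n \<Longrightarrow> R H (u N) = sc (\<mu> N H) (u N)"
      "\<And>N. R (emat i j) (u N) = 0" "\<And>N. R (emat k l) (u N) = 0"
    and e: "texpr_in n e" "\<forall>t\<in>set e. length (snd t) \<le> a + b"
  shows "\<exists>Y\<in>P. \<forall>N. \<phi> N ((R (emat i j) ^^ a) ((R (emat k l) ^^ b) (ta e (u N))))
     = coeff (cpol (j, i) (l, k) (a + b) e) a * K (\<mu> N (hmat n i j)) a * K (\<mu> N (hmat n k l)) b * \<phi> N (u N)
       + \<zeta> N * \<phi> N ((R (emat i j) ^^ a) ((R (emat k l) ^^ b) (Y N)))"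
proof -
  let ?Q4 = "{(j, i), (j, k), (l, i), (l, k)}" and ?Q3 = "{(j, i), (l, i), (l, k)}" and ?Q2 = "{(j, i), (l, k)}"
  let ?d = "a + b"
  obtain Y where Y: "Y \<in> P" "\<And>N. tT ?Q4 ?d e (u N) = tT ?Q3 ?d e (u N) + sc (\<zeta> N) (Y N)"
    using tT_drop_jk [OF ix P] by blast
  have "\<phi> N ((R (emat i j) ^^ a) ((R (emat k l) ^^ b) (ta e (u N))))
     = coeff (cpol (j, i) (l, k) ?d e) a * K (\<mu> N (hmat n i j)) a * K (\<mu> N (hmat n k l)) b * \<phi> N (u N)
       + \<zeta> N * \<phi> N ((R (emat i j) ^^ a) ((R (emat k l) ^^ b) (Y N)))" for N
  proof -
    let ?F = "\<lambda>x. \<phi> N ((R (emat i j) ^^ a) ((R (emat k l) ^^ b) x))"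
    have s: "emat i j \<in> sl n" "emat k l \<in> sl n" using ix by auto
    have uS: "u N \<in> S" and YS: "Y N \<in> S" using P Y gf_S by auto
    have l1: "lin_S (\<lambda>x. \<phi> N ((R (emat i j) ^^ a) x))" by (intro lin_S_pw \<phi> s)
    have l: "lin_S ?F" by (intro lin_S_pw [OF l1] s)
    have w: "?F (R H x) = (\<mu> N H - of_nat a * (H i i - H j j) - of_nat b * (H k k - H l l)) * ?F x"
      if "H \<in> cartan n" "x \<in> S" for H x
      using that ix
      by (intro weight_functional_pw [OF l1 that(1)] weight_functional_pw [OF \<phi>(1) that(1)] \<phi>(2)) auto
    \<comment> \<open>The grading with 1 at \<open>j\<close> and \<open>l\<close>, -1 at
      \<open>i\<close> and \<open>k\<close>, and 0 elsewhere; a position has degree 2 exactly if it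
      leads from a value 1 to a value -1.\<close>
    define h where "h a = (if a = j then 1 else 0) - (if a = i then 1 else 0)
      + (if a = l then 1 else 0) - (if a = k then 1 else (0::int))" for a
    let ?H = "dg n (\<lambda>a. of_int (h a))"
    have H: "?H \<in> cartan n"
    proof (rule dg_cartan)
      have "(\<Sum>x\<le>n. h x) = 0" unfolding h_def using ix by (simp add: sum.distrib sum_subtractf)
      thus "(\<Sum>i\<le>n. (of_int (h i) :: complex)) = 0" by (metis of_int_0 of_int_sum)
    qed
    have hb: "- 1 \<le> h x" "h x \<le> 1" "h x = 1 \<longleftrightarrow> x = j \<or> x = l" "h x = - 1 \<longleftrightarrow> x = i \<or> x = k" for x
      unfolding h_def using ix(5) by auto
    have "h x - h y = 2 \<longleftrightarrow> h x = 1 \<and> h y = - 1" for x y using hb(1) [of y] hb(2) [of x] by linarith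
    hence topl: "topl h 2 = ?Q4" using ix(1-4) by (auto simp: topl_def hb(3,4))
    have hd: "\<forall>a\<le>n. \<forall>b\<le>n. h a - h b \<le> 2" using hb(1,2) by (smt (verit))
    have "ta e (u N) - tT ?Q4 ?d e (u N) \<in> G ?H (\<mu> N ?H) (2 * int ?d - 1)"
      unfolding topl [symmetric]
      by (rule top_texpr [OF H hd _ _ e]) (auto simp: uS u(1) [OF H] intro: G_base [of _ _ _ 0])
    moreover have "?F (R ?H x) = (\<mu> N ?H + of_int (2 * int ?d)) * ?F x" if "x \<in> S" for x
      unfolding w [OF H that] using ix by (simp add: h_def algebra_simps)
    ultimately have z1: "?F (ta e (u N) - tT ?Q4 ?d e (u N)) = 0"
      by (intro lin_S_G [OF l, of ?H "\<mu> N ?H" "2 * int ?d"]) auto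
    have H2: "hmat n j k \<in> cartan n" using ix by simp
    have "tT ?Q3 ?d e (u N) - tT ?Q2 ?d e (u N) \<in> G (hmat n j k) (\<mu> N (hmat n j k)) (int ?d - 1)"
      by (rule tT_drop_li [OF ix]) (auto simp: uS u(1) [OF H2] intro: G_base [of _ _ _ 0])
    moreover have "?F (R (hmat n j k) x) = (\<mu> N (hmat n j k) + of_int (int ?d)) * ?F x" if "x \<in> S" for x
      unfolding w [OF H2 that] using ix by (simp add: hmat_def algebra_simps)
    ultimately have z2: "?F (tT ?Q3 ?d e (u N) - tT ?Q2 ?d e (u N)) = 0"
      by (intro lin_S_G [OF l, of "hmat n j k" "\<mu> N (hmat n j k)" "int ?d"]) auto
    let ?c = "cpol (j, i) (l, k) ?d e"
    let ?g = "\<lambda>c. (R (emat j i) ^^ c) ((R (emat l k) ^^ (?d - c)) (u N))"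
    have gS: "?g c \<in> S" for c using uS ix by simp
    have tS: "tT ?Q2 ?d e (u N) \<in> S"
      unfolding tT_pair [OF ix uS] pval_def using gS by (auto intro!: S_sum S_sc)
    have t3S: "tT ?Q3 ?d e (u N) \<in> S"
      by (rule tT_S [OF uS]) (use ix in auto)
    have taS: "ta e (u N) \<in> S" using e uS by (intro ta_S)
    have F4: "?F (ta e (u N)) = ?F (tT ?Q4 ?d e (u N))"
    proof -
      have t4S: "tT ?Q4 ?d e (u N) \<in> S" unfolding Y(2) using t3S YS by (intro S_add S_sc)
      have "ta e (u N) = (ta e (u N) - tT ?Q4 ?d e (u N)) + tT ?Q4 ?d e (u N)" by simp
      moreover have "ta e (u N) - tT ?Q4 ?d e (u N) \<in> S" by (rule subspace_diff [OF S_sub taS t4S])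
      ultimately show ?thesis using lin_S_add [OF l _ t4S] z1 by (metis add_0)
    qed
    have F3: "?F (tT ?Q3 ?d e (u N)) = ?F (tT ?Q2 ?d e (u N))"
    proof -
      have "tT ?Q3 ?d e (u N) = (tT ?Q3 ?d e (u N) - tT ?Q2 ?d e (u N)) + tT ?Q2 ?d e (u N)" by simp
      moreover have "tT ?Q3 ?d e (u N) - tT ?Q2 ?d e (u N) \<in> S" by (rule subspace_diff [OF S_sub t3S tS])
      ultimately show ?thesis using lin_S_add [OF l _ tS] z2 by (metis add_0)
    qed
    \<comment> \<open>The monomials with different exponents \<open>c\<close> have different
      eigenvalues under the coroot \<open>hmat n j i\<close>, and the functional has the eigenvalue
      belonging to \<open>a\<close>.\<close>
    have g0: "?F (?g c) = 0" if "c \<noteq> a" for c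
    proof (rule lin_S_eigen [OF l _ gS])
      let ?h = "hmat n j i"
      have hc: "?h \<in> cartan n" using ix by simp
      have hh: "?h j j = 1" "?h i i = -1" "?h k k = 0" "?h l l = 0" using ix by (auto simp: hmat_def)
      show "?F (R ?h (?g c)) = (\<mu> N ?h + 2 * of_nat a) * ?F (?g c)"
        unfolding w [OF hc gS] using ix by (simp add: hmat_def algebra_simps)
      have "R ?h ((R (emat l k) ^^ (?d - c)) (u N)) = sc (\<mu> N ?h) ((R (emat l k) ^^ (?d - c)) (u N))"
        using ix uS hh by (subst H_pw [OF hc]) (auto simp: u(1) [OF hc] pw_sc)
      thus "R ?h (?g c) = sc (\<mu> N ?h + 2 * of_nat c) (?g c)"
        using ix uS hh by (subst H_pw [OF hc]) (auto simp: pw_sc algebra_simps)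
      show "\<mu> N ?h + 2 * of_nat a \<noteq> \<mu> N ?h + 2 * of_nat c" using that by simp
    qed
    have ga: "?F (?g a) = K (\<mu> N (hmat n i j)) a * K (\<mu> N (hmat n k l)) b * \<phi> N (u N)"
    proof -
      have hij: "hmat n i j \<in> cartan n" and hkl: "hmat n k l \<in> cartan n" using ix by auto
      have "(R (emat k l) ^^ b) (?g a) = (R (emat j i) ^^ a) ((R (emat k l) ^^ b) ((R (emat l k) ^^ b) (u N)))"
        using ix uS by (subst pw_pw_comm) auto
      also have "(R (emat k l) ^^ b) ((R (emat l k) ^^ b) (u N)) = sc (K (\<mu> N (hmat n k l)) b) (u N)"
        using ix uS u(3) u(1) [OF hkl] by (intro sl2_power) auto
      finally have "(R (emat i j) ^^ a) ((R (emat k l) ^^ b) (?g a))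
        = sc (K (\<mu> N (hmat n k l)) b) ((R (emat i j) ^^ a) ((R (emat j i) ^^ a) (u N)))"
        using ix uS by (simp add: pw_sc)
      also have "(R (emat i j) ^^ a) ((R (emat j i) ^^ a) (u N)) = sc (K (\<mu> N (hmat n i j)) a) (u N)"
        using ix uS u(2) u(1) [OF hij] by (intro sl2_power) auto
      finally show ?thesis using uS by (simp add: lin_S_sc [OF \<phi>(1)])
    qed
    have "?F (tT ?Q2 ?d e (u N)) = (\<Sum>c\<le>?d. coeff ?c c * ?F (?g c))"
      unfolding tT_pair [OF ix uS] pval_def fst_conv snd_conv
      by (subst lin_S_sum [OF l]) (auto simp: lin_S_sc [OF l] gS intro!: S_sc)
    also have "\<dots> = (\<Sum>c\<le>?d. if c = a then coeff ?c a * ?F (?g a) else 0)"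
      by (rule sum.cong) (use g0 in auto)
    also have "\<dots> = coeff ?c a * ?F (?g a)" by simp
    finally have F2: "?F (tT ?Q2 ?d e (u N)) = coeff ?c a * ?F (?g a)" .
    have "?F (ta e (u N)) = ?F (tT ?Q3 ?d e (u N)) + \<zeta> N * ?F (Y N)"
      unfolding F4 Y(2) by (simp add: lin_S_add [OF l t3S] lin_S_sc [OF l] S_sc YS)
    thus ?thesis unfolding F3 F2 ga by (simp add: mult_ac)
  qed
  thus ?thesis using Y(1) by (intro bexI [of _ Y] allI)
qed

text \<open>Exponents beyond \<open>d\<close> are excluded by the degree, so the assumption makes
  the whole polynomial zero; its value at 1 is the symbol.\<close>

lemma symb_pair_zero:
  assumes "\<And>a b. a + b = d \<Longrightarrow> coeff (cpol (j, i) (l, k) d e) a = 0"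
  shows "symb d e (\<lambda>X. X j i + X l k) = 0"
proof -
  have deg: "degree (cpol (j, i) (l, k) d e) \<le> d"
    by (induction e) (auto simp: cpol_def intro!: degree_add_le degree_cpoly [THEN order_trans] degree_smult_le [THEN order_trans])
  have "coeff (cpol (j, i) (l, k) d e) a = 0" for a
  proof (cases "a \<le> d")
    case True
    thus ?thesis using assms [of a "d - a"] by simp
  next
    case False
    thus ?thesis using deg by (intro coeff_eq_0) simp
  qed
  hence "cpol (j, i) (l, k) d e = 0" by (intro poly_eqI) simp
  thus ?thesis using cpol_symb [of "(j, i)" "(l, k)" d e] by simp
qed

text \<open>Here j < k, so E_jk kills \<open>v\<close> and the correction term has the factor 0.
  Constant families suffice, and the two non-integral differences make both \<open>K\<close> factors
  nonzero.\<close>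

lemma separated_pair_point:
  assumes ix: "i < j" "j < k" "k < l" "l \<le> n" and nz: "m i - m j \<notin> \<int>" "m k - m l \<notin> \<int>"
    and e: "texpr_in n e" "\<forall>t\<in>set e. length (snd t) \<le> d" "ta e v = 0"
  shows "symb d e (\<lambda>X. X j i + X l k) = 0"
proof (rule symb_pair_zero)
  fix a b assume d: "a + b = d"
  let ?P = "{\<lambda>N::nat. x | x. x \<in> S}"
  have P: "good_family ?P" unfolding good_family_def
    by (auto intro: S_0 S_add S_sc R_S)
  have ix': "j \<le> n" "i \<le> n" "k \<le> n" "l \<le> n" "distinct [i, j, k, l]" using ix by auto
  have "\<exists>Y\<in>?P. \<forall>N. comp ((R (emat i j) ^^ a) ((R (emat k l) ^^ b) (ta e v)))
     = coeff (cpol (j, i) (l, k) (a + b) e) a * K (wt (hmat n i j)) a * K (wt (hmat n k l)) b * comp v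
       + 0 * comp ((R (emat i j) ^^ a) ((R (emat k l) ^^ b) (Y N)))"
    by (rule pair_functional [OF ix' P, where u = "\<lambda>N. v" and Yz = "\<lambda>N. v" and \<zeta> = "\<lambda>N. 0" and \<phi> = "\<lambda>N. comp" and \<mu> = "\<lambda>N. wt"])
      (use ix e d in \<open>auto simp: E_v lin_S_comp comp_H H_v'\<close>)
  moreover have "comp ((R (emat i j) ^^ a) ((R (emat k l) ^^ b) 0)) = 0"
    using lin_S_0 [OF lin_S_pw [OF lin_S_pw [OF lin_S_comp]], of "emat i j" "emat k l"] ix by simp
  ultimately have "coeff (cpol (j, i) (l, k) (a + b) e) a * K (m i - m j) a * K (m k - m l) b = 0"
    using e(3) ix' by (simp add: wt_hmat)
  thus "coeff (cpol (j, i) (l, k) d e) a = 0" using K_nz nz d by simp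
qed

end

section \<open>Polynomial dependence on the exponent of a lowering operator\<close>

lemma binomial_poly: "\<exists>b :: complex poly. \<forall>N. poly b (of_nat N) = of_nat (N choose i)"
proof (intro exI allI)
  fix N
  show "poly (smult (1 / fact i) (\<Prod>s = 0..<i. [:- of_nat s, 1:])) (of_nat N) = (of_nat (N choose i) :: complex)"
    by (simp add: binomial_gbinomial gbinomial_prod_rev poly_prod)
qed

lemma (in hwrep) K_poly: "poly (smult (fact a) (\<Prod>s<a. [:c - of_nat s, 1:])) x = K (c + x) a"
  by (simp add: K_def poly_prod algebra_simps)

lemma poly_eq_0_on_nat:
  fixes p :: "complex poly" assumes "\<And>N::nat. poly p (of_nat N) = 0" shows "p = 0"
proof (rule ccontr)
  assume "p \<noteq> 0"
  hence "finite {x. poly p x = 0}" by (rule poly_roots_finite)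
  moreover have "range (of_nat :: nat \<Rightarrow> complex) \<subseteq> {x. poly p x = 0}" using assms by auto
  moreover have "infinite (range (of_nat :: nat \<Rightarrow> complex))"
    by (rule range_inj_infinite) (simp add: inj_on_def)
  ultimately show False using finite_subset by blast
qed

context hwrep begin

text \<open>Families of the shape of \<open>N \<mapsto> w f\<^sup>N v\<close>: their components depend polynomially on \<open>N\<close>, which
  allows to evaluate them at the non-integral \<open>N\<close> for which \<open>f\<^sup>N v\<close> would be singular.\<close>

lemma pw_0: "X \<in> sl n \<Longrightarrow> (R X ^^ a) 0 = 0"
  by (induction a) auto

inductive_set fam :: "mat \<Rightarrow> (nat \<Rightarrow> 'v) set" for F where
  mono: "y \<in> S \<Longrightarrow> (\<lambda>N. sc (of_nat (N choose i)) ((R F ^^ (N - i)) y)) \<in> fam F"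
| add: "U \<in> fam F \<Longrightarrow> W \<in> fam F \<Longrightarrow> (\<lambda>N. U N + W N) \<in> fam F"

lemma fam_S: assumes "F \<in> sl n" "U \<in> fam F" shows "U N \<in> S"
  using assms(2) by induction (use assms(1) in \<open>auto intro!: S_sc S_add\<close>)

lemma fam_sc: assumes "F \<in> sl n" "U \<in> fam F" shows "(\<lambda>N. sc c (U N)) \<in> fam F"
  using assms(2)
proof induction
  case (mono y i)
  have "(\<lambda>N. sc c (sc (of_nat (N choose i)) ((R F ^^ (N - i)) y)))
    = (\<lambda>N. sc (of_nat (N choose i)) ((R F ^^ (N - i)) (sc c y)))"
    using assms(1) mono by (simp add: pw_sc mult.commute)
  thus ?case using fam.mono [OF S_sc [OF mono, of c], of i] by metis
next
  case (add U W)
  thus ?case using fam.add [OF add.IH] by (simp add: scale_right_distrib)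
qed

text \<open>The expansion of X F^M in iterated brackets with \<open>F\<close> stops at second order
  because the double bracket commutes with \<open>F\<close>; for root vectors it is a multiple of
  \<open>F\<close>.\<close>

lemma R_pw_commutator:
  assumes "F \<in> sl n" "X \<in> sl n" "y \<in> S"
    and c: "\<And>z. z \<in> V \<Longrightarrow> R (bracket n (bracket n X F) F) (R F z) = R F (R (bracket n (bracket n X F) F) z)"
  shows "R X ((R F ^^ M) y) = (R F ^^ M) (R X y) + sc (of_nat M) ((R F ^^ (M - 1)) (R (bracket n X F) y))
    + sc (of_nat (M choose 2)) ((R F ^^ (M - 2)) (R (bracket n (bracket n X F) F) y))"
proof -
  let ?X1 = "bracket n X F"
  let ?X2 = "bracket n ?X1 F"
  have c2: "R ?X2 ((R F ^^ M) z) = (R F ^^ M) (R ?X2 z)" if "z \<in> S" for M z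
    by (induction M) (use assms that SV in \<open>simp_all add: c\<close>)
  have c1: "R ?X1 ((R F ^^ M) z) = (R F ^^ M) (R ?X1 z) + sc (of_nat M) ((R F ^^ (M - 1)) (R ?X2 z))" if "z \<in> S" for M z
  proof (induction M)
    case (Suc M)
    have zS: "(R F ^^ M) z \<in> S" using assms that by simp
    have "R ?X1 (R F ((R F ^^ M) z)) = R F (R ?X1 ((R F ^^ M) z)) + R ?X2 ((R F ^^ M) z)"
      using assms SV [OF zS] by (intro R_comm) auto
    also have "R F (R ?X1 ((R F ^^ M) z)) = (R F ^^ Suc M) (R ?X1 z) + sc (of_nat M) ((R F ^^ Suc (M - 1)) (R ?X2 z))"
      unfolding Suc using assms that by (simp add: R_add R_sc SV R_S S_sc)
    also have "sc (of_nat M) ((R F ^^ Suc (M - 1)) (R ?X2 z)) = sc (of_nat M) ((R F ^^ M) (R ?X2 z))"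
      by (cases M) auto
    finally show ?case unfolding c2 [OF that] by (simp add: scale_left_distrib add_ac)
  qed simp
  show ?thesis
  proof (induction M)
    case (Suc M)
    have yS: "(R F ^^ M) y \<in> S" using assms by simp
    have "R X (R F ((R F ^^ M) y)) = R F (R X ((R F ^^ M) y)) + R ?X1 ((R F ^^ M) y)"
      using assms SV [OF yS] by (intro R_comm) auto
    also have "R F (R X ((R F ^^ M) y)) = (R F ^^ Suc M) (R X y) + sc (of_nat M) ((R F ^^ Suc (M - 1)) (R ?X1 y))
        + sc (of_nat (M choose 2)) ((R F ^^ Suc (M - 2)) (R ?X2 y))"
      unfolding Suc using assms by (simp add: R_add R_sc SV R_S S_sc S_add)
    also have "sc (of_nat M) ((R F ^^ Suc (M - 1)) (R ?X1 y)) = sc (of_nat M) ((R F ^^ M) (R ?X1 y))"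
      by (cases M) auto
    also have "sc (of_nat (M choose 2)) ((R F ^^ Suc (M - 2)) (R ?X2 y)) = sc (of_nat (M choose 2)) ((R F ^^ (M - 1)) (R ?X2 y))"
    proof (cases "M < 2")
      case False
      hence "Suc (M - 2) = M - 1" by simp
      thus ?thesis by (simp only:)
    qed simp
    finally have *: "R X (R F ((R F ^^ M) y)) = (R F ^^ Suc M) (R X y) + sc (of_nat M) ((R F ^^ M) (R ?X1 y))
        + sc (of_nat (M choose 2)) ((R F ^^ (M - 1)) (R ?X2 y)) + ((R F ^^ M) (R ?X1 y) + sc (of_nat M) ((R F ^^ (M - 1)) (R ?X2 y)))"
      unfolding c1 [OF assms(3)] .
    have "Suc M choose 2 = (M choose 2) + M" by (simp add: numeral_2_eq_2)
    thus ?case using * by (simp add: scale_left_distrib add_ac)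
  qed simp
qed

text \<open>The coefficients M and M choose 2 of the commutator expansion, multiplied by N choose i
  with M = N - i, are constants times N choose (i + 1) and N choose (i + 2). So the binomial shape
  reproduces itself.\<close>

lemma fam_R:
  assumes "F \<in> sl n" "X \<in> sl n" "U \<in> fam F"
    and c: "\<And>z. z \<in> V \<Longrightarrow> R (bracket n (bracket n X F) F) (R F z) = R F (R (bracket n (bracket n X F) F) z)"
  shows "(\<lambda>N. R X (U N)) \<in> fam F"
  using assms(3)
proof induction
  case (mono y i)
  let ?X1 = "bracket n X F"
  let ?X2 = "bracket n ?X1 F"
  let ?U = "\<lambda>i y N. sc (of_nat (N choose i)) ((R F ^^ (N - i)) y)"
  have u: "?U i z \<in> fam F" if "z \<in> S" for i z by (rule fam.mono [OF that])
  have s: "R X y \<in> S" "R ?X1 y \<in> S" "R ?X2 y \<in> S" using assms mono by (auto simp: R_S)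
  let ?W = "\<lambda>N. ?U i (R X y) N + sc (of_nat (i + 1)) (?U (i + 1) (R ?X1 y) N)
      + sc (of_nat ((i + 2) choose 2)) (?U (i + 2) (R ?X2 y) N)"
  have "?W \<in> fam F" by (intro fam.add fam_sc [OF assms(1)] u s)
  moreover have "R X (?U i y N) = ?W N" for N
  \<comment> \<open>For N < i the truncated exponent N - i is meaningless, but all binomial
    coefficients involved vanish.\<close>
  proof (cases "N < i")
    case True
    thus ?thesis using assms by (simp add: binomial_eq_0)
  next
    case False
    have b1: "(N choose i) * (N - i) = (i + 1) * (N choose (i + 1))"
      using binomial_absorb_comp [of N i] binomial_absorption [of i N] False
      by (metis Suc_eq_plus1 add.commute binomial_absorption mult.commute binomial_absorb_comp)
    have b2: "(N choose i) * ((N - i) choose 2) = ((i + 2) choose 2) * (N choose (i + 2))"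
    proof (cases "i + 2 \<le> N")
      case True
      have "(N choose (i + 2)) * ((i + 2) choose i) = (N choose i) * ((N - i) choose (i + 2 - i))"
        by (rule choose_mult) (use True in auto)
      moreover have "(i + 2) choose i = (i + 2) choose 2" using binomial_symmetric [of i "i + 2"] by simp
      ultimately show ?thesis by (simp add: mult.commute)
    next
      case F: False
      thus ?thesis by (simp add: binomial_eq_0)
    qed
    have rp: "R X ((R F ^^ (N - i)) y) = (R F ^^ (N - i)) (R X y) + sc (of_nat (N - i)) ((R F ^^ (N - i - 1)) (R ?X1 y))
      + sc (of_nat ((N - i) choose 2)) ((R F ^^ (N - i - 2)) (R ?X2 y))"
      by (rule R_pw_commutator [OF assms(1,2) mono]) (rule c)
    have yV: "(R F ^^ (N - i)) y \<in> V" using assms mono SV by simp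
    have "R X (?U i y N) = sc (of_nat (N choose i)) (R X ((R F ^^ (N - i)) y))"
      using assms yV by (simp add: R_sc)
    also have "\<dots> = ?U i (R X y) N + sc (of_nat ((N choose i) * (N - i))) ((R F ^^ (N - i - 1)) (R ?X1 y))
      + sc (of_nat ((N choose i) * ((N - i) choose 2))) ((R F ^^ (N - i - 2)) (R ?X2 y))"
      unfolding rp by (simp add: scale_right_distrib)
    also have "\<dots> = ?W N" unfolding b1 b2 by (simp add: diff_diff_left distrib_right)
    finally show ?thesis .
  qed
  ultimately show ?case by presburger
next
  case (add U W)
  have "R X (U N + W N) = R X (U N) + R X (W N)" for N
    using add assms by (intro R_add) (auto intro: fam_S SV)
  thus ?case using fam.add [OF add.IH] by simp
qed

lemma fam_good:
  assumes "a \<le> n" "b \<le> n" "a \<noteq> b"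
  shows "good_family (fam (emat a b))"
proof -
  have E: "emat a b \<in> sl n" using assms by simp
  have c: "R (bracket n (bracket n X (emat a b)) (emat a b)) (R (emat a b) z)
      = R (emat a b) (R (bracket n (bracket n X (emat a b)) (emat a b)) z)" if "X \<in> sl n" "z \<in> V" for X z
    unfolding bracket_emat_twice [OF assms that(1)] using that E by (simp only: R_smat R_sc R_V)
  have z: "(\<lambda>N. 0) \<in> fam (emat a b)" using fam.mono [OF S_0, of 0 "emat a b"] E
    by (simp add: pw_sc [OF E S_0, of _ 0, simplified])
  show ?thesis unfolding good_family_def
    using fam_S [OF E] z fam.add fam_sc [OF E] fam_R [OF E _ _ c] by blast
qed


lemma comp_pw_pw:
  assumes jk: "j < k" "k \<le> n"
  shows "comp ((R (emat j k) ^^ N) ((R (emat k j) ^^ M) v)) = (if M = N then K (m j - m k) N else 0)"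
proof (cases "M = N")
  case True
  have "(R (emat j k) ^^ N) ((R (emat k j) ^^ N) v) = sc (K (m j - m k) N) v"
    using jk by (intro sl2_power) (auto simp: E_v H_v' wt_hmat)
  thus ?thesis using True by (simp add: comp_sc)
next
  case False
  have s: "emat j k \<in> sl n" "emat k j \<in> sl n" using jk by auto
  have hjk: "hmat n j k \<in> cartan n" using jk by simp
  let ?x = "(R (emat k j) ^^ M) v"
  have "comp ((R (emat j k) ^^ N) ?x) = 0"
  proof (rule lin_S_eigen [where \<phi> = "\<lambda>x. comp ((R (emat j k) ^^ N) x)" and H = "hmat n j k"])
    show "lin_S (\<lambda>x. comp ((R (emat j k) ^^ N) x))" by (intro lin_S_pw lin_S_comp s)
    show "comp ((R (emat j k) ^^ N) (R (hmat n j k) ?x)) = (wt (hmat n j k) - of_nat N * (hmat n j k j j - hmat n j k k k)) * comp ((R (emat j k) ^^ N) ?x)"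
      using jk hjk s by (intro weight_functional_pw [OF lin_S_comp]) (auto simp: comp_H)
    show "?x \<in> S" using s by simp
    show "R (hmat n j k) ?x = sc (wt (hmat n j k) + of_nat M * (hmat n j k k k - hmat n j k j j)) ?x"
      using jk hjk s H_pw [OF hjk, of k j v M] by (simp add: H_v' pw_sc scale_left_distrib)
    have "- 2 * of_nat N \<noteq> (- 2 * of_nat M :: complex)" using False by simp
    thus "wt (hmat n j k) - of_nat N * (hmat n j k j j - hmat n j k k k) \<noteq> wt (hmat n j k) + of_nat M * (hmat n j k k k - hmat n j k j j)"
      using jk by (simp add: hmat_def algebra_simps)
  qed
  thus ?thesis using False by simp
qed

text \<open>For adjacent \<open>j, k\<close> the weight spaces through which \<open>f = E\<^sub>k\<^sub>j\<close> moves the highest weight vector are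
  one-dimensional.\<close>

lemma adjacent_component:
  assumes jk: "Suc j = k" "k \<le> n" and nz: "m j - m k \<notin> \<int>" and y: "y \<in> S"
  shows "\<exists>c. \<forall>N\<ge>i. comp ((R (emat j k) ^^ N) ((R (emat k j) ^^ (N - i)) y)) = K (m j - m k) N * c"
proof -
  have "y \<in> S \<and> (\<exists>c. \<forall>N\<ge>i. comp ((R (emat j k) ^^ N) ((R (emat k j) ^^ (N - i)) y)) = K (m j - m k) N * c)"
    using y
proof (induction rule: S_induct)
  case sub
  have s: "emat j k \<in> sl n" "emat k j \<in> sl n" using jk by auto
  let ?f = "\<lambda>N y. comp ((R (emat j k) ^^ N) ((R (emat k j) ^^ (N - i)) y))"
  have l: "lin_S (?f N)" for N by (intro lin_S_pw [OF lin_S_pw [OF lin_S_comp]] s)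
  show ?case
    unfolding subspace_def
  proof (intro conjI ballI allI CollectI)
    fix x y c
    assume "x \<in> {y. y \<in> S \<and> (\<exists>c. \<forall>N\<ge>i. ?f N y = K (m j - m k) N * c)}"
    then obtain c1 where x: "x \<in> S" "\<And>N. N \<ge> i \<Longrightarrow> ?f N x = K (m j - m k) N * c1" by auto
    show "sc c x \<in> S" using x by (simp add: S_sc)
    show "\<exists>d. \<forall>N\<ge>i. ?f N (sc c x) = K (m j - m k) N * d"
      using x by (intro exI [of _ "c * c1"]) (simp add: lin_S_sc [OF l])
    assume "y \<in> {y. y \<in> S \<and> (\<exists>c. \<forall>N\<ge>i. ?f N y = K (m j - m k) N * c)}"
    then obtain c2 where y: "y \<in> S" "\<And>N. N \<ge> i \<Longrightarrow> ?f N y = K (m j - m k) N * c2" by auto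
    show "x + y \<in> S" using x y by (simp add: S_add)
    show "\<exists>d. \<forall>N\<ge>i. ?f N (x + y) = K (m j - m k) N * d"
      using x y by (intro exI [of _ "c1 + c2"]) (simp add: lin_S_add [OF l] distrib_left)
  qed (auto simp: lin_S_0 [OF l] S_0 intro: exI [of _ 0])
next
  case (low ps)
  have s: "emat j k \<in> sl n" "emat k j \<in> sl n" using jk by auto
  have hjk: "hmat n j k \<in> cartan n" using jk by simp
  have lS: "low ps \<in> S" using low by (rule low_S)
  have "\<exists>c. \<forall>N\<ge>i. comp ((R (emat j k) ^^ N) ((R (emat k j) ^^ (N - i)) (low ps))) = K (m j - m k) N * c"
  proof (cases "set ps \<subseteq> {(j, k)}")
    case True
    define M where "M = length ps"
    have lp: "low ps = (R (emat k j) ^^ M) v" unfolding M_def using True by (induction ps) auto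
    have p: "comp ((R (emat j k) ^^ N) ((R (emat k j) ^^ (N - i)) (low ps))) = (if M = i then K (m j - m k) N else 0)"
      if "N \<ge> i" for N
    proof -
      have e: "(R (emat k j) ^^ (N - i)) (low ps) = (R (emat k j) ^^ (N - i + M)) v"
        unfolding lp by (simp add: funpow_add)
      have "N - i + M = N \<longleftrightarrow> M = i" using that by auto
      thus ?thesis unfolding e using jk by (simp add: comp_pw_pw)
    qed
    show ?thesis by (rule exI [of _ "if M = i then 1 else 0"]) (simp add: p)
  next
    case False
    \<comment> \<open>\<open>d\<close> numbers the indices with the adjacent indices
      \<open>j\<close> and \<open>k\<close> identified; it is weakly increasing, and strictly so
      across every pair except (j, k). The traceless element built from it commutes with E_jk and
      E_kj, while any other lowering letter decreases its eigenvalue.\<close>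
    define d where "d a = (if a < k then int a else int a - 1)" for a
    define h where "h a = (\<Sum>b\<le>n. d b) - int (n + 1) * d a" for a
    let ?H = "dg n (\<lambda>a. of_int (h a))"
    have H: "?H \<in> cartan n"
    proof (rule dg_cartan)
      have "(\<Sum>x\<le>n. h x) = 0" unfolding h_def sum_subtractf sum_distrib_left [symmetric] by simp
      thus "(\<Sum>i\<le>n. (of_int (h i) :: complex)) = 0" by (metis of_int_0 of_int_sum)
    qed
    have hjk0: "h j = h k" using jk by (simp add: h_def d_def)
    have neg: "\<exists>t>0. lshift ?H ps = - of_int t"
    proof -
      have "lowering n qs \<Longrightarrow> \<exists>t\<ge>0. lshift ?H qs = - of_int t \<and> (\<not> set qs \<subseteq> {(j, k)} \<longrightarrow> t > 0)" for qs
      proof (induction qs)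
        case (Cons p qs)
        then obtain t where t: "t \<ge> 0" "lshift ?H qs = - of_int t" "\<not> set qs \<subseteq> {(j, k)} \<longrightarrow> t > 0" by auto
        have le: "d (fst p) \<le> d (snd p)" "p \<noteq> (j, k) \<longrightarrow> d (fst p) < d (snd p)"
          using Cons.prems jk by (cases p; auto simp: d_def)+
        let ?t = "t + int (n + 1) * (d (snd p) - d (fst p))"
        have "lshift ?H (p # qs) = - of_int ?t"
          using Cons.prems t by (simp add: h_def algebra_simps)
        moreover have "?t \<ge> 0" using t le by simp
        moreover have "?t > 0" if "\<not> set (p # qs) \<subseteq> {(j, k)}"
        proof (cases "p = (j, k)")
          case True
          with that t have "t > 0" by auto
          thus ?thesis using le(1) by (simp add: add_pos_nonneg)
        next
          case False
          hence "int (n + 1) * (d (snd p) - d (fst p)) > 0" using le by simp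
          thus ?thesis using t by linarith
        qed
        ultimately show ?case by blast
      qed auto
      from this [OF low] False show ?thesis by auto
    qed
    then obtain t where t: "t > 0" "lshift ?H ps = - of_int t" by blast
    \<comment> \<open>The powers of E_kj and E_jk leave the eigenvalue of \<open>?H\<close>
      unchanged, so a word with some other letter remains strictly below the highest weight.\<close>
    have "comp ((R (emat j k) ^^ N) ((R (emat k j) ^^ (N - i)) (low ps))) = 0" for N
    proof (rule comp_eigen [OF H])
      let ?y = "(R (emat k j) ^^ (N - i)) (low ps)"
      show "(R (emat j k) ^^ N) ?y \<in> S" using s lS by simp
      have z: "?H j j - ?H k k = 0" "?H k k - ?H j j = 0" using jk hjk0 by auto
      have "R ?H ?y = sc (wt ?H - of_int t) ?y"
        using jk s lS z by (subst H_pw [OF H]) (auto simp: H_low [OF H low] t pw_sc)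
      thus "R ?H ((R (emat j k) ^^ N) ?y) = sc (wt ?H - of_int t) ((R (emat j k) ^^ N) ?y)"
        using jk s lS z by (subst H_pw [OF H]) (auto simp: pw_sc)
      show "wt ?H - of_int t \<noteq> wt ?H" using t by simp
    qed
    thus ?thesis by (intro exI [of _ 0]) simp
  qed
  thus ?case using lS by blast
qed
  thus ?thesis by blast
qed

text \<open>A generator of index \<open>i\<close> contributes a constant times N choose i, by
  \<open>adjacent_component\<close>; the range N < i, not covered there, is taken care of by the
  vanishing binomial.\<close>

lemma fam_poly:
  assumes jk: "Suc j = k" "k \<le> n" and nz: "m j - m k \<notin> \<int>" and U: "U \<in> fam (emat k j)"
  shows "\<exists>q. \<forall>N. comp ((R (emat j k) ^^ N) (U N)) = K (m j - m k) N * poly q (of_nat N)"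
  using U
proof induction
  case (mono y i)
  have s: "emat j k \<in> sl n" "emat k j \<in> sl n" using jk by auto
  obtain c where c: "\<And>N. N \<ge> i \<Longrightarrow> comp ((R (emat j k) ^^ N) ((R (emat k j) ^^ (N - i)) y)) = K (m j - m k) N * c"
    using adjacent_component [OF jk nz mono] by blast
  obtain b :: "complex poly" where b: "\<And>N. poly b (of_nat N) = of_nat (N choose i)" using binomial_poly by blast
  have "comp ((R (emat j k) ^^ N) (sc (of_nat (N choose i)) ((R (emat k j) ^^ (N - i)) y)))
      = K (m j - m k) N * poly (smult c b) (of_nat N)" for N
    using c [of N] s mono
    by (cases "N < i") (simp_all add: lin_S_sc [OF lin_S_pw [OF lin_S_comp]] b lin_S_0 [OF lin_S_pw [OF lin_S_comp]])
  thus ?case by blast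
next
  case (add U W)
  have s: "emat j k \<in> sl n" "emat k j \<in> sl n" using jk by auto
  obtain q1 q2 where "\<And>N. comp ((R (emat j k) ^^ N) (U N)) = K (m j - m k) N * poly q1 (of_nat N)"
    "\<And>N. comp ((R (emat j k) ^^ N) (W N)) = K (m j - m k) N * poly q2 (of_nat N)" using add by blast
  hence "comp ((R (emat j k) ^^ N) (U N + W N)) = K (m j - m k) N * poly (q1 + q2) (of_nat N)" for N
    using s add by (simp add: lin_S_add [OF lin_S_pw [OF lin_S_comp]] fam_S distrib_left)
  thus ?case by blast
qed

text \<open>If N = m j - m k + 1 were a natural number, E_jk would kill the vector
  \<open>u N\<close> and the argument for separated pairs would apply to the reflected weight. For
  all natural N there is an identity whose correction term carries the factor m j - m k + 1 - N.
  Divided by \<open>K (m j - m k) N\<close> it becomes polynomial in N, hence holds at the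
  non-integral root of this factor too.\<close>

lemma adjacent_pair_point:
  assumes ix: "i < j" "Suc j = k" "k < l" "l \<le> n"
    and nz: "m j - m k \<notin> \<int>" "m i - m k \<notin> \<int>" "m j - m l \<notin> \<int>"
    and e: "texpr_in n e" "\<forall>t\<in>set e. length (snd t) \<le> d" "\<And>u. u \<in> V \<Longrightarrow> ta e u = 0"
  shows "symb d e (\<lambda>X. X j i + X l k) = 0"
proof (rule symb_pair_zero)
  fix a b assume d: "a + b = d"
  have ix': "j \<le> n" "i \<le> n" "k \<le> n" "l \<le> n" "distinct [i, j, k, l]" using ix by auto
  have s: "emat j k \<in> sl n" "emat k j \<in> sl n" "emat i j \<in> sl n" "emat k l \<in> sl n" using ix by auto
  let ?P = "fam (emat k j)"
  let ?E = "R (emat j k)" and ?F = "R (emat k j)"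
  have P: "good_family ?P" using ix by (intro fam_good) auto
  define u where "u N = (?F ^^ N) v" for N
  define Yz where "Yz N = sc (of_nat N) ((?F ^^ (N - 1)) v)" for N
  define \<zeta> :: "nat \<Rightarrow> complex" where "\<zeta> N = m j - m k + 1 - of_nat N" for N
  define \<mu> where "\<mu> N H = wt H + of_nat N * (H k k - H j j)" for N and H :: mat
  have uS: "u N \<in> S" for N unfolding u_def using s by simp
  have uP: "u \<in> ?P" using fam.mono [of v 0 "emat k j"] by (simp add: u_def [abs_def])
  have YP: "Yz \<in> ?P" using fam.mono [of v 1 "emat k j"] by (simp add: Yz_def [abs_def])
  have Eu: "R (emat j k) (u N) = sc (\<zeta> N) (Yz N)" for N
  proof (cases N)
    case 0
    thus ?thesis using ix by (simp add: u_def Yz_def E_v)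
  next
    case (Suc M)
    show ?thesis unfolding u_def Yz_def \<zeta>_def Suc
      using ix by (subst sl2_step [where c = "m j - m k"]) (auto simp: E_v H_v' wt_hmat mult.commute)
  qed
  have Hu: "R H (u N) = sc (\<mu> N H) (u N)" if "H \<in> cartan n" for N H
    unfolding u_def \<mu>_def using ix that by (subst H_pw) (auto simp: H_v' pw_sc scale_left_distrib)
  have \<phi>: "lin_S (\<lambda>x. comp ((?E ^^ N) x))" for N by (intro lin_S_pw lin_S_comp s)
  have \<phi>H: "comp ((?E ^^ N) (R H x)) = \<mu> N H * comp ((?E ^^ N) x)" if "H \<in> cartan n" "x \<in> S" for N H x
    using weight_functional_pw [OF lin_S_comp that(1), of j k "wt H" x N] ix that
    by (simp add: comp_H \<mu>_def algebra_simps)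
  have Eij: "R (emat i j) (u N) = 0" for N
    unfolding u_def using ix s by (subst pw_comm) (auto simp: E_v pw_0)
  have Ekl: "R (emat k l) (u N) = 0" for N
    unfolding u_def using ix s by (subst pw_comm) (auto simp: E_v pw_0)
  obtain Y where Y: "Y \<in> ?P" "\<And>N. comp ((?E ^^ N) ((R (emat i j) ^^ a) ((R (emat k l) ^^ b) (ta e (u N)))))
     = coeff (cpol (j, i) (l, k) (a + b) e) a * K (\<mu> N (hmat n i j)) a * K (\<mu> N (hmat n k l)) b * comp ((?E ^^ N) (u N))
       + \<zeta> N * comp ((?E ^^ N) ((R (emat i j) ^^ a) ((R (emat k l) ^^ b) (Y N))))"
    using pair_functional [OF ix' P uP YP Eu \<phi> \<phi>H Hu Eij Ekl e(1), of a b] e(2) d by auto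
  let ?W = "\<lambda>N. (R (emat i j) ^^ a) ((R (emat k l) ^^ b) (Y N))"
  have WP: "?W \<in> ?P" by (intro gf_pw [OF P] s Y)
  then obtain q where q: "\<And>N. comp ((?E ^^ N) (?W N)) = K (m j - m k) N * poly q (of_nat N)"
    using fam_poly [OF ix(2) ix'(3) nz(1) WP] by auto
  let ?C = "coeff (cpol (j, i) (l, k) (a + b) e) a"
  let ?p = "smult ?C (smult (fact a) (\<Prod>s<a. [:m i - m j - of_nat s, 1:]) * smult (fact b) (\<Prod>s<b. [:m k - m l - of_nat s, 1:]))
    + [:m j - m k + 1, -1:] * q"
  have pp: "poly ?p x = ?C * (K (m i - m j + x) a * K (m k - m l + x) b) + (m j - m k + 1 - x) * poly q x" for x
    unfolding poly_add poly_smult poly_mult K_poly [unfolded poly_smult] by simp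
  have "poly ?p (of_nat N) = 0" for N
  proof -
    have z: "comp ((?E ^^ N) ((R (emat i j) ^^ a) ((R (emat k l) ^^ b) (ta e (u N))))) = 0"
      using e(3) [OF SV [OF uS]] lin_S_0 [OF lin_S_pw [OF lin_S_pw [OF \<phi> s(3)] s(4)]] by simp
    have cu: "comp ((?E ^^ N) (u N)) = K (m j - m k) N"
      unfolding u_def using ix by (subst sl2_power [where c = "m j - m k"]) (auto simp: E_v H_v' wt_hmat comp_sc)
    have m1: "\<mu> N (hmat n i j) = m i - m j + of_nat N" "\<mu> N (hmat n k l) = m k - m l + of_nat N"
      using ix by (auto simp: \<mu>_def wt_hmat) (auto simp: hmat_def)
    from Y(2) [of N] have "K (m j - m k) N * poly ?p (of_nat N) = 0"
      unfolding pp z q m1 cu \<zeta>_def by (simp only: algebra_simps)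
    thus ?thesis using K_nz [OF nz(1)] by simp
  qed
  hence "?p = 0" by (rule poly_eq_0_on_nat)
  \<comment> \<open>At this point the arguments of the two \<open>K\<close> factors become m i - m k
    + 1 and m j - m l + 1, the reflected differences; they are non-integral by assumption.\<close>
  hence "poly ?p (m j - m k + 1) = 0" by simp
  hence "?C * (K (m i - m k + 1) a * K (m j - m l + 1) b) = 0" unfolding pp by (simp add: algebra_simps)
  moreover have "m i - m k + 1 \<notin> \<int>" "m j - m l + 1 \<notin> \<int>"
    using nz(2,3) Ints_diff [OF _ Ints_1, of "m i - m k + 1"] Ints_diff [OF _ Ints_1, of "m j - m l + 1"] by auto
  ultimately show "coeff (cpol (j, i) (l, k) d e) a = 0" using K_nz d by simp
qed

end

subsection \<open>Three pairwise non-integral coordinates\<close>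

lemma sum_shift_up:
  fixes F :: "nat \<Rightarrow> 'a::comm_monoid_add"
  assumes "F 0 = 0" "F (Suc N) = 0" shows "sum F {..N} = (\<Sum>a\<le>N. F (Suc a))"
proof -
  have "sum F {..Suc N} = F 0 + (\<Sum>a\<le>N. F (Suc a))" by (rule sum.atMost_Suc_shift)
  thus ?thesis using assms by simp
qed

lemma sum_shift_down:
  fixes F :: "nat \<Rightarrow> 'a::comm_monoid_add"
  assumes "F N = 0" shows "sum F {..N} = (\<Sum>a\<le>N. if a = 0 then 0 else F (a - 1))"
proof -
  have "(\<Sum>a\<le>N. if a = 0 then 0 else F (a - 1)) = (\<Sum>a\<le>N. F a)"
    by (subst sum_shift_up [of _ N, symmetric, where F = "\<lambda>a. if a = 0 then 0 else F (a - 1)", simplified])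
      (use assms in \<open>auto simp: sum_shift_up\<close>)
  thus ?thesis ..
qed

context hwrep begin

lemma pw_add: "X \<in> sl n \<Longrightarrow> x \<in> S \<Longrightarrow> y \<in> S \<Longrightarrow> (R X ^^ a) (x + y) = (R X ^^ a) x + (R X ^^ a) y"
  by (induction a) (auto simp: R_add SV)

lemma comm_pw:
  assumes "X \<in> sl n" "F \<in> sl n" "Y \<in> sl n" "z \<in> S"
    "\<And>z. z \<in> V \<Longrightarrow> R X (R F z) = R F (R X z) + sc s (R Y z)"
    "\<And>z. z \<in> V \<Longrightarrow> R Y (R F z) = R F (R Y z)"
  shows "R X ((R F ^^ a) z) = (R F ^^ a) (R X z) + sc (s * of_nat a) ((R F ^^ (a - 1)) (R Y z))"
proof (induction a)
  case (Suc a)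
  have y: "R Y ((R F ^^ a) z) = (R F ^^ a) (R Y z)" for a
    by (induction a) (use assms SV in simp_all)
  have zV: "(R F ^^ a) z \<in> V" "(R F ^^ a) (R X z) \<in> V" "(R F ^^ (a - 1)) (R Y z) \<in> V"
    by (intro SV pw_S R_S assms)+
  have "R X ((R F ^^ Suc a) z) = R F (R X ((R F ^^ a) z)) + sc s ((R F ^^ a) (R Y z))"
    using assms(5) [OF zV(1)] by (simp add: y)
  also have "R F (R X ((R F ^^ a) z)) = (R F ^^ Suc a) (R X z) + sc (s * of_nat a) ((R F ^^ Suc (a - 1)) (R Y z))"
    unfolding Suc using assms zV by (simp add: R_add R_sc)
  also have "sc (s * of_nat a) ((R F ^^ Suc (a - 1)) (R Y z)) = sc (s * of_nat a) ((R F ^^ a) (R Y z))"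
    by (cases a) auto
  finally show ?case by (simp add: distrib_left scale_left_distrib add_ac)
qed simp

lemma H_pw_eigen:
  assumes "H \<in> cartan n" "i \<le> n" "j \<le> n" "i \<noteq> j" "x \<in> S" "R H x = sc c x"
  shows "R H ((R (emat i j) ^^ a) x) = sc (c + of_nat a * (H i i - H j j)) ((R (emat i j) ^^ a) x)"
  unfolding H_pw [OF assms(1-5)] assms(6) using assms by (simp add: pw_sc scale_left_distrib)

lemma sl2_comm:
  assumes "i \<le> n" "j \<le> n" "i \<noteq> j" "x \<in> S" "R (hmat n i j) x = sc c x"
  shows "R (emat i j) ((R (emat j i) ^^ a) x) = (R (emat j i) ^^ a) (R (emat i j) x)
    + sc (of_nat a * (c - of_nat a + 1)) ((R (emat j i) ^^ (a - 1)) x)"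
proof (induction a)
  case (Suc a)
  let ?F = "R (emat j i)"
  let ?y = "(?F ^^ a) x"
  have h: "hmat n i j j j - hmat n i j i i = -2" using assms by (simp add: hmat_def)
  have "R (emat i j) (?F ?y) = ?F (R (emat i j) ?y) + R (hmat n i j) ?y"
    using assms by (intro EE_h) (auto simp: SV)
  also have "R (hmat n i j) ?y = sc (c - 2 * of_nat a) ?y"
  proof -
    have "R (hmat n i j) ?y = (?F ^^ a) (R (hmat n i j) x) + sc (of_nat a * (hmat n i j j j - hmat n i j i i)) ?y"
      using assms by (intro H_pw) auto
    thus ?thesis unfolding h assms(5) using assms pw_sc [of "emat j i" x a c] by (simp add: algebra_simps)
  qed
  also have "?F (R (emat i j) ?y) = (?F ^^ Suc a) (R (emat i j) x) + sc (of_nat a * (c - of_nat a + 1)) ((?F ^^ Suc (a - 1)) x)"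
    unfolding Suc using assms by (simp add: R_add R_sc SV R_S S_sc)
  also have "sc (of_nat a * (c - of_nat a + 1)) ((?F ^^ Suc (a - 1)) x) = sc (of_nat a * (c - of_nat a + 1)) ?y"
    by (cases a) auto
  finally have "R (emat i j) ((?F ^^ Suc a) x) = (?F ^^ Suc a) (R (emat i j) x)
     + sc (of_nat a * (c - of_nat a + 1) + (c - 2 * of_nat a)) ?y"
    by (simp add: scale_left_distrib add_ac)
  also have "of_nat a * (c - of_nat a + 1) + (c - 2 * of_nat a) = of_nat (Suc a) * (c - of_nat (Suc a) + 1)"
    by (simp add: field_simps)
  finally show ?case by simp
qed simp

end

text \<open>With three indices, two positions such as (1, 0) and (2, 1) share an index and their
  root vectors do not commute. The pairing argument is replaced by computations with ordered
  monomials.\<close>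

locale hwrep3 = hwrep sc 2 V R v m for sc :: "complex \<Rightarrow> 'v::ab_group_add \<Rightarrow> 'v" and V R v m
begin

abbreviation "E i j \<equiv> R (emat i j)"

definition y :: "nat \<Rightarrow> 'v" where "y j = (E 2 1 ^^ j) v"

text \<open>The ordered monomials of a Verma module of sl_3. E_20 commutes with E_10 and E_21 and is
  their only bracket, so this order keeps all commutation formulas short.\<close>

definition B :: "nat \<Rightarrow> nat \<Rightarrow> nat \<Rightarrow> 'v" where "B k a j = (E 2 0 ^^ k) ((E 1 0 ^^ a) (y j))"

lemma y_S [simp]: "y j \<in> S" by (simp add: y_def)
lemma B_S [simp]: "B k a j \<in> S" by (simp add: B_def)
lemma B_V [simp]: "B k a j \<in> V" by (rule SV) simp

lemma H_y: "H \<in> cartan 2 \<Longrightarrow> R H (y j) = sc (wt H + of_nat j * (H 2 2 - H 1 1)) (y j)"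
  unfolding y_def by (rule H_pw_eigen) (auto simp: H_v')

lemma H_x: "H \<in> cartan 2 \<Longrightarrow> R H ((E 1 0 ^^ a) (y j))
    = sc (wt H + of_nat j * (H 2 2 - H 1 1) + of_nat a * (H 1 1 - H 0 0)) ((E 1 0 ^^ a) (y j))"
  by (rule H_pw_eigen) (auto simp: H_y)

lemma H_B: "H \<in> cartan 2 \<Longrightarrow> R H (B k a j) = sc (wt H + of_nat j * (H 2 2 - H 1 1)
    + of_nat a * (H 1 1 - H 0 0) + of_nat k * (H 2 2 - H 0 0)) (B k a j)"
  unfolding B_def by (rule H_pw_eigen) (auto simp: H_x [simplified])

lemma E12_y: "E 1 2 (y j) = sc (of_nat j * (m 1 - m 2 - of_nat j + 1)) (y (j - 1))"
  unfolding y_def by (subst sl2_comm [where c = "m 1 - m 2"]) (auto simp: E_v H_v' wt_hmat pw_0)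

lemma E01_y: "E 0 1 (y j) = 0"
  unfolding y_def by (subst pw_comm) (auto simp: E_v pw_0)

lemma E02_y: "E 0 2 (y j) = 0"
  unfolding y_def using EE_br [of 0 2 1] EE_comm [of 0 1 2 1]
  by (subst comm_pw [where s = 1 and Y = "emat 0 1"]) (auto simp: E_v pw_0)

lemma E20_B: "E 2 0 (B k a j) = B (Suc k) a j"
  by (simp add: B_def)

lemma E10_B: "E 1 0 (B k a j) = B k (Suc a) j"
  unfolding B_def by (subst pw_comm) auto

lemma E21_x: "E 2 1 ((E 1 0 ^^ a) (y j)) = (E 1 0 ^^ a) (y (Suc j)) + sc (of_nat a) (E 2 0 ((E 1 0 ^^ (a - 1)) (y j)))"
proof -
  have "E 2 1 ((E 1 0 ^^ a) (y j)) = (E 1 0 ^^ a) (E 2 1 (y j)) + sc (1 * of_nat a) ((E 1 0 ^^ (a - 1)) (E 2 0 (y j)))"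
    using EE_br [of 2 1 0] EE_comm [of 2 0 1 0] by (intro comm_pw) auto
  also have "(E 1 0 ^^ (a - 1)) (E 2 0 (y j)) = E 2 0 ((E 1 0 ^^ (a - 1)) (y j))"
    by (subst pw_comm) auto
  finally show ?thesis by (simp add: y_def)
qed

lemma E21_B: "E 2 1 (B k a j) = B k a (Suc j) + sc (of_nat a) (B (Suc k) (a - 1) j)"
proof -
  have "E 2 1 (B k a j) = (E 2 0 ^^ k) (E 2 1 ((E 1 0 ^^ a) (y j)))"
    unfolding B_def by (subst pw_comm) auto
  also have "\<dots> = (E 2 0 ^^ k) ((E 1 0 ^^ a) (y (Suc j))) + sc (of_nat a) ((E 2 0 ^^ k) (E 2 0 ((E 1 0 ^^ (a - 1)) (y j))))"
    unfolding E21_x by (simp add: pw_add pw_sc S_sc R_S)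
  finally show ?thesis by (simp add: B_def funpow_swap1)
qed

lemma E12_B: "E 1 2 (B k a j) = sc (of_nat j * (m 1 - m 2 - of_nat j + 1)) (B k a (j - 1))
    + sc (of_nat k) (B (k - 1) (Suc a) j)"
proof -
  have "E 1 2 (B k a j) = (E 2 0 ^^ k) (E 1 2 ((E 1 0 ^^ a) (y j))) + sc (1 * of_nat k) ((E 2 0 ^^ (k - 1)) (E 1 0 ((E 1 0 ^^ a) (y j))))"
    unfolding B_def using EE_br [of 1 2 0] EE_comm [of 1 0 2 0] by (intro comm_pw) auto
  also have "E 1 2 ((E 1 0 ^^ a) (y j)) = sc (of_nat j * (m 1 - m 2 - of_nat j + 1)) ((E 1 0 ^^ a) (y (j - 1)))"
    by (subst pw_comm) (simp_all add: E12_y [simplified] pw_sc)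
  finally show ?thesis by (simp add: B_def pw_sc)
qed

lemma E01_B: "E 0 1 (B k a j) = sc (of_nat a * (m 0 - m 1 + of_nat j - of_nat a + 1 - of_nat k)) (B k (a - 1) j)
    - sc (of_nat k) (B (k - 1) a (Suc j))"
proof -
  have h: "R (hmat 2 0 1) (y j) = sc (m 0 - m 1 + of_nat j) (y j)"
    using H_y [of "hmat 2 0 1" j] by (simp add: wt_hmat) (simp add: hmat_def)
  have "E 0 1 (E 2 0 z) = E 2 0 (E 0 1 z) + sc (-1) (E 2 1 z)" if "z \<in> V" for z
    using EE_br [of 2 0 1 z] that by simp
  hence "E 0 1 (B k a j) = (E 2 0 ^^ k) (E 0 1 ((E 1 0 ^^ a) (y j))) + sc ((-1) * of_nat k) ((E 2 0 ^^ (k - 1)) (E 2 1 ((E 1 0 ^^ a) (y j))))"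
    unfolding B_def using EE_comm [of 2 1 2 0] by (intro comm_pw) auto
  also have "E 0 1 ((E 1 0 ^^ a) (y j)) = sc (of_nat a * (m 0 - m 1 + of_nat j - of_nat a + 1)) ((E 1 0 ^^ (a - 1)) (y j))"
    using sl2_comm [of 0 1 "y j" "m 0 - m 1 + of_nat j" a] h E01_y by (simp add: pw_0)
  also have "(E 2 0 ^^ (k - 1)) (E 2 1 ((E 1 0 ^^ a) (y j))) = B (k - 1) a (Suc j) + sc (of_nat a) (B (Suc (k - 1)) (a - 1) j)"
    using E21_B [of "k - 1" a j] unfolding B_def by (subst pw_comm [symmetric]) auto
  finally have e: "E 0 1 (B k a j) = sc (of_nat a * (m 0 - m 1 + of_nat j - of_nat a + 1)) (B k (a - 1) j)
     + sc ((-1) * of_nat k) (B (k - 1) a (Suc j) + sc (of_nat a) (B (Suc (k - 1)) (a - 1) j))"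
    by (simp add: B_def pw_sc)
  have "sc ((-1) * of_nat k) (B (k - 1) a (Suc j) + sc (of_nat a) (B (Suc (k - 1)) (a - 1) j))
    = sc (- of_nat k * of_nat a) (B k (a - 1) j) - sc (of_nat k) (B (k - 1) a (Suc j))"
    by (cases k) (simp_all add: scale_right_distrib del: of_nat_Suc)
  hence "E 0 1 (B k a j) = sc (of_nat a * (m 0 - m 1 + of_nat j - of_nat a + 1) + - of_nat k * of_nat a) (B k (a - 1) j)
    - sc (of_nat k) (B (k - 1) a (Suc j))"
    unfolding e scale_left_distrib by simp
  moreover have "of_nat a * (m 0 - m 1 + of_nat j - of_nat a + 1) + - of_nat k * of_nat a
     = of_nat a * (m 0 - m 1 + of_nat j - of_nat a + 1 - of_nat k)" by (simp add: ring_distribs)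
  ultimately show ?thesis by simp
qed

lemma E02_B: "E 0 2 (B k a j) = sc (of_nat k * (m 0 - m 2 - of_nat j - of_nat a - of_nat k + 1)) (B (k - 1) a j)
    - sc (of_nat a * of_nat j * (m 1 - m 2 - of_nat j + 1)) (B k (a - 1) (j - 1))"
proof -
  let ?x = "(E 1 0 ^^ a) (y j)"
  have h: "R (hmat 2 0 2) ?x = sc (m 0 - m 2 - of_nat j - of_nat a) ?x"
    using H_x [of "hmat 2 0 2" a j] by (simp add: wt_hmat) (simp add: hmat_def)
  have "E 0 2 (E 1 0 z) = E 1 0 (E 0 2 z) + sc (-1) (E 1 2 z)" if "z \<in> V" for z
    using EE_br [of 1 0 2 z] that by simp
  hence x: "E 0 2 ?x = (E 1 0 ^^ a) (E 0 2 (y j)) + sc ((-1) * of_nat a) ((E 1 0 ^^ (a - 1)) (E 1 2 (y j)))"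
    using EE_comm [of 1 2 1 0] by (intro comm_pw) auto
  have "E 0 2 (B k a j) = (E 2 0 ^^ k) (E 0 2 ?x) + sc (of_nat k * (m 0 - m 2 - of_nat j - of_nat a - of_nat k + 1)) ((E 2 0 ^^ (k - 1)) ?x)"
    unfolding B_def by (rule sl2_comm) (use h in auto)
  also have "(E 2 0 ^^ k) (E 0 2 ?x) = - sc (of_nat a * of_nat j * (m 1 - m 2 - of_nat j + 1)) (B k (a - 1) (j - 1))"
    unfolding x E02_y E12_y B_def by (simp add: pw_0 pw_sc S_sc mult_ac scale_minus_left [symmetric] del: scale_minus_left)
  finally show ?thesis by (simp add: B_def)
qed

end

lemma eliminate_linear:
  fixes x :: "'a::comm_ring"
  assumes "x * (A * Q) = w" "w * T = x * (A * J * L)" shows "x * A * (Q * T - J * L) = 0"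
proof -
  have "x * A * (Q * T - J * L) = x * (A * Q) * T - x * (A * J * L)" by (simp add: algebra_simps)
  thus ?thesis using assms by simp
qed

section \<open>Linear independence of the ordered monomials\<close>

context hwrep3 begin

definition U :: "nat \<Rightarrow> (nat \<Rightarrow> nat \<Rightarrow> nat \<Rightarrow> complex) \<Rightarrow> 'v" where
  "U N c = (\<Sum>k\<le>N. \<Sum>a\<le>N. \<Sum>j\<le>N. sc (c k a j) (B k a j))"

text \<open>Coefficients vanish from total degree \<open>N\<close> on, which keeps every index shift
  caused by a raising operator inside the summation box of \<open>U N\<close>.\<close>

definition supp :: "nat \<Rightarrow> (nat \<Rightarrow> nat \<Rightarrow> nat \<Rightarrow> complex) \<Rightarrow> bool" where
  "supp N c \<longleftrightarrow> (\<forall>k a j. N \<le> k + a + j \<longrightarrow> c k a j = 0)"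

text \<open>\<open>e01 c\<close> and \<open>e02 c\<close> are the coefficients of E_01 and E_02
  applied to the combination with coefficients \<open>c\<close>, read off from \<open>E01_B\<close>
  and \<open>E02_B\<close> by index shifts. The part that raises the index of E_21 has no source at
  j = 0.\<close>

definition e01 :: "(nat \<Rightarrow> nat \<Rightarrow> nat \<Rightarrow> complex) \<Rightarrow> nat \<Rightarrow> nat \<Rightarrow> nat \<Rightarrow> complex" where
  "e01 c k a j = c k (Suc a) j * (of_nat (Suc a) * (m 0 - m 1 + of_nat j - of_nat (Suc a) + 1 - of_nat k))
     - (if j = 0 then 0 else c (Suc k) a (j - 1) * of_nat (Suc k))"

definition e02 :: "(nat \<Rightarrow> nat \<Rightarrow> nat \<Rightarrow> complex) \<Rightarrow> nat \<Rightarrow> nat \<Rightarrow> nat \<Rightarrow> complex" where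
  "e02 c k a j = c (Suc k) a j * (of_nat (Suc k) * (m 0 - m 2 - of_nat j - of_nat a - of_nat (Suc k) + 1))
     - c k (Suc a) (Suc j) * (of_nat (Suc a) * of_nat (Suc j) * (m 1 - m 2 - of_nat (Suc j) + 1))"

lemma R_U: assumes "X \<in> sl 2"
  shows "R X (U N c) = (\<Sum>k\<le>N. \<Sum>a\<le>N. \<Sum>j\<le>N. sc (c k a j) (R X (B k a j)))"
  unfolding U_def by (simp add: R_sum V_sum R_sc assms)

lemma U_e01: assumes "supp N c" shows "E 0 1 (U N c) = U N (e01 c)"
proof -
  have z: "c k a j = 0" if "N \<le> k + a + j" for k a j using assms that by (simp add: supp_def)
  define f where "f k a j = sc (c k a j * (of_nat a * (m 0 - m 1 + of_nat j - of_nat a + 1 - of_nat k))) (B k (a - 1) j)" for k a j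
  define g where "g k a j = sc (c k a j * of_nat k) (B (k - 1) a (Suc j))" for k a j
  have "E 0 1 (U N c) = (\<Sum>k\<le>N. \<Sum>a\<le>N. \<Sum>j\<le>N. f k a j - g k a j)"
    by (subst R_U) (simp_all add: E01_B [simplified] f_def g_def scale_right_diff_distrib)
  also have "\<dots> = (\<Sum>k\<le>N. \<Sum>a\<le>N. \<Sum>j\<le>N. f k a j) - (\<Sum>k\<le>N. \<Sum>a\<le>N. \<Sum>j\<le>N. g k a j)"
    by (simp add: sum_subtractf)
  also have "(\<Sum>k\<le>N. \<Sum>a\<le>N. \<Sum>j\<le>N. f k a j) = (\<Sum>k\<le>N. \<Sum>a\<le>N. \<Sum>j\<le>N. f k (Suc a) j)"
    by (intro sum.cong [OF refl] sum_shift_up) (simp_all add: f_def z)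
  also have "(\<Sum>k\<le>N. \<Sum>a\<le>N. \<Sum>j\<le>N. g k a j) = (\<Sum>k\<le>N. \<Sum>a\<le>N. \<Sum>j\<le>N. g (Suc k) a j)"
    by (intro sum_shift_up) (simp_all add: g_def z)
  also have "\<dots> = (\<Sum>k\<le>N. \<Sum>a\<le>N. \<Sum>j\<le>N. if j = 0 then 0 else g (Suc k) a (j - 1))"
    by (intro sum.cong [OF refl] sum_shift_down) (simp add: g_def z)
  also have "(\<Sum>k\<le>N. \<Sum>a\<le>N. \<Sum>j\<le>N. f k (Suc a) j) - \<dots>
    = (\<Sum>k\<le>N. \<Sum>a\<le>N. \<Sum>j\<le>N. f k (Suc a) j - (if j = 0 then 0 else g (Suc k) a (j - 1)))"
    by (simp add: sum_subtractf)
  also have "\<dots> = U N (e01 c)"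
    unfolding U_def
    by (intro sum.cong [OF refl]) (simp add: e01_def f_def g_def scale_left_diff_distrib del: of_nat_Suc)
  finally show ?thesis .
qed

lemma U_e02: assumes "supp N c" shows "E 0 2 (U N c) = U N (e02 c)"
proof -
  have z: "c k a j = 0" if "N \<le> k + a + j" for k a j using assms that by (simp add: supp_def)
  define f where "f k a j = sc (c k a j * (of_nat k * (m 0 - m 2 - of_nat j - of_nat a - of_nat k + 1))) (B (k - 1) a j)" for k a j
  define g where "g k a j = sc (c k a j * (of_nat a * of_nat j * (m 1 - m 2 - of_nat j + 1))) (B k (a - 1) (j - 1))" for k a j
  have "E 0 2 (U N c) = (\<Sum>k\<le>N. \<Sum>a\<le>N. \<Sum>j\<le>N. f k a j - g k a j)"
    by (subst R_U) (simp_all add: E02_B [simplified] f_def g_def scale_right_diff_distrib)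
  also have "\<dots> = (\<Sum>k\<le>N. \<Sum>a\<le>N. \<Sum>j\<le>N. f k a j) - (\<Sum>k\<le>N. \<Sum>a\<le>N. \<Sum>j\<le>N. g k a j)"
    by (simp add: sum_subtractf)
  also have "(\<Sum>k\<le>N. \<Sum>a\<le>N. \<Sum>j\<le>N. f k a j) = (\<Sum>k\<le>N. \<Sum>a\<le>N. \<Sum>j\<le>N. f (Suc k) a j)"
    by (intro sum_shift_up) (simp_all add: f_def z)
  also have "(\<Sum>k\<le>N. \<Sum>a\<le>N. \<Sum>j\<le>N. g k a j) = (\<Sum>k\<le>N. \<Sum>a\<le>N. \<Sum>j\<le>N. g k (Suc a) j)"
    by (intro sum.cong [OF refl] sum_shift_up) (simp_all add: g_def z)
  also have "\<dots> = (\<Sum>k\<le>N. \<Sum>a\<le>N. \<Sum>j\<le>N. g k (Suc a) (Suc j))"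
    by (intro sum.cong [OF refl] sum_shift_up) (simp_all add: g_def z)
  also have "(\<Sum>k\<le>N. \<Sum>a\<le>N. \<Sum>j\<le>N. f (Suc k) a j) - \<dots>
    = (\<Sum>k\<le>N. \<Sum>a\<le>N. \<Sum>j\<le>N. f (Suc k) a j - g k (Suc a) (Suc j))"
    by (simp add: sum_subtractf)
  also have "\<dots> = U N (e02 c)"
    unfolding U_def
    by (intro sum.cong [OF refl]) (simp add: e02_def f_def g_def scale_left_diff_distrib del: of_nat_Suc)
  finally show ?thesis .
qed

text \<open>E_01 and E_02 lower k + a by one, so by induction the images of a vanishing combination
  have zero coefficients. This gives two linear recursions, and non-integrality makes their
  determinants nonzero. At k + a = 0 only powers of E_21 remain, and sl_2 theory separates
  them.\<close>

lemma U_eq_0: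
  assumes nz: "m 0 - m 1 \<notin> \<int>" "m 0 - m 2 \<notin> \<int>" "m 1 - m 2 \<notin> \<int>"
  shows "supp N c \<Longrightarrow> (\<And>k a j. D < k + a \<Longrightarrow> c k a j = 0) \<Longrightarrow> U N c = 0 \<Longrightarrow> c k a j = 0"
proof (induction D arbitrary: c k a j)
  case 0
  show ?case
  proof (cases "k = 0 \<and> a = 0 \<and> j \<le> N")
    case False
    thus ?thesis using 0(1,2) by (auto simp: supp_def)
  next
    case True
    have b: "(\<Sum>j\<le>N. sc (c k a j) (B k a j)) = (if k = 0 then if a = 0 then \<Sum>j\<le>N. sc (c 0 0 j) (y j) else 0 else 0)" for k a
      using 0(2) by (auto simp: B_def)
    have "U N c = (\<Sum>k\<le>N. if k = 0 then (\<Sum>a\<le>N. if a = 0 then (\<Sum>j\<le>N. sc (c 0 0 j) (y j)) else 0) else 0)"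
      unfolding U_def b by (intro sum.cong [OF refl]) simp
    hence s: "(\<Sum>i\<le>N. sc (c 0 0 i) (y i)) = 0" using 0(3) by simp
    let ?f = "\<lambda>x. comp ((E 1 2 ^^ j) x)"
    have l: "lin_S ?f" by (intro lin_S_pw lin_S_comp) simp
    have "0 = ?f (\<Sum>i\<le>N. sc (c 0 0 i) (y i))" unfolding s using lin_S_0 [OF l] by simp
    also have "\<dots> = (\<Sum>i\<le>N. c 0 0 i * ?f (y i))"
      by (subst lin_S_sum [OF l], intro S_sc y_S, intro sum.cong [OF refl] lin_S_sc [OF l y_S])
    also have "\<dots> = (\<Sum>i\<le>N. if i = j then c 0 0 j * K (m 1 - m 2) j else 0)"
      unfolding y_def by (intro sum.cong [OF refl]) (simp add: comp_pw_pw [of 1 2, simplified])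
    also have "\<dots> = c 0 0 j * K (m 1 - m 2) j" using True by simp
    finally show ?thesis using True K_nz [OF nz(3)] by simp
  qed
next
  case (Suc D)
  have z: "c k a j = 0" if "N \<le> k + a + j" for k a j using Suc.prems(1) that by (simp add: supp_def)
  have U1: "U N (e01 c) = 0" "U N (e02 c) = 0"
    using Suc.prems by (simp_all add: U_e01 [symmetric] U_e02 [symmetric])
  have 1: "e01 c k a j = 0" for k a j
    by (rule Suc.IH [OF _ _ U1(1)]) (auto simp: supp_def e01_def Suc.prems(2) z)
  have 2: "e02 c k a j = 0" for k a j
    by (rule Suc.IH [OF _ _ U1(2)]) (auto simp: supp_def e02_def Suc.prems(2) z)
  have a1: "c k (Suc a) (Suc j) = 0" for k a j
  proof -
    define P where "P = m 0 - m 1 - of_nat a - of_nat k"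
    have "c k (Suc a) (Suc j) * (of_nat (Suc a) * (P + of_nat j + 1)) = c (Suc k) a j * of_nat (Suc k)"
      using 1 [of k a "Suc j"] by (simp add: e01_def P_def algebra_simps)
    moreover have "c (Suc k) a j * of_nat (Suc k) * (P + (m 1 - m 2) - of_nat j)
        = c k (Suc a) (Suc j) * (of_nat (Suc a) * of_nat (Suc j) * (m 1 - m 2 - of_nat j))"
      using 2 [of k a j] by (simp add: e02_def P_def algebra_simps)
    ultimately have h: "c k (Suc a) (Suc j) * of_nat (Suc a) * ((P + of_nat j + 1) * (P + (m 1 - m 2) - of_nat j)
        - of_nat (Suc j) * (m 1 - m 2 - of_nat j)) = 0"
      by (rule eliminate_linear)
    \<comment> \<open>The determinant left after eliminating \<open>c (Suc k) a j\<close> factors.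
      Its factors P and P + (m 1 - m 2) + 1 could vanish only if m 0 - m 1 or m 0 - m 2 were an
      integer.\<close>
    have e: "(P + of_nat j + 1) * (P + (m 1 - m 2) - of_nat j) - of_nat (Suc j) * (m 1 - m 2 - of_nat j)
        = P * (P + (m 1 - m 2) + 1)" by (simp add: algebra_simps)
    moreover have "P \<noteq> 0"
    proof
      assume "P = 0"
      hence "m 0 - m 1 = of_nat (a + k)" by (simp add: P_def algebra_simps)
      thus False using nz(1) by (metis Ints_of_nat)
    qed
    moreover have "P + (m 1 - m 2) + 1 \<noteq> 0"
    proof
      assume "P + (m 1 - m 2) + 1 = 0"
      hence "m 0 - m 2 = of_int (int (a + k) - 1)" by (simp add: P_def algebra_simps)
      thus False using nz(2) by (metis Ints_of_int)
    qed
    ultimately show ?thesis using h unfolding e by (simp del: of_nat_Suc)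
  qed
  have a2: "c k (Suc a) 0 = 0" for k a
  proof -
    have "c k (Suc a) 0 * (of_nat (Suc a) * (m 0 - m 1 - of_nat a - of_nat k)) = 0"
      using 1 [of k a 0] by (simp add: e01_def algebra_simps)
    moreover have "m 0 - m 1 - of_nat a - of_nat k \<noteq> 0"
    proof
      assume "m 0 - m 1 - of_nat a - of_nat k = 0"
      hence "m 0 - m 1 = of_nat (a + k)" by (simp add: algebra_simps)
      thus False using nz(1) by (metis Ints_of_nat)
    qed
    ultimately show ?thesis by (simp del: of_nat_Suc)
  qed
  have a3: "c k (Suc a) j = 0" for k a j using a1 a2 by (cases j) auto
  have a4: "c (Suc k) a j = 0" for k a j
    using 1 [of k a "Suc j"] a3 by (simp add: e01_def del: of_nat_Suc)
  have "c k a j = 0" if "D < k + a" for k a j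
  proof (cases a)
    case 0
    thus ?thesis using that a4 by (cases k) auto
  qed (use a3 in simp)
  from Suc.IH [OF Suc.prems(1) this Suc.prems(3)] show ?case .
qed

section \<open>Leading terms for the regular nilpotent point\<close>

definition Dp :: "nat \<Rightarrow> 'v set" where
  "Dp d = span {B k a j | k a j. k + a + j \<le> d \<and> (k = 0 \<longrightarrow> a + j < d)}"

lemma Dp_sub: "subspace (Dp d)" unfolding Dp_def by (rule subspace_span)

lemma B_Dp: "k + a + j \<le> d \<Longrightarrow> (k = 0 \<longrightarrow> a + j < d) \<Longrightarrow> B k a j \<in> Dp d"
  unfolding Dp_def by (rule span_base) blast

lemma Dp_add: "x \<in> Dp d \<Longrightarrow> z \<in> Dp d \<Longrightarrow> x + z \<in> Dp d" and Dp_sc: "x \<in> Dp d \<Longrightarrow> sc c x \<in> Dp d"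
  and Dp_diff: "x \<in> Dp d \<Longrightarrow> z \<in> Dp d \<Longrightarrow> x - z \<in> Dp d" and Dp_0: "0 \<in> Dp d"
  and Dp_sum: "(\<And>i. i \<in> A \<Longrightarrow> f i \<in> Dp d) \<Longrightarrow> sum f A \<in> Dp d"
  using Dp_sub by (auto simp: subspace_0 subspace_add subspace_diff subspace_scale subspace_sum)

lemma Dp_mono: "d \<le> d' \<Longrightarrow> Dp d \<subseteq> Dp d'"
  unfolding Dp_def by (rule span_mono) fastforce

text \<open>Modulo \<open>Dp\<close>, which holds all shorter monomials and those of full length
  containing E_20, only the entries \<open>X 1 0\<close> and \<open>X 2 1\<close> act. Reordering
  E_21 and E_10 produces E_20 and therefore costs nothing.\<close>

lemma R_B:
  assumes "X \<in> sl 2"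
  shows "R X (B k a j) - (sc (X 1 0) (B k (Suc a) j) + sc (X 2 1) (B k a (Suc j))) \<in> Dp (Suc (k + a + j))"
proof -
  define r where "r = k + a + j"
  define f where "f p = (if p = (1, 0) then B k (Suc a) j else if p = (2, 1) then B k a (Suc j) else 0)" for p :: "nat \<times> nat"
  have low: "B k' a' j' \<in> Dp (Suc r)" if "k' + a' + j' \<le> r" for k' a' j'
    using that by (intro B_Dp) auto
  have p: "R (etl 2 (fst p) (snd p)) (B k a j) - f p \<in> Dp (Suc r)" if pin: "p \<in> {..2} \<times> {..2}" for p
  proof -
    obtain x z where xz: "p = (x, z)" "x \<le> 2" "z \<le> 2" using pin by (cases p) auto
    have dg: "R (etl 2 x x) (B k a j) \<in> Dp (Suc r)" if "x \<le> 2" for x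
      using H_B [OF etl_diag_cartan [of x]] that low [of k a j] by (simp add: Dp_sc r_def)
    have k1: "sc (of_nat k) (B (k - 1) a (Suc j)) \<in> Dp (Suc r)" "sc (of_nat k) (B (k - 1) (Suc a) j) \<in> Dp (Suc r)"
    proof (atomize (full), cases "k = 0")
      case False
      thus "sc (of_nat k) (B (k - 1) a (Suc j)) \<in> Dp (Suc r) \<and> sc (of_nat k) (B (k - 1) (Suc a) j) \<in> Dp (Suc r)"
        by (intro conjI Dp_sc low) (simp_all add: r_def)
    qed (simp add: Dp_0)
    have up1: "E 0 1 (B k a j) \<in> Dp (Suc r)"
      unfolding E01_B by (intro Dp_diff k1 Dp_sc low) (simp add: r_def)
    have up2: "E 0 2 (B k a j) \<in> Dp (Suc r)"
      unfolding E02_B by (intro Dp_diff Dp_sc low) (simp_all add: r_def)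
    have up3: "E 1 2 (B k a j) \<in> Dp (Suc r)"
      unfolding E12_B by (intro Dp_add k1 Dp_sc low) (simp add: r_def)
    have lo: "E 2 0 (B k a j) \<in> Dp (Suc r)" unfolding E20_B by (rule B_Dp) (auto simp: r_def)
    have lo2: "E 2 1 (B k a j) - B k a (Suc j) \<in> Dp (Suc r)"
      unfolding E21_B add_diff_cancel_left' by (intro Dp_sc B_Dp) (simp_all add: r_def)
    have "x = 0 \<or> x = 1 \<or> x = 2" "z = 0 \<or> z = 1 \<or> z = 2" using xz by auto
    thus ?thesis
      using dg [of 0] dg [of 1] dg [of 2] up1 up2 up3 lo lo2 E10_B [of k a j] unfolding xz(1) f_def
      by (elim disjE) (simp_all add: etl_neq Dp_0)
  qed
  have main: "(\<Sum>p\<in>{..2} \<times> {..2}. sc (X (fst p) (snd p)) (f p)) = sc (X 1 0) (B k (Suc a) j) + sc (X 2 1) (B k a (Suc j))"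
  proof -
    have "(\<Sum>p\<in>{..2} \<times> {..2}. sc (X (fst p) (snd p)) (f p))
      = (\<Sum>p\<in>{..2::nat} \<times> {..2::nat}. (if p = (1, 0) then sc (X 1 0) (B k (Suc a) j) else 0) + (if p = (2, 1) then sc (X 2 1) (B k a (Suc j)) else 0))"
      by (rule sum.cong) (auto simp: f_def)
    thus ?thesis by (simp add: sum.distrib)
  qed
  have "R X (B k a j) - (sc (X 1 0) (B k (Suc a) j) + sc (X 2 1) (B k a (Suc j)))
    = (\<Sum>p\<in>{..2} \<times> {..2}. sc (X (fst p) (snd p)) (R (etl 2 (fst p) (snd p)) (B k a j) - f p))"
    unfolding main [symmetric] R_expand [OF assms B_V] by (simp add: sum_subtractf scale_right_diff_distrib)
  also have "\<dots> \<in> Dp (Suc r)" by (intro Dp_sum Dp_sc p)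
  finally show ?thesis unfolding r_def .
qed

lemma R_Dp: assumes "X \<in> sl 2" "x \<in> Dp d" shows "R X x \<in> Dp (Suc d)"
proof -
  have "Dp d \<subseteq> {x \<in> V. R X x \<in> Dp (Suc d)}"
    unfolding Dp_def [of d]
  proof (rule span_minimal, rule subsetI)
    fix x assume "x \<in> {B k a j |k a j. k + a + j \<le> d \<and> (k = 0 \<longrightarrow> a + j < d)}"
    then obtain k a j where x: "x = B k a j" and d: "k + a + j \<le> d" "k = 0 \<longrightarrow> a + j < d" by blast
    have "sc (X 1 0) (B k (Suc a) j) + sc (X 2 1) (B k a (Suc j)) \<in> Dp (Suc d)"
      by (intro Dp_add Dp_sc B_Dp) (use d in auto)
    moreover have "R X (B k a j) - (sc (X 1 0) (B k (Suc a) j) + sc (X 2 1) (B k a (Suc j))) \<in> Dp (Suc d)"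
      using R_B [OF assms(1)] Dp_mono [of "Suc (k + a + j)" "Suc d"] d by auto
    ultimately have "R X (B k a j) \<in> Dp (Suc d)" using Dp_add by fastforce
    thus "x \<in> {x \<in> V. R X x \<in> Dp (Suc d)}" unfolding x by simp
  qed (use sub_R_in [OF assms(1) Dp_sub] in auto)
  thus ?thesis using assms(2) by blast
qed

lemma pval_B: "pval (1, 0) (2, 1) r c v = (\<Sum>a\<le>r. sc (coeff c a) (B 0 a (r - a)))"
  by (simp add: pval_def B_def y_def)

lemma leading_word: "set w \<subseteq> sl 2 \<Longrightarrow> foldr R w v - pval (1, 0) (2, 1) (length w) (cpoly (1, 0) (2, 1) w) v \<in> Dp (length w)"
proof (induction w)
  case (Cons X w)
  let ?r = "length w" and ?c = "cpoly (1, 0) (2, 1) w"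
  let ?p = "pval (1, 0) (2, 1) ?r ?c v" and ?u = "foldr R w v"
  have X: "X \<in> sl 2" using Cons.prems by simp
  have pV: "?p \<in> V" unfolding pval_B by (intro V_sum V_sc B_V)
  have uV: "?u \<in> V" using Cons.prems by simp
  have 1: "R X ?u - R X ?p \<in> Dp (Suc ?r)"
    using R_Dp [OF X, of "?u - ?p" ?r] Cons X uV pV by (simp add: R_diff)
  have cc: "cpoly (1, 0) (2, 1) (X # w) = [:X 2 1, X 1 0:] * ?c" by (simp add: cpoly_def)
  have P: "pval (1, 0) (2, 1) (Suc ?r) ([:X 2 1, X 1 0:] * ?c) v
    = sc (X 1 0) (\<Sum>a\<le>?r. sc (coeff ?c a) (B 0 (Suc a) (?r - a))) + sc (X 2 1) (\<Sum>a\<le>?r. sc (coeff ?c a) (B 0 a (Suc ?r - a)))"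
    by (subst pval_Suc [OF degree_cpoly]) (simp add: B_def y_def)
  have "R X ?p - pval (1, 0) (2, 1) (Suc ?r) ([:X 2 1, X 1 0:] * ?c) v
    = (\<Sum>a\<le>?r. sc (coeff ?c a) (R X (B 0 a (?r - a)) - (sc (X 1 0) (B 0 (Suc a) (?r - a)) + sc (X 2 1) (B 0 a (Suc (?r - a))))))"
  proof -
    have "R X ?p = (\<Sum>a\<le>?r. sc (coeff ?c a) (R X (B 0 a (?r - a))))"
      unfolding pval_B using X by (simp add: R_sum R_sc)
    moreover have "(\<Sum>a\<le>?r. sc (coeff ?c a) (B 0 a (Suc ?r - a))) = (\<Sum>a\<le>?r. sc (coeff ?c a) (B 0 a (Suc (?r - a))))"
      by (rule sum.cong) (simp_all add: Suc_diff_le)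
    ultimately show ?thesis unfolding P
      by (simp add: sum_subtractf sum.distrib scale_right_diff_distrib scale_right_distrib scale_sum_right mult.commute)
  qed
  also have "\<dots> \<in> Dp (Suc ?r)"
  proof (intro Dp_sum Dp_sc)
    fix a assume "a \<in> {..?r}"
    thus "R X (B 0 a (?r - a)) - (sc (X 1 0) (B 0 (Suc a) (?r - a)) + sc (X 2 1) (B 0 a (Suc (?r - a)))) \<in> Dp (Suc ?r)"
      using R_B [OF X, of 0 a "?r - a"] by simp
  qed
  finally have "R X ?p - pval (1, 0) (2, 1) (Suc ?r) ([:X 2 1, X 1 0:] * ?c) v \<in> Dp (Suc ?r)" .
  from Dp_add [OF 1 this] show ?case unfolding cc by (simp del: mult_pCons_left)
qed (simp add: pval_def cpoly_def Dp_0)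

lemma leading_texpr:
  "texpr_in 2 e \<Longrightarrow> \<forall>t\<in>set e. length (snd t) \<le> d \<Longrightarrow> ta e v - pval (1, 0) (2, 1) d (cpol (1, 0) (2, 1) d e) v \<in> Dp d"
proof (induction e)
  case (Cons t e)
  have w: "set (snd t) \<subseteq> sl 2" using Cons.prems by (simp add: texpr_in_Cons)
  note lw = leading_word [OF w]
  let ?q = "pval (1, 0) (2, 1) d (if length (snd t) = d then smult (fst t) (cpoly (1, 0) (2, 1) (snd t)) else 0) v"
  have "sc (fst t) (foldr R (snd t) v) - ?q \<in> Dp d"
  proof (cases "length (snd t) = d")
    case True
    have "?q = sc (fst t) (pval (1, 0) (2, 1) d (cpoly (1, 0) (2, 1) (snd t)) v)"
      using True by (simp add: pval_def scale_sum_right)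
    thus ?thesis using Dp_sc [OF lw, of "fst t"] True by (simp add: scale_right_diff_distrib)
  next
    case False
    hence l: "length (snd t) < d" using Cons.prems by simp
    have "pval (1, 0) (2, 1) (length (snd t)) (cpoly (1, 0) (2, 1) (snd t)) v \<in> Dp d"
      unfolding pval_B using l by (intro Dp_sum Dp_sc B_Dp) auto
    moreover have "foldr R (snd t) v - pval (1, 0) (2, 1) (length (snd t)) (cpoly (1, 0) (2, 1) (snd t)) v \<in> Dp d"
      using lw Dp_mono [of "length (snd t)" d] l by auto
    ultimately have "foldr R (snd t) v \<in> Dp d" using Dp_add by fastforce
    thus ?thesis using False by (simp add: pval_def Dp_sc)
  qed
  moreover have "ta e v - pval (1, 0) (2, 1) d (cpol (1, 0) (2, 1) d e) v \<in> Dp d"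
    using Cons by (simp add: texpr_in_Cons)
  moreover have "pval (1, 0) (2, 1) d (cpol (1, 0) (2, 1) d (t # e)) v = ?q + pval (1, 0) (2, 1) d (cpol (1, 0) (2, 1) d e) v"
    by (simp add: cpol_def pval_def scale_left_distrib sum.distrib)
  ultimately have "(sc (fst t) (foldr R (snd t) v) - ?q) + (ta e v - pval (1, 0) (2, 1) d (cpol (1, 0) (2, 1) d e) v) \<in> Dp d"
    by (intro Dp_add)
  thus ?case unfolding \<open>pval (1, 0) (2, 1) d (cpol (1, 0) (2, 1) d (t # e)) v = _\<close> ta_Cons
    by (simp add: algebra_simps)
qed (simp add: pval_def cpol_def Dp_0)

lemma U_delta: assumes "k \<le> N" "a \<le> N" "j \<le> N"
  shows "U N (\<lambda>k' a' j'. if k' = k \<and> a' = a \<and> j' = j then 1 else 0) = B k a j"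
proof -
  have b: "(\<Sum>j'\<le>N. sc (if k' = k \<and> a' = a \<and> j' = j then 1 else 0) (B k' a' j'))
    = (if a' = a then if k' = k then B k a j else 0 else 0)" for k' a'
  proof -
    have "(\<Sum>j'\<le>N. sc (if k' = k \<and> a' = a \<and> j' = j then 1 else 0) (B k' a' j'))
      = (\<Sum>j'\<le>N. if j' = j then if k' = k \<and> a' = a then B k a j else 0 else 0)"
      by (rule sum.cong) auto
    thus ?thesis using assms by simp
  qed
  show ?thesis unfolding U_def b using assms by simp
qed

lemma U_add: "U N (\<lambda>k a j. c k a j + c' k a j) = U N c + U N c'"
  and U_sc: "U N (\<lambda>k a j. x * c k a j) = sc x (U N c)"
  by (simp_all add: U_def scale_left_distrib sum.distrib scale_sum_right)

lemma Dp_rep: assumes "x \<in> Dp d"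
  shows "\<exists>c. supp (Suc d) c \<and> (\<forall>a j. a + j = d \<longrightarrow> c 0 a j = 0) \<and> x = U (Suc d) c"
proof -
  have "Dp d \<subseteq> {x. \<exists>c. supp (Suc d) c \<and> (\<forall>a j. a + j = d \<longrightarrow> c 0 a j = 0) \<and> x = U (Suc d) c}" (is "_ \<subseteq> ?W")
    unfolding Dp_def
  proof (rule span_minimal, rule subsetI)
    fix x assume "x \<in> {B k a j |k a j. k + a + j \<le> d \<and> (k = 0 \<longrightarrow> a + j < d)}"
    then obtain k a j where x: "x = B k a j" and d: "k + a + j \<le> d" "k = 0 \<longrightarrow> a + j < d" by blast
    thus "x \<in> ?W" unfolding x
      by (intro CollectI exI [of _ "\<lambda>k' a' j'. if k' = k \<and> a' = a \<and> j' = j then 1 else 0"])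
        (auto simp: supp_def U_delta)
  next
    show "subspace ?W"
      unfolding subspace_def
    proof (intro conjI ballI allI)
      show "0 \<in> ?W" by (rule CollectI, rule exI [of _ "\<lambda>k a j. 0"]) (simp add: supp_def U_def)
      fix x assume "x \<in> ?W"
      then obtain c where c: "supp (Suc d) c" "\<forall>a j. a + j = d \<longrightarrow> c 0 a j = 0" "x = U (Suc d) c" by blast
      show "sc s x \<in> ?W" for s
        by (rule CollectI, rule exI [of _ "\<lambda>k a j. s * c k a j"]) (use c in \<open>simp add: U_sc supp_def\<close>)
      fix z assume "z \<in> ?W"
      then obtain c' where c': "supp (Suc d) c'" "\<forall>a j. a + j = d \<longrightarrow> c' 0 a j = 0" "z = U (Suc d) c'" by blast
      show "x + z \<in> ?W"
        by (rule CollectI, rule exI [of _ "\<lambda>k a j. c k a j + c' k a j"]) (use c c' in \<open>simp add: U_add supp_def\<close>)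
    qed
  qed
  thus ?thesis using assms by blast
qed

text \<open>If \<open>e\<close> kills \<open>v\<close>, its leading part lies in
  \<open>Dp d\<close>. The leading part uses monomials of length \<open>d\<close> without E_20, and
  elements of \<open>Dp d\<close> have coefficient zero there; independence then makes each leading
  coefficient vanish.\<close>

lemma regular_point:
  assumes nz: "m 0 - m 1 \<notin> \<int>" "m 0 - m 2 \<notin> \<int>" "m 1 - m 2 \<notin> \<int>"
    and e: "texpr_in 2 e" "\<forall>t\<in>set e. length (snd t) \<le> d" "ta e v = 0"
  shows "symb d e (\<lambda>X. X 1 0 + X 2 1) = 0"
proof (rule symb_pair_zero)
  fix a b assume ab: "a + b = d"
  let ?c = "cpol (1, 0) (2, 1) d e"
  obtain c where c: "supp (Suc d) c" "\<And>a j. a + j = d \<Longrightarrow> c 0 a j = 0" "- pval (1, 0) (2, 1) d ?c v = U (Suc d) c"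
    using Dp_rep [OF leading_texpr [OF e(1,2)]] e(3) by auto
  define c' where "c' k a j = (if k = 0 \<and> a + j = d then coeff ?c a else 0)" for k a j :: nat
  have t: "sc (c' k a j) (B k a j) = (if k = 0 then if a + j = d then sc (coeff ?c a) (B 0 a (d - a)) else 0 else 0)" for k a j
    by (auto simp: c'_def)
  have "U (Suc d) c' = (\<Sum>k\<le>Suc d. if k = 0 then (\<Sum>a\<le>Suc d. \<Sum>j\<le>Suc d. if a + j = d then sc (coeff ?c a) (B 0 a (d - a)) else 0) else 0)"
    unfolding U_def t by (intro sum.cong [OF refl]) simp
  also have "\<dots> = (\<Sum>a\<le>Suc d. \<Sum>j\<le>Suc d. if a + j = d then sc (coeff ?c a) (B 0 a (d - a)) else 0)" by simp
  also have "\<dots> = (\<Sum>a\<le>Suc d. if a \<le> d then sc (coeff ?c a) (B 0 a (d - a)) else 0)"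
  proof (rule sum.cong [OF refl])
    fix a
    have "(\<Sum>j\<le>Suc d. if a + j = d then sc (coeff ?c a) (B 0 a (d - a)) else 0)
      = (\<Sum>j\<le>Suc d. if j = d - a then (if a \<le> d then sc (coeff ?c a) (B 0 a (d - a)) else 0) else 0)"
      by (rule sum.cong) auto
    also have "\<dots> = (if a \<le> d then sc (coeff ?c a) (B 0 a (d - a)) else 0)"
      by (subst sum.delta) auto
    finally show "(\<Sum>j\<le>Suc d. if a + j = d then sc (coeff ?c a) (B 0 a (d - a)) else 0)
      = (if a \<le> d then sc (coeff ?c a) (B 0 a (d - a)) else 0)" .
  qed
  also have "\<dots> = pval (1, 0) (2, 1) d ?c v" unfolding pval_B by simp
  finally have cU: "U (Suc d) c' = pval (1, 0) (2, 1) d ?c v" .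
  have "U (Suc d) (\<lambda>k a j. c k a j + c' k a j) = U (Suc d) c + U (Suc d) c'" by (rule U_add)
  also have "\<dots> = 0" unfolding cU c(3) [symmetric] by simp
  finally have U0: "U (Suc d) (\<lambda>k a j. c k a j + c' k a j) = 0" .
  have S0: "supp (Suc d) (\<lambda>k a j. c k a j + c' k a j)" using c(1) by (auto simp: supp_def c'_def)
  have "c k a j + c' k a j = 0" if "Suc d < k + a" for k a j using S0 that by (simp add: supp_def)
  hence "c 0 a b + c' 0 a b = 0" by (rule U_eq_0 [OF nz S0 _ U0])
  thus "coeff ?c a = 0" using ab c(2) [OF ab] by (simp add: c'_def)
qed

end

section \<open>Invariance of the associated variety\<close>

text \<open>exp(-t E) Y exp(t E) for E = \<open>emat a b\<close>. The series stops at second order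
  because the double bracket of \<open>Y\<close> with E is -2 \<open>Y b a\<close> times E.\<close>

definition adt :: "nat \<Rightarrow> nat \<Rightarrow> nat \<Rightarrow> complex \<Rightarrow> mat \<Rightarrow> mat" where
  "adt n a b t Y = (\<lambda>i j. Y i j + t * bracket n Y (emat a b) i j - t\<^sup>2 * Y b a * emat a b i j)"

lemma adt_mlin: "adt n a b t Y = mlin 1 (mlin 1 Y t (bracket n Y (emat a b))) (- t\<^sup>2 * Y b a) (emat a b)"
  by (simp add: adt_def mlin_def)

lemma adt_sl: "a \<le> n \<Longrightarrow> b \<le> n \<Longrightarrow> a \<noteq> b \<Longrightarrow> Y \<in> sl n \<Longrightarrow> adt n a b t Y \<in> sl n"
  unfolding adt_mlin by simp

definition adtx :: "nat \<Rightarrow> nat \<Rightarrow> nat \<Rightarrow> complex \<Rightarrow> texpr \<Rightarrow> texpr" where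
  "adtx n a b t e = map (\<lambda>s. (fst s, map (adt n a b t) (snd s))) e"

context slrep begin

context
  fixes a b :: nat
  assumes ab: "a \<le> n" "b \<le> n" "a \<noteq> b"
begin

text \<open>The coefficients of the powers of \<open>t\<close> in the action of \<open>exp(-t E) w exp(t E)\<close>, \<open>E = emat a b\<close>.\<close>

fun dw :: "mat list \<Rightarrow> int \<Rightarrow> 'v \<Rightarrow> 'v" where
  "dw [] k u = (if k = 0 then u else 0)"
| "dw (Y # w) k u = R Y (dw w k u) + R (bracket n Y (emat a b)) (dw w (k - 1) u)
     - sc (Y b a) (R (emat a b) (dw w (k - 2) u))"

lemma dw_V: "set w \<subseteq> sl n \<Longrightarrow> u \<in> V \<Longrightarrow> dw w k u \<in> V"
  by (induction w arbitrary: k) (use ab in \<open>auto intro!: V_diff V_add V_sc\<close>)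

lemma dw_out: "set w \<subseteq> sl n \<Longrightarrow> k < 0 \<or> k > 2 * int (length w) \<Longrightarrow> dw w k u = 0"
  by (induction w arbitrary: k) (use ab in auto)

lemma dw_0: "set w \<subseteq> sl n \<Longrightarrow> dw w 0 u = foldr R w u"
  by (induction w) (use ab in \<open>auto simp: dw_out\<close>)

text \<open>Differentiating the conjugate in t gives its commutator with E; comparing coefficients
  of powers of t gives the recursion.\<close>

lemma dw_Suc:
  "set w \<subseteq> sl n \<Longrightarrow> u \<in> V \<Longrightarrow>
   sc (of_int (k + 1)) (dw w (k + 1) u) = dw w k (R (emat a b) u) - R (emat a b) (dw w k u)"
proof (induction w arbitrary: k)
  case (Cons Y w)
  let ?E = "emat a b"
  let ?Y1 = "bracket n Y ?E"
  let ?D = "\<lambda>k. dw w k u"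
  have E: "?E \<in> sl n" and Y: "Y \<in> sl n" using ab Cons.prems by auto
  have V: "?D k \<in> V" "dw w k (R ?E u) \<in> V" for k using Cons.prems E by (auto intro: dw_V)
  have ih: "dw w k (R ?E u) = sc (of_int (k + 1)) (?D (k + 1)) + R ?E (?D k)" for k
    using Cons.IH [of k] Cons.prems by (simp add: algebra_simps)
  have Y1: "R ?Y1 z = R Y (R ?E z) - R ?E (R Y z)" if "z \<in> V" for z
    using R_bracket [OF Y E that] .
  have Y2: "R ?Y1 (R ?E z) - R ?E (R ?Y1 z) = sc (- 2 * Y b a) (R ?E z)" if "z \<in> V" for z
    using R_bracket [OF _ E that, of ?Y1] R_smat [OF E that, of "- 2 * Y b a"]
    unfolding bracket_emat_twice [OF ab Y] by simp
  have 1: "R Y (dw w k (R ?E u)) - R ?E (R Y (?D k)) = sc (of_int (k + 1)) (R Y (?D (k + 1))) + R ?Y1 (?D k)" for k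
    unfolding ih using V Y E by (simp add: R_add R_sc Y1)
  have 2: "R ?Y1 (dw w (k - 1) (R ?E u)) - R ?E (R ?Y1 (?D (k - 1)))
     = sc (of_int k) (R ?Y1 (?D k)) + sc (- 2 * Y b a) (R ?E (?D (k - 1)))" for k
    unfolding ih using V E Y2 [OF V(1), of "k - 1"] by (simp add: R_add R_sc algebra_simps)
  have 3: "R ?E (dw w (k - 2) (R ?E u)) - R ?E (R ?E (?D (k - 2))) = sc (of_int (k - 1)) (R ?E (?D (k - 1)))" for k
    unfolding ih using V E by (simp add: R_add R_sc)
  have "dw (Y # w) k (R ?E u) - R ?E (dw (Y # w) k u)
    = (R Y (dw w k (R ?E u)) - R ?E (R Y (?D k))) + (R ?Y1 (dw w (k - 1) (R ?E u)) - R ?E (R ?Y1 (?D (k - 1))))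
      - sc (Y b a) (R ?E (dw w (k - 2) (R ?E u)) - R ?E (R ?E (?D (k - 2))))"
    using V E Y by (simp add: R_add R_diff R_sc scale_right_diff_distrib)
  also have "\<dots> = sc (of_int (k + 1)) (R Y (?D (k + 1))) + (sc 1 (R ?Y1 (?D k)) + sc (of_int k) (R ?Y1 (?D k)))
      + (sc (- 2 * Y b a) (R ?E (?D (k - 1))) - sc (Y b a * of_int (k - 1)) (R ?E (?D (k - 1))))"
    unfolding 1 2 3 by simp
  also have "\<dots> = sc (of_int (k + 1)) (R Y (?D (k + 1))) + sc (of_int (k + 1)) (R ?Y1 (?D k))
      - sc (of_int (k + 1) * Y b a) (R ?E (?D (k - 1)))"
    unfolding scale_left_distrib [symmetric] scale_left_diff_distrib [symmetric]
    by (simp add: algebra_simps)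
  also have "\<dots> = sc (of_int (k + 1)) (dw (Y # w) (k + 1) u)"
    by (simp add: scale_right_distrib scale_right_diff_distrib)
  finally show ?case by simp
next
  case Nil
  have "k + 1 = 0 \<Longrightarrow> k = - 1" by simp
  thus ?case using ab by (cases "k = - 1") auto
qed

lemma foldr_adt:
  assumes "u \<in> V"
  shows "set w \<subseteq> sl n \<Longrightarrow> 2 * length w \<le> N \<Longrightarrow>
    foldr R (map (adt n a b t) w) u = (\<Sum>k\<le>N. sc (t ^ k) (dw w (int k) u))"
proof (induction w arbitrary: N)
  case Nil
  have "(\<Sum>k\<le>N. sc (t ^ k) (dw [] (int k) u)) = (\<Sum>k\<le>N. if k = 0 then u else 0)"
    by (rule sum.cong) auto
  thus ?case by simp
next
  case (Cons Y w)
  let ?E = "emat a b"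
  have E: "?E \<in> sl n" and Y: "Y \<in> sl n" and w: "set w \<subseteq> sl n" using ab Cons.prems by auto
  obtain N' where N: "N = Suc (Suc N')" "2 * length w \<le> N'" using Cons.prems(2) by (cases N; cases "N - 1") auto
  let ?D = "\<lambda>k. dw w k u"
  have V: "?D k \<in> V" for k using dw_V w assms by simp
  have A: "R (adt n a b t Y) z = R Y z + sc t (R (bracket n Y ?E) z) - sc (t\<^sup>2 * Y b a) (R ?E z)" if "z \<in> V" for z
    unfolding adt_mlin using that E Y by (simp add: R_mlin)
  have o: "?D (int k) = 0" if "k > N'" for k using dw_out [OF w, of "int k" u] that N(2) by simp
  have n: "?D (- 1) = 0" "?D (- 2) = 0" using dw_out [OF w] by auto
  have s: "R X (\<Sum>k\<le>N'. sc (t ^ k) (?D (int k))) = (\<Sum>k\<le>N'. sc (t ^ k) (R X (?D (int k))))" if "X \<in> sl n" for X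
    using that V by (simp add: R_sum R_sc)
  have s0: "(\<Sum>k\<le>N'. sc (t ^ k) (R Y (?D (int k)))) = (\<Sum>k\<le>N. sc (t ^ k) (R Y (?D (int k))))"
    unfolding N(1) using o [of "Suc N'"] o [of "Suc (Suc N')"] Y by simp
  have s1: "sc t (\<Sum>k\<le>N'. sc (t ^ k) (R (bracket n Y ?E) (?D (int k)))) = (\<Sum>k\<le>N. sc (t ^ k) (R (bracket n Y ?E) (?D (int k - 1))))"
    unfolding N(1) sum.atMost_Suc_shift [of _ "Suc N'"] using o [of "Suc N'"] n
    by (simp add: scale_sum_right)
  have s2: "sc (t\<^sup>2 * Y b a) (\<Sum>k\<le>N'. sc (t ^ k) (R ?E (?D (int k)))) = (\<Sum>k\<le>N. sc (t ^ k * Y b a) (R ?E (?D (int k - 2))))"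
    unfolding N(1) sum.atMost_Suc_shift [of _ "Suc N'"] sum.atMost_Suc_shift [of _ "N'"] using n E
    by (simp add: scale_sum_right power2_eq_square mult_ac)
  have "foldr R (map (adt n a b t) (Y # w)) u = R (adt n a b t Y) (\<Sum>k\<le>N'. sc (t ^ k) (?D (int k)))"
    using Cons.IH [OF w N(2)] by simp
  also have "\<dots> = (\<Sum>k\<le>N. sc (t ^ k) (R Y (?D (int k)))) + (\<Sum>k\<le>N. sc (t ^ k) (R (bracket n Y ?E) (?D (int k - 1))))
      - (\<Sum>k\<le>N. sc (t ^ k * Y b a) (R ?E (?D (int k - 2))))"
    using E Y by (subst A) (simp_all add: V_sum V s s0 [symmetric] s1 [symmetric] s2 [symmetric])
  also have "\<dots> = (\<Sum>k\<le>N. sc (t ^ k) (dw (Y # w) (int k) u))"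
    by (simp add: scale_right_distrib scale_right_diff_distrib sum.distrib sum_subtractf)
  finally show ?case .
qed

definition dwx :: "texpr \<Rightarrow> int \<Rightarrow> 'v \<Rightarrow> 'v" where
  "dwx e k u = sum_list (map (\<lambda>s. sc (fst s) (dw (snd s) k u)) e)"

lemma dwx_Suc: "texpr_in n e \<Longrightarrow> u \<in> V \<Longrightarrow>
   sc (of_int (k + 1)) (dwx e (k + 1) u) = dwx e k (R (emat a b) u) - R (emat a b) (dwx e k u)"
proof (induction e)
  case (Cons s e)
  have E: "emat a b \<in> sl n" using ab by simp
  have s: "set (snd s) \<subseteq> sl n" using Cons.prems by (simp add: texpr_in_Cons)
  have dV: "dwx e k u \<in> V"
    using Cons.prems by (induction e) (auto simp: dwx_def texpr_in_Cons intro!: V_add V_sc dw_V)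
  have "sc (of_int (k + 1)) (dwx (s # e) (k + 1) u)
    = sc (fst s) (sc (of_int (k + 1)) (dw (snd s) (k + 1) u)) + sc (of_int (k + 1)) (dwx e (k + 1) u)"
    by (simp add: dwx_def scale_right_distrib mult.commute)
  also have "\<dots> = sc (fst s) (dw (snd s) k (R (emat a b) u) - R (emat a b) (dw (snd s) k u)) + (dwx e k (R (emat a b) u) - R (emat a b) (dwx e k u))"
    using Cons s dw_Suc [OF s, of u k] by (simp add: texpr_in_Cons)
  also have "\<dots> = dwx (s # e) k (R (emat a b) u) - R (emat a b) (dwx (s # e) k u)"
    using E s Cons.prems dV dw_V [OF s] by (simp add: dwx_def R_add R_sc scale_right_diff_distrib)
  finally show ?case .
qed (use ab in \<open>simp add: dwx_def\<close>)

text \<open>The coefficient of degree 0 is the action of \<open>e\<close> itself, and each further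
  one is a commutator with E divided by k + 1. The exponential of E itself is never applied to the
  module, where E may fail to be locally nilpotent.\<close>

lemma dwx_zero:
  assumes "texpr_in n e" "\<And>u. u \<in> V \<Longrightarrow> ta e u = 0"
  shows "u \<in> V \<Longrightarrow> dwx e (int k) u = 0"
proof (induction k arbitrary: u)
  case 0
  have "texpr_in n e \<Longrightarrow> dwx e 0 u = ta e u"
    by (induction e) (auto simp: dwx_def ta_Cons texpr_in_Cons dw_0)
  thus ?case using assms 0 by simp
next
  case (Suc k)
  have E: "emat a b \<in> sl n" using ab by simp
  have "sc (of_int (int k + 1)) (dwx e (int k + 1) u) = 0"
    using dwx_Suc [OF assms(1) Suc.prems, of "int k"] Suc E by simp
  moreover have "of_int (int k + 1) \<noteq> (0 :: complex)"
    by (metis of_int_0_eq_iff of_nat_Suc of_nat_neq_0 add.commute of_nat_0_eq_iff nat.distinct(1))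
  ultimately have "dwx e (int k + 1) u = 0" by (simp del: of_int_add)
  thus ?case by (simp add: add.commute)
qed

lemma ta_adtx:
  assumes "texpr_in n e" "\<And>u. u \<in> V \<Longrightarrow> ta e u = 0" "u \<in> V"
  shows "ta (adtx n a b t e) u = 0"
proof -
  define N where "N = sum_list (map (\<lambda>s. 2 * length (snd s)) e)"
  have "texpr_in n e' \<Longrightarrow> \<forall>s\<in>set e'. 2 * length (snd s) \<le> N \<Longrightarrow>
    ta (adtx n a b t e') u = (\<Sum>k\<le>N. sc (t ^ k) (dwx e' (int k) u))" for e'
  proof (induction e')
    case (Cons s e')
    have "ta (adtx n a b t (s # e')) u = sc (fst s) (\<Sum>k\<le>N. sc (t ^ k) (dw (snd s) (int k) u)) + ta (adtx n a b t e') u"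
      using Cons.prems foldr_adt [OF assms(3), of "snd s" N t] by (simp add: adtx_def ta_Cons texpr_in_Cons)
    also have "\<dots> = (\<Sum>k\<le>N. sc (t ^ k) (dwx (s # e') (int k) u))"
      using Cons by (simp add: texpr_in_Cons dwx_def scale_right_distrib sum.distrib scale_sum_right mult.commute)
    finally show ?case .
  qed (simp add: adtx_def dwx_def)
  moreover have "\<forall>s\<in>set e. 2 * length (snd s) \<le> N"
    unfolding N_def by (intro ballI member_le_sum_list) auto
  ultimately show ?thesis using assms dwx_zero [OF assms(1,2,3)] by simp
qed

end

end

lemma symb_adtx: "symb d (adtx n a b t e) \<xi> = symb d e (\<lambda>Y. \<xi> (adt n a b t Y))"
  by (induction e) (auto simp: symb_def adtx_def o_def)

section \<open>The minimal nilpotent orbit\<close>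

definition rk :: "nat \<Rightarrow> (nat \<Rightarrow> complex) \<Rightarrow> (nat \<Rightarrow> complex) \<Rightarrow> mat" where
  "rk n v \<alpha> = (\<lambda>i j. if i \<le> n \<and> j \<le> n then v i * \<alpha> j else 0)"

definition unitv :: "nat \<Rightarrow> nat \<Rightarrow> complex" where "unitv x = (\<lambda>i. if i = x then 1 else 0)"

lemma rk_cong: "(\<And>i. i \<le> n \<Longrightarrow> v i = v' i) \<Longrightarrow> (\<And>i. i \<le> n \<Longrightarrow> \<alpha> i = \<alpha>' i) \<Longrightarrow> rk n v \<alpha> = rk n v' \<alpha>'"
  by (auto simp: rk_def fun_eq_iff)

text \<open>Transvections and scalings act transitively on traceless matrices of rank one. The set
  \<open>Z\<close> is left open because the statement is needed both for the orbit and for the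
  points of an associated variety. A third index, present since n is at least 2, is needed to move
  matrix positions.\<close>

lemma rank_one_orbit:
  assumes n: "2 \<le> n"
    and elem: "\<And>v \<alpha> a b t. rk n v \<alpha> \<in> Z \<Longrightarrow> a \<le> n \<Longrightarrow> b \<le> n \<Longrightarrow> a \<noteq> b \<Longrightarrow>
        rk n (v(a := v a + t * v b)) (\<alpha>(b := \<alpha> b - t * \<alpha> a)) \<in> Z"
    and scale: "\<And>v \<alpha> c. rk n v \<alpha> \<in> Z \<Longrightarrow> c \<noteq> 0 \<Longrightarrow> rk n (\<lambda>i. c * v i) \<alpha> \<in> Z"
    and base: "rk n (unitv x0) (unitv y0) \<in> Z" "x0 \<noteq> y0" "x0 \<le> n" "y0 \<le> n"
    and va: "(\<Sum>i\<le>n. \<alpha> i * v i) = 0" "v x1 \<noteq> 0" "x1 \<le> n" "\<alpha> y1 \<noteq> 0" "y1 \<le> n"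
  shows "rk n v \<alpha> \<in> Z"
proof -
  define Q where "Q x y \<longleftrightarrow> x \<noteq> y \<and> x \<le> n \<and> y \<le> n \<and> rk n (unitv x) (unitv y) \<in> Z" for x y
  have main: "rk n v \<alpha> \<in> Z" if Q: "Q x y" and s: "(\<Sum>i\<le>n. \<alpha> i * v i) = 0" and nz: "v x \<noteq> 0" "\<alpha> y \<noteq> 0" for v \<alpha> x y
  proof -
    have xy: "x \<noteq> y" "x \<le> n" "y \<le> n" using Q by (auto simp: Q_def)
    define u where "u i = v i / v x" for i
    define \<beta> where "\<beta> i = \<alpha> i / \<alpha> y" for i
    have A: "rk n (\<lambda>i. if i = x then 1 else if i \<in> F then u i else 0) (unitv y) \<in> Z"
      if "finite F" "F \<subseteq> {..n} - {x, y}" for F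
      using that
    proof (induction F)
      case empty
      have "(\<lambda>i. if i = x then 1 else if i \<in> {} then u i else 0) = unitv x" by (auto simp: unitv_def)
      thus ?case using Q by (simp add: Q_def)
    next
      case (insert a F)
      let ?v = "\<lambda>i. if i = x then 1 else if i \<in> F then u i else 0"
      have IH: "rk n ?v (unitv y) \<in> Z" using insert by blast
      have "rk n (?v(a := ?v a + u a * ?v x)) ((unitv y)(x := unitv y x - u a * unitv y a)) \<in> Z"
        by (rule elem [OF IH]) (use insert xy in auto)
      also have "rk n (?v(a := ?v a + u a * ?v x)) ((unitv y)(x := unitv y x - u a * unitv y a))
        = rk n (\<lambda>i. if i = x then 1 else if i \<in> insert a F then u i else 0) (unitv y)"
        by (rule rk_cong) (use insert xy in \<open>auto simp: unitv_def\<close>)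
      finally show ?case .
    qed
    \<comment> \<open>The y-entry is chosen so that the partial covector \<open>?b F\<close>
      annihilates the vector. A transvection adding one entry of \<open>\<beta>\<close> updates it
      in just this way, and at the end vanishing of the trace identifies it with
      \<open>u y\<close>.\<close>
    let ?u = "\<lambda>F. u(y := - (\<Sum>b\<in>F. \<beta> b * u b))"
    let ?b = "\<lambda>F i. if i = y then 1 else if i \<in> F then \<beta> i else 0"
    have B: "rk n (?u F) (?b F) \<in> Z" if "finite F" "F \<subseteq> {..n} - {y}" for F
      using that
    proof (induction F)
      case empty
      have "rk n (\<lambda>i. if i = x then 1 else if i \<in> {..n} - {x, y} then u i else 0) (unitv y) \<in> Z"
        by (rule A) auto
      also have "rk n (\<lambda>i. if i = x then 1 else if i \<in> {..n} - {x, y} then u i else 0) (unitv y) = rk n (?u {}) (?b {})"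
        by (rule rk_cong) (use xy nz in \<open>auto simp: unitv_def u_def\<close>)
      finally show ?case .
    next
      case (insert b F)
      have IH: "rk n (?u F) (?b F) \<in> Z" using insert by blast
      have "rk n ((?u F)(y := ?u F y + (- \<beta> b) * ?u F b)) ((?b F)(b := ?b F b - (- \<beta> b) * ?b F y)) \<in> Z"
        by (rule elem [OF IH]) (use insert xy in auto)
      also have "rk n ((?u F)(y := ?u F y + (- \<beta> b) * ?u F b)) ((?b F)(b := ?b F b - (- \<beta> b) * ?b F y))
        = rk n (?u (insert b F)) (?b (insert b F))"
        by (rule rk_cong) (use insert in auto)
      finally show ?case .
    qed
    have "(\<Sum>i\<le>n. \<beta> i * u i) = (\<Sum>i\<le>n. \<alpha> i * v i) / (\<alpha> y * v x)"
      unfolding sum_divide_distrib by (rule sum.cong) (auto simp: \<beta>_def u_def)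
    hence "(\<Sum>i\<le>n. \<beta> i * u i) = 0" using s by simp
    moreover have "(\<Sum>i\<le>n. \<beta> i * u i) = \<beta> y * u y + (\<Sum>i\<in>{..n} - {y}. \<beta> i * u i)"
      using xy by (intro sum.remove) auto
    ultimately have uy: "u y = - (\<Sum>i\<in>{..n} - {y}. \<beta> i * u i)" using nz by (simp add: \<beta>_def eq_neg_iff_add_eq_0)
    have "rk n (?u ({..n} - {y})) (?b ({..n} - {y})) \<in> Z" by (rule B) auto
    also have "rk n (?u ({..n} - {y})) (?b ({..n} - {y})) = rk n u \<beta>"
      by (rule rk_cong) (use uy nz in \<open>auto simp: \<beta>_def\<close>)
    finally have "rk n (\<lambda>i. (v x * \<alpha> y) * u i) \<beta> \<in> Z" by (rule scale) (use nz in simp)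
    also have "rk n (\<lambda>i. (v x * \<alpha> y) * u i) \<beta> = rk n v \<alpha>"
      using nz by (auto simp: rk_def u_def \<beta>_def fun_eq_iff)
    finally show ?thesis .
  qed
  have sc2: "(\<Sum>i\<le>n. f i * unitv z i) = f z" "(\<Sum>i\<le>n. unitv z i * f i) = f z" if "z \<le> n" for f z
    using that by (simp_all add: unitv_def if_distrib [of "\<lambda>x. _ * x"] if_distrib [of "\<lambda>x. x * _"] cong: if_cong)
  \<comment> \<open>The vector e_x + e_z, reachable by \<open>main\<close>, is reduced to e_z by a
    further transvection; this moves the row index while the column index stays.\<close>
  have Q1: "Q z y" if Q: "Q x y" and z: "z \<le> n" "z \<noteq> x" "z \<noteq> y" for x y z
  proof -
    have xy: "x \<noteq> y" "x \<le> n" "y \<le> n" using Q by (auto simp: Q_def)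
    let ?v = "\<lambda>i. unitv x i + unitv z i"
    have "rk n ?v (unitv y) \<in> Z"
      using xy z by (intro main [OF Q]) (auto simp: sc2, auto simp: unitv_def)
    from elem [OF this xy(2) z(1), of "- 1"]
    have "rk n (?v(x := ?v x + - 1 * ?v z)) ((unitv y)(z := unitv y z - - 1 * unitv y x)) \<in> Z" using z by simp
    also have "rk n (?v(x := ?v x + - 1 * ?v z)) ((unitv y)(z := unitv y z - - 1 * unitv y x)) = rk n (unitv z) (unitv y)"
      by (rule rk_cong) (use xy z in \<open>auto simp: unitv_def\<close>)
    finally show ?thesis using xy z by (simp add: Q_def)
  qed
  have Q2: "Q x z" if Q: "Q x y" and z: "z \<le> n" "z \<noteq> x" "z \<noteq> y" for x y z
  proof -
    have xy: "x \<noteq> y" "x \<le> n" "y \<le> n" using Q by (auto simp: Q_def)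
    let ?a = "\<lambda>i. unitv y i + unitv z i"
    have "rk n (unitv x) ?a \<in> Z"
      using xy z by (intro main [OF Q]) (auto simp: sc2, auto simp: unitv_def)
    from elem [OF this z(1) xy(3), of "1"]
    have "rk n ((unitv x)(z := unitv x z + 1 * unitv x y)) (?a(y := ?a y - 1 * ?a z)) \<in> Z" using z by simp
    also have "rk n ((unitv x)(z := unitv x z + 1 * unitv x y)) (?a(y := ?a y - 1 * ?a z)) = rk n (unitv x) (unitv z)"
      by (rule rk_cong) (use xy z in \<open>auto simp: unitv_def\<close>)
    finally show ?thesis using xy z by (simp add: Q_def)
  qed
  have Q0: "Q x0 y0" using base by (simp add: Q_def)
  have Qall: "Q x y" if "x \<noteq> y" "x \<le> n" "y \<le> n" for x y
  proof -
    have step: "Q x y" if q: "Q x' y'" "x \<noteq> y'" "x \<noteq> y" "x \<le> n" "y \<le> n" for x y x' y'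
    proof -
      have xy': "Q x y'"
      proof (cases "x = x'")
        case False
        show ?thesis by (rule Q1 [OF q(1) q(4) False q(2)])
      qed (use q(1) in simp)
      show ?thesis
      proof (cases "y = y'")
        case False
        show ?thesis by (rule Q2 [OF xy' q(5) q(3) [symmetric] False])
      qed (use xy' in simp)
    qed
    obtain z where z: "z \<le> n" "z \<noteq> x0" "z \<noteq> y0"
    proof -
      have "\<exists>z\<in>{0, 1, 2 :: nat}. z \<noteq> x0 \<and> z \<noteq> y0"
        by (cases "x0 = 0 \<or> y0 = 0"; cases "x0 = 1 \<or> y0 = 1") auto
      then obtain z where "z \<in> {0, 1, 2 :: nat}" "z \<noteq> x0 \<and> z \<noteq> y0" ..
      moreover from this(1) have "z \<le> n" using n by auto
      ultimately show ?thesis using that by blast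
    qed
    show ?thesis
    proof (cases "x = y0")
      case False
      thus ?thesis using step [OF Q0] that by blast
    next
      case True
      have "Q x0 z" using Q2 [OF Q0 z] .
      thus ?thesis using step [of x0 z x y] True z that by blast
    qed
  qed
  show ?thesis
  proof (cases "x1 = y1")
    case False
    from main [OF Qall [OF False va(3,5)] va(1,2,4)] show ?thesis .
  next
    case True
    \<comment> \<open>If the only nonzero entry of \<open>v\<close> stood at x1 = y1, the trace
      would be the single nonzero product there.\<close>
    have "\<exists>z\<le>n. z \<noteq> x1 \<and> v z \<noteq> 0"
    proof (rule ccontr)
      assume "\<not> (\<exists>z\<le>n. z \<noteq> x1 \<and> v z \<noteq> 0)"
      hence "(\<Sum>i\<le>n. \<alpha> i * v i) = (\<Sum>i\<le>n. if i = x1 then \<alpha> x1 * v x1 else 0)"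
        by (intro sum.cong) auto
      thus False using va True by simp
    qed
    then obtain z where z: "z \<le> n" "z \<noteq> y1" "v z \<noteq> 0" using True by blast
    from main [OF Qall [OF z(2,1) va(5)] va(1) z(3) va(4)] show ?thesis .
  qed
qed

lemma rank_one_of_minors:
  assumes "supp_mat n X" "\<And>a b c d. X a b * X c d = X a d * X c b" "X x y \<noteq> 0"
  shows "X = rk n (\<lambda>i. X i y) (\<lambda>j. X x j / X x y)"
proof (intro ext)
  fix i j
  have "X i j * X x y = X i y * X x j" by (rule assms(2))
  hence "X i j = X i y * (X x j / X x y)" using assms(3) by (simp add: field_simps)
  thus "X i j = rk n (\<lambda>i. X i y) (\<lambda>j. X x j / X x y) i j"
    using assms(1) by (auto simp: rk_def supp_mat_def)
qed

lemma mmul_emat01: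
  assumes "1 \<le> n"
  shows "mmul n (mmul n A (emat 0 1)) B = rk n (\<lambda>i. A i 0) (\<lambda>j. B 1 j)"
proof (intro ext)
  fix i j
  have "(\<Sum>k\<le>n. (if i \<le> n \<and> k = 1 then A i 0 else 0) * B k j) = (\<Sum>k\<le>n. if k = 1 then (if i \<le> n then A i 0 else 0) * B 1 j else 0)"
    by (rule sum.cong) auto
  thus "mmul n (mmul n A (emat 0 1)) B i j = rk n (\<lambda>i. A i 0) (\<lambda>j. B 1 j) i j"
    unfolding mmul_emat_right [OF le0 assms] using assms
    by (cases "i \<le> n"; cases "j \<le> n") (simp_all add: mmul_def rk_def)
qed

definition inv_pair :: "nat \<Rightarrow> mat \<Rightarrow> mat \<Rightarrow> bool" where
  "inv_pair n A B \<longleftrightarrow> supp_mat n A \<and> supp_mat n B \<and> mmul n A B = idm n \<and> mmul n B A = idm n"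

lemma inv_pair_iff: "inv_pair n A B \<longleftrightarrow> supp_mat n A \<and> supp_mat n B
    \<and> (\<forall>i\<le>n. \<forall>j\<le>n. (\<Sum>k\<le>n. A i k * B k j) = (if i = j then 1 else 0))
    \<and> (\<forall>i\<le>n. \<forall>j\<le>n. (\<Sum>k\<le>n. B i k * A k j) = (if i = j then 1 else 0))"
proof -
  have "mmul n A B = idm n \<longleftrightarrow> (\<forall>i\<le>n. \<forall>j\<le>n. (\<Sum>k\<le>n. A i k * B k j) = (if i = j then 1 else 0))" for A B
  proof
    assume m: "mmul n A B = idm n"
    show "\<forall>i\<le>n. \<forall>j\<le>n. (\<Sum>k\<le>n. A i k * B k j) = (if i = j then 1 else 0)"
    proof (intro allI impI)
      fix i j assume "i \<le> n" "j \<le> n"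
      thus "(\<Sum>k\<le>n. A i k * B k j) = (if i = j then 1 else 0)"
        using fun_cong [OF fun_cong [OF m, of i], of j] by (simp add: mmul_def idm_def)
    qed
  next
    assume "\<forall>i\<le>n. \<forall>j\<le>n. (\<Sum>k\<le>n. A i k * B k j) = (if i = j then 1 else 0)"
    thus "mmul n A B = idm n" by (auto simp: mmul_def idm_def fun_eq_iff)
  qed
  thus ?thesis by (simp add: inv_pair_def)
qed

lemma Omin_iff: "1 \<le> n \<Longrightarrow> X \<in> Omin n \<longleftrightarrow> (\<exists>A B. inv_pair n A B \<and> X = rk n (\<lambda>i. A i 0) (\<lambda>j. B 1 j))"
  unfolding Omin_def inv_pair_def by (auto simp: mmul_emat01 simp del: One_nat_def)

text \<open>Conjugation by 1 + t E_ab: the matrix \<open>A\<close> is multiplied by it from the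
  left, and its inverse \<open>B\<close> by 1 - t E_ab from the right.\<close>

lemma Omin_elem:
  assumes n: "1 \<le> n" and r: "rk n v \<alpha> \<in> Omin n" and ab: "a \<le> n" "b \<le> n" "a \<noteq> b"
  shows "rk n (v(a := v a + t * v b)) (\<alpha>(b := \<alpha> b - t * \<alpha> a)) \<in> Omin n"
proof -
  obtain A B where AB: "inv_pair n A B" "rk n v \<alpha> = rk n (\<lambda>i. A i 0) (\<lambda>j. B 1 j)"
    using r Omin_iff [OF n] by auto
  have e: "v i * \<alpha> j = A i 0 * B 1 j" if "i \<le> n" "j \<le> n" for i j
    using fun_cong [OF fun_cong [OF AB(2), of i], of j] that by (simp add: rk_def)
  define A' where "A' = (\<lambda>i j. A i j + (if i = a then t * A b j else 0))"
  define B' where "B' = (\<lambda>i j. B i j - (if j = b then t * B i a else 0))"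
  have s: "(\<Sum>k\<le>n. A' i k * B' k j) = (\<Sum>k\<le>n. A i k * B k j) + (if i = a then t * (\<Sum>k\<le>n. A b k * B k j) else 0)
    - (if j = b then t * (\<Sum>k\<le>n. A i k * B k a) else 0) - (if i = a \<and> j = b then t * t * (\<Sum>k\<le>n. A b k * B k a) else 0)" for i j
    by (simp add: A'_def B'_def sum_distrib_left sum.distrib [symmetric] sum_subtractf [symmetric] algebra_simps)
  have s': "(\<Sum>k\<le>n. B' i k * A' k j) = (\<Sum>k\<le>n. B i k * A k j)" for i j
  proof -
    have "(\<Sum>k\<le>n. B' i k * A' k j) = (\<Sum>k\<le>n. B i k * A k j + (if k = a then B i a * (t * A b j) else 0) - (if k = b then t * B i a * A b j else 0))"
      by (rule sum.cong) (use ab in \<open>auto simp: A'_def B'_def algebra_simps\<close>)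
    thus ?thesis using ab by (simp add: sum.distrib sum_subtractf)
  qed
  have "inv_pair n A' B'"
    using AB(1) ab unfolding inv_pair_iff s s' by (auto simp: supp_mat_def A'_def B'_def)
  moreover have "rk n (v(a := v a + t * v b)) (\<alpha>(b := \<alpha> b - t * \<alpha> a)) = rk n (\<lambda>i. A' i 0) (\<lambda>j. B' 1 j)"
  proof (intro ext)
    fix i j
    show "rk n (v(a := v a + t * v b)) (\<alpha>(b := \<alpha> b - t * \<alpha> a)) i j = rk n (\<lambda>i. A' i 0) (\<lambda>j. B' 1 j) i j"
    proof (cases "i \<le> n \<and> j \<le> n")
      case True
      let ?x = "if i = a then t else 0" and ?y = "if j = b then t else 0"
      have e12: "A' i 0 = A i 0 + ?x * A b 0" "B' 1 j = B 1 j - ?y * B 1 a" by (simp_all add: A'_def B'_def)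
      have "A' i 0 * B' 1 j = A i 0 * B 1 j + ?x * (A b 0 * B 1 j) - ?y * (A i 0 * B 1 a) - ?x * ?y * (A b 0 * B 1 a)"
        unfolding e12 by (simp only: algebra_simps)
      also have "\<dots> = v i * \<alpha> j + ?x * (v b * \<alpha> j) - ?y * (v i * \<alpha> a) - ?x * ?y * (v b * \<alpha> a)"
        using True ab by (simp only: e)
      also have "\<dots> = (v i + ?x * v b) * (\<alpha> j - ?y * \<alpha> a)" by (simp only: algebra_simps)
      also have "\<dots> = (v(a := v a + t * v b)) i * (\<alpha>(b := \<alpha> b - t * \<alpha> a)) j" by simp
      finally show ?thesis using True by (simp add: rk_def)
    qed (auto simp: rk_def)
  qed
  ultimately show ?thesis using Omin_iff [OF n] by blast
qed

text \<open>Only column 0 of \<open>A\<close> and row 1 of \<open>B\<close> enter the orbit point.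
  Multiplying column 0 of \<open>A\<close> by \<open>c\<close> is compensated in row 0 of
  \<open>B\<close>, which leaves row 1 untouched.\<close>

lemma Omin_scale:
  assumes n: "1 \<le> n" and r: "rk n v \<alpha> \<in> Omin n" and c: "c \<noteq> 0"
  shows "rk n (\<lambda>i. c * v i) \<alpha> \<in> Omin n"
proof -
  obtain A B where AB: "inv_pair n A B" "rk n v \<alpha> = rk n (\<lambda>i. A i 0) (\<lambda>j. B 1 j)"
    using r Omin_iff [OF n] by auto
  have e: "v i * \<alpha> j = A i 0 * B 1 j" if "i \<le> n" "j \<le> n" for i j
    using fun_cong [OF fun_cong [OF AB(2), of i], of j] that by (simp add: rk_def)
  define A' where "A' = (\<lambda>i j. A i j * (if j = 0 then c else 1))"
  define B' where "B' = (\<lambda>i j. B i j / (if i = 0 then c else 1))"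
  have "(\<Sum>k\<le>n. A' i k * B' k j) = (\<Sum>k\<le>n. A i k * B k j)" for i j
    by (rule sum.cong) (use c in \<open>auto simp: A'_def B'_def\<close>)
  moreover have "(\<Sum>k\<le>n. B' i k * A' k j) = (\<Sum>k\<le>n. B i k * A k j) * ((if j = 0 then c else 1) / (if i = 0 then c else 1))" for i j
    unfolding sum_distrib_right by (rule sum.cong) (auto simp: A'_def B'_def)
  ultimately have "inv_pair n A' B'"
    using AB(1) c unfolding inv_pair_iff by (auto simp: supp_mat_def A'_def B'_def)
  moreover have "rk n (\<lambda>i. c * v i) \<alpha> = rk n (\<lambda>i. A' i 0) (\<lambda>j. B' 1 j)"
    using e by (auto simp: rk_def A'_def B'_def fun_eq_iff)
  ultimately show ?thesis using Omin_iff [OF n] by blast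
qed

lemma emat01_Omin: "1 \<le> n \<Longrightarrow> rk n (unitv 0) (unitv 1) \<in> Omin n"
proof -
  assume n: "1 \<le> n"
  have i: "(\<Sum>k\<le>n. idm n i k * idm n k j) = (if i = j then 1 else 0)" if "i \<le> n" "j \<le> n" for i j
  proof -
    have "(\<Sum>k\<le>n. idm n i k * idm n k j) = (\<Sum>k\<le>n. if k = i then idm n i j else 0)"
      by (rule sum.cong) (auto simp: idm_def)
    thus ?thesis using that by (simp add: idm_def)
  qed
  have "inv_pair n (idm n) (idm n)" unfolding inv_pair_iff using i by (auto simp: supp_mat_def idm_def)
  moreover have "rk n (unitv 0) (unitv 1) = rk n (\<lambda>i. idm n i 0) (\<lambda>j. idm n 1 j)"
    using n by (intro rk_cong) (auto simp: unitv_def idm_def)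
  ultimately show ?thesis using Omin_iff [OF n] by blast
qed

lemma Omin_rank_one:
  assumes "2 \<le> n" "(\<Sum>i\<le>n. \<alpha> i * v i) = 0" "v x \<noteq> 0" "x \<le> n" "\<alpha> y \<noteq> 0" "y \<le> n"
  shows "rk n v \<alpha> \<in> Omin n"
  by (rule rank_one_orbit [OF assms(1) _ _ emat01_Omin _ _ _ assms(2-6)])
    (use assms(1) in \<open>auto intro!: Omin_elem Omin_scale\<close>)

lemma Omin_minors:
  assumes "1 \<le> n" "X \<in> Omin n"
  shows "X \<in> sl n" "X a b * X c d = X a d * X c b"
proof -
  obtain A B where AB: "inv_pair n A B" "X = rk n (\<lambda>i. A i 0) (\<lambda>j. B 1 j)"
    using assms Omin_iff by blast
  have "(\<Sum>k\<le>n. B 1 k * A k 0) = 0" using AB(1) assms(1) unfolding inv_pair_iff by auto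
  moreover have "mtrace n X = (\<Sum>k\<le>n. B 1 k * A k 0)"
    unfolding mtrace_def AB(2) by (rule sum.cong) (auto simp: rk_def)
  ultimately show "X \<in> sl n" unfolding sl_def using AB(2) by (auto simp: supp_mat_def rk_def)
  show "X a b * X c d = X a d * X c b" unfolding AB(2) by (auto simp: rk_def)
qed

lemma continuous_entry: "continuous_on UNIV (\<lambda>X :: mat. X a b)"
  by (rule continuous_on_product_then_coordinatewise, rule continuous_on_product_then_coordinatewise,
      rule continuous_on_id)

lemma zero_closure_Omin: assumes "1 \<le> n" shows "(\<lambda>i j. 0) \<in> closure (Omin n)"
proof -
  let ?f = "\<lambda>c. rk n (\<lambda>i. c * unitv 0 i) (unitv 1)"
  have "continuous_on UNIV ?f"
  proof (intro continuous_on_coordinatewise_then_product)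
    show "continuous_on UNIV (\<lambda>c. ?f c i j)" for i j
      by (cases "i \<le> n \<and> j \<le> n") (auto simp: rk_def intro!: continuous_intros)
  qed
  hence "?f ` closure (- {0}) \<subseteq> closure (?f ` (- {0}))"
    by (intro image_closure_subset closure_subset) (auto intro: continuous_on_subset)
  also have "\<dots> \<subseteq> closure (Omin n)"
    using assms by (intro closure_mono) (auto intro!: Omin_scale emat01_Omin simp del: One_nat_def)
  finally have "?f ` closure (- {0}) \<subseteq> closure (Omin n)" .
  moreover have "closure (- {0 :: complex}) = UNIV" by (simp add: closure_complement)
  ultimately have "?f 0 \<in> closure (Omin n)" by blast
  moreover have "?f 0 = (\<lambda>i j. 0)" by (auto simp: rk_def fun_eq_iff)
  ultimately show ?thesis by simp
qed

text \<open>Support, trace zero and vanishing 2 x 2 minors are closed conditions that hold on the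
  orbit. Conversely, a nonzero matrix satisfying them has rank one and lies in the orbit itself, and
  zero is a limit of scaled orbit points.\<close>

lemma closure_Omin_iff:
  assumes n: "2 \<le> n"
  shows "X \<in> closure (Omin n) \<longleftrightarrow> X \<in> sl n \<and> (\<forall>a b c d. X a b * X c d = X a d * X c b)"
proof
  assume X: "X \<in> closure (Omin n)"
  let ?C = "{X. (\<forall>a b. n < a \<or> n < b \<longrightarrow> X a b = 0)} \<inter> {X. mtrace n X = 0} \<inter> {X :: mat. \<forall>a b c d. X a b * X c d = X a d * X c b}"
  have "closed ?C" unfolding mtrace_def
    by (intro closed_Int closed_Collect_all closed_Collect_imp closed_Collect_eq continuous_intros continuous_entry open_Collect_const)
  moreover have "Omin n \<subseteq> ?C"
    using Omin_minors [of n] n by (fastforce simp: sl_def supp_mat_def)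
  ultimately have "closure (Omin n) \<subseteq> ?C" by (intro closure_minimal)
  thus "X \<in> sl n \<and> (\<forall>a b c d. X a b * X c d = X a d * X c b)" using X by (auto simp: sl_def supp_mat_def)
next
  assume X: "X \<in> sl n \<and> (\<forall>a b c d. X a b * X c d = X a d * X c b)"
  show "X \<in> closure (Omin n)"
  proof (cases "\<forall>a b. X a b = 0")
    case True
    hence "X = (\<lambda>i j. 0)" by (auto simp: fun_eq_iff)
    thus ?thesis using zero_closure_Omin n by simp
  next
    case False
    then obtain x y where xy: "X x y \<noteq> 0" by blast
    have s: "supp_mat n X" using X by (simp add: sl_def)
    hence le: "x \<le> n" "y \<le> n" using xy by (auto simp: supp_mat_def not_less [symmetric])
    have "(\<Sum>i\<le>n. X x i / X x y * X i y) = (\<Sum>i\<le>n. X i i)"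
    proof (rule sum.cong [OF refl])
      fix i
      have "X x i * X i y = X x y * X i i" using X by blast
      thus "X x i / X x y * X i y = X i i" using xy by simp
    qed
    also have "\<dots> = 0" using X by (simp add: sl_def mtrace_def)
    finally have "rk n (\<lambda>i. X i y) (\<lambda>j. X x j / X x y) \<in> Omin n"
      using n le xy by (intro Omin_rank_one [where x = x and y = y]) auto
    moreover have "X = rk n (\<lambda>i. X i y) (\<lambda>j. X x j / X x y)"
      by (rule rank_one_of_minors [OF s _ xy]) (use X in blast)
    ultimately show ?thesis using closure_subset by force
  qed
qed

section \<open>The trace pairing with rank one matrices, and points of the variety\<close>

definition qf :: "nat \<Rightarrow> mat \<Rightarrow> (nat \<Rightarrow> complex) \<Rightarrow> (nat \<Rightarrow> complex) \<Rightarrow> complex" where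
  "qf n Y v \<alpha> = (\<Sum>i\<le>n. \<Sum>j\<le>n. \<alpha> i * Y i j * v j)"

lemma killing_rk: "killing n (rk n v \<alpha>) Y = 2 * of_nat (n + 1) * qf n Y v \<alpha>"
proof -
  have "mtrace n (mmul n (rk n v \<alpha>) Y) = (\<Sum>i\<le>n. \<Sum>k\<le>n. \<alpha> k * Y k i * v i)"
    unfolding mtrace_def mmul_def rk_def by (intro sum.cong refl) (auto intro!: sum.cong)
  also have "\<dots> = qf n Y v \<alpha>" unfolding qf_def by (rule sum.swap)
  finally show ?thesis by (simp add: killing_def)
qed

lemma qf_add: "qf n Y (\<lambda>i. v i + v' i) \<alpha> = qf n Y v \<alpha> + qf n Y v' \<alpha>"
    "qf n Y v (\<lambda>i. \<alpha> i + \<alpha>' i) = qf n Y v \<alpha> + qf n Y v \<alpha>'"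
  and qf_scale: "qf n Y (\<lambda>i. c * v i) \<alpha> = c * qf n Y v \<alpha>" "qf n Y v (\<lambda>i. c * \<alpha> i) = c * qf n Y v \<alpha>"
  by (simp_all add: qf_def sum.distrib [symmetric] sum_distrib_left algebra_simps)

lemma qf_unitv_left: "i \<le> n \<Longrightarrow> qf n Y v (unitv i) = (\<Sum>j\<le>n. Y i j * v j)"
proof -
  assume i: "i \<le> n"
  have "qf n Y v (unitv i) = (\<Sum>k\<le>n. if k = i then (\<Sum>j\<le>n. Y i j * v j) else 0)"
    unfolding qf_def by (intro sum.cong refl) (auto simp: unitv_def)
  thus ?thesis using i by simp
qed

lemma qf_unitv_right: "i \<le> n \<Longrightarrow> qf n Y (unitv i) \<alpha> = (\<Sum>j\<le>n. \<alpha> j * Y j i)"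
proof -
  assume i: "i \<le> n"
  have "qf n Y (unitv i) \<alpha> = (\<Sum>k\<le>n. \<Sum>j\<le>n. if j = i then \<alpha> k * Y k i else 0)"
    unfolding qf_def by (intro sum.cong refl) (auto simp: unitv_def)
  thus ?thesis using i by simp
qed

lemma qf_unitv: "i \<le> n \<Longrightarrow> j \<le> n \<Longrightarrow> qf n Y (unitv i) (unitv j) = Y j i"
proof -
  assume "i \<le> n" "j \<le> n"
  moreover have "(\<Sum>k\<le>n. Y j k * unitv i k) = (\<Sum>k\<le>n. if k = i then Y j i else 0)"
    by (rule sum.cong) (auto simp: unitv_def)
  ultimately show ?thesis by (simp add: qf_unitv_left)
qed

text \<open>Invariance of the trace form: conjugating the rank one matrix by 1 + t E_ab amounts to
  conjugating \<open>Y\<close> the other way, which is \<open>adt\<close>.\<close>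

lemma qf_elem:
  assumes ab: "a \<le> n" "b \<le> n" "a \<noteq> b"
  shows "qf n Y (v(a := v a + t * v b)) (\<alpha>(b := \<alpha> b - t * \<alpha> a)) = qf n (adt n a b t Y) v \<alpha>"
proof -
  have v: "v(a := v a + t * v b) = (\<lambda>i. v i + (t * v b) * unitv a i)"
    and al: "\<alpha>(b := \<alpha> b - t * \<alpha> a) = (\<lambda>i. \<alpha> i + (- t * \<alpha> a) * unitv b i)"
    by (auto simp: unitv_def fun_eq_iff)
  have L: "qf n Y (v(a := v a + t * v b)) (\<alpha>(b := \<alpha> b - t * \<alpha> a))
    = qf n Y v \<alpha> + t * v b * (\<Sum>j\<le>n. \<alpha> j * Y j a) - t * \<alpha> a * (\<Sum>j\<le>n. Y b j * v j) - t * t * v b * \<alpha> a * Y b a"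
  proof -
    have "qf n Y (v(a := v a + t * v b)) (\<alpha>(b := \<alpha> b - t * \<alpha> a)) = qf n Y v \<alpha> + (- t * \<alpha> a) * qf n Y v (unitv b)
      + (t * v b) * (qf n Y (unitv a) \<alpha> + (- t * \<alpha> a) * qf n Y (unitv a) (unitv b))"
      unfolding v al by (simp only: qf_add qf_scale) (simp add: algebra_simps)
    thus ?thesis
      unfolding qf_unitv [OF ab(1,2)] qf_unitv_left [OF ab(2), of Y v] qf_unitv_right [OF ab(1), of Y \<alpha>]
      by (simp add: algebra_simps)
  qed
  have B: "bracket n Y (emat a b) i j = (if j = b then Y i a else 0) - (if i = a then Y b j else 0)" if "i \<le> n" "j \<le> n" for i j
    unfolding bracket_def mlin_def mmul_emat_left [OF ab(1,2)] mmul_emat_right [OF ab(1,2)] using that by simp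
  have "qf n (adt n a b t Y) v \<alpha> = (\<Sum>i\<le>n. \<Sum>j\<le>n. \<alpha> i * Y i j * v j + (if j = b then t * v b * (\<alpha> i * Y i a) else 0)
     - (if i = a then t * \<alpha> a * (Y b j * v j) else 0) - (if i = a then if j = b then t * t * v b * \<alpha> a * Y b a else 0 else 0))"
    unfolding qf_def
  proof (intro sum.cong refl)
    fix i j assume "i \<in> {..n}" "j \<in> {..n}"
    hence A: "adt n a b t Y i j = Y i j + t * ((if j = b then Y i a else 0) - (if i = a then Y b j else 0)) - t * t * Y b a * emat a b i j"
      unfolding adt_def power2_eq_square by (simp only: B atMost_iff)
    show "\<alpha> i * adt n a b t Y i j * v j = \<alpha> i * Y i j * v j + (if j = b then t * v b * (\<alpha> i * Y i a) else 0)
     - (if i = a then t * \<alpha> a * (Y b j * v j) else 0) - (if i = a then if j = b then t * t * v b * \<alpha> a * Y b a else 0 else 0)"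
      unfolding A by (auto simp: emat_def algebra_simps)
  qed
  also have "\<dots> = qf n Y v \<alpha> + (\<Sum>i\<le>n. t * v b * (\<alpha> i * Y i a)) - (\<Sum>j\<le>n. t * \<alpha> a * (Y b j * v j)) - t * t * v b * \<alpha> a * Y b a"
  proof -
    have 1: "(\<Sum>i\<le>n. \<Sum>j\<le>n. if i = a then f j else 0) = (\<Sum>j\<le>n. f j)" for f :: "nat \<Rightarrow> complex"
      by (subst sum.swap) (use ab in simp)
    show ?thesis unfolding qf_def sum.distrib sum_subtractf 1 using ab by simp
  qed
  finally show ?thesis unfolding L by (simp add: sum_distrib_left)
qed

lemma killing_emat: assumes "a \<le> n" "b \<le> n" shows "killing n Y (emat a b) = 2 * of_nat (n + 1) * Y b a"
proof -
  have "mtrace n (mmul n Y (emat a b)) = (\<Sum>i\<le>n. if i = b then Y b a else 0)"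
    unfolding mtrace_def mmul_emat_right [OF assms] by (rule sum.cong) auto
  thus ?thesis using assms by (simp add: killing_def)
qed

lemma killing_dual_gdual: "killing_dual n X \<in> gdual n"
proof -
  have mt: "mtrace n (mmul n X Y) = (\<Sum>i\<le>n. \<Sum>k\<le>n. X i k * Y k i)" for X Y
    unfolding mtrace_def mmul_def by (rule sum.cong) auto
  have "killing n X (mlin a Y b Z) = a * killing n X Y + b * killing n X Z" for a b Y Z
    unfolding killing_def mt by (simp add: mlin_def sum.distrib [symmetric] sum_distrib_left algebra_simps)
  thus ?thesis by (auto simp: gdual_def killing_dual_def)
qed

lemma symb_cong: "texpr_in n e \<Longrightarrow> (\<And>Y. Y \<in> sl n \<Longrightarrow> \<xi> Y = \<eta> Y) \<Longrightarrow> symb d e \<xi> = symb d e \<eta>"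
proof (induction e)
  case (Cons t e)
  have "map \<xi> (snd t) = map \<eta> (snd t)" using Cons.prems by (auto simp: texpr_in_def)
  hence "prod_list (map \<xi> (snd t)) = prod_list (map \<eta> (snd t))" by (simp only:)
  thus ?case using Cons by (simp add: symb_def texpr_in_def)
qed (simp add: symb_def)

lemma symb_scale: "symb d e (\<lambda>Y. c * \<xi> Y) = c ^ d * symb d e \<xi>"
proof (induction e)
  case (Cons t e)
  have "prod_list (map (\<lambda>Y. c * \<xi> Y) w) = c ^ length w * prod_list (map \<xi> w)" for w
    by (induction w) auto
  thus ?case using Cons by (auto simp: symb_def algebra_simps)
qed (simp add: symb_def)

lemma annT_kills:
  assumes "simple_hw n V R v \<mu>" "e \<in> annT n \<mu>" "u \<in> V"
  shows "slrep.ta vsmul R e u = 0"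
proof -
  have "slrep vsmul n V R" using simple_hw_hwrep [OF assms(1)] by (simp add: hwrep_def)
  hence "slrep.ta vsmul R e u = tact R e u" by (rule tact_ta [symmetric])
  also have "\<dots> = vzero" using assms unfolding annT_def by blast
  finally show ?thesis by (simp add: vect_ops)
qed

text \<open>A single non-integral root supplies one point of rank one. The annihilator is stable
  under \<open>adtx\<close>, which gives stability of the variety under transvections, and
  homogeneity of symbols gives stability under scaling; then \<open>rank_one_orbit\<close>
  applies.\<close>

lemma min_orbit_subset:
  assumes n: "2 \<le> n" and s: "simple_hw n V R v \<mu>"
    and ij: "i < j" "j \<le> n" "epsc n \<mu> i - epsc n \<mu> j \<notin> \<int>"
  shows "killing_dual n ` closure (Omin n) \<subseteq> assoc_var n \<mu>"
proof -
  interpret hwrep vsmul n V R v "epsc n \<mu>" by (rule simple_hw_hwrep [OF s])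
  define Z where "Z = {X. killing_dual n X \<in> assoc_var n \<mu>}"
  have ann: "texpr_in n e" "\<And>u. u \<in> V \<Longrightarrow> ta e u = 0" if "e \<in> annT n \<mu>" for e
    using that annT_kills [OF s that] by (auto simp: annT_def)
  have Z: "rk n w \<alpha> \<in> Z \<longleftrightarrow> (\<forall>e\<in>annT n \<mu>. \<forall>d. (\<forall>t\<in>set e. length (snd t) \<le> d) \<longrightarrow> symb d e (\<lambda>Y. qf n Y w \<alpha>) = 0)" for w \<alpha>
  proof -
    have "symb d e (killing_dual n (rk n w \<alpha>)) = (2 * of_nat (n + 1)) ^ d * symb d e (\<lambda>Y. qf n Y w \<alpha>)" if "e \<in> annT n \<mu>" for d e
      unfolding symb_scale [symmetric]
      by (rule symb_cong [OF ann(1) [OF that]]) (simp add: killing_dual_def killing_rk)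
    moreover have "(2 * of_nat (n + 1)) ^ d \<noteq> (0 :: complex)" for d
    proof (rule power_not_zero)
      have "(of_nat (2 * (n + 1)) :: complex) \<noteq> 0" unfolding of_nat_eq_0_iff by simp
      thus "2 * of_nat (n + 1) \<noteq> (0 :: complex)" unfolding of_nat_mult of_nat_numeral .
    qed
    ultimately have "symb d e (killing_dual n (rk n w \<alpha>)) = 0 \<longleftrightarrow> symb d e (\<lambda>Y. qf n Y w \<alpha>) = 0" if "e \<in> annT n \<mu>" for d e
      using that by (simp only: mult_eq_0_iff simp_thms)
    thus ?thesis using killing_dual_gdual [of n] by (auto simp: Z_def assoc_var_def)
  qed
  have base: "rk n (unitv i) (unitv j) \<in> Z"
    unfolding Z
  proof (intro ballI allI impI)
    fix e d assume e: "e \<in> annT n \<mu>" "\<forall>t\<in>set e. length (snd t) \<le> d"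
    have "symb d e (\<lambda>Y. qf n Y (unitv i) (unitv j)) = symb d e (\<lambda>Y. Y j i)"
      using ij by (simp add: qf_unitv)
    also have "\<dots> = 0" using single_root_point [OF ij ann(1) [OF e(1)] e(2)] ann(2) [OF e(1)] by simp
    finally show "symb d e (\<lambda>Y. qf n Y (unitv i) (unitv j)) = 0" .
  qed
  have elem: "rk n (w(a := w a + t * w b)) (\<alpha>(b := \<alpha> b - t * \<alpha> a)) \<in> Z"
    if r: "rk n w \<alpha> \<in> Z" and ab: "a \<le> n" "b \<le> n" "a \<noteq> b" for w \<alpha> a b t
    unfolding Z
  proof (intro ballI allI impI)
    fix e d assume e: "e \<in> annT n \<mu>" "\<forall>t\<in>set e. length (snd t) \<le> d"
    have "adtx n a b t e \<in> annT n \<mu>"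
      unfolding annT_def
    proof (intro CollectI conjI allI impI ballI)
      show "texpr_in n (adtx n a b t e)"
        using ann(1) [OF e(1)] adt_sl [OF ab] by (force simp: texpr_in_def adtx_def)
      fix V' R' v' u assume h: "simple_hw n V' R' v' \<mu>" "u \<in> V'"
      have sr: "slrep vsmul n V' R'" using simple_hw_hwrep [OF h(1)] by (simp add: hwrep_def)
      have "slrep.ta vsmul R' (adtx n a b t e) u = 0"
        by (rule slrep.ta_adtx [OF sr ab ann(1) [OF e(1)] annT_kills [OF h(1) e(1)] h(2)])
      thus "tact R' (adtx n a b t e) u = vzero" using tact_ta [OF sr] by (simp add: vect_ops)
    qed
    moreover have "\<forall>s\<in>set (adtx n a b t e). length (snd s) \<le> d" using e(2) by (auto simp: adtx_def)
    ultimately have "symb d (adtx n a b t e) (\<lambda>Y. qf n Y w \<alpha>) = 0" using r unfolding Z by blast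
    thus "symb d e (\<lambda>Y. qf n Y (w(a := w a + t * w b)) (\<alpha>(b := \<alpha> b - t * \<alpha> a))) = 0"
      unfolding symb_adtx qf_elem [OF ab] .
  qed
  have scale: "rk n (\<lambda>i. c * w i) \<alpha> \<in> Z" if "rk n w \<alpha> \<in> Z" for w \<alpha> c
    using that unfolding Z by (simp add: qf_scale symb_scale)
  show ?thesis
  proof (rule image_subsetI)
    fix X assume "X \<in> closure (Omin n)"
    hence X: "X \<in> sl n" "\<And>a b c d. X a b * X c d = X a d * X c b" using closure_Omin_iff [OF n] by auto
    show "killing_dual n X \<in> assoc_var n \<mu>"
    proof (cases "\<forall>a b. X a b = 0")
      case True
      hence X0: "killing_dual n X Y = 0" for Y
        by (simp add: killing_dual_def killing_def mtrace_def mmul_def)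
      show ?thesis
        unfolding assoc_var_def
      proof (intro CollectI conjI ballI allI impI killing_dual_gdual)
        fix e d assume e: "e \<in> annT n \<mu>" "\<forall>t\<in>set e. length (snd t) \<le> d"
        have "symb d e (killing_dual n X) = symb d e (\<lambda>Y. 0 * Y 0 0)" by (simp add: X0 [abs_def])
        also have "\<dots> = 0 ^ d * symb d e (\<lambda>Y. Y 0 0)" by (rule symb_scale)
        also have "\<dots> = 0"
        \<comment> \<open>In degree 0 the factor 0 ^ d is 1. Such an expression is a scalar, and as
          it kills the nonzero vector \<open>v\<close> the scalar is 0.\<close>
        proof (cases "d = 0")
          case True
          have "\<forall>t\<in>set e'. length (snd t) \<le> 0 \<Longrightarrow> ta e' v = vsmul (symb 0 e' (\<lambda>Y. Y 0 0)) v" for e'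
            by (induction e') (auto simp: ta_Cons symb_def fv.scale_left_distrib)
          hence "vsmul (symb 0 e (\<lambda>Y. Y 0 0)) v = 0" using e ann(2) [OF e(1) v_V] True by simp
          thus ?thesis using v_nz True by simp
        qed simp
        finally show "symb d e (killing_dual n X) = 0" .
      qed
    next
      case False
      then obtain x y where xy: "X x y \<noteq> 0" by blast
      have sX: "supp_mat n X" using X by (simp add: sl_def)
      hence le: "x \<le> n" "y \<le> n" using xy by (auto simp: supp_mat_def not_less [symmetric])
      have "(\<Sum>i\<le>n. X x i / X x y * X i y) = (\<Sum>i\<le>n. X i i)"
      proof (rule sum.cong [OF refl])
        fix i
        have "X x i * X i y = X x y * X i i" by (rule X(2))
        thus "X x i / X x y * X i y = X i i" using xy by simp
      qed
      hence sm: "(\<Sum>i\<le>n. X x i / X x y * X i y) = 0" using X(1) by (simp add: sl_def mtrace_def)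
      have rZ: "rk n (\<lambda>i. X i y) (\<lambda>j. X x j / X x y) \<in> Z"
        by (rule rank_one_orbit [OF n elem scale base, of _ _ x y]) (use ij xy le sm in auto)
      have "X \<in> Z" by (subst rank_one_of_minors [OF sX X(2) xy]) (rule rZ)
      thus ?thesis unfolding Z_def by blast
    qed
  qed
qed

text \<open>At the point in question the minor with rows i, k and columns j, l is nonzero: the
  entries (i, j) and (k, l) do not vanish, while (i, l) does. The entry (k, j) is not examined, so j
  = k is allowed, as the case n = 2 requires.\<close>

lemma two_root_point_outside:
  assumes n: "2 \<le> n" and ix: "i \<le> n" "j \<le> n" "k \<le> n" "l \<le> n" "i \<noteq> j" "k \<noteq> l" "i \<noteq> l" "i \<noteq> k" "j \<noteq> l"
    and z: "\<And>e d. e \<in> annT n \<mu> \<Longrightarrow> \<forall>t\<in>set e. length (snd t) \<le> d \<Longrightarrow> symb d e (\<lambda>X. X j i + X l k) = 0"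
  shows "assoc_var n \<mu> \<noteq> killing_dual n ` closure (Omin n)"
proof
  assume eq: "assoc_var n \<mu> = killing_dual n ` closure (Omin n)"
  define \<xi> where "\<xi> Y = (if Y \<in> sl n then Y j i + Y l k else 0)" for Y :: mat
  have "\<xi> \<in> assoc_var n \<mu>"
    unfolding assoc_var_def
  proof (intro CollectI conjI ballI allI impI)
    show "\<xi> \<in> gdual n"
      unfolding gdual_def by (auto simp: \<xi>_def mlin_def algebra_simps) (auto simp: mlin_def [symmetric])
    fix e d assume e: "e \<in> annT n \<mu>" "\<forall>t\<in>set e. length (snd t) \<le> d"
    have "symb d e \<xi> = symb d e (\<lambda>X. X j i + X l k)"
      by (rule symb_cong [of n]) (use e in \<open>auto simp: annT_def \<xi>_def\<close>)
    thus "symb d e \<xi> = 0" using z [OF e] by simp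
  qed
  then obtain Y where Y: "Y \<in> closure (Omin n)" "\<xi> = killing_dual n Y" unfolding eq by blast
  have mi: "Y i j * Y k l = Y i l * Y k j" using Y(1) closure_Omin_iff [OF n] by blast
  have v: "\<xi> (emat a b) = 2 * of_nat (n + 1) * Y b a" if "a \<le> n" "b \<le> n" "a \<noteq> b" for a b
    unfolding Y(2) using that by (simp add: killing_dual_def killing_emat)
  have "\<xi> (emat j i) = 1" "\<xi> (emat l k) = 1" "\<xi> (emat l i) = 0"
    using ix by (auto simp: \<xi>_def emat_def) (auto simp: emat_def [symmetric])
  hence "Y i j \<noteq> 0" "Y k l \<noteq> 0" "Y i l = 0" using v [of j i] v [of l k] v [of l i] ix
    by (auto simp del: of_nat_add of_nat_Suc)
  with mi show False by simp
qed

text \<open>Only minors in the directions y, z and \<alpha>, \<beta> with these duality relations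
  are known to vanish, and coordinate minors have to be recovered from them. Off the diagonal,
  suitable unit vectors do this; principal minors can merely be compared with each other, and the
  trace decides.\<close>

lemma quadric_minors:
  assumes n: "2 \<le> n" and X: "X \<in> sl n"
    and q: "\<And>y z \<alpha> \<beta>. (\<Sum>i\<le>n. \<alpha> i * y i) = 0 \<Longrightarrow> (\<Sum>i\<le>n. \<alpha> i * z i) = 0 \<Longrightarrow> (\<Sum>i\<le>n. \<beta> i * z i) = 0 \<Longrightarrow>
      (\<Sum>i\<le>n. \<beta> i * y i) = 1 \<Longrightarrow> qf n X y \<alpha> * qf n X z \<beta> = qf n X z \<alpha> * qf n X y \<beta>"
  shows "X a b * X c d = X a d * X c b"
proof -
  have su: "(\<Sum>i\<le>n. f i * unitv z i) = f z" "(\<Sum>i\<le>n. unitv z i * f i) = f z" if "z \<le> n" for f z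
    using that by (simp_all add: unitv_def if_distrib [of "\<lambda>x. _ * x"] if_distrib [of "\<lambda>x. x * _"] cong: if_cong)
  have u: "unitv x y = (if y = x then 1 else 0)" for x y by (simp add: unitv_def)
  have q1: "X a b * X b c = X a c * X b b" if "a \<le> n" "b \<le> n" "c \<le> n" "a \<noteq> b" "b \<noteq> c" "a \<noteq> c" for a b c
  proof -
    have "qf n X (unitv b) (unitv a) * qf n X (unitv c) (unitv b) = qf n X (unitv c) (unitv a) * qf n X (unitv b) (unitv b)"
      by (rule q; use that in \<open>simp add: su; simp add: u\<close>)
    thus ?thesis using that by (simp add: qf_unitv)
  qed
  have q2: "X a b * X d c = X a c * X d b"
    if h: "a \<le> n" "b \<le> n" "c \<le> n" "d \<le> n" "a \<noteq> b" "b \<noteq> c" "a \<noteq> c" "d \<noteq> b" "d \<noteq> c" for a b c d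
  proof -
    have "qf n X (unitv b) (unitv a) * qf n X (unitv c) (\<lambda>i. unitv b i + unitv d i)
      = qf n X (unitv c) (unitv a) * qf n X (unitv b) (\<lambda>i. unitv b i + unitv d i)"
      by (rule q; use h in \<open>simp add: su; simp add: u\<close>)
    thus ?thesis using q1 [of a b c] h by (simp add: qf_add qf_unitv algebra_simps)
  qed
  have q3: "X a a * X b b - X a b * X b a = X c c * X b b - X c b * X b c"
    if h: "a \<le> n" "b \<le> n" "c \<le> n" "a \<noteq> b" "b \<noteq> c" "a \<noteq> c" for a b c
  proof -
    have "qf n X (unitv b) (\<lambda>i. unitv a i + unitv c i) * qf n X (\<lambda>i. unitv a i + - 1 * unitv c i) (unitv b)
      = qf n X (\<lambda>i. unitv a i + - 1 * unitv c i) (\<lambda>i. unitv a i + unitv c i) * qf n X (unitv b) (unitv b)"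
      by (rule q; use h in \<open>simp add: su distrib_right sum.distrib; simp add: u\<close>)
    hence "(X a b + X c b) * (X b a - X b c) = (X a a + X c a - (X a c + X c c)) * X b b"
      using h by (simp only: qf_add qf_scale qf_unitv) (simp add: algebra_simps)
    moreover have "X a b * X b c = X a c * X b b" "X c b * X b a = X c a * X b b" using q1 h by auto
    ultimately show ?thesis by (simp add: algebra_simps)
  qed
  have other: "\<exists>z\<le>n. z \<noteq> x \<and> z \<noteq> y" for x y
  proof -
    have "\<exists>z\<in>{0, 1, 2 :: nat}. z \<noteq> x \<and> z \<noteq> y"
      by (cases "x = 0 \<or> y = 0"; cases "x = 1 \<or> y = 1") auto
    then obtain z where "z \<in> {0, 1, 2 :: nat}" "z \<noteq> x \<and> z \<noteq> y" ..
    moreover from this(1) have "z \<le> n" using n by auto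
    ultimately show ?thesis by blast
  qed
  \<comment> \<open>By \<open>q3\<close> all principal minors share one value M. If M were nonzero,
    the off-diagonal entries would vanish and the diagonal would be constant, so that trace zero
    would make the matrix, and hence M, zero.\<close>
  have pr: "X a a * X b b - X a b * X b a = 0" if h: "a \<le> n" "b \<le> n" "a \<noteq> b" for a b
  proof (rule ccontr)
    define M where "M = X a a * X b b - X a b * X b a"
    assume "X a a * X b b - X a b * X b a \<noteq> 0"
    hence M0: "M \<noteq> 0" by (simp add: M_def)
    define m where "m x y = X x x * X y y - X x y * X y x" for x y
    have ms: "m x y = m y x" for x y by (simp add: m_def)
    have mc: "m x y = m z y" if "x \<le> n" "y \<le> n" "z \<le> n" "x \<noteq> y" "y \<noteq> z" for x y z
      using q3 [of x y z] that by (cases "x = z") (auto simp: m_def)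
    have mM: "m x y = M" if xy: "x \<le> n" "y \<le> n" "x \<noteq> y" for x y
    proof -
      have ab: "m a b = M" by (simp add: m_def M_def)
      obtain z where z: "z \<le> n" "z \<noteq> b" "z \<noteq> y" using other by blast
      have "m x y = m z y" using mc [of x y z] xy z by auto
      also have "\<dots> = m b z \<or> y = b"
        using mc [of y z b] ms xy z h by auto
      finally have "m x y = m b z \<or> y = b" by (metis \<open>m x y = m z y\<close>)
      moreover have "m z b = m a b" using mc [of z b a] z h by auto
      ultimately show ?thesis using ab ms \<open>m x y = m z y\<close> by metis
    qed
    have off: "X x y = 0" if xy: "x \<le> n" "y \<le> n" "x \<noteq> y" for x y
    proof -
      obtain z where z: "z \<le> n" "z \<noteq> x" "z \<noteq> y" using other by blast
      have 1: "X x y * X y z = X x z * X y y" using q1 [of x y z] xy z by auto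
      have 2: "X x z * X z y = X x y * X z z" using q1 [of x z y] xy z by auto
      have "X x y * M = X x y * X z z * X y y - X x y * X y z * X z y"
        using mM [of y z] xy z by (simp add: m_def algebra_simps)
      also have "\<dots> = 0" unfolding 1 2 [symmetric] by simp
      finally show ?thesis using M0 by simp
    qed
    have dg: "X x x * X y y = M" if "x \<le> n" "y \<le> n" "x \<noteq> y" for x y
      using mM [OF that] off [OF that] by (simp add: m_def)
    have eq: "X x x = X a a" if x: "x \<le> n" for x
    proof (cases "x = a")
      case False
      obtain z where z: "z \<le> n" "z \<noteq> x" "z \<noteq> a" using other by blast
      have e: "X x x * X z z = X a a * X z z" using dg [of x z] dg [of a z] x z h by auto
      have "X z z \<noteq> 0" using dg [of a z] z h M0 by auto
      with e show ?thesis by simp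
    qed simp
    have "0 = (\<Sum>i\<le>n. X i i)" using X by (simp add: sl_def mtrace_def)
    also have "\<dots> = (\<Sum>i\<le>n. X a a)" by (rule sum.cong) (use eq in auto)
    also have "\<dots> = of_nat (Suc n) * X a a" by simp
    finally have "X a a = 0" by (simp del: of_nat_Suc)
    thus False using dg [OF h] M0 by simp
  qed
  show ?thesis
  proof (cases "a \<le> n \<and> b \<le> n \<and> c \<le> n \<and> d \<le> n \<and> a \<noteq> c \<and> b \<noteq> d")
    case False
    have "X x y = 0" if "\<not> x \<le> n \<or> \<not> y \<le> n" for x y using X that by (auto simp: sl_def supp_mat_def)
    thus ?thesis using False by (auto simp: mult.commute)
  next
    case True
    hence h: "a \<le> n" "b \<le> n" "c \<le> n" "d \<le> n" "a \<noteq> c" "b \<noteq> d" by auto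
    show ?thesis
    proof (cases "a = b")
      case ab: True
      show ?thesis
      proof (cases "c = d")
        case True
        thus ?thesis using ab pr [of a c] h by simp
      next
        case False
        thus ?thesis using ab q1 [of c a d] h by (simp add: mult.commute)
      qed
    next
      case ab: False
      show ?thesis
      proof (cases "a = d")
        case ad: True
        show ?thesis
        proof (cases "c = b")
          case True
          thus ?thesis using ad pr [of a c] h by simp
        next
          case False
          thus ?thesis using ad q1 [of c a b] h by (simp add: mult.commute)
        qed
      next
        case ad: False
        consider "c = b" | "c = d" | "c \<noteq> b" "c \<noteq> d" by blast
        thus ?thesis
        proof cases
          case 1
          thus ?thesis using q1 [of a c d] h ab ad by simp
        next
          case 2
          thus ?thesis using q1 [of a c b] h ab ad by simp
        next
          case 3
          thus ?thesis using q2 [of a b d c] h ab ad by simp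
        qed
      qed
    qed
  qed
qed

section \<open>A module with small annihilator\<close>

locale weyl_alg = vector_space sc for sc :: "complex \<Rightarrow> 'v::ab_group_add \<Rightarrow> 'v" +
  fixes n :: nat and x d :: "nat \<Rightarrow> 'v \<Rightarrow> 'v"
  assumes x_add: "x a (u + w) = x a u + x a w" and x_sc: "x a (sc c u) = sc c (x a u)"
    and d_add: "d a (u + w) = d a u + d a w" and d_sc: "d a (sc c u) = sc c (d a u)"
    and xx: "x a (x b u) = x b (x a u)" and dd: "d a (d b u) = d b (d a u)"
    and dx: "d b (x a u) = x a (d b u) + (if a = b then u else 0)"
begin

lemma x_0: "x a 0 = 0" and d_0: "d a 0 = 0" using x_sc [of a 0 0] d_sc [of a 0 0] by auto

lemma x_sum: "x a (sum f I) = (\<Sum>i\<in>I. x a (f i))" and d_sum: "d a (sum f I) = (\<Sum>i\<in>I. d a (f i))"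
  by (induction I rule: infinite_finite_induct) (auto simp: x_0 d_0 x_add d_add)

definition W :: "mat \<Rightarrow> 'v \<Rightarrow> 'v" where
  "W X u = (\<Sum>a\<le>n. \<Sum>b\<le>n. sc (X a b) (x a (d b u)))"

lemma W_add: "W X (u + w) = W X u + W X w" and W_sc: "W X (sc c u) = sc c (W X u)"
  and W_mlin: "W (mlin s X t Y) u = sc s (W X u) + sc t (W Y u)"
  by (simp_all add: W_def x_add d_add x_sc d_sc mlin_def scale_right_distrib scale_left_distrib
      sum.distrib scale_sum_right mult.commute)

lemma W_W: "W X (W Y u) = (\<Sum>a\<le>n. \<Sum>b\<le>n. \<Sum>c\<le>n. \<Sum>e\<le>n. sc (X a b * Y c e) (x a (x c (d b (d e u))))) + W (mmul n X Y) u"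
proof -
  have 1: "W X (W Y u) = (\<Sum>a\<le>n. \<Sum>b\<le>n. \<Sum>c\<le>n. \<Sum>e\<le>n. sc (X a b * Y c e) (x a (d b (x c (d e u)))))"
    unfolding W_def by (simp add: x_sum d_sum x_sc d_sc scale_sum_right)
  have 2: "\<dots> = (\<Sum>a\<le>n. \<Sum>b\<le>n. \<Sum>c\<le>n. \<Sum>e\<le>n. sc (X a b * Y c e) (x a (x c (d b (d e u)))))
      + (\<Sum>a\<le>n. \<Sum>b\<le>n. \<Sum>c\<le>n. \<Sum>e\<le>n. if c = b then sc (X a b * Y b e) (x a (d e u)) else 0)"
    unfolding dx sum.distrib [symmetric] by (intro sum.cong refl) (auto simp: x_add x_0 scale_right_distrib)
  have 3: "(\<Sum>a\<le>n. \<Sum>b\<le>n. \<Sum>c\<le>n. \<Sum>e\<le>n. if c = b then sc (X a b * Y b e) (x a (d e u)) else 0)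
    = (\<Sum>a\<le>n. \<Sum>b\<le>n. \<Sum>e\<le>n. sc (X a b * Y b e) (x a (d e u)))"
  proof (rule sum.cong [OF refl], rule sum.cong [OF refl])
    fix a b assume b: "b \<in> {..n}"
    have "(\<Sum>c\<le>n. \<Sum>e\<le>n. if c = b then sc (X a b * Y b e) (x a (d e u)) else 0)
      = (\<Sum>c\<le>n. if c = b then (\<Sum>e\<le>n. sc (X a b * Y b e) (x a (d e u))) else 0)"
      by (rule sum.cong) auto
    thus "(\<Sum>c\<le>n. \<Sum>e\<le>n. if c = b then sc (X a b * Y b e) (x a (d e u)) else 0)
      = (\<Sum>e\<le>n. sc (X a b * Y b e) (x a (d e u)))" using b by simp
  qed
  have 4: "\<dots> = W (mmul n X Y) u"
  proof -
    have "(\<Sum>b\<le>n. \<Sum>e\<le>n. sc (X a b * Y b e) (x a (d e u))) = (\<Sum>e\<le>n. sc (mmul n X Y a e) (x a (d e u)))" if "a \<le> n" for a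
      by (subst sum.swap) (rule sum.cong, simp, use that in \<open>simp add: mmul_def scale_sum_left\<close>)
    thus ?thesis unfolding W_def by (rule sum.cong [OF refl]) simp
  qed
  show ?thesis unfolding 1 2 3 4 ..
qed

text \<open>The part of \<open>W_W\<close> with two multiplications and two derivations is symmetric
  in the matrices, as the \<open>x\<close> commute among themselves and so do the \<open>d\<close>;
  the difference leaves the matrix commutator.\<close>

lemma W_bracket: "W (bracket n X Y) u = W X (W Y u) - W Y (W X u)"
proof -
  have "(\<Sum>a\<le>n. \<Sum>b\<le>n. \<Sum>c\<le>n. \<Sum>e\<le>n. sc (Y a b * X c e) (x a (x c (d b (d e u)))))
    = (\<Sum>c\<le>n. \<Sum>e\<le>n. \<Sum>a\<le>n. \<Sum>b\<le>n. sc (Y a b * X c e) (x a (x c (d b (d e u)))))"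
  proof -
    have "(\<Sum>a\<le>n. \<Sum>b\<le>n. \<Sum>c\<le>n. \<Sum>e\<le>n. f a b c e) = (\<Sum>c\<le>n. \<Sum>e\<le>n. \<Sum>a\<le>n. \<Sum>b\<le>n. f a b c e)"
      for f :: "nat \<Rightarrow> nat \<Rightarrow> nat \<Rightarrow> nat \<Rightarrow> 'v"
      using sum.swap [of "\<lambda>p q. f (fst p) (snd p) (fst q) (snd q)" "{..n} \<times> {..n}" "{..n} \<times> {..n}"]
      by (simp add: sum.cartesian_product [symmetric] case_prod_beta [symmetric])
        (simp add: sum.cartesian_product' )
    thus ?thesis .
  qed
  also have "\<dots> = (\<Sum>a\<le>n. \<Sum>b\<le>n. \<Sum>c\<le>n. \<Sum>e\<le>n. sc (X a b * Y c e) (x a (x c (d b (d e u)))))"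
    by (intro sum.cong refl) (metis xx dd mult.commute)
  finally show ?thesis unfolding W_W bracket_def by (simp add: W_mlin)
qed

lemma W_rk: "W (rk n y \<alpha>) u = (\<Sum>a\<le>n. sc (y a) (x a (\<Sum>b\<le>n. sc (\<alpha> b) (d b u))))"
  unfolding W_def by (simp add: rk_def x_sum x_sc scale_sum_right)

text \<open>Since \<alpha> annihilates y and z, the derivation along \<alpha> commutes with
  multiplication by both linear forms. Either side is then the product of the two forms applied
  after the two derivations.\<close>

lemma W_quadric:
  assumes "(\<Sum>i\<le>n. \<alpha> i * y i) = 0" "(\<Sum>i\<le>n. \<alpha> i * z i) = 0"
  shows "W (rk n y \<alpha>) (W (rk n z \<beta>) u) = W (rk n z \<alpha>) (W (rk n y \<beta>) u)"
proof -
  define xv where "xv y u = (\<Sum>a\<le>n. sc (y a) (x a u))" for y u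
  define dv where "dv \<alpha> u = (\<Sum>b\<le>n. sc (\<alpha> b) (d b u))" for \<alpha> u
  have r: "W (rk n y \<alpha>) u = xv y (dv \<alpha> u)" for y \<alpha> u by (simp add: W_rk xv_def dv_def)
  have c: "dv \<alpha> (xv y u) = xv y (dv \<alpha> u)" if "(\<Sum>i\<le>n. \<alpha> i * y i) = 0" for \<alpha> y u
  proof -
    have "dv \<alpha> (xv y u) = (\<Sum>b\<le>n. \<Sum>a\<le>n. sc (\<alpha> b * y a) (x a (d b u)) + (if a = b then sc (\<alpha> b * y b) u else 0))"
      unfolding dv_def xv_def by (simp add: d_sum d_sc scale_sum_right dx) (intro sum.cong refl, auto simp: scale_right_distrib)
    also have "\<dots> = (\<Sum>b\<le>n. \<Sum>a\<le>n. sc (\<alpha> b * y a) (x a (d b u))) + sc (\<Sum>i\<le>n. \<alpha> i * y i) u"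
      by (simp add: sum.distrib scale_sum_left)
    also have "(\<Sum>b\<le>n. \<Sum>a\<le>n. sc (\<alpha> b * y a) (x a (d b u))) = xv y (dv \<alpha> u)"
      unfolding dv_def xv_def by (subst sum.swap) (simp add: x_sum x_sc scale_sum_right mult.commute)
    finally show ?thesis using that by simp
  qed
  have xvxv: "xv y (xv z u) = xv z (xv y u)" for y z u
    unfolding xv_def by (simp add: x_sum x_sc scale_sum_right) (subst sum.swap, simp add: xx mult.commute)
  show ?thesis unfolding r c [OF assms(1)] c [OF assms(2)] by (simp add: xvxv)
qed

end

text \<open>How the operator \<open>D s = A B - C (H - s)\<close> changes when the module is tensored with a module that has
  a three step filtration \<open>F2 \<subseteq> F1 \<subseteq> UNIV\<close> on whose layers \<open>h\<close> acts by \<open>0, 1, 0\<close>.\<close>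

locale tensor_step = vector_space sc for sc :: "complex \<Rightarrow> 'v::ab_group_add \<Rightarrow> 'v" +
  fixes A B C H a b c h :: "'v \<Rightarrow> 'v" and F1 F2 :: "'v set"
  assumes lin: "\<And>u w. A (u + w) = A u + A w" "\<And>u w. B (u + w) = B u + B w" "\<And>u w. C (u + w) = C u + C w"
      "\<And>u w. H (u + w) = H u + H w" "\<And>u w. a (u + w) = a u + a w" "\<And>u w. c (u + w) = c u + c w"
    and sub: "subspace F1" "subspace F2" "F2 \<subseteq> F1"
    and stable: "\<And>f. f \<in> F1 \<Longrightarrow> A f \<in> F1 \<and> B f \<in> F1 \<and> C f \<in> F1 \<and> H f \<in> F1"
      "\<And>f. f \<in> F2 \<Longrightarrow> A f \<in> F2 \<and> B f \<in> F2 \<and> C f \<in> F2 \<and> H f \<in> F2"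
    and img: "\<And>f. a f \<in> F1" "\<And>f. h f \<in> F1" "\<And>f. b f \<in> F2" "\<And>f. c f \<in> F2"
    and ker: "\<And>f. f \<in> F1 \<Longrightarrow> a f = 0" "\<And>f. f \<in> F1 \<Longrightarrow> c f = 0" "\<And>f. f \<in> F2 \<Longrightarrow> b f = 0" "\<And>f. f \<in> F2 \<Longrightarrow> h f = 0"
    and one: "\<And>f. f \<in> F1 \<Longrightarrow> f - h f \<in> F2"
begin

definition D :: "complex \<Rightarrow> 'v \<Rightarrow> 'v" where "D s f = A (B f) - C (H f - sc s f)"

text \<open>\<open>D\<close> with every capital operator replaced by its sum with the action on the
  new tensor factor, written in small letters.\<close>

definition D' :: "complex \<Rightarrow> 'v \<Rightarrow> 'v" where
  "D' s f = (A (B f + b f) + a (B f + b f)) - (C (H f + h f - sc s f) + c (H f + h f - sc s f))"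

lemma diffs: "A (u - w) = A u - A w" "B (u - w) = B u - B w" "C (u - w) = C u - C w" "H (u - w) = H u - H w"
  using lin(1) [of "u - w" w] lin(2) [of "u - w" w] lin(3) [of "u - w" w] lin(4) [of "u - w" w]
  by (simp_all add: algebra_simps)

lemmas F_ops = subspace_add [OF sub(1)] subspace_diff [OF sub(1)] subspace_scale [OF sub(1)]
  subspace_add [OF sub(2)] subspace_diff [OF sub(2)] subspace_scale [OF sub(2)] subspace_0 [OF sub(1)] subspace_0 [OF sub(2)]

lemma D_diff: "D s (u - w) = D s u - D s w"
proof -
  have e: "(H u - H w) - (sc s u - sc s w) = (H u - sc s u) - (H w - sc s w)" by simp
  show ?thesis unfolding D_def diffs(2,4) scale_right_diff_distrib e diffs(1) diffs(3) by simp
qed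

lemma D_F1: "f \<in> F1 \<Longrightarrow> D s f \<in> F1" and D_F2: "f \<in> F2 \<Longrightarrow> D s f \<in> F2"
  unfolding D_def using stable by (auto intro!: F_ops(1-6) stable(1) [THEN conjunct2, THEN conjunct2, THEN conjunct1]
    stable(2) [THEN conjunct2, THEN conjunct2, THEN conjunct1])

lemma step_0: "D' s f - D s f \<in> F1"
proof -
  have "D' s f - D s f = A (b f) + a (B f + b f) - C (h f) - c (H f + h f - sc s f)"
    unfolding D'_def D_def by (simp add: lin(1,3) diffs algebra_simps)
  also have "\<dots> \<in> F1" using img stable sub(3) by (intro F_ops) blast+
  finally show ?thesis .
qed

lemma step_1: assumes f: "f \<in> F1" shows "D' s f - D (s - 1) f \<in> F2"
proof -
  have B: "B f + b f \<in> F1" "H f + h f - sc s f \<in> F1"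
    using f img stable sub(3) by (auto intro!: F_ops)
  have "D' s f - D (s - 1) f = A (b f) + C (f - h f)"
    unfolding D'_def D_def ker(1) [OF B(1)] ker(2) [OF B(2)]
    by (simp add: lin(1,3) diffs scale_left_diff_distrib algebra_simps)
  also have "\<dots> \<in> F2" using img stable one [OF f] by (intro F_ops) blast+
  finally show ?thesis .
qed

lemma step_2: assumes f: "f \<in> F2" shows "D' s f = D s f"
proof -
  have F1: "B f \<in> F1" "H f - sc s f \<in> F1" using f stable sub(3) by (auto intro!: F_ops)
  show ?thesis unfolding D'_def D_def ker(3,4) [OF f] using ker(1) [OF F1(1)] ker(2) [OF F1(2)] by simp
qed

lemma D'_F1: "f \<in> F1 \<Longrightarrow> D' s f \<in> F1"
  using F_ops(1) [OF step_0 D_F1, of f s f s] by simp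

text \<open>The rightmost \<open>cs\<close> acts first and carries everything into
  \<open>F1\<close>. There \<open>h\<close> is 1 modulo \<open>F2\<close>, so the shift is matched
  by parameters increased by 1 and the image lies in \<open>F2\<close>, where \<open>D'\<close>
  agrees with \<open>D\<close>.\<close>

lemma D'_kill:
  assumes k: "\<And>f. foldr D cs f = 0"
  shows "foldr D' (cs @ map (\<lambda>s. s + 1) cs @ cs) f = 0"
proof -
  have 0: "foldr D' ss f - foldr D ss f \<in> F1" for ss
  proof (induction ss)
    case (Cons s ss)
    have "D' s (foldr D' ss f) - D s (foldr D ss f)
      = (D' s (foldr D' ss f) - D s (foldr D' ss f)) + D s (foldr D' ss f - foldr D ss f)"
      by (simp add: D_diff)
    also have "\<dots> \<in> F1" by (rule F_ops(1) [OF step_0 D_F1 [OF Cons.IH]])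
    finally show ?case by simp
  qed (simp add: F_ops)
  have 1: "g \<in> F1 \<Longrightarrow> foldr D' (map (\<lambda>s. s + 1) ss) g - foldr D ss g \<in> F2 \<and> foldr D' (map (\<lambda>s. s + 1) ss) g \<in> F1" for ss g
  proof (induction ss)
    case (Cons s ss)
    let ?u = "foldr D' (map (\<lambda>s. s + 1) ss) g"
    have "D' (s + 1) ?u - D s (foldr D ss g) = (D' (s + 1) ?u - D (s + 1 - 1) ?u) + D s (?u - foldr D ss g)"
      by (simp add: D_diff)
    also have "\<dots> \<in> F2" using Cons by (intro F_ops(4) step_1 D_F2) auto
    finally show ?case using Cons D'_F1 by simp
  qed (simp add: F_ops)
  have 2: "g \<in> F2 \<Longrightarrow> foldr D' ss g = foldr D ss g \<and> foldr D ss g \<in> F2" for ss g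
    by (induction ss) (auto simp: step_2 D_F2)
  have "foldr D' cs f \<in> F1" using 0 [of cs] k by simp
  from 1 [OF this, of cs] have "foldr D' (map (\<lambda>s. s + 1) cs) (foldr D' cs f) \<in> F2" using k by simp
  from 2 [OF this, of cs] show ?thesis using k by simp
qed

end

text \<open>\<open>F t k\<close> is the coefficient of the tensor of basis vectors \<open>e (t 0) \<otimes> e (t 1) \<otimes> \<dots>\<close> with the monomial of exponents
  \<open>k\<close>; the variable number \<open>j0\<close> has exponents in \<open>c + \<int>\<close>. The variables before \<open>j0\<close> are rescaled so that
  the monomials with negative exponents form a submodule.\<close>

type_synonym tens = "(nat \<Rightarrow> nat) \<Rightarrow> (nat \<Rightarrow> int) \<Rightarrow> complex"

definition tsc :: "complex \<Rightarrow> tens \<Rightarrow> tens" where "tsc s F = (\<lambda>t k. s * F t k)"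

definition xop :: "nat \<Rightarrow> nat \<Rightarrow> tens \<Rightarrow> tens" where
  "xop j0 a F = (\<lambda>t k. (if a < j0 then - of_int (k a) else 1) * F t (k(a := k a - 1)))"

definition dop :: "nat \<Rightarrow> complex \<Rightarrow> nat \<Rightarrow> tens \<Rightarrow> tens" where
  "dop j0 c b F = (\<lambda>t k. (if b < j0 then - 1 else of_int (k b + 1) + (if b = j0 then c else 0)) * F t (k(b := k b + 1)))"

interpretation ts: vector_space tsc
  by unfold_locales (simp_all add: tsc_def fun_eq_iff algebra_simps)

lemma dop_xop: "dop j0 c b (xop j0 a F) = xop j0 a (dop j0 c b F) + (if a = b then F else 0)"
proof (cases "a = b")
  case True
  thus ?thesis by (intro ext) (simp add: dop_def xop_def, simp add: algebra_simps)
next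
  case False
  hence e: "k(b := k b + 1, a := k a - 1) = k(a := k a - 1, b := k b + 1)" for k :: "nat \<Rightarrow> int"
    by (rule fun_upd_twist [symmetric])
  show ?thesis using False by (intro ext) (simp add: dop_def xop_def e)
qed

lemma xop_xop: "xop j0 a (xop j0 b F) = xop j0 b (xop j0 a F)"
proof (cases "a = b")
  case False
  hence e: "k(b := k b - 1, a := k a - 1) = k(a := k a - 1, b := k b - 1)" for k :: "nat \<Rightarrow> int"
    by (rule fun_upd_twist [symmetric])
  show ?thesis using False by (intro ext) (simp add: xop_def e)
qed simp

lemma dop_dop: "dop j0 c a (dop j0 c b F) = dop j0 c b (dop j0 c a F)"
proof (cases "a = b")
  case False
  hence e: "k(b := k b + 1, a := k a + 1) = k(a := k a + 1, b := k b + 1)" for k :: "nat \<Rightarrow> int"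
    by (rule fun_upd_twist [symmetric])
  show ?thesis using False by (intro ext) (simp add: dop_def e)
qed simp

interpretation tw: weyl_alg tsc n "xop j0" "dop j0 c" for n j0 c
  by unfold_locales (rule xop_xop dop_dop dop_xop | simp add: xop_def dop_def tsc_def fun_eq_iff algebra_simps)+

definition slot :: "nat \<Rightarrow> nat \<Rightarrow> mat \<Rightarrow> tens \<Rightarrow> tens" where
  "slot n r X F = (\<lambda>t k. \<Sum>j\<le>n. X (t r) j * F (t(r := j)) k)"

definition tact' :: "nat \<Rightarrow> nat \<Rightarrow> complex \<Rightarrow> nat \<Rightarrow> mat \<Rightarrow> tens \<Rightarrow> tens" where
  "tact' n j0 c M X F = tw.W n j0 c X F + (\<Sum>r<M. slot n r X F)"

lemma sum_fun_apply: "(\<Sum>i\<in>I. f i) x = (\<Sum>i\<in>I. f i x)"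
  by (induction I rule: infinite_finite_induct) simp_all

lemma slot_add: "slot n r X (F + G) = slot n r X F + slot n r X G"
  and slot_sc: "slot n r X (tsc s F) = tsc s (slot n r X F)"
  and slot_mlin: "slot n r (mlin s X s' Y) F = tsc s (slot n r X F) + tsc s' (slot n r Y F)"
  by (simp_all add: slot_def tsc_def mlin_def fun_eq_iff algebra_simps sum.distrib sum_distrib_left)

lemma slot_0 [simp]: "slot n r X 0 = 0" by (simp add: slot_def fun_eq_iff)

lemma slot_sum: "slot n r X (sum f I) = (\<Sum>i\<in>I. slot n r X (f i))"
  by (induction I rule: infinite_finite_induct) (simp_all only: sum.infinite sum.empty sum.insert slot_0 slot_add not_False_eq_True)

lemma slot_slot:
  assumes "supp_mat n X"
  shows "slot n r X (slot n r Y F) = slot n r (mmul n X Y) F"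
proof (intro ext)
  fix t k
  have "slot n r X (slot n r Y F) t k = (\<Sum>j\<le>n. \<Sum>l\<le>n. X (t r) j * Y j l * F (t(r := l)) k)"
    by (simp add: slot_def sum_distrib_left mult.assoc)
  also have "\<dots> = (\<Sum>l\<le>n. (\<Sum>j\<le>n. X (t r) j * Y j l) * F (t(r := l)) k)"
    by (subst sum.swap) (simp add: sum_distrib_right)
  also have "\<dots> = slot n r (mmul n X Y) F t k"
    using assms by (cases "t r \<le> n") (auto simp: slot_def mmul_def supp_mat_def)
  finally show "slot n r X (slot n r Y F) t k = slot n r (mmul n X Y) F t k" .
qed

lemma slot_slot_comm: "r \<noteq> r' \<Longrightarrow> slot n r X (slot n r' Y F) = slot n r' Y (slot n r X F)"
  by (intro ext) (simp add: slot_def sum_distrib_left, subst sum.swap, simp add: fun_upd_twist mult.left_commute)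

lemma W_slot: "tw.W n j0 c X (slot n r Y F) = slot n r Y (tw.W n j0 c X F)"
proof -
  have x: "xop j0 a (slot n r Y F) = slot n r Y (xop j0 a F)" for a F
    by (intro ext) (simp add: xop_def slot_def sum_distrib_left mult.left_commute)
  have d: "dop j0 c a (slot n r Y F) = slot n r Y (dop j0 c a F)" for a F
    by (intro ext) (simp add: dop_def slot_def sum_distrib_left mult.left_commute)
  show ?thesis unfolding tw.W_def by (simp add: x d slot_sum slot_sc)
qed

lemma tact'_add: "tact' n j0 c M X (F + G) = tact' n j0 c M X F + tact' n j0 c M X G"
  by (simp add: tact'_def tw.W_add slot_add sum.distrib)

lemma tact'_sc: "tact' n j0 c M X (tsc s F) = tsc s (tact' n j0 c M X F)"
  by (simp add: tact'_def tw.W_sc slot_sc ts.scale_right_distrib ts.scale_sum_right)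

lemma tact'_mlin: "tact' n j0 c M (mlin s X s' Y) F = tsc s (tact' n j0 c M X F) + tsc s' (tact' n j0 c M Y F)"
  by (simp add: tact'_def tw.W_mlin slot_mlin ts.scale_right_distrib ts.scale_sum_right sum.distrib)

lemma tact'_bracket:
  assumes X: "supp_mat n X" and Y: "supp_mat n Y"
  shows "tact' n j0 c M (bracket n X Y) F = tact' n j0 c M X (tact' n j0 c M Y F) - tact' n j0 c M Y (tact' n j0 c M X F)"
proof (induction M)
  case 0
  show ?case by (simp add: tact'_def tw.W_bracket)
next
  case (Suc M)
  have S: "tact' n j0 c (Suc M) Z G = tact' n j0 c M Z G + slot n M Z G" for Z G
    by (simp add: tact'_def)
  have c1: "tact' n j0 c M Z (slot n M Z' G) = slot n M Z' (tact' n j0 c M Z G)" for Z Z' G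
    by (simp add: tact'_def slot_add slot_sum W_slot slot_slot_comm)
  have c2: "slot n M (bracket n X Y) F = slot n M X (slot n M Y F) - slot n M Y (slot n M X F)"
    unfolding bracket_def slot_mlin slot_slot [OF X] slot_slot [OF Y] by (simp add: tsc_def fun_eq_iff)
  have g: "(a - b) + (e - d) = (a + s + (u + e)) - (b + u + (s + d))" for a b d e s u :: tens
    by (simp add: algebra_simps)
  show ?case unfolding S Suc.IH c2 slot_add tact'_add c1 by (rule g)
qed

lemma slrep_tact':
  assumes V: "ts.subspace V" "\<And>X F. X \<in> sl n \<Longrightarrow> F \<in> V \<Longrightarrow> tact' n j0 c M X F \<in> V"
  shows "slrep tsc n V (tact' n j0 c M)"
  by unfold_locales (use V in \<open>auto simp: tact'_add tact'_sc tact'_mlin tact'_bracket sl_def\<close>)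

definition tD :: "nat \<Rightarrow> nat \<Rightarrow> complex \<Rightarrow> nat \<Rightarrow> (nat \<Rightarrow> complex) \<Rightarrow> (nat \<Rightarrow> complex) \<Rightarrow> (nat \<Rightarrow> complex) \<Rightarrow> (nat \<Rightarrow> complex)
  \<Rightarrow> complex \<Rightarrow> tens \<Rightarrow> tens" where
  "tD n j0 c M y z \<alpha> \<beta> s F = tact' n j0 c M (rk n y \<alpha>) (tact' n j0 c M (rk n z \<beta>) F)
    - tact' n j0 c M (rk n z \<alpha>) (tact' n j0 c M (rk n y \<beta>) F - tsc s F)"

text \<open>Induction on the number of tensor factors: without any, the minor vanishes by
  \<open>W_quadric\<close>; each further factor triples the length of the list through
  \<open>D'_kill\<close>.\<close>

lemma tD_nilpotent:
  assumes dual: "(\<Sum>i\<le>n. \<alpha> i * y i) = 0" "(\<Sum>i\<le>n. \<alpha> i * z i) = 0" "(\<Sum>i\<le>n. \<beta> i * z i) = 0" "(\<Sum>i\<le>n. \<beta> i * y i) = 1"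
  shows "\<exists>cs. cs \<noteq> [] \<and> (\<forall>F. foldr (tD n j0 c M y z \<alpha> \<beta>) cs F = 0)"
proof (induction M)
  case 0
  have "tD n j0 c 0 y z \<alpha> \<beta> 0 F = 0" for F
    using tw.W_quadric [OF dual(1,2)] by (simp add: tD_def tact'_def)
  thus ?case by (intro exI [of _ "[0]"]) simp
next
  case (Suc M)
  then obtain cs where cs: "cs \<noteq> []" "\<And>F. foldr (tD n j0 c M y z \<alpha> \<beta>) cs F = 0" by blast
  define al where "al \<gamma> F = (\<lambda>t k. \<Sum>j\<le>n. \<gamma> j * F (t(M := j)) k)" for \<gamma> :: "nat \<Rightarrow> complex" and F :: tens
  let ?T = "tact' n j0 c M"
  \<comment> \<open>\<open>al \<gamma>\<close> contracts the new factor with a covector. On the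
    kernel of \<alpha> the operator with matrix \<open>rk n y \<beta>\<close> is the identity modulo
    \<open>F2\<close>, because \<beta> takes the value 1 on y.\<close>
  define F1 where "F1 = {F. al \<alpha> F = 0}"
  define F2 where "F2 = {F. al \<alpha> F = 0 \<and> al \<beta> F = 0}"
  have al_add: "al \<gamma> (F + G) = al \<gamma> F + al \<gamma> G" and al_sc: "al \<gamma> (tsc s F) = tsc s (al \<gamma> F)" for \<gamma> F G s
    by (simp_all add: al_def tsc_def fun_eq_iff algebra_simps sum.distrib sum_distrib_left)
  have al_diff: "al \<gamma> (F - G) = al \<gamma> F - al \<gamma> G" for \<gamma> F G
    by (simp add: al_def fun_eq_iff algebra_simps sum_subtractf)
  have al_0: "al \<gamma> 0 = 0" for \<gamma> by (simp add: al_def fun_eq_iff)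
  have al_sum: "al \<gamma> (sum f I) = (\<Sum>i\<in>I. al \<gamma> (f i))" for \<gamma> f and I :: "nat set"
    by (induction I rule: infinite_finite_induct) (simp_all only: sum.infinite sum.empty sum.insert al_0 al_add not_False_eq_True)
  have al_slot: "al \<gamma> (slot n r X F) = slot n r X (al \<gamma> F)" if "r < M" for \<gamma> r X F
    using that by (intro ext) (simp add: slot_def al_def sum_distrib_left, subst sum.swap, simp add: fun_upd_twist mult.left_commute)
  have al_W: "al \<gamma> (tw.W n j0 c X F) = tw.W n j0 c X (al \<gamma> F)" for \<gamma> X F
  proof -
    have x: "al \<gamma> (xop j0 a F) = xop j0 a (al \<gamma> F)" for a F
      by (intro ext) (simp add: xop_def al_def sum_distrib_left mult.left_commute)
    have d: "al \<gamma> (dop j0 c a F) = dop j0 c a (al \<gamma> F)" for a F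
      by (intro ext) (simp add: dop_def al_def sum_distrib_left mult.left_commute)
    show ?thesis unfolding tw.W_def by (simp add: x d al_sum al_sc)
  qed
  have al_T: "al \<gamma> (?T X F) = ?T X (al \<gamma> F)" for \<gamma> X F
    by (simp add: tact'_def al_add al_W al_sum al_slot)
  have T0: "?T X 0 = 0" for X using tact'_sc [of n j0 c M X 0 0] by simp
  have st: "slot n M (rk n v \<gamma>) F = (\<lambda>t k. (if t M \<le> n then v (t M) else 0) * al \<gamma> F t k)" for v \<gamma> F
    by (intro ext) (simp add: slot_def rk_def al_def sum_distrib_left mult.assoc)
  have st_0: "slot n M (rk n v \<gamma>) F = 0" if "al \<gamma> F = 0" for v \<gamma> F
    unfolding st that by (simp add: fun_eq_iff)
  have al_st: "al \<delta> (slot n M (rk n v \<gamma>) F) = tsc (\<Sum>i\<le>n. \<delta> i * v i) (al \<gamma> F)" for \<delta> v \<gamma> F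
    unfolding st by (intro ext) (simp add: al_def tsc_def sum_distrib_right mult.assoc)
  interpret tensor_step tsc "?T (rk n y \<alpha>)" "?T (rk n z \<beta>)" "?T (rk n z \<alpha>)" "?T (rk n y \<beta>)"
    "slot n M (rk n y \<alpha>)" "slot n M (rk n z \<beta>)" "slot n M (rk n z \<alpha>)" "slot n M (rk n y \<beta>)" F1 F2
  proof (unfold_locales, goal_cases)
    case 7 show ?case by (auto simp: F1_def ts.subspace_def al_add al_sc al_0)
  next
    case 8 show ?case by (auto simp: F2_def ts.subspace_def al_add al_sc al_0)
  qed (auto simp: F1_def F2_def tact'_add slot_add al_T T0 al_st dual al_diff st_0)
  have D: "D s F = tD n j0 c M y z \<alpha> \<beta> s F" for s F by (simp add: D_def tD_def)
  have D': "D' s F = tD n j0 c (Suc M) y z \<alpha> \<beta> s F" for s F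
    by (simp add: D'_def tD_def tact'_def add.assoc)
  have "foldr (tD n j0 c (Suc M) y z \<alpha> \<beta>) (cs @ map (\<lambda>s. s + 1) cs @ cs) F = 0" for F
    using D'_kill [of cs F] cs(2) unfolding D [abs_def] D' [abs_def] .
  thus ?case using cs(1) by blast
qed

text \<open>Fixing the total exponent makes the identity matrix act by a scalar. This allows
  \<open>rk n y \<beta>\<close>, which has trace 1, to be replaced by its traceless part.\<close>

definition tV :: "nat \<Rightarrow> nat \<Rightarrow> int \<Rightarrow> tens set" where
  "tV n M K = {F. \<forall>t k. F t k \<noteq> 0 \<longrightarrow> (\<forall>r<M. t r \<le> n) \<and> (\<Sum>a\<le>n. k a) = K}"

lemma tens_subspace: "ts.subspace {F. \<forall>t k. F t k \<noteq> 0 \<longrightarrow> P t k}" (is "ts.subspace ?S")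
  unfolding ts.subspace_def
proof (intro conjI ballI allI)
  show "0 \<in> ?S" by simp
  fix F assume F: "F \<in> ?S"
  show "tsc s F \<in> ?S" for s using F by (simp add: tsc_def)
  fix G assume G: "G \<in> ?S"
  show "F + G \<in> ?S"
  proof (intro CollectI allI impI)
    fix t k assume nz: "(F + G) t k \<noteq> 0"
    show "P t k"
    proof (cases "F t k = 0")
      case True
      hence "G t k \<noteq> 0" using nz by simp
      thus ?thesis using G by blast
    next
      case False
      thus ?thesis using F by blast
    qed
  qed
qed

lemmas tV_subspace = tens_subspace [where P = "\<lambda>t k. (\<forall>r<M. t r \<le> n) \<and> (\<Sum>a\<le>n. k a) = K" for n M K, folded tV_def]

lemma sum_fun_upd:
  fixes k :: "nat \<Rightarrow> int"
  assumes "a \<le> n" shows "(\<Sum>i\<le>n. (k(a := z)) i) = (\<Sum>i\<le>n. k i) - k a + z"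
  using assms by (subst (1 2) sum.remove [of _ a]) (auto intro!: sum.cong)

lemma tV_xd:
  assumes F: "F \<in> tV n M K" and ab: "a \<le> n" "b \<le> n"
  shows "xop j0 a (dop j0 c b F) \<in> tV n M K"
  unfolding tV_def
proof (intro CollectI allI impI)
  fix t k assume "xop j0 a (dop j0 c b F) t k \<noteq> 0"
  hence "F t ((k(a := k a - 1))(b := (k(a := k a - 1)) b + 1)) \<noteq> 0" by (auto simp: xop_def dop_def)
  hence "(\<forall>r<M. t r \<le> n) \<and> (\<Sum>i\<le>n. ((k(a := k a - 1))(b := (k(a := k a - 1)) b + 1)) i) = K"
    using F unfolding tV_def by blast
  thus "(\<forall>r<M. t r \<le> n) \<and> sum k {..n} = K" unfolding sum_fun_upd [OF ab(2)] sum_fun_upd [OF ab(1)] by simp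
qed

lemma tV_slot:
  assumes F: "F \<in> tV n M K" and X: "supp_mat n X"
  shows "slot n r X F \<in> tV n M K"
  unfolding tV_def
proof (intro CollectI allI impI)
  fix t k assume nz: "slot n r X F t k \<noteq> 0"
  then obtain j where j: "X (t r) j * F (t(r := j)) k \<noteq> 0" unfolding slot_def by (metis (mono_tags, lifting) sum.neutral)
  hence "t r \<le> n" using X by (auto simp: supp_mat_def not_less [symmetric])
  moreover have "F (t(r := j)) k \<noteq> 0" using j by simp
  hence "(\<forall>r'<M. (t(r := j)) r' \<le> n) \<and> sum k {..n} = K" using F unfolding tV_def by blast
  ultimately show "(\<forall>r<M. t r \<le> n) \<and> sum k {..n} = K" by (metis fun_upd_apply)
qed

lemma tV_tact':
  assumes F: "F \<in> tV n M K" and X: "supp_mat n X"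
  shows "tact' n j0 c M X F \<in> tV n M K"
  unfolding tact'_def tw.W_def
  by (intro ts.subspace_add [OF tV_subspace] ts.subspace_sum [OF tV_subspace] ts.subspace_scale [OF tV_subspace] tV_xd tV_slot F X)
    auto

lemma slrep_tV: "slrep tsc n (tV n M K) (tact' n j0 c M)"
  by (rule slrep_tact' [OF tV_subspace]) (simp add: tV_tact' sl_def)

text \<open>The Euler operator: each x_a d_a reads off an exponent, index \<open>j0\<close>
  contributes \<open>c\<close> in addition, and every tensor factor contributes 1.\<close>

lemma tact'_idm:
  assumes F: "F \<in> tV n M K" and j0: "j0 \<le> n"
  shows "tact' n j0 c M (idm n) F = tsc (of_int K + c + of_nat M) F"
proof (intro ext)
  fix t k
  show "tact' n j0 c M (idm n) F t k = tsc (of_int K + c + of_nat M) F t k"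
  proof (cases "F t k = 0")
    case True
    have "tw.W n j0 c (idm n) F t k = (\<Sum>a\<le>n. \<Sum>b\<le>n. if a = b then xop j0 a (dop j0 c a F) t k else 0)"
      unfolding tw.W_def sum_fun_apply by (intro sum.cong refl) (auto simp: idm_def tsc_def)
    also have "\<dots> = 0" using True by (simp add: xop_def dop_def)
    finally have "tw.W n j0 c (idm n) F t k = 0" .
    moreover have "slot n r (idm n) F t k = 0" for r
      using True unfolding slot_def idm_def by (intro sum.neutral) auto
    ultimately show ?thesis using True by (simp add: tact'_def tsc_def sum_fun_apply)
  next
    case False
    hence h: "\<forall>r<M. t r \<le> n" "sum k {..n} = K" using F by (auto simp: tV_def)
    have "tw.W n j0 c (idm n) F t k = (\<Sum>a\<le>n. \<Sum>b\<le>n. if a = b then xop j0 a (dop j0 c a F) t k else 0)"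
      unfolding tw.W_def sum_fun_apply by (intro sum.cong refl) (auto simp: idm_def tsc_def)
    also have "\<dots> = (\<Sum>a\<le>n. (of_int (k a) + (if a = j0 then c else 0)) * F t k)"
      by (rule sum.cong) (auto simp: xop_def dop_def)
    also have "\<dots> = (of_int K + c) * F t k"
      using j0 by (simp add: sum_distrib_right [symmetric] sum.distrib of_int_sum [symmetric] h(2) del: of_int_sum)
    finally have 1: "tw.W n j0 c (idm n) F t k = (of_int K + c) * F t k" .
    have "slot n r (idm n) F t k = F t k" if "r < M" for r
    proof -
      have "slot n r (idm n) F t k = (\<Sum>j\<le>n. if t r = j then F t k else 0)"
        unfolding slot_def idm_def by (rule sum.cong) auto
      thus ?thesis using h(1) that by simp
    qed
    hence 2: "(\<Sum>r<M. slot n r (idm n) F) t k = of_nat M * F t k" by (simp add: sum_fun_apply)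
    show ?thesis using 1 2 by (simp add: tact'_def tsc_def algebra_simps)
  qed
qed

section \<open>Multiplicativity of symbols and the upper bound for the variety\<close>

lemma symb_append: "symb d (e @ f) \<xi> = symb d e \<xi> + symb d f \<xi>"
  by (simp add: symb_def)

lemma symb_tmul_aux:
  assumes "length w \<le> d1" "\<forall>t\<in>set f. length (snd t) \<le> d2"
  shows "symb (d1 + d2) (map (\<lambda>t. (s * fst t, w @ snd t)) f) \<xi>
    = (if length w = d1 then s * prod_list (map \<xi> w) else 0) * symb d2 f \<xi>"
  using assms by (induction f) (auto simp: symb_def algebra_simps)

lemma symb_tmul:
  assumes "\<forall>t\<in>set e. length (snd t) \<le> d1" "\<forall>t\<in>set f. length (snd t) \<le> d2"
  shows "symb (d1 + d2) (tmul e f) \<xi> = symb d1 e \<xi> * symb d2 f \<xi>"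
    and "\<forall>t\<in>set (tmul e f). length (snd t) \<le> d1 + d2"
proof -
  show "symb (d1 + d2) (tmul e f) \<xi> = symb d1 e \<xi> * symb d2 f \<xi>"
    using assms(1)
  proof (induction e)
    case (Cons t e)
    have "tmul (t # e) f = map (\<lambda>u. (fst t * fst u, snd t @ snd u)) f @ tmul e f" by (simp add: tmul_def)
    moreover have "symb d1 (t # e) \<xi> = (if length (snd t) = d1 then fst t * prod_list (map \<xi> (snd t)) else 0) + symb d1 e \<xi>"
      by (simp add: symb_def)
    ultimately show ?case using Cons assms(2) by (simp add: symb_append symb_tmul_aux distrib_right)
  qed (simp add: tmul_def symb_def)
  show "\<forall>t\<in>set (tmul e f). length (snd t) \<le> d1 + d2"
    using assms by (fastforce simp: tmul_def intro: add_mono)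
qed

lemma gdual_sum:
  assumes \<xi>: "\<xi> \<in> gdual n" and Y: "\<And>x. x \<in> A \<Longrightarrow> Y x \<in> sl n"
  shows "(\<lambda>i j. \<Sum>x\<in>A. s x * Y x i j) \<in> sl n \<and> \<xi> (\<lambda>i j. \<Sum>x\<in>A. s x * Y x i j) = (\<Sum>x\<in>A. s x * \<xi> (Y x))"
proof -
  have lin: "\<xi> (mlin a X b Z) = a * \<xi> X + b * \<xi> Z" if "X \<in> sl n" "Z \<in> sl n" for X Z a b
    using \<xi> that by (auto simp: gdual_def)
  have 0: "(\<lambda>i j. 0) \<in> sl n" by (simp add: sl_def supp_mat_def mtrace_def)
  have "\<xi> (\<lambda>i j. 0) = 0" using lin [OF 0 0, of 0 0] by (simp add: mlin_def)
  with 0 have base: "(\<lambda>i j. 0) \<in> sl n \<and> \<xi> (\<lambda>i j. 0) = 0" by blast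
  show ?thesis
    using Y
  proof (induction A rule: infinite_finite_induct)
    case (insert x A)
    have e: "(\<lambda>i j. \<Sum>x\<in>insert x A. s x * Y x i j) = mlin (s x) (Y x) 1 (\<lambda>i j. \<Sum>x\<in>A. s x * Y x i j)"
      using insert.hyps by (simp add: mlin_def fun_eq_iff)
    have "Y x \<in> sl n" "(\<lambda>i j. \<Sum>x\<in>A. s x * Y x i j) \<in> sl n"
      "\<xi> (\<lambda>i j. \<Sum>x\<in>A. s x * Y x i j) = (\<Sum>x\<in>A. s x * \<xi> (Y x))" using insert by auto
    thus ?case unfolding e using lin insert.hyps by simp
  qed (use base in simp_all)
qed

lemma killing_sum: "killing n X Y = 2 * of_nat (n + 1) * (\<Sum>i\<le>n. \<Sum>k\<le>n. X i k * Y k i)"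
proof -
  have "mtrace n (mmul n X Y) = (\<Sum>i\<le>n. \<Sum>k\<le>n. X i k * Y k i)" unfolding mtrace_def mmul_def by (rule sum.cong) auto
  thus ?thesis by (simp add: killing_def)
qed

text \<open>The matrix is read off from the values of \<xi> on the letters \<open>etl\<close>; it is
  traceless because the diagonal letters add up to zero.\<close>

lemma gdual_killing:
  assumes \<xi>: "\<xi> \<in> gdual n"
  obtains X where "X \<in> sl n" "\<xi> = killing_dual n X"
proof
  define X where "X = (\<lambda>i j. if i \<le> n \<and> j \<le> n then \<xi> (etl n j i) / (2 * of_nat (n + 1)) else 0)"
  have z: "(\<lambda>i j. \<Sum>x\<le>n. 1 * etl n x x i j) = (\<lambda>i j. 0)"
  proof (intro ext)
    fix i j
    have N: "1 + complex_of_nat n \<noteq> 0" by (metis of_nat_Suc of_nat_neq_0)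
    have "(\<Sum>x\<le>n. 1 * etl n x x i j) = (\<Sum>x\<le>n. emat x x i j) - idm n i j"
      using N by (simp add: etl_def sum_subtractf)
    also have "(\<Sum>x\<le>n. emat x x i j) = (\<Sum>x\<le>n. if x = i then (if i = j then 1 else 0) else 0)"
      by (rule sum.cong) (auto simp: emat_def)
    also have "\<dots> - idm n i j = 0"
      by (auto simp: idm_def)
    finally show "(\<Sum>x\<le>n. 1 * etl n x x i j) = 0" .
  qed
  have "(\<Sum>x\<le>n. 1 * \<xi> (etl n x x)) = \<xi> (\<lambda>i j. 0)"
    using gdual_sum [OF \<xi>, of "{..n}" "\<lambda>x. etl n x x" "\<lambda>_. 1"] unfolding z by simp
  also have "\<xi> (\<lambda>i j. 0) = 0" using gdual_sum [OF \<xi>, of "{}" "\<lambda>_. undefined"] by simp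
  finally have "(\<Sum>x\<le>n. \<xi> (etl n x x)) = 0" by simp
  thus "X \<in> sl n"
    by (auto simp: sl_def supp_mat_def mtrace_def X_def sum_divide_distrib [symmetric] simp del: of_nat_add of_nat_Suc)
  show "\<xi> = killing_dual n X"
  proof
    fix Y show "\<xi> Y = killing_dual n X Y"
    proof (cases "Y \<in> sl n")
      case True
      have "\<xi> Y = \<xi> (\<lambda>i j. \<Sum>p\<in>{..n} \<times> {..n}. Y (fst p) (snd p) * etl n (fst p) (snd p) i j)"
        by (rule arg_cong [where f = \<xi>]) (rule sl_expand [OF True])
      also have "\<dots> = (\<Sum>p\<in>{..n} \<times> {..n}. Y (fst p) (snd p) * \<xi> (etl n (fst p) (snd p)))"
        using gdual_sum [OF \<xi>, of "{..n} \<times> {..n}" "\<lambda>p. etl n (fst p) (snd p)"] by auto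
      also have "\<dots> = (\<Sum>k\<le>n. \<Sum>i\<le>n. 2 * of_nat (n + 1) * (X i k * Y k i))"
        unfolding sum.cartesian_product by (rule sum.cong) (auto simp: X_def simp del: of_nat_add of_nat_Suc)
      also have "\<dots> = killing n X Y" unfolding killing_sum sum_distrib_left by (rule sum.swap)
      finally show ?thesis using True by (simp add: killing_dual_def)
    qed (use \<xi> in \<open>simp add: gdual_def killing_dual_def\<close>)
  qed
qed

lemma rk_sl: "(\<Sum>i\<le>n. \<alpha> i * v i) = 0 \<Longrightarrow> rk n v \<alpha> \<in> sl n"
  by (auto simp: sl_def supp_mat_def rk_def mtrace_def mult.commute)

lemma killing_rk_right: "killing n X (rk n v \<alpha>) = 2 * of_nat (n + 1) * qf n X v \<alpha>"
  unfolding killing_def mtrace_mmul_comm [of n X] killing_rk [unfolded killing_def, symmetric] ..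

text \<open>A product of shifted minors kills the model, and its symbol is a power of the unshifted
  minor. Every point of the variety is therefore a zero of these minors, and
  \<open>quadric_minors\<close> extends this to all coordinate minors.\<close>

lemma assoc_var_upper_bound:
  assumes n: "2 \<le> n" and j0: "j0 \<le> n"
    and hw: "hwrep tsc n (tV n M K) (tact' n j0 c M) v (epsc n \<mu>)"
  shows "assoc_var n \<mu> \<subseteq> killing_dual n ` closure (Omin n)"
proof
  fix \<xi> assume xi: "\<xi> \<in> assoc_var n \<mu>"
  hence gd: "\<xi> \<in> gdual n" by (simp add: assoc_var_def)
  then obtain X where X: "X \<in> sl n" "\<xi> = killing_dual n X" by (rule gdual_killing)
  interpret slrep tsc n "tV n M K" "tact' n j0 c M" by (rule slrep_tV)
  have "qf n X y \<alpha> * qf n X z \<beta> = qf n X z \<alpha> * qf n X y \<beta>"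
    if dual: "(\<Sum>i\<le>n. \<alpha> i * y i) = 0" "(\<Sum>i\<le>n. \<alpha> i * z i) = 0" "(\<Sum>i\<le>n. \<beta> i * z i) = 0" "(\<Sum>i\<le>n. \<beta> i * y i) = 1"
    for y z \<alpha> \<beta>
  proof -
    define N where "N = (of_nat (n + 1) :: complex)"
    have N: "N \<noteq> 0" unfolding N_def using of_nat_neq_0 [of n, where 'a = complex] by simp
    \<comment> \<open>Three of the rank one matrices are traceless by the orthogonality relations;
      from \<open>rk n y \<beta>\<close>, of trace 1, the multiple 1 / (n + 1) of the identity is
      subtracted.\<close>
    define A B C H where "A = rk n y \<alpha>" and "B = rk n z \<beta>" and "C = rk n z \<alpha>"
      and "H = mlin 1 (rk n y \<beta>) (- (1 / N)) (idm n)"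
    have sl: "A \<in> sl n" "B \<in> sl n" "C \<in> sl n"
      using dual by (auto simp: A_def B_def C_def H_def rk_sl)
    have Hsl: "H \<in> sl n"
    proof -
      have "mtrace n H = (\<Sum>i\<le>n. \<beta> i * y i) - (\<Sum>i\<le>n. 1 / N)"
        by (simp add: mtrace_def A_def B_def C_def H_def mlin_def rk_def idm_def sum_subtractf mult.commute)
      also have "\<dots> = 0" using dual(4) N by (simp add: N_def add.commute)
      finally show ?thesis by (auto simp: sl_def supp_mat_def A_def B_def C_def H_def mlin_def rk_def idm_def)
    qed
    define \<kappa> where "\<kappa> = (of_int K + c + of_nat M) / N"
    \<comment> \<open>On the model \<open>H\<close> acts as \<open>rk n y \<beta>\<close> minus the
      scalar \<open>\<kappa>\<close>, so this expression acts as \<open>tD\<close> with parameter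
      \<open>s\<close>. The shift sits in a word of length 1 and does not reach the symbol of degree
      2.\<close>
    define ex where "ex s = [(1, [A, B]), (- 1, [C, H]), (s - \<kappa>, [C])]" for s
    have tex: "texpr_in n (ex s)" for s
      using sl Hsl by (simp add: ex_def texpr_in_def)
    have ta_ex: "ta (ex s) F = tD n j0 c M y z \<alpha> \<beta> s F" if F: "F \<in> tV n M K" for s F
    proof -
      have "tact' n j0 c M H F = tact' n j0 c M (rk n y \<beta>) F - tsc \<kappa> F"
        unfolding A_def B_def C_def H_def tact'_mlin tact'_idm [OF F j0] by (simp add: \<kappa>_def tsc_def fun_eq_iff)
      hence h: "tact' n j0 c M (rk n y \<beta>) F = tact' n j0 c M H F + tsc \<kappa> F" by simp
      have "tact' n j0 c M (rk n y \<beta>) F - tsc s F = tact' n j0 c M H F + tsc (\<kappa> - s) F"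
        unfolding h by (simp add: tsc_def fun_eq_iff algebra_simps)
      thus ?thesis unfolding tD_def ex_def ta_def
        by (simp add: A_def B_def C_def H_def tact'_add tact'_sc) (simp add: tsc_def fun_eq_iff algebra_simps)
    qed
    obtain cs where cs: "\<And>F. foldr (tD n j0 c M y z \<alpha> \<beta>) cs F = 0"
      using tD_nilpotent [OF dual] by blast
    define e where "e ss = foldr (\<lambda>s. tmul (ex s)) ss [(1, [])]" for ss
    have e: "texpr_in n (e ss) \<and> (\<forall>F\<in>tV n M K. ta (e ss) F = foldr (tD n j0 c M y z \<alpha> \<beta>) ss F)" for ss
    proof (induction ss)
      case Nil
      show ?case by (auto simp: e_def ta_def texpr_in_def)
    next
      case (Cons s ss)
      have es: "e (s # ss) = tmul (ex s) (e ss)" by (simp add: e_def)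
      have "ta (e (s # ss)) F = foldr (tD n j0 c M y z \<alpha> \<beta>) (s # ss) F" if F: "F \<in> tV n M K" for F
        unfolding es using Cons tex F ta_V [of "e ss" F] ta_ex [of "ta (e ss) F" s] by (simp add: ta_tmul)
      thus ?case unfolding es using Cons tex by (simp add: texpr_in_tmul)
    qed
    have ann: "e cs \<in> annT n \<mu>"
      by (rule annT_of_model [OF hw]) (use e [of cs] cs in auto)
    have len: "(\<forall>t\<in>set (e ss). length (snd t) \<le> 2 * length ss)
        \<and> symb (2 * length ss) (e ss) \<xi> = (\<xi> A * \<xi> B - \<xi> C * \<xi> H) ^ length ss" for ss
    proof (induction ss)
      case Nil
      show ?case by (simp add: e_def symb_def)
    next
      case (Cons s ss)
      have es: "e (s # ss) = tmul (ex s) (e ss)" by (simp add: e_def)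
      have l: "\<forall>t\<in>set (ex s). length (snd t) \<le> 2" by (simp add: ex_def)
      have s: "symb 2 (ex s) \<xi> = \<xi> A * \<xi> B - \<xi> C * \<xi> H" by (simp add: ex_def symb_def)
      show ?case
        using symb_tmul(1) [OF l conjunct1 [OF Cons], of \<xi>] symb_tmul(2) [OF l conjunct1 [OF Cons]] Cons unfolding es by (simp add: s)
    qed
    have "symb (2 * length cs) (e cs) \<xi> = 0"
      using xi ann conjunct1 [OF len [of cs]] unfolding assoc_var_def by blast
    hence "(\<xi> A * \<xi> B - \<xi> C * \<xi> H) ^ length cs = 0" using conjunct2 [OF len [of cs]] by simp
    hence q: "\<xi> A * \<xi> B = \<xi> C * \<xi> H" by simp
    have HH: "killing n X H = killing n X (rk n y \<beta>)"
    proof -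
      have "(\<Sum>i\<le>n. \<Sum>k\<le>n. X i k * idm n k i) = (\<Sum>i\<le>n. \<Sum>k\<le>n. if k = i then X i i else 0)"
        by (intro sum.cong refl) (auto simp: idm_def)
      also have "\<dots> = 0" using X(1) by (simp add: sl_def mtrace_def)
      finally have "(\<Sum>i\<le>n. \<Sum>k\<le>n. X i k * idm n k i) = 0" .
      thus ?thesis unfolding killing_sum A_def B_def C_def H_def mlin_def
        by (simp add: distrib_left right_diff_distrib sum_subtractf sum.distrib sum_divide_distrib [symmetric])
    qed
    have kr: "killing n X (rk n v \<gamma>) = 2 * N * qf n X v \<gamma>" for v \<gamma>
      unfolding N_def by (rule killing_rk_right)
    have "\<xi> A = 2 * N * qf n X y \<alpha>" "\<xi> B = 2 * N * qf n X z \<beta>" "\<xi> C = 2 * N * qf n X z \<alpha>" "\<xi> H = 2 * N * qf n X y \<beta>"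
      unfolding X(2) killing_dual_def using sl Hsl HH kr by (simp_all only: if_True A_def B_def C_def)
    with q have "2 * N * qf n X y \<alpha> * (2 * N * qf n X z \<beta>) = 2 * N * qf n X z \<alpha> * (2 * N * qf n X y \<beta>)" by simp
    hence "(2 * N) ^ 2 * (qf n X y \<alpha> * qf n X z \<beta>) = (2 * N) ^ 2 * (qf n X z \<alpha> * qf n X y \<beta>)"
      by (simp only: power2_eq_square mult_ac)
    thus ?thesis using N by simp
  qed
  hence "X a b * X c d = X a d * X c b" for a b c d by (rule quadric_minors [OF n X(1)])
  thus "\<xi> \<in> killing_dual n ` closure (Omin n)"
    using X by (auto simp: closure_Omin_iff [OF n])
qed

section \<open>Tensor powers of the vector representation\<close>

definition tV0 :: "nat \<Rightarrow> nat \<Rightarrow> tens set" where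
  "tV0 n M = {F. \<forall>t k. F t k \<noteq> 0 \<longrightarrow> (\<forall>r<M. t r \<le> n) \<and> k = (\<lambda>_. 0)}"

lemmas tV0_subspace = tens_subspace [where P = "\<lambda>t k. (\<forall>r<M. t r \<le> n) \<and> k = (\<lambda>_. 0)" for n M, folded tV0_def]

text \<open>The derivations kill the constant monomial, so only the tensor factors are acted
  on.\<close>

lemma W_tV0:
  assumes F: "\<And>t k. F t k \<noteq> 0 \<Longrightarrow> k = (\<lambda>_. 0)"
  shows "tw.W n 0 0 X F = 0"
proof -
  have "xop 0 a (dop 0 0 b F) t k = 0" for a b t k
  proof (cases "F t ((k(a := k a - 1))(b := (k(a := k a - 1)) b + 1)) = 0")
    case False
    from F [OF this] have "((k(a := k a - 1))(b := (k(a := k a - 1)) b + 1)) b = 0" by metis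
    hence z: "(k(a := k a - 1)) b + 1 = 0" by simp
    have "complex_of_int ((k(a := k a - 1)) b + 1) = 0" unfolding z by simp
    thus ?thesis unfolding xop_def dop_def by simp
  qed (simp add: xop_def dop_def)
  hence "xop 0 a (dop 0 0 b F) = 0" for a b by (simp add: fun_eq_iff)
  thus ?thesis by (simp add: tw.W_def)
qed

lemma slrep_tV0: "slrep tsc n (tV0 n M) (tact' n 0 0 M)"
proof (rule slrep_tact' [OF tV0_subspace])
  fix X F assume X: "X \<in> sl n" and F: "F \<in> tV0 n M"
  have "slot n r X F \<in> tV0 n M" for r
    unfolding tV0_def
  proof (intro CollectI allI impI)
    fix t k assume nz: "slot n r X F t k \<noteq> 0"
    then obtain j where j: "X (t r) j * F (t(r := j)) k \<noteq> 0" unfolding slot_def by (metis (mono_tags, lifting) sum.neutral)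
    hence "t r \<le> n" using X by (auto simp: sl_def supp_mat_def not_less [symmetric])
    moreover have "F (t(r := j)) k \<noteq> 0" using j by simp
    hence "(\<forall>r'<M. (t(r := j)) r' \<le> n) \<and> k = (\<lambda>_. 0)" using F unfolding tV0_def by blast
    ultimately show "(\<forall>r<M. t r \<le> n) \<and> k = (\<lambda>_. 0)" by (metis fun_upd_apply)
  qed
  moreover have "tw.W n 0 0 X F = 0" by (rule W_tV0) (use F in \<open>auto simp: tV0_def\<close>)
  ultimately show "tact' n 0 0 M X F \<in> tV0 n M"
    unfolding tact'_def by (auto intro!: ts.subspace_sum [OF tV0_subspace])
qed

text \<open>E_10 turns one tensor index 0 into 1, so its power M + 1 kills a tensor with M factors.
  The symbol of that power is nonzero at the point of the minimal orbit given by E_01.\<close>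

lemma assoc_var_integral:
  assumes n: "2 \<le> n" and hw: "hwrep tsc n (tV0 n M) (tact' n 0 0 M) v (epsc n \<mu>)"
  shows "assoc_var n \<mu> \<noteq> killing_dual n ` closure (Omin n)"
proof
  assume eq: "assoc_var n \<mu> = killing_dual n ` closure (Omin n)"
  interpret slrep tsc n "tV0 n M" "tact' n 0 0 M" by (rule slrep_tV0)
  let ?f = "tact' n 0 0 M (emat 1 0)"
  have count: "(\<forall>t k. (?f ^^ s) F t k \<noteq> 0 \<longrightarrow> s \<le> card {r. r < M \<and> t r = 1})" and inV: "(?f ^^ s) F \<in> tV0 n M"
    if F: "F \<in> tV0 n M" for F s
  proof (induction s)
    case 0
    show "\<forall>t k. (?f ^^ 0) F t k \<noteq> 0 \<longrightarrow> 0 \<le> card {r. r < M \<and> t r = 1}" "(?f ^^ 0) F \<in> tV0 n M" using F by auto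
  next
    case (Suc s)
    let ?G = "(?f ^^ s) F"
    show "(?f ^^ Suc s) F \<in> tV0 n M" using Suc n by simp
    have "tw.W n 0 0 (emat 1 0) ?G = 0" by (rule W_tV0) (use Suc(2) in \<open>auto simp: tV0_def\<close>)
    hence G: "(?f ^^ Suc s) F = (\<Sum>r<M. slot n r (emat 1 0) ?G)" by (simp add: tact'_def)
    show "\<forall>t k. (?f ^^ Suc s) F t k \<noteq> 0 \<longrightarrow> Suc s \<le> card {r. r < M \<and> t r = 1}"
    proof (intro allI impI)
      fix t k assume "(?f ^^ Suc s) F t k \<noteq> 0"
      then obtain r where r: "r < M" "slot n r (emat 1 0) ?G t k \<noteq> 0"
        unfolding G sum_fun_apply by (metis (mono_tags, lifting) lessThan_iff sum.neutral)
      then obtain j where j: "emat 1 0 (t r) j * ?G (t(r := j)) k \<noteq> 0" unfolding slot_def by (metis (mono_tags, lifting) sum.neutral)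
      hence tr: "t r = 1" "j = 0" "?G (t(r := j)) k \<noteq> 0" by (auto simp: emat_def split: if_splits)
      have "s \<le> card {r'. r' < M \<and> (t(r := j)) r' = 1}" using Suc(1) tr(3) by blast
      also have "{r'. r' < M \<and> (t(r := j)) r' = 1} = {r'. r' < M \<and> t r' = 1} - {r}" using tr by auto
      also have "card \<dots> < card {r'. r' < M \<and> t r' = 1}" by (rule card_Diff1_less) (use r tr in auto)
      finally show "Suc s \<le> card {r. r < M \<and> t r = 1}" by simp
    qed
  qed
  define e :: texpr where "e = [(1, replicate (M + 1) (emat 1 0))]"
  have "(?f ^^ (M + 1)) F = 0" if F: "F \<in> tV0 n M" for F
  proof -
    have "(?f ^^ (M + 1)) F t k = 0" for t k
    proof (rule ccontr)
      assume "(?f ^^ (M + 1)) F t k \<noteq> 0"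
      hence "M + 1 \<le> card {r. r < M \<and> t r = 1}" using count [OF F] by blast
      also have "\<dots> \<le> card {..<M}" by (rule card_mono) auto
      finally show False by simp
    qed
    thus ?thesis by (simp add: fun_eq_iff)
  qed
  hence "e \<in> annT n \<mu>"
    using n by (intro annT_of_model [OF hw]) (auto simp: e_def texpr_in_def ta_def foldr_replicate)
  moreover have "killing_dual n (rk n (unitv 0) (unitv 1)) \<in> assoc_var n \<mu>"
    unfolding eq using emat01_Omin [of n] n closure_subset [of "Omin n"] by auto
  ultimately have "symb (M + 1) e (killing_dual n (rk n (unitv 0) (unitv 1))) = 0"
    unfolding assoc_var_def by (auto simp: e_def)
  hence "killing_dual n (rk n (unitv 0) (unitv 1)) (emat 1 0) = 0"
    by (auto simp add: e_def symb_def)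
  thus False using n by (simp add: killing_dual_def killing_emat rk_def unitv_def del: of_nat_add of_nat_Suc)
qed

text \<open>The tensor \<open>e\<^sub>0 \<and> \<dots> \<and> e\<^sub>h\<^sub>-\<^sub>1\<close>.\<close>

definition perm_ext :: "nat \<Rightarrow> (nat \<Rightarrow> nat) \<Rightarrow> nat \<Rightarrow> nat" where
  "perm_ext h u = (\<lambda>i. if i < h then u i else i)"

definition wedge :: "nat \<Rightarrow> (nat \<Rightarrow> nat) \<Rightarrow> complex" where
  "wedge h u = (if perm_ext h u permutes {..<h} then of_int (sign (perm_ext h u)) else 0)"

lemma wedge_cong: "(\<And>i. i < h \<Longrightarrow> u i = w i) \<Longrightarrow> wedge h u = wedge h w"
proof -
  assume "\<And>i. i < h \<Longrightarrow> u i = w i"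
  hence "perm_ext h u = perm_ext h w" by (simp add: perm_ext_def fun_eq_iff)
  thus ?thesis by (simp add: wedge_def)
qed

lemma wedge_supp: "wedge h u \<noteq> 0 \<Longrightarrow> r < h \<Longrightarrow> u r < h"
proof -
  assume "wedge h u \<noteq> 0" and r: "r < h"
  hence "perm_ext h u permutes {..<h}" by (auto simp: wedge_def split: if_splits)
  from permutes_in_image [OF this, of r] r show ?thesis by (simp add: perm_ext_def)
qed

lemma wedge_id: "wedge h (\<lambda>i. i) = 1"
proof -
  have "perm_ext h (\<lambda>i. i) = id" by (auto simp: perm_ext_def)
  thus ?thesis by (simp add: wedge_def permutes_id)
qed

lemma wedge_swap:
  assumes "r < h" "r' < h" "r \<noteq> r'"
  shows "wedge h (u \<circ> Transposition.transpose r r') = - wedge h u"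
proof -
  let ?\<tau> = "Transposition.transpose r r'"
  have t: "?\<tau> permutes {..<h}" using assms by (intro permutes_swap_id) auto
  have e: "perm_ext h (u \<circ> ?\<tau>) = perm_ext h u \<circ> ?\<tau>"
    using assms by (auto simp: perm_ext_def fun_eq_iff Transposition.transpose_def)
  have e': "perm_ext h u = perm_ext h (u \<circ> ?\<tau>) \<circ> ?\<tau>" unfolding e by (simp add: comp_assoc)
  show ?thesis
  proof (cases "perm_ext h u permutes {..<h}")
    case True
    hence "perm_ext h (u \<circ> ?\<tau>) permutes {..<h}" unfolding e using t by (intro permutes_compose)
    moreover have "sign (perm_ext h u \<circ> ?\<tau>) = - sign (perm_ext h u)"
      using True t assms by (subst sign_compose) (auto simp: permutation_permutes sign_swap_id intro: permutation_swap_id)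
    ultimately show ?thesis using True by (simp add: wedge_def e)
  next
    case False
    hence "\<not> perm_ext h (u \<circ> ?\<tau>) permutes {..<h}" using e' permutes_compose [OF t] by metis
    thus ?thesis using False by (simp add: wedge_def)
  qed
qed

text \<open>Replacing a factor e_j by e_i with i < j repeats a factor. If a term is nonzero, then j
  < h, so i occurs at exactly two positions; their terms differ by a transposition and
  cancel.\<close>

lemma wedge_raise:
  assumes ij: "i < j"
  shows "(\<Sum>r<h. if u r = i then wedge h (u(r := j)) else 0) = 0"
proof (cases "\<exists>r<h. u r = i \<and> wedge h (u(r := j)) \<noteq> 0")
  case True
  then obtain r where r: "r < h" "u r = i" "wedge h (u(r := j)) \<noteq> 0" by blast
  let ?p = "perm_ext h (u(r := j))"
  have p: "?p permutes {..<h}" using r(3) by (auto simp: wedge_def split: if_splits)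
  have j: "j < h" using wedge_supp [OF r(3,1)] by simp
  hence "i \<in> ?p ` {..<h}" using permutes_image [OF p] ij by auto
  then obtain r' where r': "r' < h" "?p r' = i" by auto
  hence ne: "r' \<noteq> r" "u r' = i" using r(1) ij by (auto simp: perm_ext_def split: if_splits)
  have only: "u s \<noteq> i" if "s < h" "s \<noteq> r" "s \<noteq> r'" for s
  proof
    assume "u s = i"
    hence "?p s = ?p r'" using that r' ne by (simp add: perm_ext_def)
    thus False using permutes_inj [OF p] that by (auto dest: injD)
  qed
  have "(u(r := j)) \<circ> Transposition.transpose r r' = u(r' := j)"
    using ne r(2) by (auto simp: fun_eq_iff Transposition.transpose_def)
  hence "wedge h (u(r' := j)) = - wedge h (u(r := j))"
    using wedge_swap [of r h r' "u(r := j)"] r(1) r'(1) ne by simp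
  moreover have "(\<Sum>s<h. if u s = i then wedge h (u(s := j)) else 0)
      = (\<Sum>s\<in>{r, r'}. if u s = i then wedge h (u(s := j)) else 0)"
    by (rule sum.mono_neutral_right) (use r(1) r'(1) only in auto)
  ultimately show ?thesis using r(2) ne by simp
qed (auto intro: sum.neutral)

lemma wedge_weight: "(\<Sum>r<h. if u r = i then wedge h u else 0) = (if i < h then wedge h u else 0)"
proof (cases "wedge h u = 0")
  case False
  hence p: "perm_ext h u permutes {..<h}" by (auto simp: wedge_def split: if_splits)
  have "bij_betw u {..<h} {..<h}"
    using permutes_imp_bij [OF p] by (rule bij_betw_cong [THEN iffD1, rotated]) (simp add: perm_ext_def)
  hence "(\<Sum>r<h. if u r = i then wedge h u else 0) = (\<Sum>r<h. if r = i then wedge h u else 0)"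
    by (rule sum.reindex_bij_betw)
  thus ?thesis by simp
qed (auto intro: sum.neutral)

text \<open>The head of the list takes the positions from \<open>sum_list hs\<close> on, so the
  positions used by the tail are the same before and after the recursion step.\<close>

fun wedges :: "nat list \<Rightarrow> (nat \<Rightarrow> nat) \<Rightarrow> complex" where
  "wedges [] t = 1"
| "wedges (h # hs) t = wedge h (\<lambda>i. t (sum_list hs + i)) * wedges hs t"

lemma wedges_cong: "(\<And>i. i < sum_list hs \<Longrightarrow> t i = t' i) \<Longrightarrow> wedges hs t = wedges hs t'"
proof (induction hs)
  case (Cons h hs)
  have "wedge h (\<lambda>i. t (sum_list hs + i)) = wedge h (\<lambda>i. t' (sum_list hs + i))"
    by (rule wedge_cong) (simp add: Cons.prems)
  thus ?case using Cons by simp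
qed simp

lemma wedges_nonzero: "\<exists>t. wedges hs t \<noteq> 0"
proof (induction hs)
  case (Cons h hs)
  then obtain t where t: "wedges hs t \<noteq> 0" by blast
  let ?t = "\<lambda>r. if r < sum_list hs then t r else r - sum_list hs"
  have "wedges hs ?t = wedges hs t" by (rule wedges_cong) simp
  thus ?case using t by (intro exI [of _ ?t]) (simp add: wedge_id)
qed simp

lemma wedges_supp: "wedges hs t \<noteq> 0 \<Longrightarrow> (\<And>h. h \<in> set hs \<Longrightarrow> h \<le> n) \<Longrightarrow> r < sum_list hs \<Longrightarrow> t r < n"
proof (induction hs arbitrary: r)
  case (Cons h hs)
  show ?case
  proof (cases "r < sum_list hs")
    case False
    have "t (sum_list hs + (r - sum_list hs)) < h"
      by (rule wedge_supp [of h "\<lambda>i. t (sum_list hs + i)"]) (use Cons.prems False in auto)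
    thus ?thesis using False Cons.prems(2) [of h] by simp
  qed (use Cons in auto)
qed simp

lemma sum_shift: "(\<Sum>r<h + s. f r) = (\<Sum>r<s. f r) + (\<Sum>r<h. f (s + r))" for f :: "nat \<Rightarrow> complex"
  by (induction h) (auto simp: add_ac)

text \<open>The Leibniz rule for replacing one index, split according to whether the replaced
  position belongs to the tail or to the head.\<close>

lemma wedges_sum_Cons:
  "(\<Sum>r<sum_list (h # hs). if t r = i then wedges (h # hs) (t(r := j)) else 0)
   = wedge h (\<lambda>i. t (sum_list hs + i)) * (\<Sum>r<sum_list hs. if t r = i then wedges hs (t(r := j)) else 0)
   + wedges hs t * (\<Sum>r<h. if t (sum_list hs + r) = i then wedge h ((\<lambda>i. t (sum_list hs + i))(r := j)) else 0)"
proof -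
  let ?s = "sum_list hs"
  have 1: "wedge h (\<lambda>i. (t(r := j)) (?s + i)) = wedge h (\<lambda>i. t (?s + i))" if "r < ?s" for r
    by (rule wedge_cong) (use that in auto)
  have 2: "wedges hs (t(?s + r := j)) = wedges hs t" for r by (rule wedges_cong) simp
  have 3: "(\<lambda>i. (t(?s + r := j)) (?s + i)) = (\<lambda>i. t (?s + i))(r := j)" for r by (auto simp: fun_eq_iff)
  have "(\<Sum>r<sum_list (h # hs). if t r = i then wedges (h # hs) (t(r := j)) else 0)
    = (\<Sum>r<?s. if t r = i then wedges (h # hs) (t(r := j)) else 0)
      + (\<Sum>r<h. if t (?s + r) = i then wedges (h # hs) (t(?s + r := j)) else 0)"
    using sum_shift [of _ h ?s] by (simp del: wedges.simps)
  also have "(\<Sum>r<?s. if t r = i then wedges (h # hs) (t(r := j)) else 0)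
    = wedge h (\<lambda>i. t (?s + i)) * (\<Sum>r<?s. if t r = i then wedges hs (t(r := j)) else 0)"
    unfolding sum_distrib_left wedges.simps by (rule sum.cong [OF refl]) (use 1 in simp)
  also have "(\<Sum>r<h. if t (?s + r) = i then wedges (h # hs) (t(?s + r := j)) else 0)
    = wedges hs t * (\<Sum>r<h. if t (?s + r) = i then wedge h ((\<lambda>i. t (?s + i))(r := j)) else 0)"
    unfolding sum_distrib_left wedges.simps 2 3 by (rule sum.cong) simp_all
  finally show ?thesis .
qed

lemma wedges_raise:
  assumes "i < j" shows "(\<Sum>r<sum_list hs. if t r = i then wedges hs (t(r := j)) else 0) = 0"
proof (induction hs)
  case (Cons h hs)
  show ?case unfolding wedges_sum_Cons Cons using wedge_raise [OF assms] by simp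
qed simp

lemma wedges_weight:
  "(\<Sum>r<sum_list hs. if t r = i then wedges hs t else 0) = of_nat (length (filter (\<lambda>h. i < h) hs)) * wedges hs t"
proof -
  have "(\<Sum>r<sum_list hs. if t r = i then wedges hs (t(r := i)) else 0) = of_nat (length (filter (\<lambda>h. i < h) hs)) * wedges hs t"
  proof (induction hs)
    case (Cons h hs)
    have "(\<Sum>r<h. if t (sum_list hs + r) = i then wedge h ((\<lambda>i. t (sum_list hs + i))(r := i)) else 0)
      = (\<Sum>r<h. if t (sum_list hs + r) = i then wedge h (\<lambda>i. t (sum_list hs + i)) else 0)"
      by (rule sum.cong) (auto intro!: arg_cong [where f = "wedge h"])
    also have "\<dots> = (if i < h then wedge h (\<lambda>i. t (sum_list hs + i)) else 0)" by (rule wedge_weight)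
    finally show ?case unfolding wedges_sum_Cons Cons by (simp add: algebra_simps)
  qed simp
  thus ?thesis by (simp add: fun_upd_idem cong: if_cong)
qed

text \<open>The exponents of a highest weight monomial. For a < j0, raising exponent -1 to 0 meets
  the coefficient 0 of the rescaled \<open>xop\<close>; for j0 < b the exponent is 0 and the
  derivation gives 0. Every x_a d_b with a < b falls under one of these cases.\<close>

definition hwk :: "nat \<Rightarrow> nat \<Rightarrow> int" where "hwk j0 = (\<lambda>a. if a < j0 then - 1 else 0)"

definition hwv :: "nat \<Rightarrow> nat list \<Rightarrow> tens" where
  "hwv j0 hs = (\<lambda>t k. if k = hwk j0 then wedges hs t else 0)"

text \<open>The exponents contribute the first summand; the number of columns higher than
  \<open>i\<close> is the length of row \<open>i\<close> of the partition.\<close>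

definition hww :: "nat \<Rightarrow> complex \<Rightarrow> nat list \<Rightarrow> nat \<Rightarrow> complex" where
  "hww j0 c hs i = (if i < j0 then - 1 else if i = j0 then c else 0) + of_nat (length (filter (\<lambda>h. i < h) hs))"

lemma hwv_nonzero: "hwv j0 hs \<noteq> 0"
proof
  assume z: "hwv j0 hs = 0"
  obtain t where "wedges hs t \<noteq> 0" using wedges_nonzero by blast
  thus False using fun_cong [OF fun_cong [OF z, of t], of "hwk j0"] by (simp add: hwv_def)
qed

lemma slot_emat: "i \<le> n \<Longrightarrow> j \<le> n \<Longrightarrow> slot n r (emat i j) F t k = (if t r = i then F (t(r := j)) k else 0)"
proof -
  assume "i \<le> n" "j \<le> n"
  have "slot n r (emat i j) F t k = (\<Sum>l\<le>n. if l = j then (if t r = i then F (t(r := j)) k else 0) else 0)"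
    unfolding slot_def by (rule sum.cong) (auto simp: emat_def)
  thus ?thesis using \<open>j \<le> n\<close> by simp
qed

lemma hwv_raise:
  assumes ij: "i < j" "j \<le> n"
  shows "tact' n j0 c (sum_list hs) (emat i j) (hwv j0 hs) = 0"
proof -
  have "xop j0 a (dop j0 c b (hwv j0 hs)) = 0" if "a < b" for a b
  proof (intro ext)
    fix t k
    have "k a = hwk j0 a + 1 \<and> k b = hwk j0 b - 1" if "(k(a := k a - 1))(b := (k(a := k a - 1)) b + 1) = hwk j0"
      using fun_cong [OF that, of a] fun_cong [OF that, of b] \<open>a < b\<close> by auto
    thus "xop j0 a (dop j0 c b (hwv j0 hs)) t k = 0 t k"
      using that by (auto simp: xop_def dop_def hwv_def hwk_def)
  qed
  hence "tw.W n j0 c (emat i j) (hwv j0 hs) = 0"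
    using ij unfolding tw.W_def by (intro sum.neutral ballI) (auto simp: emat_def tsc_def fun_eq_iff)
  moreover have "(\<Sum>r<sum_list hs. slot n r (emat i j) (hwv j0 hs)) = 0"
  proof (intro ext)
    fix t k
    have "(\<Sum>r<sum_list hs. slot n r (emat i j) (hwv j0 hs)) t k
      = (if k = hwk j0 then \<Sum>r<sum_list hs. if t r = i then wedges hs (t(r := j)) else 0 else 0)"
      using ij by (simp add: sum_fun_apply slot_emat hwv_def cong: if_cong)
    thus "(\<Sum>r<sum_list hs. slot n r (emat i j) (hwv j0 hs)) t k = 0 t k" using wedges_raise [OF ij(1)] by simp
  qed
  ultimately show ?thesis by (simp add: tact'_def)
qed

lemma hwv_weight:
  assumes H: "H \<in> cartan n" and hs: "\<And>h. h \<in> set hs \<Longrightarrow> h \<le> n"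
  shows "tact' n j0 c (sum_list hs) H (hwv j0 hs) = tsc (\<Sum>j\<le>n. hww j0 c hs j * H j j) (hwv j0 hs)"
proof (intro ext)
  fix t k
  let ?v = "hwv j0 hs"
  have off: "H a b = 0" if "a \<noteq> b" for a b using H that by (simp add: cartan_def del: cartan_sl)
  have "tw.W n j0 c H ?v t k = (\<Sum>a\<le>n. \<Sum>b\<le>n. if b = a then H a a * xop j0 a (dop j0 c a ?v) t k else 0)"
    unfolding tw.W_def sum_fun_apply by (intro sum.cong refl) (auto simp: tsc_def off)
  also have "\<dots> = (\<Sum>a\<le>n. (if a < j0 then - 1 else if a = j0 then c else 0) * H a a * ?v t k)"
    by simp (rule sum.cong, auto simp: xop_def dop_def hwv_def hwk_def)
  finally have 1: "tw.W n j0 c H ?v t k = (\<Sum>a\<le>n. (if a < j0 then - 1 else if a = j0 then c else 0) * H a a * ?v t k)" .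
  have s: "slot n r H ?v t k = (\<Sum>a\<le>n. H a a * (if t r = a then ?v t k else 0))" for r
  proof -
    have "slot n r H ?v t k = (\<Sum>a\<le>n. H a a * (if t r = a then ?v (t(r := a)) k else 0))"
      unfolding slot_def by (rule sum.cong) (auto simp: off)
    thus ?thesis by (simp add: fun_upd_idem cong: if_cong)
  qed
  have "(\<Sum>r<sum_list hs. slot n r H ?v) t k = (\<Sum>a\<le>n. H a a * (\<Sum>r<sum_list hs. if t r = a then ?v t k else 0))"
    unfolding sum_fun_apply s sum_distrib_left by (rule sum.swap)
  also have "\<dots> = (\<Sum>a\<le>n. of_nat (length (filter (\<lambda>h. a < h) hs)) * H a a * ?v t k)"
  proof (rule sum.cong [OF refl])
    fix a
    have "(\<Sum>r<sum_list hs. if t r = a then ?v t k else 0)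
      = (if k = hwk j0 then \<Sum>r<sum_list hs. if t r = a then wedges hs t else 0 else 0)"
      by (simp add: hwv_def cong: if_cong)
    thus "H a a * (\<Sum>r<sum_list hs. if t r = a then ?v t k else 0) = of_nat (length (filter (\<lambda>h. a < h) hs)) * H a a * ?v t k"
      by (simp add: wedges_weight hwv_def)
  qed
  finally have 2: "(\<Sum>r<sum_list hs. slot n r H ?v) t k = (\<Sum>a\<le>n. of_nat (length (filter (\<lambda>h. a < h) hs)) * H a a * ?v t k)" .
  show "tact' n j0 c (sum_list hs) H ?v t k = tsc (\<Sum>j\<le>n. hww j0 c hs j * H j j) ?v t k"
    unfolding tact'_def plus_fun_apply 1 2 sum.distrib [symmetric] tsc_def sum_distrib_right
    by (rule sum.cong) (simp_all add: hww_def distrib_right)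
qed

text \<open>The common shift \<open>s\<close> of all coordinates is multiplied by the trace of a
  Cartan element and so disappears.\<close>

lemma hwrep_hwv:
  assumes V: "slrep tsc n V (tact' n j0 c (sum_list hs))" "hwv j0 hs \<in> V"
    and hs: "\<And>h. h \<in> set hs \<Longrightarrow> h \<le> n" and m: "\<And>i. i \<le> n \<Longrightarrow> m i = hww j0 c hs i + s"
  shows "hwrep tsc n V (tact' n j0 c (sum_list hs)) (hwv j0 hs) m"
proof -
  interpret slrep tsc n V "tact' n j0 c (sum_list hs)" by (rule V)
  show ?thesis
  proof
    fix H assume H: "H \<in> cartan n"
    have "(\<Sum>j\<le>n. m j * H j j) = (\<Sum>j\<le>n. hww j0 c hs j * H j j) + s * mtrace n H"
      by (simp add: m distrib_right sum.distrib mtrace_def sum_distrib_left)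
    moreover have "mtrace n H = 0" using cartan_sl [OF H] by (simp add: sl_def)
    ultimately show "tact' n j0 c (sum_list hs) H (hwv j0 hs) = tsc (\<Sum>j\<le>n. m j * H j j) (hwv j0 hs)"
      using hwv_weight [OF H hs] by simp
  qed (use V(2) hwv_nonzero hwv_raise in auto)
qed

lemma hwv_tV:
  assumes hs: "\<And>h. h \<in> set hs \<Longrightarrow> h \<le> n"
  shows "hwv j0 hs \<in> tV n (sum_list hs) (\<Sum>a\<le>n. hwk j0 a)" "hwv 0 hs \<in> tV0 n (sum_list hs)"
  using wedges_supp [OF _ hs] by (fastforce simp: tV_def tV0_def hwv_def hwk_def split: if_splits)+

text \<open>A partition \<open>\<nu>\<close> with at most \<open>n\<close> rows is encoded by its column heights.\<close>

lemma column_heights: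
  assumes "\<And>i. i < n \<Longrightarrow> \<nu> (Suc i) \<le> \<nu> i" "\<nu> n = 0"
  shows "\<exists>hs. (\<forall>h\<in>set hs. h \<le> n) \<and> (\<forall>i\<le>n. length (filter (\<lambda>h. i < h) hs) = \<nu> i)"
  using assms
proof (induction n arbitrary: \<nu>)
  case 0
  show ?case by (rule exI [of _ "[]"]) (use 0 in auto)
next
  case (Suc n)
  let ?\<nu> = "\<lambda>i. \<nu> i - \<nu> n"
  have mono: "\<nu> n \<le> \<nu> i" if "i \<le> n" for i
    using that Suc.prems(1) by (induction rule: inc_induct) (auto intro: order_trans)
  have "\<exists>hs. (\<forall>h\<in>set hs. h \<le> n) \<and> (\<forall>i\<le>n. length (filter (\<lambda>h. i < h) hs) = ?\<nu> i)"
    by (rule Suc.IH) (use Suc.prems in \<open>auto intro: diff_le_mono\<close>)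
  then obtain hs where hs: "\<forall>h\<in>set hs. h \<le> n" "\<And>i. i \<le> n \<Longrightarrow> length (filter (\<lambda>h. i < h) hs) = ?\<nu> i" by blast
  have f: "filter (\<lambda>h. i < h) hs = []" if "n \<le> i" for i using hs(1) that by (auto simp: filter_empty_conv)
  show ?case
  proof (intro exI conjI allI impI)
    show "\<forall>h\<in>set (hs @ replicate (\<nu> n) (Suc n)). h \<le> Suc n" using hs(1) by auto
    show "length (filter (\<lambda>h. i < h) (hs @ replicate (\<nu> n) (Suc n))) = \<nu> i" if "i \<le> Suc n" for i
      using that hs(2) [of i] f [of i] mono [of i] Suc.prems(2) by (cases "i = Suc n") auto
  qed
qed

section \<open>Associated varieties of weights\<close>

lemma chain_diff:
  fixes N :: "nat \<Rightarrow> complex"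
  assumes "\<And>i. i < n \<Longrightarrow> \<exists>d::nat. N i - N (Suc i) = of_nat d"
  shows "\<exists>\<nu>::nat \<Rightarrow> nat. (\<forall>i\<le>n. N i - N n = of_nat (\<nu> i)) \<and> (\<forall>i<n. \<nu> (Suc i) \<le> \<nu> i) \<and> \<nu> n = 0"
proof -
  obtain g :: "nat \<Rightarrow> nat" where g: "\<And>i. i < n \<Longrightarrow> N i - N (Suc i) = of_nat (g i)" using assms by metis
  define \<nu> where "\<nu> i = (\<Sum>r=i..<n. g r)" for i
  have S: "\<nu> i = g i + \<nu> (Suc i)" if "i < n" for i unfolding \<nu>_def using that by (rule sum.atLeast_Suc_lessThan)
  have "N i - N n = of_nat (\<nu> i)" if "i \<le> n" for i
    using that
  proof (induction rule: inc_induct)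
    case (step i)
    have "N i - N n = (N i - N (Suc i)) + (N (Suc i) - N n)" by simp
    thus ?case using step g [of i] S [of i] by simp
  qed (simp add: \<nu>_def)
  thus ?thesis using S by (intro exI [of _ \<nu>]) (auto simp: \<nu>_def)
qed

text \<open>The weight is matched with the model: away from \<open>j0\<close> the coordinates,
  corrected by the exponents -1, have to form a partition up to a common constant, and the free
  parameter \<open>c\<close> fits the coordinate at \<open>j0\<close>. Non-integrality then yields
  the reverse inclusion.\<close>

lemma assoc_var_one_gap:
  fixes n :: nat and \<mu> :: weight
  defines "m \<equiv> epsc n \<mu>"
  assumes n: "2 \<le> n" and j0: "j0 \<le> n" and nz: "\<And>i. i \<le> n \<Longrightarrow> i \<noteq> j0 \<Longrightarrow> m i - m j0 \<notin> \<int>"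
    and dom: "\<And>i i'. i < i' \<Longrightarrow> i' \<le> n \<Longrightarrow> i \<noteq> j0 \<Longrightarrow> i' \<noteq> j0 \<Longrightarrow> \<exists>d::nat. m i - m i' + of_nat (i' - i) = of_nat d + 1"
  shows "assoc_var n \<mu> = killing_dual n ` closure (Omin n)"
proof -
  define N where "N i = m i + (if i < j0 then 1 else 0)" for i
  \<comment> \<open>The exceptional index borrows the value of a neighbour, so that the chain of
    coordinates stays weakly decreasing across \<open>j0\<close>.\<close>
  define f where "f i = (if i \<noteq> j0 then i else if 0 < j0 then j0 - 1 else 1)" for i
  have "\<exists>d::nat. N (f i) - N (f (Suc i)) = of_nat d" if i: "i < n" for i
  proof -
    consider "i \<noteq> j0" "Suc i \<noteq> j0" | "Suc i = j0" | "i = j0" "j0 = 0" | "i = j0" "0 < j0" by auto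
    thus ?thesis
    proof cases
      case 1
      then obtain d :: nat where "m i - m (Suc i) + of_nat (Suc i - i) = of_nat d + 1" using dom [of i "Suc i"] i by auto
      thus ?thesis using 1 by (intro exI [of _ d]) (auto simp: N_def f_def)
    next
      case 2
      thus ?thesis by (intro exI [of _ 0]) (auto simp: N_def f_def)
    next
      case 3
      thus ?thesis by (intro exI [of _ 0]) (auto simp: N_def f_def)
    next
      \<comment> \<open>Across \<open>j0\<close> dominance refers to indices at distance 2: one of
        the two units is the 1 on the right hand side, the other is the exponent -1 recorded in
        \<open>N\<close>.\<close>
      case 4
      have lt: "j0 - 1 < Suc j0" "j0 - 1 \<noteq> j0" using 4 by arith+
      obtain d :: nat where "m (j0 - 1) - m (Suc j0) + of_nat (Suc j0 - (j0 - 1)) = of_nat d + 1"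
        using dom [OF lt(1) _ lt(2)] i 4 by auto
      moreover have "Suc j0 - (j0 - 1) = 2" using 4 by simp
      ultimately have "m (j0 - 1) - m (Suc j0) + 2 = of_nat d + 1" by simp
      hence "m (j0 - 1) + 1 - m (Suc j0) = of_nat d" by (simp add: algebra_simps)
      thus ?thesis using 4 by (intro exI [of _ d]) (auto simp: N_def f_def)
    qed
  qed
  from chain_diff [of n "\<lambda>i. N (f i)", OF this] obtain \<nu> :: "nat \<Rightarrow> nat"
    where \<nu>: "\<And>i. i \<le> n \<Longrightarrow> N (f i) - N (f n) = of_nat (\<nu> i)" "\<And>i. i < n \<Longrightarrow> \<nu> (Suc i) \<le> \<nu> i" "\<nu> n = 0" by blast
  obtain hs where hs: "\<And>h. h \<in> set hs \<Longrightarrow> h \<le> n" "\<And>i. i \<le> n \<Longrightarrow> length (filter (\<lambda>h. i < h) hs) = \<nu> i"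
    using column_heights [of n \<nu>, OF \<nu>(2,3)] by blast
  define s where "s = N (f n)"
  define c where "c = m j0 - s - of_nat (\<nu> j0)"
  have m: "m i = hww j0 c hs i + s" if "i \<le> n" for i
  proof (cases "i = j0")
    case False
    hence "m i + (if i < j0 then 1 else 0) - s = of_nat (\<nu> i)" using \<nu>(1) [OF that] by (simp add: N_def f_def s_def)
    thus ?thesis using False that by (auto simp: hww_def hs(2) algebra_simps)
  qed (use that in \<open>simp add: hww_def hs(2) c_def\<close>)
  have hw: "hwrep tsc n (tV n (sum_list hs) (\<Sum>a\<le>n. hwk j0 a)) (tact' n j0 c (sum_list hs)) (hwv j0 hs) (epsc n \<mu>)"
    using hwrep_hwv [OF slrep_tV hwv_tV(1) [OF hs(1)] hs(1) m] unfolding m_def .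
  obtain V R v where "simple_hw n V R v \<mu>" using hwrep.simple_hw_exists [OF hw refl] by blast
  moreover obtain i j where "i < j" "j \<le> n" "m i - m j \<notin> \<int>"
  proof (cases "j0 = 0")
    case True
    have "m 0 - m 1 \<notin> \<int>" using nz [of 1] n True Ints_minus [of "m 0 - m 1"] by auto
    thus ?thesis using that [of 0 1] n by simp
  next
    case False
    thus ?thesis using that [of 0 j0] nz [of 0] j0 by simp
  qed
  ultimately have "killing_dual n ` closure (Omin n) \<subseteq> assoc_var n \<mu>" using min_orbit_subset [OF n] unfolding m_def by blast
  thus ?thesis using assoc_var_upper_bound [OF n j0 hw] by blast
qed

lemma assoc_var_dominant_integral:
  assumes n: "2 \<le> n" and dom: "\<And>i. i < n \<Longrightarrow> \<exists>d::nat. epsc n \<mu> i - epsc n \<mu> (Suc i) = of_nat d"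
  shows "assoc_var n \<mu> \<noteq> killing_dual n ` closure (Omin n)"
proof -
  from chain_diff [of n "epsc n \<mu>", OF dom] obtain \<nu> :: "nat \<Rightarrow> nat"
    where \<nu>: "\<And>i. i \<le> n \<Longrightarrow> epsc n \<mu> i - epsc n \<mu> n = of_nat (\<nu> i)" "\<And>i. i < n \<Longrightarrow> \<nu> (Suc i) \<le> \<nu> i" "\<nu> n = 0" by blast
  obtain hs where hs: "\<And>h. h \<in> set hs \<Longrightarrow> h \<le> n" "\<And>i. i \<le> n \<Longrightarrow> length (filter (\<lambda>h. i < h) hs) = \<nu> i"
    using column_heights [of n \<nu>, OF \<nu>(2,3)] by blast
  have m: "epsc n \<mu> i = hww 0 0 hs i + epsc n \<mu> n" if "i \<le> n" for i
    using \<nu>(1) [OF that] hs(2) [OF that] by (simp add: hww_def algebra_simps)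
  show ?thesis
    using assoc_var_integral [OF n hwrep_hwv [OF slrep_tV0 hwv_tV(2) [OF hs(1)] hs(1) m]] .
qed

text \<open>A combinatorial search: whenever removing one index never leaves a single integrality
  class, the classes admit a separated pair, an adjacent pair or, for n = 2, three distinct
  singletons.\<close>

lemma assoc_var_other:
  fixes n :: nat and \<mu> :: weight
  defines "m \<equiv> epsc n \<mu>"
  assumes n: "2 \<le> n" and no: "\<And>j0. j0 \<le> n \<Longrightarrow> \<exists>i\<le>n. \<exists>i'\<le>n. i \<noteq> j0 \<and> i' \<noteq> j0 \<and> m i - m i' \<notin> \<int>"
  shows "assoc_var n \<mu> \<noteq> killing_dual n ` closure (Omin n)"
proof (cases "\<exists>V R v. simple_hw n V R v \<mu>")
  case False
  \<comment> \<open>Without a simple module the annihilator condition is vacuous. The empty word,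
    whose symbol of degree 0 is 1, then belongs to the annihilator and the variety is empty.\<close>
  have "[(1, [])] \<in> annT n \<mu>" using False by (auto simp: annT_def texpr_in_def)
  hence "\<xi> \<notin> assoc_var n \<mu>" for \<xi> unfolding assoc_var_def by (auto simp: symb_def intro!: bexI [of _ "[(1, [])]"] exI [of _ 0])
  hence "assoc_var n \<mu> = {}" by blast
  moreover have "killing_dual n ` closure (Omin n) \<noteq> {}" using emat01_Omin [of n] n closure_subset [of "Omin n"] by auto
  ultimately show ?thesis by simp
next
  case True
  then obtain V R v where s: "simple_hw n V R v \<mu>" by blast
  interpret hwrep vsmul n V R v m unfolding m_def by (rule simple_hw_hwrep [OF s])
  have ann: "texpr_in n e" "\<And>u. u \<in> V \<Longrightarrow> ta e u = 0" if "e \<in> annT n \<mu>" for e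
    using that annT_kills [OF s that] by (auto simp: annT_def)
  define I where "I i j \<longleftrightarrow> m i - m j \<in> \<int>" for i j
  have refl: "I i i" for i by (simp add: I_def)
  have sym: "I i j \<Longrightarrow> I j i" for i j unfolding I_def using Ints_minus [of "m i - m j"] by simp
  have trans: "I i j \<Longrightarrow> I j k \<Longrightarrow> I i k" for i j k
    unfolding I_def using Ints_add [of "m i - m j" "m j - m k"] by simp
  have sep: ?thesis if "i < j" "j < k" "k < l" "l \<le> n" "\<not> I i j" "\<not> I k l" for i j k l
    by (rule two_root_point_outside [of n i j k l])
      (use that n ann separated_pair_point [of i j k l] in \<open>auto simp: I_def\<close>)
  have adj: ?thesis if "i < j" "k = Suc j" "k < l" "l \<le> n" "\<not> I j k" "\<not> I i k" "\<not> I j l" for i j k l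
    by (rule two_root_point_outside [of n i j k l])
      (use that n ann adjacent_pair_point [of i j k l] in \<open>auto simp: I_def\<close>)
  have no': "\<exists>i\<le>n. \<exists>i'\<le>n. i \<noteq> j0 \<and> i' \<noteq> j0 \<and> \<not> I i i'" if "j0 \<le> n" for j0 using no [OF that] by (simp add: I_def)
  \<comment> \<open>The first index outside the class of 0 and the last index outside the class of
    n. For j < k they give the separated gaps (j - 1, j) and (k, k + 1).\<close>
  define j where "j = (LEAST j. \<not> I 0 j)"
  define k where "k = (GREATEST k. k \<le> n \<and> \<not> I k n)"
  obtain a b where ab: "a \<le> n" "b \<le> n" "\<not> I a b" using no' [of 0] by blast
  have tr': "I c a \<Longrightarrow> I c b \<Longrightarrow> I a b" and tr'': "I a c \<Longrightarrow> I b c \<Longrightarrow> I a b" for a b c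
    using trans [OF sym [of c a], of b] trans [OF _ sym [of b c], of a] by auto
  have "\<exists>j\<le>n. \<not> I 0 j" using ab tr' [of 0 a b] by auto
  then obtain j' where j': "j' \<le> n" "\<not> I 0 j'" by blast
  have j_not: "\<not> I 0 j" unfolding j_def by (rule LeastI [of "\<lambda>j. \<not> I 0 j", OF j'(2)])
  have j_less: "I 0 i" if "i < j" for i using not_less_Least [OF that [unfolded j_def]] by simp
  note j = j_not j_less
  have "j \<le> j'" unfolding j_def by (rule Least_le) (rule j'(2))
  hence jn: "j \<le> n" using j'(1) by simp
  have j1: "1 \<le> j" using j(1) refl [of 0] by (cases j) auto
  have "\<exists>k\<le>n. \<not> I k n" using ab tr'' [of a n b] by auto
  then obtain k' where k': "k' \<le> n \<and> \<not> I k' n" by blast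
  have "k \<le> n \<and> \<not> I k n" unfolding k_def by (rule GreatestI_nat [of _ k' n]) (use k' in auto)
  hence k: "k \<le> n" "\<not> I k n" by auto
  have k2: "I i n" if "k < i" "i \<le> n" for i
  proof (rule ccontr)
    assume "\<not> I i n"
    hence "i \<le> k" unfolding k_def by (intro Greatest_le_nat [of _ i n]) (use that in auto)
    thus False using that by simp
  qed
  have kn: "k < n" using k refl [of n] by (cases "k = n") auto
  have Ij: "\<not> I i j" if "i < j" for i using j trans [of 0 i j] that by auto
  have Ik: "\<not> I k i" if "k < i" "i \<le> n" for i using k k2 [OF that] trans [of k i n] by auto
  show ?thesis
  proof (cases j k rule: linorder_cases)
    case less
    show ?thesis by (rule sep [of "j - 1" j k "Suc k"]) (use less j1 kn Ij Ik in auto)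
  next
    case equal
    \<comment> \<open>Otherwise all indices except \<open>j\<close> would form one class, which is
      excluded. So the indices before \<open>j\<close>, the index \<open>j\<close> and those after
      it lie in three different classes.\<close>
    have "\<not> I 0 n"
    proof
      assume "I 0 n"
      hence "I 0 i" if "i \<le> n" "i \<noteq> j" for i
        using j(2) [of i] k2 [of i] that equal tr'' [of 0 n i] by (cases i j rule: linorder_cases) auto
      thus False using no' [OF jn] tr' [of 0] by blast
    qed
    hence I0n: "\<not> I a b" if "a < j" "j < b" "b \<le> n" for a b
      using j(2) [OF that(1)] k2 [of b] that equal trans [of 0 a b] trans [of 0 b n] by auto
    consider "2 \<le> j" | "j = 1" "3 \<le> n" | "j = 1" "n = 2" using j1 n by linarith
    thus ?thesis
    proof cases
      case 1
      show ?thesis by (rule adj [of "j - 2" "j - 1" j "Suc j"]) (use 1 equal kn Ij I0n in auto)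
    next
      case 2
      show ?thesis by (rule adj [of 0 1 2 3]) (use 2 equal Ik I0n in auto)
    next
      case 3
      hence nz: "m 0 - m 1 \<notin> \<int>" "m 0 - m 2 \<notin> \<int>" "m 1 - m 2 \<notin> \<int>"
        using Ij [of 0] I0n [of 0 2] Ik [of 2] equal unfolding I_def by auto
      have "hwrep vsmul 2 V R v m" using hwrep_axioms 3 by simp
      then interpret h: hwrep3 vsmul V R v m unfolding hwrep3_def .
      show ?thesis
        by (rule two_root_point_outside [of n 0 1 1 2])
          (use 3 n h.regular_point [OF nz] ann in auto)
    qed
  next
    case greater
    have n0: "\<not> I 0 n"
      using k2 [OF greater jn] j(1) tr'' [of 0 n j] by auto
    \<comment> \<open>Otherwise \<open>Suc k\<close> would be equivalent both to 0 and to n. There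
      remain two classes, both intervals, and neither is a singleton because of
      \<open>no'\<close>.\<close>
    have jk: "j = Suc k"
    proof (rule ccontr)
      assume "j \<noteq> Suc k"
      hence "I 0 (Suc k)" "I (Suc k) n" using greater j(2) k2 kn by auto
      thus False using n0 trans [of 0 "Suc k" n] by auto
    qed
    have 2: "2 \<le> j"
    proof (rule ccontr)
      assume "\<not> 2 \<le> j"
      hence "I i n" if "i \<le> n" "i \<noteq> 0" for i using k2 [of i] that jk by auto
      thus False using no' [of 0] tr'' [of _ n] by blast
    qed
    have "j < n"
    proof (rule ccontr)
      assume "\<not> j < n"
      hence "I 0 i" if "i \<le> n" "i \<noteq> n" for i using j(2) [of i] that by auto
      thus False using no' [of n] tr' [of 0] by blast
    qed
    have jl: "\<not> I (j - 1) (Suc j)" using Ik [of "Suc j"] jk \<open>j < n\<close> by auto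
    show ?thesis by (rule adj [of "j - 2" "j - 1" j "Suc j"]) (use 2 \<open>j < n\<close> Ij jl in auto)
  qed
qed

text \<open>If \<open>assoc_var_other\<close> does not exclude the weight, all indices other than
  some \<open>j0\<close> form one class. If \<open>j0\<close> belonged to it too, the weight would
  be dominant integral by \<open>dom\<close>, which is excluded as well.\<close>

lemma assoc_var_min_iff:
  fixes n :: nat and \<mu> :: weight
  defines "m \<equiv> epsc n \<mu>"
  assumes n: "2 \<le> n"
    and dom: "\<And>i i'. i < i' \<Longrightarrow> i' \<le> n \<Longrightarrow> m i - m i' \<in> \<int> \<Longrightarrow> \<exists>d::nat. m i - m i' + of_nat (i' - i) = of_nat d + 1"
  shows "assoc_var n \<mu> = killing_dual n ` closure (Omin n) \<longleftrightarrow>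
    (\<exists>j0\<le>n. (\<forall>i\<le>n. i \<noteq> j0 \<longrightarrow> m i - m j0 \<notin> \<int>) \<and> (\<forall>i\<le>n. \<forall>i'\<le>n. i \<noteq> j0 \<longrightarrow> i' \<noteq> j0 \<longrightarrow> m i - m i' \<in> \<int>))"
    (is "?L \<longleftrightarrow> (\<exists>j0\<le>n. ?A j0 \<and> ?B j0)")
proof
  assume "\<exists>j0\<le>n. ?A j0 \<and> ?B j0"
  then obtain j0 where j0: "j0 \<le> n" "?A j0" "?B j0" by blast
  show ?L by (rule assoc_var_one_gap [OF n j0(1)]) (use j0 dom in \<open>auto simp: m_def\<close>)
next
  assume L: ?L
  have "\<exists>j0\<le>n. ?B j0"
  proof (rule ccontr)
    assume nb: "\<not> (\<exists>j0\<le>n. ?B j0)"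
    have "assoc_var n \<mu> \<noteq> killing_dual n ` closure (Omin n)"
    proof (rule assoc_var_other [OF n])
      fix j0 assume "j0 \<le> n"
      with nb have "\<not> ?B j0" by blast
      thus "\<exists>i\<le>n. \<exists>i'\<le>n. i \<noteq> j0 \<and> i' \<noteq> j0 \<and> epsc n \<mu> i - epsc n \<mu> i' \<notin> \<int>" unfolding m_def by blast
    qed
    thus False using L by simp
  qed
  then obtain j0 where j0: "j0 \<le> n" "?B j0" by blast
  show "\<exists>j0\<le>n. ?A j0 \<and> ?B j0"
  proof (rule ccontr)
    assume nb: "\<not> ?thesis"
    have "\<not> ?A j0"
    proof
      assume "?A j0"
      hence "\<exists>j0\<le>n. ?A j0 \<and> ?B j0" using j0 by (intro exI [of _ j0] conjI)
      thus False using nb by contradiction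
    qed
    then obtain i where i: "i \<le> n" "i \<noteq> j0" "m i - m j0 \<in> \<int>" by blast
    have all: "m a - m j0 \<in> \<int>" if "a \<le> n" for a
    proof (cases "a = j0")
      case False
      hence "m a - m i \<in> \<int>" using j0(2) i(1,2) that by simp
      from Ints_add [OF this i(3)] show ?thesis by simp
    qed simp
    have "\<exists>d::nat. m i - m (Suc i) = of_nat d" if "i < n" for i
    proof -
      have "m i - m (Suc i) \<in> \<int>" using Ints_diff [OF all all, of i "Suc i"] that by simp
      thus ?thesis using dom [of i "Suc i"] that by auto
    qed
    hence "assoc_var n \<mu> \<noteq> killing_dual n ` closure (Omin n)"
      unfolding m_def by (rule assoc_var_dominant_integral [OF n])
    thus False using L by simp
  qed
qed

section \<open>Admissible weights\<close>

text \<open>The coordinates of \<mu> + \<rho>, with \<rho> = (n, n - 1, ..., 0) and last coordinate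
  0. The dot action permutes them up to a common constant.\<close>

definition lw :: "nat \<Rightarrow> weight \<Rightarrow> nat \<Rightarrow> complex" where
  "lw n \<mu> j = epsc n \<mu> j + of_nat (n - j)"

lemma epsc_cong: "(\<And>i. 1 \<le> i \<Longrightarrow> i \<le> n \<Longrightarrow> f i = g i) \<Longrightarrow> epsc n f j = epsc n g j"
  unfolding epsc_def by (rule sum.cong) auto

lemma epsc_normw: "epsc n (normw n f) j = epsc n f j"
  by (rule epsc_cong) (simp add: normw_def)

lemma epsc_wsub: "epsc n (wsub n a b) j = epsc n a j - epsc n b j"
  unfolding wsub_def epsc_normw by (simp add: epsc_def sum_subtractf)

lemma epsc_step: "j < n \<Longrightarrow> epsc n f j = f (Suc j) + epsc n f (Suc j)"
  unfolding epsc_def by (simp add: sum.atLeast_Suc_atMost)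

lemma epsc_telescope:
  assumes "\<And>j. j < n \<Longrightarrow> f (Suc j) = m j - m (Suc j)" "j \<le> n"
  shows "epsc n f j = m j - m n"
  using assms(2)
proof (induction rule: inc_induct)
  case (step j)
  thus ?case using assms(1) [of j] by (simp add: epsc_step)
qed (simp add: epsc_def)

lemma lw_diff: "i < j \<Longrightarrow> j \<le> n \<Longrightarrow> lw n \<mu> i - lw n \<mu> j = epsc n \<mu> i - epsc n \<mu> j + of_nat (j - i)"
  by (simp add: lw_def of_nat_diff)

lemma lw_diff_Ints: "i \<le> n \<Longrightarrow> j \<le> n \<Longrightarrow> lw n \<mu> i - lw n \<mu> j \<in> \<int> \<longleftrightarrow> epsc n \<mu> i - epsc n \<mu> j \<in> \<int>"
proof -
  assume "i \<le> n" "j \<le> n"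
  hence "lw n \<mu> i - lw n \<mu> j = (epsc n \<mu> i - epsc n \<mu> j) + of_int (int j - int i)"
    by (simp add: lw_def of_nat_diff)
  thus ?thesis by (metis Ints_add Ints_diff Ints_of_int add_diff_cancel_right')
qed

lemma lw_n: "lw n \<mu> n = 0" by (simp add: lw_def epsc_def)

lemma lw_dot: "j \<le> n \<Longrightarrow> lw n (dot n w \<mu>) j = lw n \<mu> (inv w j) - lw n \<mu> (inv w n)"
  if w: "w permutes {0..n}"
proof -
  assume j: "j \<le> n"
  have r: "epsc n rho_w i = of_nat (n - i)" for i by (simp add: epsc_def rho_w_def)
  have a: "epsc n (wadd n \<mu> rho_w) i = lw n \<mu> i" for i
    unfolding wadd_def epsc_normw lw_def r [symmetric] by (simp add: epsc_def sum.distrib)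
  have "epsc n (wact n w (wadd n \<mu> rho_w)) j = lw n \<mu> (inv w j) - lw n \<mu> (inv w n)"
    unfolding wact_def by (rule epsc_telescope [where m = "\<lambda>j. lw n \<mu> (inv w j)", OF _ j]) (simp add: omegac_def a)
  thus ?thesis unfolding dot_def lw_def [of n "wsub n _ _"] epsc_wsub r by simp
qed

lemma weight_eqI:
  assumes "\<And>j. j \<le> n \<Longrightarrow> lw n a j = lw n b j" "a = normw n a" "b = normw n b"
  shows "a = b"
proof
  fix i
  show "a i = b i"
  proof (cases "1 \<le> i \<and> i \<le> n")
    case True
    have lt: "i - 1 < n" "Suc (i - 1) = i" using True by auto
    have E: "epsc n a j = epsc n b j" if "j \<le> n" for j using assms(1) [OF that] by (simp add: lw_def)
    have "a i + epsc n a i = b i + epsc n b i"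
      using epsc_step [OF lt(1), of a] epsc_step [OF lt(1), of b] E [of "i - 1"] lt(1) unfolding lt(2) by simp
    thus ?thesis using E [of i] True by simp
  next
    case False
    have "a i = normw n a i" "b i = normw n b i" using assms(2,3) by metis+
    thus ?thesis using False by (auto simp: normw_def)
  qed
qed

lemma dot_normw: "dot n w \<mu> = normw n (dot n w \<mu>)"
  by (auto simp: dot_def wsub_def normw_def)

lemma scaled_Ints_iff:
  assumes "1 \<le> q" "coprime p q"
  shows "(of_nat p / of_nat q * of_int z :: complex) \<in> \<int> \<longleftrightarrow> int q dvd z"
proof
  assume "(of_nat p / of_nat q * of_int z :: complex) \<in> \<int>"
  then obtain t where "(of_nat p / of_nat q * of_int z :: complex) = of_int t" by (auto elim: Ints_cases)
  hence "(of_int (int p * z) :: complex) = of_int (int q * t)" using assms(1) by (simp add: field_simps)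
  hence "int p * z = int q * t" unfolding of_int_eq_iff .
  hence "int q dvd int p * z" by simp
  thus "int q dvd z" using assms(2) by (simp add: coprime_dvd_mult_right_iff coprime_commute)
next
  assume "int q dvd z"
  then obtain t where "z = int q * t" by blast
  hence "(of_nat p / of_nat q * of_int z :: complex) = of_int (int p * t)" using assms(1) by simp
  thus "(of_nat p / of_nat q * of_int z :: complex) \<in> \<int>" by simp
qed

lemma int_add_Ints_iff: "of_int z - a \<in> \<int> \<longleftrightarrow> (a :: complex) \<in> \<int>"
  by (metis Ints_diff Ints_of_int diff_diff_eq2 add_diff_cancel_left')

text \<open>In terms of the permutation \<open>w\<close>, the coordinates of \<open>\<nu> + \<rho>\<close> are \<open>M - (p/q) e\<close>, where \<open>M\<close> belongs to the
  dominant weight and \<open>e\<close> to the coweight of the definition of \<open>Pr\<close>.\<close>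

definition adm_coords :: "nat \<Rightarrow> nat \<Rightarrow> nat \<Rightarrow> weight \<Rightarrow> (nat \<Rightarrow> int) \<Rightarrow> (nat \<Rightarrow> int) \<Rightarrow> (nat \<Rightarrow> nat) \<Rightarrow> bool" where
  "adm_coords n p q \<nu> M e w \<longleftrightarrow> w permutes {0..n}
    \<and> (\<forall>i i'. i < i' \<longrightarrow> i' \<le> n \<longrightarrow> 1 \<le> M i - M i' \<and> M i - M i' \<le> int p - 1)
    \<and> (\<forall>i i'. i < i' \<longrightarrow> i' \<le> n \<longrightarrow> (if w i < w i' then 0 \<le> e i - e i' \<and> e i - e i' \<le> int q - 1
         else 1 \<le> e i - e i' \<and> e i - e i' \<le> int q))
    \<and> (\<forall>j j'. j \<le> n \<longrightarrow> j' \<le> n \<longrightarrow> lw n \<nu> j - lw n \<nu> j'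
         = of_int (M (inv w j) - M (inv w j')) - of_nat p / of_nat q * of_int (e (inv w j) - e (inv w j')))"

lemma adm_coordsD:
  assumes "adm_coords n p q \<nu> M e w"
  shows "w permutes {0..n}"
    "\<And>i i'. i < i' \<Longrightarrow> i' \<le> n \<Longrightarrow> 1 \<le> M i - M i' \<and> M i - M i' \<le> int p - 1"
    "\<And>i i'. i < i' \<Longrightarrow> i' \<le> n \<Longrightarrow> if w i < w i' then 0 \<le> e i - e i' \<and> e i - e i' \<le> int q - 1 else 1 \<le> e i - e i' \<and> e i - e i' \<le> int q"
    "\<And>j j'. j \<le> n \<Longrightarrow> j' \<le> n \<Longrightarrow> lw n \<nu> j - lw n \<nu> j'
      = of_int (M (inv w j) - M (inv w j')) - of_nat p / of_nat q * of_int (e (inv w j) - e (inv w j'))"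
  using assms unfolding adm_coords_def by blast+

lemma Pr_coordinates:
  assumes "\<nu> \<in> Pr n p q"
  shows "\<exists>M e w. adm_coords n p q \<nu> M e w"
proof -
  obtain c :: "nat \<Rightarrow> nat" and w \<eta> where *: "\<nu> = dot n w (wsub n (normw n (\<lambda>i. of_nat (c i))) (normw n (\<lambda>i. (of_nat p / of_nat q) * of_int (\<eta> i))))"
    "int (\<Sum>i\<in>{1..n}. c i) \<le> int p - int n - 1" "w \<in> weyl n" "cond_C n q w \<eta>"
    using assms unfolding Pr_def PrZ_def by blast
  have w: "w permutes {0..n}" using *(3) by (simp add: weyl_def)
  \<comment> \<open>The summands 1 come from \<rho>. They make consecutive differences positive, and
    the level bound makes M 0 - M n at most p - 1.\<close>
  define M where "M i = (\<Sum>r\<in>{i+1..n}. int (c r) + 1)" for i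
  define e where "e i = (\<Sum>r\<in>{i+1..n}. \<eta> r)" for i
  have split: "(\<Sum>r\<in>{i+1..n}. f r) = (\<Sum>r\<in>{i+1..i'}. f r) + (\<Sum>r\<in>{i'+1..n}. f r)" if "i < i'" "i' \<le> n" for f :: "nat \<Rightarrow> int" and i i'
    by (subst sum.union_disjoint [symmetric]) (use that in \<open>auto intro!: sum.cong\<close>)
  have lwP: "lw n (wsub n (normw n (\<lambda>i. of_nat (c i))) (normw n (\<lambda>i. (of_nat p / of_nat q) * of_int (\<eta> i)))) i
      = of_int (M i) - of_nat p / of_nat q * of_int (e i)" for i
    unfolding lw_def epsc_wsub epsc_normw by (simp add: epsc_def M_def e_def sum.distrib sum_distrib_left of_nat_diff)
  have "adm_coords n p q \<nu> M e w"
    unfolding adm_coords_def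
  proof (intro conjI allI impI)
    show "w permutes {0..n}" by (rule w)
    fix i i' :: nat assume ii: "i < i'" "i' \<le> n"
    have MM: "M i - M i' = (\<Sum>r\<in>{i+1..i'}. int (c r) + 1)" using split [OF ii] by (simp add: M_def)
    have "(\<Sum>r\<in>{i+1..i'}. 1) \<le> (\<Sum>r\<in>{i+1..i'}. int (c r) + 1)" by (rule sum_mono) simp
    moreover have "(\<Sum>r\<in>{i+1..i'}. int (c r) + 1) \<le> (\<Sum>r\<in>{1..n}. int (c r) + 1)" by (rule sum_mono2) (use ii in auto)
    moreover have "(\<Sum>r\<in>{1..n}. int (c r) + 1) \<le> int p - 1" using *(2) by (simp add: sum.distrib)
    ultimately show "1 \<le> M i - M i'" "M i - M i' \<le> int p - 1" using MM ii by simp_all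
    have "e i - e i' = cpair \<eta> i i'" using split [OF ii] by (simp add: e_def cpair_def)
    thus "if w i < w i' then 0 \<le> e i - e i' \<and> e i - e i' \<le> int q - 1 else 1 \<le> e i - e i' \<and> e i - e i' \<le> int q"
      using *(4) ii unfolding cond_C_def by presburger
  next
    fix j j' assume j: "j \<le> n" and j': "j' \<le> n"
    show "lw n \<nu> j - lw n \<nu> j' = of_int (M (inv w j) - M (inv w j')) - of_nat p / of_nat q * of_int (e (inv w j) - e (inv w j'))"
      unfolding *(1) lw_dot [OF w j] lw_dot [OF w j'] lwP by (simp add: algebra_simps)
  qed
  thus ?thesis by blast
qed

lemma Pr_normw: "\<nu> \<in> Pr n p q \<Longrightarrow> \<nu> = normw n \<nu>"
  unfolding Pr_def using dot_normw by blast

definition one_gap :: "nat \<Rightarrow> weight \<Rightarrow> nat \<Rightarrow> bool" where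
  "one_gap n \<nu> j0 \<longleftrightarrow> (\<forall>i\<le>n. i \<noteq> j0 \<longrightarrow> lw n \<nu> i - lw n \<nu> j0 \<notin> \<int>)
    \<and> (\<forall>i\<le>n. \<forall>i'\<le>n. i \<noteq> j0 \<longrightarrow> i' \<noteq> j0 \<longrightarrow> lw n \<nu> i - lw n \<nu> i' \<in> \<int>)"

text \<open>A third index, available as n is at least 2, would differ from the second exceptional
  index by an integer and also by a non-integer.\<close>

lemma one_gap_unique:
  assumes "2 \<le> n" "one_gap n \<nu> j" "one_gap n \<nu> j'" "j \<le> n" "j' \<le> n"
  shows "j = j'"
proof (rule ccontr)
  assume ne: "j \<noteq> j'"
  have "\<exists>t\<in>{0, 1, 2}. t \<noteq> j \<and> t \<noteq> j'" by auto
  then obtain t where t: "t \<in> {0, 1, 2}" "t \<noteq> j" "t \<noteq> j'" by blast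
  hence "t \<le> n" using assms(1) by auto
  hence "lw n \<nu> t - lw n \<nu> j' \<in> \<int>" "lw n \<nu> t - lw n \<nu> j' \<notin> \<int>"
    using assms ne t(2,3) unfolding one_gap_def by blast+
  thus False by contradiction
qed

section \<open>The minimal coset representatives as cycles\<close>

definition wcyc :: "nat \<Rightarrow> nat \<Rightarrow> nat" where
  "wcyc j i = (if i = j then 0 else if i < j then i + 1 else i)"

lemma wcyc_word: "foldr (\<circ>) (map sref [1..<j+1]) id = wcyc j"
proof (induction j)
  case 0
  show ?case by (auto simp: wcyc_def)
next
  case (Suc j)
  have f: "foldr (\<circ>) (xs @ [y]) id = foldr (\<circ>) xs id \<circ> y" for xs and y :: "nat \<Rightarrow> nat"
    by (induction xs) (auto simp: comp_assoc)
  have "foldr (\<circ>) (map sref [1..<Suc j + 1]) id = foldr (\<circ>) (map sref [1..<j + 1] @ [sref (Suc j)]) id" by simp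
  also have "\<dots> = wcyc j \<circ> sref (Suc j)" unfolding f Suc ..
  also have "\<dots> = wcyc (Suc j)" by (auto simp: wcyc_def sref_def Transposition.transpose_def fun_eq_iff)
  finally show ?case .
qed

lemma wcyc_permutes: "j \<le> n \<Longrightarrow> wcyc j permutes {0..n}"
proof -
  assume j: "j \<le> n"
  have "inj_on (wcyc j) {0..n}" by (rule inj_onI) (auto simp: wcyc_def split: if_splits)
  moreover have "wcyc j ` {0..n} \<subseteq> {0..n}" using j by (auto simp: wcyc_def)
  ultimately have "bij_betw (wcyc j) {0..n} {0..n}" by (simp add: bij_betw_def endo_inj_surj)
  thus ?thesis using j by (intro bij_imp_permutes) (auto simp: wcyc_def)
qed

lemma inv_wcyc: "j \<le> n \<Longrightarrow> inv (wcyc j) i = (if i = 0 then j else if i \<le> j then i - 1 else i)"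
  using permutes_inv_eq [OF wcyc_permutes, of j n i] by (auto simp: wcyc_def)

text \<open>Membership says that the inverse of w increases on 1, ..., n. Such a permutation of 0,
  ..., n is determined by its value j at 0.\<close>

lemma Wpar_wcyc: "Wpar n {2..n} = {wcyc j | j. j \<le> n}"
proof (intro equalityI subsetI)
  fix w assume "w \<in> {wcyc j | j. j \<le> n}"
  then obtain j where j: "j \<le> n" "w = wcyc j" by blast
  show "w \<in> Wpar n {2..n}"
    using wcyc_permutes [OF j(1)] unfolding Wpar_def weyl_def in_rootsub_def j(2)
    by (auto simp: inv_wcyc [OF j(1)] split: if_splits)
next
  fix w assume w: "w \<in> Wpar n {2..n}"
  hence wp: "w permutes {0..n}" by (simp add: Wpar_def weyl_def)
  let ?u = "inv w"
  have up: "?u permutes {0..n}" by (rule permutes_inv [OF wp])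
  have inj: "?u a = ?u b \<Longrightarrow> a = b" for a b using permutes_inj [OF up] by (auto dest: injD)
  have u_le: "?u i \<le> n" if "i \<le> n" for i using permutes_in_image [OF up, of i] that by simp
  have mono: "?u a < ?u b" if "1 \<le> a" "a < b" "b \<le> n" for a b
  proof -
    have "{a+1..b} \<subseteq> {2..n}" using that by auto
    hence "\<not> ?u b < ?u a" using w that unfolding Wpar_def in_rootsub_def by blast
    moreover have "?u a \<noteq> ?u b" using inj [of a b] that by auto
    ultimately show ?thesis by simp
  qed
  have gap: "?u a + (b - a) \<le> ?u b" if "1 \<le> a" "a \<le> b" "b \<le> n" for a b
    using that(2,3)
  proof (induction rule: dec_induct)
    case (step b)
    thus ?case using mono [of b "Suc b"] that(1) by simp
  qed simp
  define j where "j = ?u 0"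
  have jn: "j \<le> n" using u_le [of 0] by (simp add: j_def)
  \<comment> \<open>Being strictly increasing into 0, ..., n leaves only the values i - 1 and i; the
    change from the first to the second happens at the omitted value j.\<close>
  have ui: "?u i = (if i \<le> j then i - 1 else i)" if i: "1 \<le> i" "i \<le> n" for i
  proof -
    have lo: "i - 1 \<le> ?u i" using gap [of 1 i] i by simp
    have hi: "?u i \<le> i" using gap [of i n] u_le [of n] i by simp
    show ?thesis
    proof (cases "i \<le> j")
      case True
      have "?u i \<noteq> i"
      proof
        assume "?u i = i"
        hence "j \<le> ?u j" using gap [of i j] True jn i by simp
        moreover have "?u j \<le> j" using gap [of j n] u_le [of n] True i jn by simp
        ultimately have "?u j = ?u 0" unfolding j_def [symmetric] by simp
        from inj [OF this] show False using True i by simp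
      qed
      thus ?thesis using lo hi True by simp
    next
      case False
      have "?u i \<noteq> i - 1"
      proof
        assume "?u i = i - 1"
        hence "?u (Suc j) \<le> j" using gap [of "Suc j" i] False i by simp
        moreover have "j \<le> ?u (Suc j)" using gap [of 1 "Suc j"] False i by simp
        ultimately have "?u (Suc j) = ?u 0" unfolding j_def [symmetric] by simp
        from inj [OF this] show False by simp
      qed
      thus ?thesis using lo hi False by simp
    qed
  qed
  have "w t = wcyc j t" for t
  proof (cases "t \<le> n")
    case True
    have wt: "w t \<le> n" using permutes_in_image [OF wp, of t] True by simp
    have "?u (w t) = t" by (rule permutes_inverses(2) [OF wp])
    moreover have "?u (w t) = inv (wcyc j) (w t)"
      using ui [of "w t"] wt by (cases "w t = 0") (auto simp: inv_wcyc [OF jn] j_def [symmetric])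
    ultimately show ?thesis using permutes_inv_eq [OF wcyc_permutes [OF jn], of "w t" t] by auto
  next
    case False
    thus ?thesis using permutes_not_in [OF wp, of t] permutes_not_in [OF wcyc_permutes [OF jn], of t] by simp
  qed
  thus "w \<in> {wcyc j | j. j \<le> n}" using jn by auto
qed

section \<open>Admissible weights with one exceptional coordinate\<close>

context
  fixes n p q :: nat
  assumes n: "2 \<le> n" and q: "1 \<le> q" and pq: "coprime p q" and p: "n + 1 \<le> p"
begin

text \<open>An integral difference of coordinates needs a coweight difference divisible by q, and
  the ranges in the definition of \<open>Pr\<close> leave only 0 and q. For 0, the difference of
  \<open>M\<close> is positive; for q, the order is reversed but p is added, which exceeds the
  negative difference.\<close>

lemma Pr_dominant:
  assumes "\<nu> \<in> Pr n p q" "j < j'" "j' \<le> n" "lw n \<nu> j - lw n \<nu> j' \<in> \<int>"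
  shows "\<exists>d::nat. lw n \<nu> j - lw n \<nu> j' = of_nat d + 1"
proof -
  obtain M e w where adm: "adm_coords n p q \<nu> M e w" using Pr_coordinates [OF assms(1)] by blast
  note w = adm_coordsD(1) [OF adm] and M = adm_coordsD(2) [OF adm] and e = adm_coordsD(3) [OF adm] and l = adm_coordsD(4) [OF adm]
  let ?i = "inv w j" and ?i' = "inv w j'"
  have wi: "w ?i = j" "w ?i' = j'" by (simp_all add: permutes_inverses(1) [OF w])
  have le: "?i \<le> n" "?i' \<le> n"
    using permutes_in_image [OF permutes_inv [OF w], of j] permutes_in_image [OF permutes_inv [OF w], of j'] assms by auto
  have dv: "int q dvd e ?i - e ?i'"
  proof -
    have jn: "j \<le> n" using assms(2,3) by simp
    from assms(4) show ?thesis unfolding l [OF jn assms(3)] int_add_Ints_iff scaled_Ints_iff [OF q pq] .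
  qed
  have "\<exists>z\<ge>1. lw n \<nu> j - lw n \<nu> j' = of_int z"
  proof (cases ?i ?i' rule: linorder_cases)
    case less
    have "0 \<le> e ?i - e ?i'" "e ?i - e ?i' < int q" using e [OF less le(2)] wi assms(2) by auto
    hence "e ?i - e ?i' = 0" using dv by (metis dvd_imp_mod_0 mod_pos_pos_trivial)
    thus ?thesis using l [of j j'] assms M [OF less le(2)] by (intro exI [of _ "M ?i - M ?i'"]) simp
  next
    case equal
    thus ?thesis using wi assms(2) by simp
  next
    case greater
    have "1 \<le> e ?i' - e ?i" "e ?i' - e ?i \<le> int q" using e [OF greater le(1)] wi assms(2) by auto
    moreover have "int q dvd e ?i' - e ?i" using dv by (metis dvd_minus_iff minus_diff_eq)
    ultimately have "e ?i' - e ?i = int q" using zdvd_imp_le [of "int q" "e ?i' - e ?i"] by simp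
    hence e': "e ?i - e ?i' = - int q" by simp
    have "lw n \<nu> j - lw n \<nu> j' = of_int (M ?i - M ?i' + int p)"
      using l [of j j'] assms q unfolding e' by simp
    thus ?thesis using M [OF greater le(1)] by (intro exI [of _ "M ?i - M ?i' + int p"]) simp
  qed
  then obtain z where "z \<ge> 1" "lw n \<nu> j - lw n \<nu> j' = of_int z" by blast
  thus ?thesis by (intro exI [of _ "nat (z - 1)"]) simp
qed

text \<open>\<open>a\<close> is the residue modulo q of the coweight at the exceptional index
  relative to any other. Adding (p/q) a to the exceptional coordinate makes it exceed all others by
  integers from 1 to p - 1.\<close>

lemma Pr_one_gap_shift:
  assumes "\<nu> \<in> Pr n p q" "j \<le> n" "one_gap n \<nu> j"
  obtains a :: nat where "1 \<le> a" "a \<le> q - 1"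
    "\<And>i. i \<le> n \<Longrightarrow> i \<noteq> j \<Longrightarrow> \<exists>z. 1 \<le> z \<and> z \<le> int p - 1 \<and> lw n \<nu> j - lw n \<nu> i + of_nat p / of_nat q * of_nat a = of_int z"
proof -
  obtain M e w where adm: "adm_coords n p q \<nu> M e w" using Pr_coordinates [OF assms(1)] by blast
  note w = adm_coordsD(1) [OF adm] and M = adm_coordsD(2) [OF adm] and e = adm_coordsD(3) [OF adm] and l = adm_coordsD(4) [OF adm]
  let ?x = "inv w j"
  have le: "inv w i \<le> n" if "i \<le> n" for i using permutes_in_image [OF permutes_inv [OF w], of i] that by simp
  have ne: "inv w i \<noteq> ?x" if "i \<noteq> j" for i using permutes_inverses(1) [OF w] that by metis
  have dv: "lw n \<nu> i - lw n \<nu> i' \<in> \<int> \<longleftrightarrow> int q dvd e (inv w i) - e (inv w i')" if "i \<le> n" "i' \<le> n" for i i'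
    unfolding l [OF that] int_add_Ints_iff scaled_Ints_iff [OF q pq] ..
  define t where "t = (if j = 0 then 1 else 0 :: nat)"
  have t: "t \<le> n" "t \<noteq> j" using n by (auto simp: t_def)
  \<comment> \<open>All other indices are congruent modulo q, so the reference index
    \<open>t\<close> does not matter.\<close>
  define a where "a = nat ((e ?x - e (inv w t)) mod int q)"
  have ai: "int a = (e ?x - e (inv w i)) mod int q" if i: "i \<le> n" "i \<noteq> j" for i
  proof -
    have "int q dvd e (inv w i) - e (inv w t)" using dv [OF i(1) t(1)] assms(3) i t unfolding one_gap_def by blast
    hence "int q dvd (e ?x - e (inv w t)) - (e ?x - e (inv w i))" by simp
    hence "(e ?x - e (inv w t)) mod int q = (e ?x - e (inv w i)) mod int q" by (rule mod_eq_dvd_iff [THEN iffD2])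
    thus ?thesis using q by (simp add: a_def)
  qed
  have nd: "\<not> int q dvd e ?x - e (inv w i)" if "i \<le> n" "i \<noteq> j" for i
  proof -
    have "\<not> int q dvd e (inv w i) - e ?x" using dv [OF that(1) assms(2)] assms(3) that unfolding one_gap_def by blast
    thus ?thesis by (metis dvd_minus_iff minus_diff_eq)
  qed
  have a1: "1 \<le> a" using ai [OF t] nd [OF t] by (cases a) (auto simp: dvd_eq_mod_eq_0)
  have "int a < int q" using ai [OF t] q by simp
  hence a2: "a \<le> q - 1" by simp
  show ?thesis
  proof (rule that [OF a1 a2])
    fix i assume i: "i \<le> n" "i \<noteq> j"
    show "\<exists>z. 1 \<le> z \<and> z \<le> int p - 1 \<and> lw n \<nu> j - lw n \<nu> i + of_nat p / of_nat q * of_nat a = of_int z"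
    proof (cases "?x < inv w i")
      case True
      have b: "0 \<le> e ?x - e (inv w i)" "e ?x - e (inv w i) \<le> int q" using e [OF True le [OF i(1)]] by (auto split: if_splits)
      moreover have "e ?x - e (inv w i) \<noteq> int q" using nd [OF i] by auto
      ultimately have "int a = e ?x - e (inv w i)" using ai [OF i] by simp
      hence "of_nat a = (of_int (e ?x - e (inv w i)) :: complex)" by (metis of_int_of_nat_eq)
      hence "lw n \<nu> j - lw n \<nu> i + of_nat p / of_nat q * of_nat a = of_int (M ?x - M (inv w i))"
        using l [OF assms(2) i(1)] by simp
      thus ?thesis using M [OF True le [OF i(1)]] by blast
    next
      \<comment> \<open>Here the coweight difference is a - q, so p is added to a difference of
        \<open>M\<close> that lies between 1 - p and -1.\<close>
      case False
      hence lt: "inv w i < ?x" using ne [OF i(2)] by simp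
      have b: "0 \<le> e (inv w i) - e ?x" "e (inv w i) - e ?x \<le> int q" using e [OF lt le [OF assms(2)]] by (auto split: if_splits)
      have "e (inv w i) - e ?x \<noteq> 0" using nd [OF i] by auto
      hence "(e ?x - e (inv w i) + int q) mod int q = e ?x - e (inv w i) + int q" using b by (intro mod_pos_pos_trivial) auto
      hence "int a = e ?x - e (inv w i) + int q" using ai [OF i] by simp
      hence aq: "of_nat a = (of_int (e ?x - e (inv w i)) + of_nat q :: complex)" by (metis of_int_add of_int_of_nat_eq)
      have "of_nat p / of_nat q * of_nat q = (of_nat p :: complex)" using q by simp
      hence "lw n \<nu> j - lw n \<nu> i + of_nat p / of_nat q * of_nat a = of_int (M ?x - M (inv w i)) + of_nat p"
        unfolding l [OF assms(2) i(1)] aq distrib_left by (simp only: diff_add_eq add_diff_cancel diff_add_cancel add.assoc [symmetric])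
      hence "lw n \<nu> j - lw n \<nu> i + of_nat p / of_nat q * of_nat a = of_int (M ?x - M (inv w i) + int p)" by simp
      thus ?thesis using M [OF lt le [OF assms(2)]] by (intro exI [of _ "M ?x - M (inv w i) + int p"]) auto
    qed
  qed
qed

text \<open>Putting the exceptional coordinate first and shifting it produces strictly decreasing
  coordinates with integral differences, hence a dominant integral weight; undoing shift and
  reordering returns the given weight.\<close>

lemma Pr_one_gap_Lam:
  assumes \<nu>: "\<nu> \<in> Pr n p q" and j: "j \<le> n" "one_gap n \<nu> j"
  shows "\<nu> \<in> dot n (inv (wcyc j)) ` Lam n p q"
proof -
  obtain a :: nat where a: "1 \<le> a" "a \<le> q - 1"
    "\<And>i. i \<le> n \<Longrightarrow> i \<noteq> j \<Longrightarrow> \<exists>z. 1 \<le> z \<and> z \<le> int p - 1 \<and> lw n \<nu> j - lw n \<nu> i + of_nat p / of_nat q * of_nat a = of_int z"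
    using Pr_one_gap_shift [OF \<nu> j] by blast
  have wp: "wcyc j permutes {0..n}" by (rule wcyc_permutes [OF j(1)])
  define t where "t = inv (wcyc j)"
  have t: "t i = (if i = 0 then j else if i \<le> j then i - 1 else i)" for i unfolding t_def by (rule inv_wcyc [OF j(1)])
  define x :: complex where "x = of_nat p / of_nat q * of_nat a"
  define Q where "Q r = lw n \<nu> (t r) + (if r = 0 then x else 0)" for r
  have "\<exists>c::nat. Q r - Q (Suc r) = of_nat c + 1" if r: "r < n" for r
  proof (cases "r = 0")
    case True
    have t1: "t 1 \<le> n" "t 1 \<noteq> j" "t 0 = j" using j(1) n by (auto simp: t)
    obtain z where "1 \<le> z" "lw n \<nu> j - lw n \<nu> (t 1) + x = of_int z" using a(3) [OF t1(1,2)] unfolding x_def by blast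
    hence "1 \<le> z" "Q 0 - Q 1 = of_int z" using t1(3) by (simp_all add: Q_def algebra_simps)
    thus ?thesis using True by (intro exI [of _ "nat (z - 1)"]) simp
  next
    case False
    have "t r < t (Suc r)" "t (Suc r) \<le> n" "t r \<noteq> j" "t (Suc r) \<noteq> j" using False r j(1) by (auto simp: t)
    moreover from this have "lw n \<nu> (t r) - lw n \<nu> (t (Suc r)) \<in> \<int>" using j(2) unfolding one_gap_def by auto
    ultimately show ?thesis using Pr_dominant [OF \<nu>] False by (simp add: Q_def)
  qed
  then obtain c' where c': "\<And>r. r < n \<Longrightarrow> Q r - Q (Suc r) = of_nat (c' r) + 1" by metis
  define c where "c r = c' (r - 1)" for r
  define \<kappa> where "\<kappa> = wsub n (normw n (\<lambda>i. of_nat (c i))) (wsc n (of_nat p / of_nat q * of_nat a) omega1)"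
  have Qe: "epsc n (\<lambda>i. of_nat (c i) + 1) i = Q i - Q n" if "i \<le> n" for i
    by (rule epsc_telescope [where m = Q, OF _ that]) (simp add: c_def c')
  have e1: "epsc n (\<lambda>i. of_nat (c i) + 1) i = epsc n (\<lambda>i. of_nat (c i)) i + of_nat (n - i)" for i
    by (simp add: epsc_def sum.distrib)
  have eo: "epsc n (\<lambda>i. x * omega1 i) i = (if i = 0 then x else 0)" for i
  proof -
    have "epsc n (\<lambda>i. x * omega1 i) i = (\<Sum>r\<in>{i+1..n}. if r = 1 then x else 0)" unfolding epsc_def omega1_def by (rule sum.cong) auto
    thus ?thesis using n by auto
  qed
  have lk: "lw n \<kappa> i = lw n \<nu> (t i) - Q n" if i: "i \<le> n" for i
  proof -
    have E: "epsc n (\<lambda>i. of_nat (c i)) i + of_nat (n - i) = Q i - Q n" using Qe [OF i] e1 [of i] by simp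
    have "lw n \<kappa> i = (epsc n (\<lambda>i. of_nat (c i)) i + of_nat (n - i)) - (if i = 0 then x else 0)"
      unfolding \<kappa>_def lw_def [of n "wsub n _ _"] epsc_wsub wsc_def epsc_normw x_def [symmetric] eo by simp
    thus ?thesis unfolding E by (simp add: Q_def)
  qed
  have tn: "t n \<le> n" "t n \<noteq> j" "t 0 = j" "n \<noteq> 0" using j(1) n by (auto simp: t)
  \<comment> \<open>The difference of the first and last coordinate is the sum of the labels plus n,
    so the upper bound p - 1 is the level condition of \<open>PrZ\<close>.\<close>
  obtain z where "z \<le> int p - 1" "lw n \<nu> j - lw n \<nu> (t n) + x = of_int z" using a(3) [OF tn(1,2)] unfolding x_def by blast
  hence z: "z \<le> int p - 1" "Q 0 - Q n = of_int z" using tn(3,4) by (simp_all add: Q_def algebra_simps)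
  have "(of_int (int (\<Sum>i\<in>{1..n}. c i) + int n) :: complex) = epsc n (\<lambda>i. of_nat (c i)) 0 + of_nat n" by (simp add: epsc_def)
  also have "\<dots> = of_int z" using e1 [of 0] Qe [of 0] z(2) by simp
  finally have "int (\<Sum>i\<in>{1..n}. c i) + int n = z" unfolding of_int_eq_iff .
  hence "normw n (\<lambda>i. of_nat (c i)) \<in> PrZ n p" using z(1) unfolding PrZ_def by (intro CollectI exI [of _ c]) auto
  hence \<kappa>: "\<kappa> \<in> Lam n p q" using a(1,2) unfolding Lam_def \<kappa>_def by blast
  have "\<nu> = dot n t \<kappa>"
  proof (rule weight_eqI)
    show "\<nu> = normw n \<nu>" by (rule Pr_normw [OF \<nu>])
    show "dot n t \<kappa> = normw n (dot n t \<kappa>)" by (rule dot_normw)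
    fix s assume s: "s \<le> n"
    have tp: "t permutes {0..n}" unfolding t_def by (rule permutes_inv [OF wp])
    have it: "inv t = wcyc j" unfolding t_def by (rule permutes_inv_inv [OF wp])
    have ti: "t (wcyc j i) = i" for i unfolding t_def by (rule permutes_inverses(2) [OF wp])
    have wl: "wcyc j i \<le> n" if "i \<le> n" for i using permutes_in_image [OF wp, of i] that by simp
    show "lw n \<nu> s = lw n (dot n t \<kappa>) s"
      unfolding lw_dot [OF tp s] it lk [OF wl [OF s]] lk [OF wl [OF order_refl]] ti lw_n by simp
  qed
  thus ?thesis using \<kappa> unfolding t_def by blast
qed

lemma Lam_Pr_one_gap:
  assumes "\<kappa> \<in> Lam n p q" and j: "j \<le> n"
  shows "dot n (inv (wcyc j)) \<kappa> \<in> Pr n p q" "one_gap n (dot n (inv (wcyc j)) \<kappa>) j"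
proof -
  obtain \<mu> a where \<kappa>: "\<kappa> = wsub n \<mu> (wsc n (of_nat p / of_nat q * of_nat a) omega1)" "\<mu> \<in> PrZ n p" "1 \<le> a" "a \<le> q - 1"
    using assms(1) unfolding Lam_def by blast
  have wp: "wcyc j permutes {0..n}" by (rule wcyc_permutes [OF j])
  have tp: "inv (wcyc j) permutes {0..n}" by (rule permutes_inv [OF wp])
  \<comment> \<open>The coweight is a times the first fundamental one. The inverse cycle reverses
    only pairs that contain 0, and there the pairing a, from 1 to q - 1, fits both ranges of
    \<open>cond_C\<close>.\<close>
  define \<eta> where "\<eta> i = (if i = 1 then int a else 0)" for i :: nat
  have \<kappa>': "\<kappa> = wsub n \<mu> (normw n (\<lambda>i. (of_nat p / of_nat q) * of_int (\<eta> i)))"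
    unfolding \<kappa>(1) wsc_def by (rule arg_cong [where f = "wsub n \<mu>"]) (auto simp: normw_def omega1_def \<eta>_def fun_eq_iff)
  have cp: "cpair \<eta> i i' = (if i = 0 then int a else 0)" if "i < i'" for i i'
    unfolding cpair_def \<eta>_def using that by auto
  have C: "cond_C n q (inv (wcyc j)) \<eta>"
    unfolding cond_C_def
  proof (intro allI impI)
    fix i i' assume ii: "i < i' \<and> i' \<le> n"
    show "if inv (wcyc j) i < inv (wcyc j) i' then 0 \<le> cpair \<eta> i i' \<and> cpair \<eta> i i' \<le> int q - 1
      else 1 \<le> cpair \<eta> i i' \<and> cpair \<eta> i i' \<le> int q"
      using ii \<kappa>(3,4) q by (cases "i = 0") (auto simp: cp inv_wcyc [OF j])
  qed
  show "dot n (inv (wcyc j)) \<kappa> \<in> Pr n p q"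
    unfolding Pr_def using \<kappa>(2) \<kappa>' tp C by (intro CollectI exI [of _ \<mu>] exI [of _ "inv (wcyc j)"] exI [of _ \<eta>]) (simp add: weyl_def)
  obtain c :: "nat \<Rightarrow> nat" where c: "\<mu> = normw n (\<lambda>i. of_nat (c i))" using \<kappa>(2) unfolding PrZ_def by blast
  define M where "M i = int (\<Sum>r\<in>{i+1..n}. c r) + int (n - i)" for i
  have lk: "lw n \<kappa> i = of_int (M i) - of_nat p / of_nat q * of_int (if i = 0 then int a else 0)" for i
  proof -
    have "epsc n (\<lambda>i. of_nat p / of_nat q * of_int (\<eta> i)) i = (\<Sum>r\<in>{i+1..n}. if r = 1 then of_nat p / of_nat q * of_nat a else 0)"
      unfolding epsc_def \<eta>_def by (rule sum.cong) auto
    also have "\<dots> = of_nat p / of_nat q * of_int (if i = 0 then int a else 0)" using n by auto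
    finally show ?thesis unfolding \<kappa>' lw_def epsc_wsub epsc_normw c by (simp add: M_def epsc_def)
  qed
  have w0: "wcyc j i = 0 \<longleftrightarrow> i = j" for i by (auto simp: wcyc_def)
  have d: "lw n (dot n (inv (wcyc j)) \<kappa>) i - lw n (dot n (inv (wcyc j)) \<kappa>) i'
      = of_int (M (wcyc j i) - M (wcyc j i')) - of_nat p / of_nat q * of_int ((if i = j then int a else 0) - (if i' = j then int a else 0))"
    if "i \<le> n" "i' \<le> n" for i i'
    unfolding lw_dot [OF tp that(1)] lw_dot [OF tp that(2)] permutes_inv_inv [OF wp] lk w0 by (simp add: algebra_simps)
  have nd: "\<not> int q dvd int a" "\<not> int q dvd - int a" using \<kappa>(3,4) q by (auto dest: dvd_imp_le)
  show "one_gap n (dot n (inv (wcyc j)) \<kappa>) j"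
    unfolding one_gap_def
  proof (intro conjI allI impI)
    fix i assume i: "i \<le> n" "i \<noteq> j"
    show "lw n (dot n (inv (wcyc j)) \<kappa>) i - lw n (dot n (inv (wcyc j)) \<kappa>) j \<notin> \<int>"
      unfolding d [OF i(1) j] int_add_Ints_iff scaled_Ints_iff [OF q pq] using nd i by simp
    fix i' assume i': "i' \<le> n" "i' \<noteq> j"
    show "lw n (dot n (inv (wcyc j)) \<kappa>) i - lw n (dot n (inv (wcyc j)) \<kappa>) i' \<in> \<int>"
      unfolding d [OF i(1) i'(1)] int_add_Ints_iff scaled_Ints_iff [OF q pq] using i i' by simp
  qed
qed

lemma PrO_one_gap: "\<nu> \<in> PrO n p q (Omin n) \<longleftrightarrow> \<nu> \<in> Pr n p q \<and> (\<exists>j\<le>n. one_gap n \<nu> j)"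
proof (cases "\<nu> \<in> Pr n p q")
  case True
  have "assoc_var n \<nu> = killing_dual n ` closure (Omin n) \<longleftrightarrow> (\<exists>j0\<le>n. (\<forall>i\<le>n. i \<noteq> j0 \<longrightarrow> epsc n \<nu> i - epsc n \<nu> j0 \<notin> \<int>)
    \<and> (\<forall>i\<le>n. \<forall>i'\<le>n. i \<noteq> j0 \<longrightarrow> i' \<noteq> j0 \<longrightarrow> epsc n \<nu> i - epsc n \<nu> i' \<in> \<int>))"
  proof (rule assoc_var_min_iff [OF n])
    fix i i' assume i: "i < i'" "i' \<le> n" "epsc n \<nu> i - epsc n \<nu> i' \<in> \<int>"
    hence "lw n \<nu> i - lw n \<nu> i' \<in> \<int>" by (simp add: lw_diff_Ints)
    from Pr_dominant [OF True i(1,2) this] show "\<exists>d::nat. epsc n \<nu> i - epsc n \<nu> i' + of_nat (i' - i) = of_nat d + 1"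
      unfolding lw_diff [OF i(1,2)] .
  qed
  also have "\<dots> \<longleftrightarrow> (\<exists>j\<le>n. one_gap n \<nu> j)"
    unfolding one_gap_def using lw_diff_Ints [of _ n _ \<nu>] by (intro ex_cong1 conj_cong refl) auto
  finally show ?thesis using True by (simp add: PrO_def)
qed (simp add: PrO_def)

end

theorem mainTheorem2:
  fixes n p q :: nat
  assumes "2 \<le> n" and "1 \<le> q" and "coprime p q" and "n + 1 \<le> p"
  shows "PrO n p q (Omin n) = (\<Union>w\<in>Wpar n {2..n}. dot n (inv w) ` Lam n p q)
       \<and> (\<forall>w\<in>Wpar n {2..n}. \<forall>w'\<in>Wpar n {2..n}. w \<noteq> w' \<longrightarrow>
            dot n (inv w) ` Lam n p q \<inter> dot n (inv w') ` Lam n p q = {})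
       \<and> Wpar n {2..n} = {foldr (\<circ>) (map sref [1..<j+1]) id | j. j \<le> n}
       \<and> (2 \<le> q \<longrightarrow> PrO n p q (Omin n) \<noteq> {})"
proof (intro conjI ballI impI)
  show eq: "PrO n p q (Omin n) = (\<Union>w\<in>Wpar n {2..n}. dot n (inv w) ` Lam n p q)"
  proof (intro equalityI subsetI)
    fix \<nu> assume "\<nu> \<in> PrO n p q (Omin n)"
    then obtain j where j: "\<nu> \<in> Pr n p q" "j \<le> n" "one_gap n \<nu> j" using PrO_one_gap [OF assms] by blast
    have "\<nu> \<in> dot n (inv (wcyc j)) ` Lam n p q" by (rule Pr_one_gap_Lam [OF assms j])
    thus "\<nu> \<in> (\<Union>w\<in>Wpar n {2..n}. dot n (inv w) ` Lam n p q)" unfolding Wpar_wcyc using j(2) by blast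
  next
    fix \<nu> assume "\<nu> \<in> (\<Union>w\<in>Wpar n {2..n}. dot n (inv w) ` Lam n p q)"
    then obtain j \<kappa> where j: "j \<le> n" "\<kappa> \<in> Lam n p q" "\<nu> = dot n (inv (wcyc j)) \<kappa>" unfolding Wpar_wcyc by blast
    show "\<nu> \<in> PrO n p q (Omin n)"
      unfolding PrO_one_gap [OF assms] j(3) using Lam_Pr_one_gap [OF assms j(2,1)] j(1) by blast
  qed
  show "dot n (inv w) ` Lam n p q \<inter> dot n (inv w') ` Lam n p q = {}"
    if w: "w \<in> Wpar n {2..n}" "w' \<in> Wpar n {2..n}" "w \<noteq> w'" for w w'
  proof (rule ccontr)
    assume ne: "dot n (inv w) ` Lam n p q \<inter> dot n (inv w') ` Lam n p q \<noteq> {}"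
    obtain j j' where j: "j \<le> n" "w = wcyc j" "j' \<le> n" "w' = wcyc j'" using w(1,2) unfolding Wpar_wcyc by blast
    obtain \<kappa> \<kappa>' where k: "\<kappa> \<in> Lam n p q" "\<kappa>' \<in> Lam n p q" "dot n (inv w) \<kappa> = dot n (inv w') \<kappa>'" using ne by blast
    have "one_gap n (dot n (inv w) \<kappa>) j" unfolding j(2) by (rule Lam_Pr_one_gap(2) [OF assms k(1) j(1)])
    moreover have "one_gap n (dot n (inv w) \<kappa>) j'" unfolding k(3) j(4) by (rule Lam_Pr_one_gap(2) [OF assms k(2) j(3)])
    ultimately have "j = j'" using one_gap_unique [OF assms(1)] j(1,3) by blast
    thus False using j w(3) by simp
  qed
  show "Wpar n {2..n} = {foldr (\<circ>) (map sref [1..<j+1]) id | j. j \<le> n}"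
    unfolding Wpar_wcyc wcyc_word ..
  assume q: "2 \<le> q"
  \<comment> \<open>The zero weight with a = 1 is the witness; a = 1 is allowed exactly because q is
    at least 2.\<close>
  have "normw n (\<lambda>i. of_nat 0) \<in> PrZ n p" unfolding PrZ_def using assms(4) by (intro CollectI exI [of _ "\<lambda>_. 0"]) simp
  hence "wsub n (normw n (\<lambda>i. of_nat 0)) (wsc n (of_nat p / of_nat q * of_nat 1) omega1) \<in> Lam n p q"
    unfolding Lam_def using q by (intro CollectI exI [of _ "normw n (\<lambda>i. of_nat 0)"] exI [of _ 1]) auto
  moreover have "wcyc 0 \<in> Wpar n {2..n}" unfolding Wpar_wcyc by blast
  ultimately show "PrO n p q (Omin n) \<noteq> {}" unfolding eq by blast
qed

end
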